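(* Let $\Omega\subseteq\mathbb R^n$ be an open set satisfying the cone condition $(h_1)$ stated in the context. Let $r\in\mathbb N$ and let $p,q$ be real numbers with $1\le p\le q<+\infty$, $q\ge \frac nr$, and moreover $q>\frac nr$ if $\frac nr=p>1$. Let $s\in\mathbb R$ with $s\le p$ and let $g\in\mathcal M^{q,\frac sp}_0(\Omega)$. Then the operator $u\in W^{r,p}(\Omega)\longmapsto gu\in L^p(\Omega)$ is compact.
   Context: Functions are complex valued, $B_\rho(x)$ is the open ball in $\mathbb R^n$ of center $x$ and radius $\rho$, and $d>0$ is a fixed real number. $W^{r,p}(\Omega)$ is the usual Sobolev space. Cones: for $x\in\mathbb R^n$, an open infinite cone with vertex $x$ is a set $\{x+\lambda(y-x):\lambda>0,\ |y-z|<a\}$ with $a>0$, $z\in\mathbb R^n$, $|z-x|>a$. $C_\theta(x)$ denotes an open infinite cone with vertex $x$ and opening $\theta$, and $C_\theta(x,h)=C_\theta(x)\cap B_h(x)$. Condition $(h_1)$: there exists $\theta\in\,]0,\pi/2[$ such that for every $x\in\Omega$ there is a cone $C_\theta(x)$ with $\overline{C_\theta(x,\rho)}\subset\Omega$ for all $\rho\in\,]0,d]$. Spaces: $\Omega_\rho(x)=B_\rho(x)\cap\Omega$. For $1\le p<+\infty$ and $\sigma\in\mathbb R$, $\mathcal M^{p,\sigma}(\Omega)$ is the space of $g\in L^p_{loc}(\overline\Omega)$ (i.e. $g\in L^p(\Omega\cap B)$ for every ball $B$) such that $$\|g\|_{\mathcal M^{p,\sigma}(\Omega)}=\sup_{x\in\Omega,\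 \rho\in]0,d]}\rho^{\sigma-n/p}\|g\|_{L^p(\Omega_\rho(x))}<+\infty,$$ with this norm. $\mathcal M^{p,\sigma}_0(\Omega)$ is the closure of $C_0^\infty(\Omega)$ in $\mathcal M^{p,\sigma}(\Omega)$ (for $\sigma\ge0$ one has $C_0^\infty(\Omega)\subset \mathcal M^{p,\sigma}(\Omega)$; in general, the closure of $C_0^\infty(\Omega)\cap\mathcal M^{p,\sigma}(\Omega)$). *)

theory Defs
  imports "HOL-Analysis.Analysis"
begin

section \<open>Topology of a space with a (semi)norm\<close>

text \<open>
  Elements of $L^p(\Omega)$, $W^{r,p}(\Omega)$ and $\mathcal{M}^{p,\sigma}(\Omega)$ are represented by
  functions on the whole of $\mathbb{R}^n$ whose values outside $\Omega$ play no role. Equality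
  almost everywhere is not quotiented out, so the norms are seminorms on these carriers. The
  topology below is the pullback of the norm topology of the quotient: closures, and compactness
  of closed sets, are those of the quotient.
\<close>

definition seminorm_topology :: "'v::minus set \<Rightarrow> ('v \<Rightarrow> real) \<Rightarrow> 'v topology" where
  "seminorm_topology V N =
     topology (\<lambda>U. U \<subseteq> V \<and> (\<forall>f\<in>U. \<exists>\<epsilon>>0. \<forall>h\<in>V. N (h - f) < \<epsilon> \<longrightarrow> h \<in> U))"

lemma openin_seminorm_topology:
  "openin (seminorm_topology V N) U \<longleftrightarrow>
     U \<subseteq> V \<and> (\<forall>f\<in>U. \<exists>\<epsilon>>0. \<forall>h\<in>V. N (h - f) < \<epsilon> \<longrightarrow> h \<in> U)"
proof -
  let ?L = "\<lambda>U. U \<subseteq> V \<and> (\<forall>f\<in>U. \<exists>\<epsilon>>0. \<forall>h\<in>V. N (h - f) < \<epsilon> \<longrightarrow> h \<in> U)"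
  have "?L (S \<inter> T)" if S: "?L S" and T: "?L T" for S T
  proof (intro conjI ballI)
    show "S \<inter> T \<subseteq> V"
      using S by blast
    fix f assume f: "f \<in> S \<inter> T"
    obtain a where a: "a > 0" "\<forall>h\<in>V. N (h - f) < a \<longrightarrow> h \<in> S"
      using S f by blast
    obtain b where b: "b > 0" "\<forall>h\<in>V. N (h - f) < b \<longrightarrow> h \<in> T"
      using T f by blast
    show "\<exists>\<epsilon>>0. \<forall>h\<in>V. N (h - f) < \<epsilon> \<longrightarrow> h \<in> S \<inter> T"
      using a b by (intro exI[of _ "min a b"]) auto
  qed
  moreover have "?L (\<Union>\<K>)" if "\<forall>K\<in>\<K>. ?L K" for \<K>
    using that by (meson Sup_least Union_iff)
  ultimately have "istopology ?L"
    unfolding istopology_def by blast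
  then show ?thesis
    by (simp add: seminorm_topology_def)
qed

lemma topspace_seminorm_topology [simp]: "topspace (seminorm_topology V N) = V"
proof
  show "topspace (seminorm_topology V N) \<subseteq> V"
    using openin_seminorm_topology[of V N "topspace (seminorm_topology V N)"] by simp
  have "openin (seminorm_topology V N) V"
    by (auto simp: openin_seminorm_topology intro: exI[of _ 1])
  then show "V \<subseteq> topspace (seminorm_topology V N)"
    by (rule openin_subset)
qed

text \<open>Compact linear operators between spaces of complex functions.\<close>

definition compact_operator ::
  "('a \<Rightarrow> complex) set \<Rightarrow> (('a \<Rightarrow> complex) \<Rightarrow> real) \<Rightarrow>
   ('b \<Rightarrow> complex) set \<Rightarrow> (('b \<Rightarrow> complex) \<Rightarrow> real) \<Rightarrow>
   (('a \<Rightarrow> complex) \<Rightarrow> ('b \<Rightarrow> complex)) \<Rightarrow> bool" where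
  "compact_operator U NU V NV T \<longleftrightarrow>
     T ` U \<subseteq> V \<and>
     (\<forall>u\<in>U. \<forall>v\<in>U. \<forall>a b. T (\<lambda>x. a * u x + b * v x) = (\<lambda>x. a * T u x + b * T v x)) \<and>
     (\<forall>B\<subseteq>U. (\<exists>C. \<forall>u\<in>B. NU u \<le> C) \<longrightarrow>
        compactin (seminorm_topology V NV) (seminorm_topology V NV closure_of (T ` B)))"


section \<open>Lebesgue spaces, test functions and Sobolev spaces\<close>

definition Lp :: "real \<Rightarrow> (real^'n) set \<Rightarrow> (real^'n \<Rightarrow> complex) set" where
  "Lp p S = {f \<in> borel_measurable (lebesgue_on S).
               integrable (lebesgue_on S) (\<lambda>x. norm (f x) powr p)}"

definition Lp_norm :: "real \<Rightarrow> (real^'n) set \<Rightarrow> (real^'n \<Rightarrow> complex) \<Rightarrow> real" where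
  "Lp_norm p S f = (LINT x|lebesgue_on S. norm (f x) powr p) powr (1 / p)"

definition partial_deriv :: "'n \<Rightarrow> (real^'n \<Rightarrow> complex) \<Rightarrow> real^'n \<Rightarrow> complex" where
  "partial_deriv i f x = frechet_derivative f (at x) (axis i 1)"

primrec iter_partial_deriv :: "'n list \<Rightarrow> (real^'n \<Rightarrow> complex) \<Rightarrow> real^'n \<Rightarrow> complex" where
  "iter_partial_deriv [] f = f"
| "iter_partial_deriv (i # js) f = partial_deriv i (iter_partial_deriv js f)"

text \<open>$C_0^\infty(\Omega)$, each function being extended by $0$ to the whole space.\<close>

definition test_functions :: "(real^'n) set \<Rightarrow> (real^'n \<Rightarrow> complex) set" where
  "test_functions \<Omega> =
     {\<phi>. (\<forall>js. iter_partial_deriv js \<phi> differentiable_on UNIV) \<and>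
         compact (closure {x. \<phi> x \<noteq> 0}) \<and> closure {x. \<phi> x \<noteq> 0} \<subseteq> \<Omega>}"

text \<open>
  A multi-index of order $k$ is given by a list of $k$ coordinate directions; lists that are
  permutations of one another describe the same derivative. In the Sobolev norm a mixed
  derivative is thus counted with its multinomial multiplicity, which gives a norm equivalent
  to the sum over multi-indices.
\<close>

definition has_weak_deriv ::
  "(real^'n) set \<Rightarrow> 'n list \<Rightarrow> (real^'n \<Rightarrow> complex) \<Rightarrow> (real^'n \<Rightarrow> complex) \<Rightarrow> bool" where
  "has_weak_deriv \<Omega> js u v \<longleftrightarrow>
     (\<forall>K. compact K \<and> K \<subseteq> \<Omega> \<longrightarrow> integrable (lebesgue_on K) u \<and> integrable (lebesgue_on K) v) \<and>
     (\<forall>\<phi>\<in>test_functions \<Omega>.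
        (LINT x|lebesgue_on \<Omega>. u x * iter_partial_deriv js \<phi> x) =
        (- 1) ^ length js * (LINT x|lebesgue_on \<Omega>. v x * \<phi> x))"

definition sobolev :: "nat \<Rightarrow> real \<Rightarrow> (real^'n) set \<Rightarrow> (real^'n \<Rightarrow> complex) set" where
  "sobolev r p \<Omega> =
     {u \<in> Lp p \<Omega>. \<forall>js. length js \<le> r \<longrightarrow> (\<exists>v \<in> Lp p \<Omega>. has_weak_deriv \<Omega> js u v)}"

text \<open>Meaningful for \<^term>\<open>u \<in> sobolev r p \<Omega>\<close>; weak derivatives are unique almost everywhere in \<open>\<Omega>\<close>.\<close>

definition sobolev_norm :: "nat \<Rightarrow> real \<Rightarrow> (real^'n) set \<Rightarrow> (real^'n \<Rightarrow> complex) \<Rightarrow> real" where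
  "sobolev_norm r p \<Omega> u =
     (\<Sum>js | length js \<le> r.
        Lp_norm p \<Omega> (SOME v. v \<in> Lp p \<Omega> \<and> has_weak_deriv \<Omega> js u v) powr p) powr (1 / p)"


section \<open>The cone condition\<close>

text \<open>The opening of a cone is its half-angle: $\sin\theta = a / |z - x|$.\<close>

definition is_open_cone :: "real \<Rightarrow> real^'n \<Rightarrow> (real^'n) set \<Rightarrow> bool" where
  "is_open_cone \<theta> x C \<longleftrightarrow>
     (\<exists>a z. 0 < a \<and> a < norm (z - x) \<and> sin \<theta> = a / norm (z - x) \<and>
        C = {x + l *\<^sub>R (y - x) | l y. 0 < l \<and> norm (y - z) < a})"

definition cone_condition :: "real \<Rightarrow> (real^'n) set \<Rightarrow> bool" where
  "cone_condition d \<Omega> \<longleftrightarrow>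
     (\<exists>\<theta>. 0 < \<theta> \<and> \<theta> < pi / 2 \<and>
        (\<forall>x\<in>\<Omega>. \<exists>C. is_open_cone \<theta> x C \<and> (\<forall>\<rho>\<in>{0<..d}. closure (C \<inter> ball x \<rho>) \<subseteq> \<Omega>)))"


section \<open>Spaces of Morrey type\<close>

definition morrey_enorm ::
  "real \<Rightarrow> real \<Rightarrow> real \<Rightarrow> (real^'n) set \<Rightarrow> (real^'n \<Rightarrow> complex) \<Rightarrow> ennreal" where
  "morrey_enorm d p \<sigma> \<Omega> g =
     (SUP (x, \<rho>) \<in> \<Omega> \<times> {0<..d}.
        ennreal (\<rho> powr (\<sigma> - real CARD('n) / p) * Lp_norm p (\<Omega> \<inter> ball x \<rho>) g))"

definition morrey :: "real \<Rightarrow> real \<Rightarrow> real \<Rightarrow> (real^'n) set \<Rightarrow> (real^'n \<Rightarrow> complex) set" where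
  "morrey d p \<sigma> \<Omega> =
     {g. (\<forall>x R. g \<in> Lp p (\<Omega> \<inter> ball x R)) \<and> morrey_enorm d p \<sigma> \<Omega> g < \<infinity>}"

definition morrey_norm ::
  "real \<Rightarrow> real \<Rightarrow> real \<Rightarrow> (real^'n) set \<Rightarrow> (real^'n \<Rightarrow> complex) \<Rightarrow> real" where
  "morrey_norm d p \<sigma> \<Omega> g = enn2real (morrey_enorm d p \<sigma> \<Omega> g)"

definition morrey0 :: "real \<Rightarrow> real \<Rightarrow> real \<Rightarrow> (real^'n) set \<Rightarrow> (real^'n \<Rightarrow> complex) set" where
  "morrey0 d p \<sigma> \<Omega> =
     seminorm_topology (morrey d p \<sigma> \<Omega>) (morrey_norm d p \<sigma> \<Omega>)
       closure_of (test_functions \<Omega> \<inter> morrey d p \<sigma> \<Omega>)"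

end

theory Submission
  imports Defs
begin

text \<open>Only the balls of radius \<open>d\<close> in the Morrey norm matter. On a fixed scale, Taylor expansion along the
  cones (if \<open>r p > n\<close>, or \<open>p = 1\<close> and \<open>r = n\<close>) or the critical Sobolev inequality and Hoelder's
  inequality (otherwise) bound \<open>g u\<close> in \<open>L\<^sup>p\<close> of a small ball by the local norms of \<open>g\<close> in \<open>L\<^sup>q\<close> and
  of \<open>u\<close> in \<open>W\<^sup>r\<^sup>,\<^sup>p\<close>. Averaging over all such balls gives
  \<open>\<parallel>g u\<parallel> \<le> C \<parallel>g\<parallel> \<parallel>u\<parallel>\<close> with the Morrey norm of \<open>g\<close>. Hence multiplication by \<open>g\<close> is a limit in
  operator norm of multiplications by test functions, and these are compact by Rellich's argument.

  Weak gradients are used only through bounds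
  \<open>\<bar>u (y + h) - u y\<bar> \<le> \<bar>h\<bar> \<integral>\<^sub>0\<^sup>1 f (y + s h) ds\<close> along segments in the domain. Such bounds survive
  truncation and taking absolute values, so that no approximation by smooth functions is needed.\<close>

subsection \<open>Powers, integrals and the cone condition\<close>

text \<open>All estimates are made on balls with constants independent of the centre, they are put
  in a form homogeneous of degree \<open>p\<close>, and integration over the centres replaces a
  covering with bounded overlap. The cone condition provides no smooth boundary and hence no
  extension operator; it only gives, at every point, segments inside the domain whose increments
  fill a ball. For this reason every inequality concerns increments along such segments, averaged
  over the increments. For the critical Sobolev inequality this averaging alone yields an estimate
  of weak type. Truncation makes it strong, because the increments of the dyadic layers of a
  function add up to at most the increment of the function. If \<open>n / r = p > 1\<close>,
  functions in the Sobolev space may be unbounded and no finite critical exponent belongs to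
  \<open>p\<close>; there \<open>p\<close> is lowered slightly on balls, and
  \<open>q > n / r\<close> leaves the room for it.\<close>

lemma nn_integral_lborel_shift:
  fixes f :: "'a::euclidean_space \<Rightarrow> ennreal"
  assumes [measurable]: "f \<in> borel_measurable borel"
  shows "(\<integral>\<^sup>+x. f (x + h) \<partial>lborel) = (\<integral>\<^sup>+x. f x \<partial>lborel)"
proof -
  have "(\<integral>\<^sup>+x. f x \<partial>lborel) = (\<integral>\<^sup>+x. f x \<partial>distr lborel borel ((+) h))"
    by (simp add: lborel_distr_plus)
  also have "\<dots> = (\<integral>\<^sup>+x. f (x + h) \<partial>lborel)"
    by (subst nn_integral_distr) (auto simp: add.commute)
  finally show ?thesis by simp
qed

lemma nn_integral_lborel_scale:
  fixes f :: "'a::euclidean_space \<Rightarrow> ennreal"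
  assumes [measurable]: "f \<in> borel_measurable borel" and t: "0 < t"
  shows "(\<integral>\<^sup>+x. f x \<partial>lborel) = ennreal (t ^ DIM('a)) * (\<integral>\<^sup>+x. f (t *\<^sub>R x) \<partial>lborel)"
proof -
  have "(\<integral>\<^sup>+x. f x \<partial>lborel) =
      (\<integral>\<^sup>+x. f x \<partial>density (distr lborel borel (\<lambda>x. 0 + t *\<^sub>R x)) (\<lambda>_. ennreal (\<bar>t\<bar>^DIM('a))))"
    using t by (subst lborel_affine[of t 0]) auto
  also have "\<dots> = ennreal (t ^ DIM('a)) * (\<integral>\<^sup>+x. f (t *\<^sub>R x) \<partial>lborel)"
    using t by (simp add: nn_integral_density nn_integral_distr nn_integral_cmult)
  finally show ?thesis .
qed

lemma emeasure_lborel_cball_center: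
  fixes c :: "'a::euclidean_space"
  shows "emeasure lborel (cball c a) = emeasure lborel (cball (0::'a) a)"
proof -
  have "emeasure lborel (cball c a) = emeasure lborel ((+) c -` cball c a \<inter> space borel)"
    using emeasure_distr[of "(+) c" lborel borel "cball c a"] by (simp add: lborel_distr_plus)
  also have "(+) c -` cball c a \<inter> space borel = cball 0 a"
    by (auto simp: dist_norm)
  finally show ?thesis .
qed

lemma AE_lborel_shift:
  fixes P :: "'a::euclidean_space \<Rightarrow> bool"
  assumes "AE x in lborel. P x"
  shows "AE x in lborel. P (x + h)"
proof -
  have "AE x in distr lborel borel ((+) h). P x"
    using assms unfolding lborel_distr_plus by simp
  then have "AE x in lborel. P (h + x)"
    by (rule AE_distrD[rotated]) simp
  then show ?thesis by (simp add: add.commute)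
qed

text \<open>For \<open>x\<close> above \<open>lam\<close>, write \<open>x\<close> as
  \<open>lam powr (1 - p) * x * lam powr (p - 1)\<close> and enlarge the last factor to
  \<open>x powr (p - 1)\<close>. The free level \<open>lam\<close> lets this pointwise bound stand
  in for Hoelder's inequality: it is integrated first and the level is chosen afterwards.\<close>

lemma le_add_powr:
  fixes x lam p :: real
  assumes "0 \<le> x" "0 < lam" "1 \<le> p"
  shows "x \<le> lam + lam powr (1 - p) * x powr p"
proof (cases "x \<le> lam")
  case True
  then show ?thesis by (smt (verit) mult_nonneg_nonneg powr_ge_zero)
next
  case False
  have "x = lam powr (1 - p) * (x powr 1 * lam powr (p - 1))"
    using assms by (simp add: powr_add[symmetric] mult.left_commute)
  also have "\<dots> \<le> lam powr (1 - p) * (x powr 1 * x powr (p - 1))"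
    using False assms by (intro mult_left_mono powr_mono2) auto
  also have "\<dots> = lam powr (1 - p) * x powr p"
    using False assms by (simp only: powr_add[symmetric]) simp
  finally show ?thesis using assms by simp
qed

text \<open>With this level the constant term \<open>lam * m\<close> of the integrated bound is
  exactly \<open>a / 2\<close> and can be absorbed; the identity records the constant that remains
  when the other half is solved for the integral.\<close>

lemma powr_half_bound:
  fixes a m p :: real
  assumes a: "0 < a" and m: "0 < m" and p: "1 \<le> p"
  defines "lam \<equiv> a / (2 * m)"
  shows "lam powr (p - 1) * (a / 2) * (2 powr p * m powr (p - 1)) = a powr p"
proof -
  have "lam powr (p - 1) = a powr (p - 1) / (2 powr (p - 1) * m powr (p - 1))"
    using a m by (simp add: lam_def powr_divide powr_mult)
  moreover have "a powr p = a powr (p - 1) * a"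
    using a by (simp add: powr_diff)
  moreover have "2 powr p = 2 powr (p - 1) * (2::real)" by (simp add: powr_diff)
  ultimately show ?thesis using a m by simp
qed

text \<open>A substitute for Jensen's inequality up to the constant \<open>2 powr p\<close>, obtained from
  \<open>x \<le> \<lambda> + \<lambda> powr (1 - p) * x powr p\<close> with \<open>\<lambda> = a / (2 * m)\<close>.\<close>

lemma powr_le_nn_integral:
  fixes F :: "'b \<Rightarrow> real"
  assumes [measurable]: "F \<in> borel_measurable M" and F: "\<And>x. 0 \<le> F x"
    and mass: "emeasure M (space M) \<le> ennreal m" and m: "0 < m" and p: "1 \<le> p"
    and a: "0 \<le> a" "ennreal a \<le> (\<integral>\<^sup>+x. ennreal (F x) \<partial>M)"
  shows "ennreal (a powr p) \<le> ennreal (2 powr p * m powr (p - 1)) * (\<integral>\<^sup>+x. ennreal (F x powr p) \<partial>M)"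
proof (cases "a = 0 \<or> (\<integral>\<^sup>+x. ennreal (F x powr p) \<partial>M) = \<infinity>")
  case True
  then show ?thesis using m by (auto simp: ennreal_mult_eq_top_iff ennreal_mult_top)
next
  case False
  then obtain I where I: "(\<integral>\<^sup>+x. ennreal (F x powr p) \<partial>M) = ennreal I" "0 \<le> I"
    by (metis ennreal_cases infinity_ennreal_def)
  have a0: "0 < a" using False a by simp
  define lam where "lam = a / (2 * m)"
  have lam: "0 < lam" using a0 m by (simp add: lam_def)
  have "ennreal a \<le> (\<integral>\<^sup>+x. ennreal (lam + lam powr (1 - p) * F x powr p) \<partial>M)"
    using a(2) by (rule order_trans) (intro nn_integral_mono ennreal_leI le_add_powr F lam p)
  also have "\<dots> = ennreal lam * emeasure M (space M) + ennreal (lam powr (1 - p)) * ennreal I"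
    using lam by (simp add: nn_integral_add nn_integral_cmult I(1) ennreal_mult')
  also have "\<dots> \<le> ennreal lam * ennreal m + ennreal (lam powr (1 - p)) * ennreal I"
    by (intro add_right_mono mult_left_mono mass) simp
  also have "\<dots> = ennreal (lam * m + lam powr (1 - p) * I)"
    using lam m I by (simp add: ennreal_mult)
  finally have "a \<le> lam * m + lam powr (1 - p) * I"
    using lam m I by (subst (asm) ennreal_le_iff) auto
  then have "a / 2 \<le> lam powr (1 - p) * I"
    using m by (simp add: lam_def)
  then have "lam powr (p - 1) * (a / 2) \<le> lam powr (p - 1) * (lam powr (1 - p) * I)"
    by (intro mult_left_mono) auto
  also have "\<dots> = I" using lam by (simp add: powr_add[symmetric] mult.assoc[symmetric])
  finally have "lam powr (p - 1) * (a / 2) * (2 powr p * m powr (p - 1)) \<le> I * (2 powr p * m powr (p - 1))"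
    by (rule mult_right_mono) simp
  then have "a powr p \<le> 2 powr p * m powr (p - 1) * I"
    using powr_half_bound[OF a0 m p] by (simp add: lam_def mult.commute)
  then show ?thesis using I m by (simp add: ennreal_mult[symmetric] ennreal_leI)
qed

text \<open>Counting measure on \<open>I\<close> has mass \<open>card I\<close>, so
  \<open>powr_le_nn_integral\<close> applies to it.\<close>

lemma powr_sum_le:
  fixes x :: "'i \<Rightarrow> real"
  assumes "finite I" "I \<noteq> {}" and x: "\<And>i. i \<in> I \<Longrightarrow> 0 \<le> x i" and p: "1 \<le> p"
  shows "(\<Sum>i\<in>I. x i) powr p \<le> 2 powr p * real (card I) powr (p - 1) * (\<Sum>i\<in>I. x i powr p)"
proof -
  \<comment> \<open>\<open>powr_le_nn_integral\<close> asks for a function that is nonnegative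
    everywhere, whereas the sign of \<open>x\<close> is known only on \<open>I\<close>.\<close>
  let ?x = "\<lambda>i. max 0 (x i)"
  have "ennreal ((\<Sum>i\<in>I. ?x i) powr p)
      \<le> ennreal (2 powr p * real (card I) powr (p - 1)) * (\<integral>\<^sup>+i. ennreal (?x i powr p) \<partial>count_space I)"
    using assms by (intro powr_le_nn_integral)
      (auto simp: nn_integral_count_space_finite emeasure_count_space card_gt_0_iff ennreal_of_nat_eq_real_of_nat sum_nonneg)
  also have "\<dots> = ennreal (2 powr p * real (card I) powr (p - 1) * (\<Sum>i\<in>I. ?x i powr p))"
    using assms by (simp add: nn_integral_count_space_finite ennreal_mult sum_nonneg)
  finally have "(\<Sum>i\<in>I. ?x i) powr p \<le> 2 powr p * real (card I) powr (p - 1) * (\<Sum>i\<in>I. ?x i powr p)"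
    by (subst (asm) ennreal_le_iff) (auto intro!: mult_nonneg_nonneg sum_nonneg)
  moreover have "(\<Sum>i\<in>I. ?x i) = (\<Sum>i\<in>I. x i)" "(\<Sum>i\<in>I. ?x i powr p) = (\<Sum>i\<in>I. x i powr p)"
    using x by (auto intro!: sum.cong)
  ultimately show ?thesis by simp
qed

text \<open>Later the \<open>N\<close> increments on the right have integrals bounded by one and the
  same quantity. Together with the factor \<open>N powr (p - 1)\<close> they give
  \<open>N powr p\<close>, which is the correct growth for an increment \<open>N\<close> times as
  long.\<close>

lemma telescope_powr_le:
  fixes f :: "nat \<Rightarrow> real"
  assumes N: "0 < N" and p: "1 \<le> p"
  shows "ennreal (\<bar>f N - f 0\<bar> powr p)
    \<le> ennreal (2 powr p * real N powr (p - 1)) * (\<Sum>i<N. ennreal (\<bar>f (Suc i) - f i\<bar> powr p))"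
proof -
  have "\<bar>f N - f 0\<bar> = \<bar>\<Sum>i<N. f (Suc i) - f i\<bar>"
    by (simp add: sum_lessThan_telescope)
  then have "\<bar>f N - f 0\<bar> powr p \<le> (\<Sum>i<N. \<bar>f (Suc i) - f i\<bar>) powr p"
    using p by (simp add: powr_mono2 sum_abs)
  also have "\<dots> \<le> 2 powr p * real N powr (p - 1) * (\<Sum>i<N. \<bar>f (Suc i) - f i\<bar> powr p)"
    using powr_sum_le[of "{..<N}" "\<lambda>i. \<bar>f (Suc i) - f i\<bar>" p] N p by auto
  finally show ?thesis
    by (simp add: ennreal_mult[symmetric] sum_nonneg ennreal_leI)
qed

lemma powr_add_le_two:
  fixes x y p :: real
  assumes "0 \<le> x" "0 \<le> y" "1 \<le> p"
  shows "(x + y) powr p \<le> 2 powr p * (x powr p + y powr p)"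
proof -
  have "(x + y) powr p \<le> (2 * max x y) powr p"
    using assms by (intro powr_mono2) auto
  also have "\<dots> = 2 powr p * max x y powr p" using assms by (simp add: powr_mult)
  also have "\<dots> \<le> 2 powr p * (x powr p + y powr p)"
    using assms by (intro mult_left_mono) (auto simp: max_def)
  finally show ?thesis .
qed

lemma powr_superadditive:
  fixes x y p :: real
  assumes "0 \<le> x" "0 \<le> y" "1 \<le> p"
  shows "x powr p + y powr p \<le> (x + y) powr p"
proof (cases "x + y = 0")
  case True
  then have "x = 0" "y = 0" using assms by auto
  then show ?thesis using assms by simp
next
  case False
  have e: "z powr p = z * z powr (p - 1)" if "0 \<le> z" for z :: real
    using that by (cases "z = 0") (auto simp: powr_diff)
  have "x * x powr (p - 1) + y * y powr (p - 1) \<le> x * (x + y) powr (p - 1) + y * (x + y) powr (p - 1)"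
    using assms by (intro add_mono mult_left_mono powr_mono2) auto
  then show ?thesis using assms by (simp add: e algebra_simps)
qed

text \<open>Iterated superadditivity. That the constant is 1 is essential for summing over
  truncation levels, whose number is arbitrary.\<close>

lemma sum_powr_le_powr_sum:
  fixes x :: "'i \<Rightarrow> real"
  assumes "finite I" and "\<And>i. i \<in> I \<Longrightarrow> 0 \<le> x i" and p: "1 \<le> p"
  shows "(\<Sum>i\<in>I. x i powr p) \<le> (\<Sum>i\<in>I. x i) powr p"
  using assms(1,2)
proof (induction I rule: finite_induct)
  case (insert i I)
  then have "(\<Sum>i\<in>insert i I. x i powr p) \<le> x i powr p + (\<Sum>i\<in>I. x i) powr p" by simp
  also have "\<dots> \<le> (x i + (\<Sum>i\<in>I. x i)) powr p"
    using insert p by (intro powr_superadditive sum_nonneg) auto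
  finally show ?case using insert by simp
qed simp

text \<open>The increment \<open>h\<close> is the parameter and the starting point varies: estimates
  are integrated over the starting point with \<open>h\<close> fixed, and for open
  \<open>\<Omega>\<close> the set of admissible starting points is open.\<close>

definition segment_in :: "'a::real_vector set \<Rightarrow> 'a \<Rightarrow> 'a set" where
  "segment_in \<Omega> h = {y. \<forall>s\<in>{0..1}. y + s *\<^sub>R h \<in> \<Omega>}"

text \<open>The complement is the set of differences of a closed set and a compact set, hence
  closed.\<close>

lemma open_translates_in:
  fixes \<Omega> S :: "'a::euclidean_space set"
  assumes "open \<Omega>" "compact S"
  shows "open {y. \<forall>z\<in>S. y + z \<in> \<Omega>}"
proof -
  have "closed (\<Union>x\<in>-\<Omega>. \<Union>y\<in>S. {x - y})"
    using assms by (intro closed_compact_differences) auto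
  moreover have "{y. \<forall>z\<in>S. y + z \<in> \<Omega>} = - (\<Union>x\<in>-\<Omega>. \<Union>y\<in>S. {x - y})"
  proof (intro equalityI subsetI)
    fix y assume "y \<in> - (\<Union>x\<in>-\<Omega>. \<Union>y\<in>S. {x - y})"
    then have "y + z \<in> \<Omega>" if "z \<in> S" for z
      using that by (metis (no_types, lifting) ComplD ComplI UN_I add_diff_cancel_right' insertI1)
    then show "y \<in> {y. \<forall>z\<in>S. y + z \<in> \<Omega>}" by simp
  qed auto
  ultimately show ?thesis by (simp add: closed_def)
qed

lemma open_segment_in:
  fixes \<Omega> :: "'a::euclidean_space set"
  assumes "open \<Omega>"
  shows "open (segment_in \<Omega> h)"
proof -
  have "compact ((\<lambda>s. s *\<^sub>R h) ` {0..1::real})"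
    by (intro compact_continuous_image continuous_intros) auto
  from open_translates_in[OF assms this] show ?thesis by (simp add: segment_in_def)
qed

text \<open>Joint openness in \<open>(y, h)\<close> is what yields joint measurability, and with it
  the exchange of integrals and of null sets between starting points and increments.\<close>

lemma open_segment_in_pairs:
  fixes \<Omega> :: "'a::euclidean_space set"
  assumes "open \<Omega>"
  shows "open {(y, h). y \<in> segment_in \<Omega> h}"
proof (rule Topological_Spaces.openI)
  fix p assume "p \<in> {(y, h). y \<in> segment_in \<Omega> h}"
  then obtain y h where p: "p = (y, h)" and y: "y \<in> segment_in \<Omega> h" by blast
  define S where "S = (\<lambda>s. y + s *\<^sub>R h) ` {0..1::real}"
  have "compact S" unfolding S_def
    by (intro compact_continuous_image continuous_intros) auto
  moreover have "S \<subseteq> \<Omega>" using y by (auto simp: S_def segment_in_def)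
  ultimately obtain e where e: "0 < e" "(\<Union>x\<in>S. ball x e) \<subseteq> \<Omega>"
    using compact_subset_open_imp_ball_epsilon_subset assms by metis
  show "\<exists>T. open T \<and> p \<in> T \<and> T \<subseteq> {(y, h). y \<in> segment_in \<Omega> h}"
  proof (intro exI[of _ "ball y (e/2) \<times> ball h (e/2)"] conjI)
    show "ball y (e/2) \<times> ball h (e/2) \<subseteq> {(y, h). y \<in> segment_in \<Omega> h}"
    proof
      fix z assume "z \<in> ball y (e/2) \<times> ball h (e/2)"
      then obtain y' h' where z: "z = (y', h')" "y' \<in> ball y (e/2)" "h' \<in> ball h (e/2)" by blast
      have "y' + s *\<^sub>R h' \<in> \<Omega>" if s: "s \<in> {0..1}" for s
      proof -
      have a: "dist y y' * 2 < e" "dist h h' * 2 < e" "0 \<le> s" "s \<le> 1" using z s by auto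
      have "norm (s *\<^sub>R (h - h')) \<le> 1 * norm (h - h')"
        using a by (simp add: mult_left_le_one_le)
      moreover have eq: "y + s *\<^sub>R h - (y' + s *\<^sub>R h') = (y - y') + s *\<^sub>R (h - h')"
        by (simp add: algebra_simps)
      ultimately have "dist (y + s *\<^sub>R h) (y' + s *\<^sub>R h') \<le> norm (y - y') + norm (h - h')"
        using norm_triangle_ineq[of "y - y'" "s *\<^sub>R (h - h')"] unfolding dist_norm eq by linarith
      then have "dist (y + s *\<^sub>R h) (y' + s *\<^sub>R h') < e"
        using a by (simp add: dist_norm)
      moreover have "ball (y + s *\<^sub>R h) e \<subseteq> \<Omega>"
        using e(2) s unfolding S_def by (simp add: UN_subset_iff)
      ultimately show ?thesis by auto
      qed
      then show "z \<in> {(y, h). y \<in> segment_in \<Omega> h}" by (simp add: z segment_in_def)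
    qed
    show "open (ball y (e/2) \<times> ball h (e/2))"
      by (intro open_Times open_ball)
    show "p \<in> ball y (e/2) \<times> ball h (e/2)"
      using e p by simp
  qed
qed

text \<open>By compactness of the sphere finitely many directions \<open>c\<close> serve all points of the domain.\<close>

locale cone_domain =
  fixes \<Omega> J :: "'a::euclidean_space set" and a d :: real
  assumes open_domain: "open \<Omega>" and finite_dirs: "finite J" and radius_pos: "0 < a" and d_pos: "0 < d"
    and center: "\<And>c. c \<in> J \<Longrightarrow> a < norm c" "\<And>c. c \<in> J \<Longrightarrow> norm c + a \<le> d"
    and cones: "\<And>x. x \<in> \<Omega> \<Longrightarrow> \<exists>c\<in>J. \<forall>h\<in>cball c a. x \<in> segment_in \<Omega> h"
begin

text \<open>The points \<open>x\<close> for which the truncated cone spanned by \<open>x\<close> and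
  the ball of radius \<open>a\<close> about \<open>x + c\<close> lies in
  \<open>\<Omega>\<close>.\<close>

definition part :: "'a \<Rightarrow> 'a set" where
  "part c = {x. \<forall>h\<in>cball c a. x \<in> segment_in \<Omega> h}"

lemma open_part: "open (part c)"
proof -
  have "compact ((\<lambda>(s, h). s *\<^sub>R h) ` ({0..1::real} \<times> cball c a))"
    by (intro compact_continuous_image compact_Times) (auto simp: case_prod_unfold intro!: continuous_intros)
  from open_translates_in[OF open_domain this] show ?thesis
    by (rule back_subst[where P = "\<lambda>U. open U"]) (auto simp: part_def segment_in_def)
qed

lemma part_measurable [measurable]: "part c \<in> sets borel"
  using open_part by simp

lemma domain_measurable [measurable]: "\<Omega> \<in> sets borel"
  using open_domain by simp

lemma segment_in_measurable [measurable]: "segment_in \<Omega> h \<in> sets borel"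
  using open_segment_in[OF open_domain] by simp

lemma segment_in_pairs_measurable [measurable]:
  assumes [measurable]: "f \<in> borel_measurable M" "g \<in> borel_measurable M"
  shows "Measurable.pred M (\<lambda>x. f x \<in> segment_in \<Omega> (g x))"
proof -
  have [measurable]: "{(y, h). y \<in> segment_in \<Omega> h} \<in> sets (borel \<Otimes>\<^sub>M borel)"
    using open_segment_in_pairs[OF open_domain] unfolding borel_prod by (rule borel_open)
  have "Measurable.pred M (\<lambda>x. (f x, g x) \<in> {(y, h). y \<in> segment_in \<Omega> h})"
    by measurable
  then show ?thesis by simp
qed

lemma indicator_segment_in_measurable [measurable]:
  assumes [measurable]: "f \<in> borel_measurable M" "g \<in> borel_measurable M"
  shows "(\<lambda>x. indicator (segment_in \<Omega> (g x)) (f x) :: ennreal) \<in> borel_measurable M"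
  unfolding indicator_def by measurable

lemma domain_subset_parts: "\<Omega> \<subseteq> (\<Union>c\<in>J. part c)"
  using cones by (auto simp: part_def)

end

subsection \<open>Truncation at dyadic levels\<close>

text \<open>The layer of \<open>x\<close> between the heights \<open>l\<close> and
  \<open>2 * l\<close>. The layers at \<open>l * 2 ^ k\<close> tile everything above
  \<open>l\<close>, so their sums telescope.\<close>

definition level_trunc :: "real \<Rightarrow> real \<Rightarrow> real" where
  "level_trunc l x = min (max (x - l) 0) l"

lemma level_trunc_measurable [measurable]: "level_trunc l \<in> borel_measurable borel"
  unfolding level_trunc_def by measurable

lemma sum_level_trunc:
  assumes "0 \<le> l"
  shows "(\<Sum>k<K. level_trunc (l * 2 ^ k) x) = min (max (x - l) 0) (l * 2 ^ K - l)"
proof (induction K)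
  case (Suc K)
  have "l \<le> l * 2 ^ K" using assms by (simp add: mult_le_cancel_left1)
  then show ?case using Suc assms by (auto simp: level_trunc_def)
qed simp

text \<open>All layers are nondecreasing in \<open>x\<close>, so their increments have the same sign
  and no cancellation is lost by taking absolute values separately.\<close>

lemma sum_level_trunc_diff_le:
  assumes "0 \<le> l"
  shows "(\<Sum>k<K. \<bar>level_trunc (l * 2 ^ k) x - level_trunc (l * 2 ^ k) y\<bar>) \<le> \<bar>x - y\<bar>"
proof -
  have *: "(\<Sum>k<K. \<bar>level_trunc (l * 2 ^ k) x - level_trunc (l * 2 ^ k) y\<bar>) \<le> \<bar>x - y\<bar>"
    if "y \<le> x" for x y
  proof -
    have "level_trunc (l * 2 ^ k) y \<le> level_trunc (l * 2 ^ k) x" for k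
      using that by (auto simp: level_trunc_def)
    then have "(\<Sum>k<K. \<bar>level_trunc (l * 2 ^ k) x - level_trunc (l * 2 ^ k) y\<bar>) =
        (\<Sum>k<K. level_trunc (l * 2 ^ k) x) - (\<Sum>k<K. level_trunc (l * 2 ^ k) y)"
      by (simp add: sum_subtractf)
    also have "\<dots> \<le> \<bar>x - y\<bar>"
      using that unfolding sum_level_trunc[OF assms] by auto
    finally show ?thesis .
  qed
  show ?thesis
  proof (cases "y \<le> x")
    case False
    then show ?thesis using *[of x y] by (simp add: abs_minus_commute)
  qed (rule *)
qed

lemma sum_level_trunc_diff_powr_le:
  assumes "0 \<le> l" "1 \<le> p"
  shows "(\<Sum>k<K. \<bar>level_trunc (l * 2 ^ k) x - level_trunc (l * 2 ^ k) y\<bar> powr p) \<le> \<bar>x - y\<bar> powr p"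
  using assms sum_level_trunc_diff_le[OF assms(1)]
  by (intro order_trans[OF sum_powr_le_powr_sum] powr_mono2) (auto intro!: sum_nonneg)

text \<open>The number \<open>N\<close> of steps and the step length \<open>1 / M\<close> separate the scale \<open>N / M\<close>, adapted to the
  measure of a level set, from the scale \<open>1 / M\<close>, at which the truncations of all levels are
  compared with the function itself.\<close>

lemma (in cone_domain) level_set_decay:
  fixes w :: "'a \<Rightarrow> real" and p l :: real and N M :: nat
  assumes [measurable]: "w \<in> borel_measurable borel" and w0: "\<And>x. x \<notin> \<Omega> \<Longrightarrow> w x = 0"
    and l: "0 < l" and p: "1 \<le> p" and N: "0 < N" "N \<le> M"
    and small: "2 * emeasure lborel {x. l \<le> w x} \<le> ennreal ((real N / real M) ^ DIM('a)) * emeasure lborel (cball (0::'a) a)"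
  shows "ennreal (l powr p / 2) * emeasure lborel (cball (0::'a) a) * emeasure lborel {x. 2 * l \<le> w x}
     \<le> ennreal (2 powr p * real N powr p) * (\<Sum>c\<in>J. \<integral>\<^sup>+h. indicator (cball c a) h *
          (\<integral>\<^sup>+y. indicator (segment_in \<Omega> (h /\<^sub>R real M)) y *
             ennreal (\<bar>level_trunc l (w (y + h /\<^sub>R real M)) - level_trunc l (w y)\<bar> powr p) \<partial>lborel) \<partial>lborel)"
proof -
  define v where "v x = level_trunc l (w x)" for x
  have [measurable]: "v \<in> borel_measurable borel" unfolding v_def by measurable
  \<comment> \<open>\<open>t\<close> is the relative distance at which most directions have left the
    level set \<open>A\<close>.\<close>
  define t where "t = real N / real M"
  have t: "0 < t" "t \<le> 1" using N by (auto simp: t_def)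
  have kappa: "emeasure lborel (cball c a) = emeasure lborel (cball (0::'a) a)" for c :: 'a
    by (rule emeasure_lborel_cball_center)
  define \<kappa> where "\<kappa> = emeasure lborel (cball (0::'a) a)"
  have \<kappa>fin: "\<kappa> < \<infinity>" unfolding \<kappa>_def by (rule emeasure_lborel_cball_finite)
  define A where "A = {x. l \<le> w x}"
  define B where "B = {x. 2 * l \<le> w x}"
  have [measurable]: "cball c a \<in> sets borel" for c :: 'a by simp
  have [measurable]: "A \<in> sets borel" "B \<in> sets borel" unfolding A_def B_def by measurable
  define E where "E h = (\<integral>\<^sup>+y. indicator (segment_in \<Omega> (h /\<^sub>R real M)) y *
             ennreal (\<bar>v (y + h /\<^sub>R real M) - v y\<bar> powr p) \<partial>lborel)" for h
  \<comment> \<open>On \<open>B\<close> the truncation has its top value \<open>l\<close>, off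
    \<open>A\<close> it is 0. The set of \<open>h\<close> with \<open>x + t *\<^sub>R h\<close> in
    \<open>A\<close> is a copy of \<open>A\<close> dilated by \<open>1 / t\<close>; by
    \<open>small\<close> it occupies at most half of the ball of increments, and the other half sees
    the full jump \<open>l\<close>.\<close>
  have far: "ennreal (l powr p / 2) * \<kappa> \<le> (\<integral>\<^sup>+h. indicator (cball c a) h * ennreal (\<bar>v (x + t *\<^sub>R h) - v x\<bar> powr p) \<partial>lborel)"
    if x: "x \<in> B" for x c
  proof -
    let ?G = "cball c a \<inter> {h. x + t *\<^sub>R h \<in> A}"
    have "emeasure lborel A = (\<integral>\<^sup>+h. indicator A (h + x) \<partial>lborel)"
      by (subst nn_integral_lborel_shift) auto
    also have "\<dots> = ennreal (t ^ DIM('a)) * (\<integral>\<^sup>+h. indicator A (t *\<^sub>R h + x) \<partial>lborel)"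
      using t by (intro nn_integral_lborel_scale) auto
    also have "(\<integral>\<^sup>+h. indicator A (t *\<^sub>R h + x) \<partial>lborel) = emeasure lborel {h. x + t *\<^sub>R h \<in> A}"
      by (subst nn_integral_indicator[symmetric])
        (auto simp: indicator_def add.commute simp del: nn_integral_indicator intro!: nn_integral_cong)
    finally have A: "emeasure lborel A = ennreal (t ^ DIM('a)) * emeasure lborel {h. x + t *\<^sub>R h \<in> A}" .
    have "ennreal (t ^ DIM('a)) * (2 * emeasure lborel {h. x + t *\<^sub>R h \<in> A}) \<le> ennreal (t ^ DIM('a)) * \<kappa>"
      using small unfolding A_def[symmetric] A t_def[symmetric] \<kappa>_def by (simp add: mult_ac)
    then have "2 * emeasure lborel {h. x + t *\<^sub>R h \<in> A} \<le> \<kappa>"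
      using t by (subst (asm) ennreal_mult_le_mult_iff) auto
    moreover have "emeasure lborel ?G \<le> emeasure lborel {h. x + t *\<^sub>R h \<in> A}"
      by (rule emeasure_mono) auto
    ultimately have G: "2 * emeasure lborel ?G \<le> \<kappa>"
      by (meson mult_left_mono order_trans zero_le)
    have "emeasure lborel (cball c a - ?G) + emeasure lborel ?G = emeasure lborel ((cball c a - ?G) \<union> ?G)"
      by (intro plus_emeasure) auto
    also have "(cball c a - ?G) \<union> ?G = cball c a" by auto
    finally have \<kappa>: "\<kappa> = emeasure lborel ?G + emeasure lborel (cball c a - ?G)"
      by (simp add: \<kappa>_def kappa[of c] add.commute)
    have "emeasure lborel ?G \<le> \<kappa>" by (subst \<kappa>) simp
    then have "emeasure lborel ?G \<noteq> top" using \<kappa>fin by (auto simp: top_unique)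
    moreover have "emeasure lborel ?G + emeasure lborel ?G \<le> emeasure lborel ?G + emeasure lborel (cball c a - ?G)"
      using G \<kappa> by (simp add: mult_2)
    ultimately have "emeasure lborel ?G \<le> emeasure lborel (cball c a - ?G)"
      by (simp add: ennreal_add_left_cancel_le)
    then have half: "\<kappa> \<le> 2 * emeasure lborel (cball c a - ?G)"
      by (subst \<kappa>) (simp add: mult_2 add_right_mono)
    have "ennreal (l powr p / 2) * \<kappa> \<le> ennreal (l powr p / 2) * (2 * emeasure lborel (cball c a - ?G))"
      by (intro mult_left_mono half) simp
    also have "\<dots> = ennreal (l powr p) * emeasure lborel (cball c a - ?G)"
    proof -
      have "ennreal (l powr p / 2) * 2 = ennreal (l powr p)"
        using ennreal_mult''[of 2 "l powr p / 2"] by simp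
      then show ?thesis by (simp add: mult.assoc[symmetric])
    qed
    also have "\<dots> = (\<integral>\<^sup>+h. ennreal (l powr p) * indicator (cball c a - ?G) h \<partial>lborel)"
      by (subst nn_integral_cmult_indicator) auto
    also have "\<dots> \<le> (\<integral>\<^sup>+h. indicator (cball c a) h * ennreal (\<bar>v (x + t *\<^sub>R h) - v x\<bar> powr p) \<partial>lborel)"
    proof (intro nn_integral_mono)
      fix h
      have "v x = l" using x l by (auto simp: v_def B_def level_trunc_def)
      moreover have "v (x + t *\<^sub>R h) = 0" if "x + t *\<^sub>R h \<notin> A"
        using that l by (auto simp: v_def A_def level_trunc_def)
      ultimately show "ennreal (l powr p) * indicator (cball c a - ?G) h \<le> indicator (cball c a) h * ennreal (\<bar>v (x + t *\<^sub>R h) - v x\<bar> powr p)"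
        using l by (auto split: split_indicator)
    qed
    finally show ?thesis .
  qed
  \<comment> \<open>The jump over \<open>t *\<^sub>R h\<close> is split into \<open>N\<close> steps
    of length \<open>h / M\<close>. After translation each step has the same integral
    \<open>E h\<close>, so \<open>N\<close> of them and the factor from the power of the sum give
    \<open>N powr p\<close>.\<close>
  have step: "(\<integral>\<^sup>+x. indicator (part c) x * ennreal (\<bar>v (x + t *\<^sub>R h) - v x\<bar> powr p) \<partial>lborel)
      \<le> ennreal (2 powr p * real N powr p) * E h" if h: "h \<in> cball c a" for c h
  proof -
    let ?k = "h /\<^sub>R real M"
    have "(\<integral>\<^sup>+x. indicator (part c) x * ennreal (\<bar>v (x + t *\<^sub>R h) - v x\<bar> powr p) \<partial>lborel) \<le>
      (\<integral>\<^sup>+x. ennreal (2 powr p * real N powr (p - 1)) * (\<Sum>i<N. indicator (segment_in \<Omega> ?k) (x + real i *\<^sub>R ?k) *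
          ennreal (\<bar>v (x + real i *\<^sub>R ?k + ?k) - v (x + real i *\<^sub>R ?k)\<bar> powr p)) \<partial>lborel)"
    proof (intro nn_integral_mono)
      fix x
      show "indicator (part c) x * ennreal (\<bar>v (x + t *\<^sub>R h) - v x\<bar> powr p) \<le>
        ennreal (2 powr p * real N powr (p - 1)) * (\<Sum>i<N. indicator (segment_in \<Omega> ?k) (x + real i *\<^sub>R ?k) *
          ennreal (\<bar>v (x + real i *\<^sub>R ?k + ?k) - v (x + real i *\<^sub>R ?k)\<bar> powr p))"
      proof (cases "x \<in> part c")
        case True
        have seg: "x + real i *\<^sub>R ?k \<in> segment_in \<Omega> ?k" if "i < N" for i
          unfolding segment_in_def
        proof (intro CollectI ballI)
          fix s :: real assume s: "s \<in> {0..1}"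
          \<comment> \<open>From \<open>i < N\<close> and \<open>N \<le> M\<close> every step stays
            within the segment from \<open>x\<close> to \<open>x + h\<close>, which lies in the
            domain because \<open>x\<close> is in \<open>part c\<close>.\<close>
          have "(real i + s) / real M \<in> {0..1}"
            using s that N by (auto simp: divide_le_eq)
          then have "x + ((real i + s) / real M) *\<^sub>R h \<in> \<Omega>"
            using True h unfolding part_def segment_in_def by blast
          then show "x + real i *\<^sub>R ?k + s *\<^sub>R ?k \<in> \<Omega>"
            by (simp add: scaleR_left_distrib divide_inverse add.assoc distrib_right)
        qed
        have N': "x + real N *\<^sub>R ?k = x + t *\<^sub>R h"
          by (simp add: t_def divide_inverse)
        have "ennreal (\<bar>v (x + t *\<^sub>R h) - v x\<bar> powr p)
          \<le> ennreal (2 powr p * real N powr (p - 1)) *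
            (\<Sum>i<N. ennreal (\<bar>v (x + real (Suc i) *\<^sub>R ?k) - v (x + real i *\<^sub>R ?k)\<bar> powr p))"
          using telescope_powr_le[OF N(1) p, of "\<lambda>i. v (x + real i *\<^sub>R ?k)"] unfolding N' by simp
        also have "(\<Sum>i<N. ennreal (\<bar>v (x + real (Suc i) *\<^sub>R ?k) - v (x + real i *\<^sub>R ?k)\<bar> powr p)) =
            (\<Sum>i<N. indicator (segment_in \<Omega> ?k) (x + real i *\<^sub>R ?k) *
          ennreal (\<bar>v (x + real i *\<^sub>R ?k + ?k) - v (x + real i *\<^sub>R ?k)\<bar> powr p))"
        proof (rule sum.cong[OF refl])
          fix i assume i: "i \<in> {..<N}"
          have S: "x + real (Suc i) *\<^sub>R ?k = x + real i *\<^sub>R ?k + ?k"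
            by (simp only: of_nat_Suc scaleR_left_distrib scaleR_one add_ac)
          show "ennreal (\<bar>v (x + real (Suc i) *\<^sub>R ?k) - v (x + real i *\<^sub>R ?k)\<bar> powr p) =
            indicator (segment_in \<Omega> ?k) (x + real i *\<^sub>R ?k) *
            ennreal (\<bar>v (x + real i *\<^sub>R ?k + ?k) - v (x + real i *\<^sub>R ?k)\<bar> powr p)"
            unfolding S using seg i by (simp only: indicator_simps lessThan_iff mult_1)
        qed
        finally show ?thesis
          using True by simp
      qed simp
    qed
    also have "\<dots> = ennreal (2 powr p * real N powr (p - 1)) * (\<Sum>i<N. (\<integral>\<^sup>+x. indicator (segment_in \<Omega> ?k) (x + real i *\<^sub>R ?k) *
          ennreal (\<bar>v (x + real i *\<^sub>R ?k + ?k) - v (x + real i *\<^sub>R ?k)\<bar> powr p) \<partial>lborel))"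
      by (subst nn_integral_cmult, measurable, subst nn_integral_sum) auto
    also have "\<dots> = ennreal (2 powr p * real N powr (p - 1)) * (\<Sum>i<N. E h)"
      unfolding E_def
      by (subst nn_integral_lborel_shift[of "\<lambda>x. indicator (segment_in \<Omega> ?k) x * ennreal (\<bar>v (x + ?k) - v x\<bar> powr p)"]) auto
    also have "\<dots> = ennreal (2 powr p * (real N powr (p - 1) * real N)) * E h"
      by (simp add: ennreal_mult mult.assoc ennreal_of_nat_eq_real_of_nat)
    also have "real N powr (p - 1) * real N = real N powr p"
      using N by (simp add: powr_diff)
    finally show ?thesis .
  qed
  \<comment> \<open>Since \<open>w\<close> vanishes outside the domain and \<open>l > 0\<close>, the
    set \<open>B\<close> lies in the domain, and finitely many parts cover it.\<close>
  have Bsub: "B \<subseteq> (\<Union>c\<in>J. part c)"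
    using domain_subset_parts w0 l by (force simp: B_def)
  have "ennreal (l powr p / 2) * \<kappa> * emeasure lborel B \<le> ennreal (l powr p / 2) * \<kappa> * (\<Sum>c\<in>J. emeasure lborel (part c \<inter> B))"
  proof (intro mult_left_mono)
    have "emeasure lborel B \<le> emeasure lborel (\<Union>c\<in>J. part c \<inter> B)"
      using Bsub finite_dirs by (intro emeasure_mono) auto
    also have "\<dots> \<le> (\<Sum>c\<in>J. emeasure lborel (part c \<inter> B))"
      using finite_dirs by (intro emeasure_subadditive_finite) auto
    finally show "emeasure lborel B \<le> (\<Sum>c\<in>J. emeasure lborel (part c \<inter> B))" .
  qed simp
  also have "\<dots> = (\<Sum>c\<in>J. ennreal (l powr p / 2) * \<kappa> * emeasure lborel (part c \<inter> B))"
    by (simp add: sum_distrib_left)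
  also have "\<dots> \<le> (\<Sum>c\<in>J. ennreal (2 powr p * real N powr p) * (\<integral>\<^sup>+h. indicator (cball c a) h * E h \<partial>lborel))"
  proof (intro sum_mono)
    fix c assume "c \<in> J"
    have "ennreal (l powr p / 2) * \<kappa> * emeasure lborel (part c \<inter> B) = (\<integral>\<^sup>+x. ennreal (l powr p / 2) * \<kappa> * indicator (part c \<inter> B) x \<partial>lborel)"
      by (subst nn_integral_cmult_indicator) auto
    also have "\<dots> \<le> (\<integral>\<^sup>+x. (\<integral>\<^sup>+h. indicator (part c) x * (indicator (cball c a) h * ennreal (\<bar>v (x + t *\<^sub>R h) - v x\<bar> powr p)) \<partial>lborel) \<partial>lborel)"
      using far by (intro nn_integral_mono) (auto split: split_indicator)
    also have "\<dots> = (\<integral>\<^sup>+h. (\<integral>\<^sup>+x. indicator (part c) x * (indicator (cball c a) h * ennreal (\<bar>v (x + t *\<^sub>R h) - v x\<bar> powr p)) \<partial>lborel) \<partial>lborel)"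
      by (rule lborel_pair.Fubini') measurable
    also have "\<dots> = (\<integral>\<^sup>+h. indicator (cball c a) h * (\<integral>\<^sup>+x. indicator (part c) x * ennreal (\<bar>v (x + t *\<^sub>R h) - v x\<bar> powr p) \<partial>lborel) \<partial>lborel)"
      by (subst nn_integral_cmult[symmetric]) (auto intro!: nn_integral_cong simp: mult_ac)
    also have "\<dots> \<le> (\<integral>\<^sup>+h. ennreal (2 powr p * real N powr p) * (indicator (cball c a) h * E h) \<partial>lborel)"
      using step by (intro nn_integral_mono) (auto split: split_indicator)
    also have "\<dots> = ennreal (2 powr p * real N powr p) * (\<integral>\<^sup>+h. indicator (cball c a) h * E h \<partial>lborel)"
      unfolding E_def by (subst nn_integral_cmult) auto
    finally show "ennreal (l powr p / 2) * \<kappa> * emeasure lborel (part c \<inter> B) \<le> ennreal (2 powr p * real N powr p) * (\<integral>\<^sup>+h. indicator (cball c a) h * E h \<partial>lborel)" .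
  qed
  finally show ?thesis
    by (simp add: sum_distrib_left[symmetric] \<kappa>_def B_def E_def v_def)
qed

subsection \<open>The critical Sobolev inequality\<close>

text \<open>Let \<open>S\<close> be the whole sum. Replacing each \<open>f k powr \<beta>\<close> by
  \<open>S powr \<beta>\<close> gives \<open>S \<le> (A + B * C) * S powr \<beta>\<close>, and
  \<open>\<beta> < 1\<close> allows this to be solved for \<open>S\<close>. The alternative
  \<open>S \<le> 1\<close> accounts for the maximum with 1: otherwise
  \<open>A \<le> A * S powr \<beta>\<close>. The bound does not depend on \<open>K\<close>.\<close>

lemma sum_bootstrap:
  fixes f D :: "nat \<Rightarrow> real"
  assumes f: "\<And>k. 0 \<le> f k" and D: "\<And>k. 0 \<le> D k" and B: "0 \<le> B" and \<beta>: "0 < \<beta>" "\<beta> < 1"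
    and step: "\<And>k. k < K \<Longrightarrow> f (Suc k) \<le> B * f k powr \<beta> * D k"
    and sumD: "(\<Sum>k<K. D k) \<le> C" and f0: "f 0 \<le> A"
  shows "(\<Sum>k\<le>K. f k) \<le> max 1 ((A + B * C) powr (1 / (1 - \<beta>)))"
proof (cases "(\<Sum>k\<le>K. f k) \<le> 1")
  case False
  define S where "S = (\<Sum>k\<le>K. f k)"
  have S: "1 < S" using False by (simp add: S_def)
  have fS: "f k \<le> S" if "k \<le> K" for k
    unfolding S_def using that f by (intro member_le_sum) auto
  have C: "0 \<le> C" using sumD D by (meson order_trans sum_nonneg)
  have "S = f 0 + (\<Sum>k<K. f (Suc k))"
    using sum.lessThan_Suc_shift[of f K] unfolding S_def lessThan_Suc_atMost .
  also have "\<dots> \<le> A + (\<Sum>k<K. B * S powr \<beta> * D k)"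
  proof (intro add_mono f0 sum_mono)
    fix k assume k: "k \<in> {..<K}"
    have "f (Suc k) \<le> B * f k powr \<beta> * D k" using step k by simp
    also have "\<dots> \<le> B * S powr \<beta> * D k"
      using k f fS B D \<beta> by (intro mult_right_mono mult_left_mono powr_mono2) auto
    finally show "f (Suc k) \<le> B * S powr \<beta> * D k" .
  qed
  also have "\<dots> = A + B * S powr \<beta> * (\<Sum>k<K. D k)" by (simp add: sum_distrib_left)
  also have "\<dots> \<le> A * S powr \<beta> + B * S powr \<beta> * C"
  proof (intro add_mono)
    have "0 \<le> A" using f0 f[of 0] by simp
    moreover have "1 \<le> S powr \<beta>" using S \<beta> by (simp add: ge_one_powr_ge_zero)
    ultimately show "A \<le> A * S powr \<beta>" by (simp add: mult_le_cancel_left1)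
    show "B * S powr \<beta> * sum D {..<K} \<le> B * S powr \<beta> * C"
      using sumD B by (intro mult_left_mono) auto
  qed
  also have "\<dots> = (A + B * C) * S powr \<beta>" by (simp add: algebra_simps)
  finally have "S / S powr \<beta> \<le> A + B * C" using S by (simp add: divide_le_eq)
  then have "S powr (1 - \<beta>) \<le> A + B * C" using S by (simp add: powr_diff)
  then have "(S powr (1 - \<beta>)) powr (1 / (1 - \<beta>)) \<le> (A + B * C) powr (1 / (1 - \<beta>))"
    using \<beta> by (intro powr_mono2) auto
  then have "S \<le> (A + B * C) powr (1 / (1 - \<beta>))" using S \<beta> by (simp add: powr_powr)
  then show ?thesis by (simp add: S_def)
qed simp

text \<open>The step length \<open>h / M\<close> is common to all levels, so the sum over the levels
  can be taken inside the integrals. There the increments of the layers are dominated by the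
  increment of \<open>w\<close>, with no loss in the number of levels.\<close>

lemma (in cone_domain) sum_level_differences_le:
  fixes w :: "'a \<Rightarrow> real"
  assumes [measurable]: "w \<in> borel_measurable borel" and p: "1 \<le> p" and l: "0 < l" and M: "0 < M"
    and diff: "\<And>h. norm h \<le> d \<Longrightarrow> (\<integral>\<^sup>+y. indicator (segment_in \<Omega> h) y *
        ennreal (\<bar>w (y + h) - w y\<bar> powr p) \<partial>lborel) \<le> ennreal (norm h powr p)"
  shows "(\<Sum>k<K. \<Sum>c\<in>J. \<integral>\<^sup>+h. indicator (cball c a) h *
          (\<integral>\<^sup>+y. indicator (segment_in \<Omega> (h /\<^sub>R real M)) y *
             ennreal (\<bar>level_trunc (l * 2 ^ k) (w (y + h /\<^sub>R real M)) - level_trunc (l * 2 ^ k) (w y)\<bar> powr p) \<partial>lborel) \<partial>lborel)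
      \<le> ennreal (real (card J) * measure lborel (cball (0::'a) a) * (d / real M) powr p)"
proof -
  have [measurable]: "cball c a \<in> sets borel" for c :: 'a by simp
  have le: "(\<Sum>k<K. \<integral>\<^sup>+h. indicator (cball c a) h *
          (\<integral>\<^sup>+y. indicator (segment_in \<Omega> (h /\<^sub>R real M)) y *
             ennreal (\<bar>level_trunc (l * 2 ^ k) (w (y + h /\<^sub>R real M)) - level_trunc (l * 2 ^ k) (w y)\<bar> powr p) \<partial>lborel) \<partial>lborel)
      \<le> ennreal (measure lborel (cball (0::'a) a) * (d / real M) powr p)" if c: "c \<in> J" for c
  proof -
    have "(\<Sum>k<K. \<integral>\<^sup>+h. indicator (cball c a) h *
          (\<integral>\<^sup>+y. indicator (segment_in \<Omega> (h /\<^sub>R real M)) y *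
             ennreal (\<bar>level_trunc (l * 2 ^ k) (w (y + h /\<^sub>R real M)) - level_trunc (l * 2 ^ k) (w y)\<bar> powr p) \<partial>lborel) \<partial>lborel)
       = (\<integral>\<^sup>+h. (\<Sum>k<K. indicator (cball c a) h *
          (\<integral>\<^sup>+y. indicator (segment_in \<Omega> (h /\<^sub>R real M)) y *
             ennreal (\<bar>level_trunc (l * 2 ^ k) (w (y + h /\<^sub>R real M)) - level_trunc (l * 2 ^ k) (w y)\<bar> powr p) \<partial>lborel)) \<partial>lborel)"
      by (rule nn_integral_sum[symmetric]) measurable
    also have "\<dots> \<le> (\<integral>\<^sup>+h. ennreal ((d / real M) powr p) * indicator (cball c a) h \<partial>lborel)"
    proof (intro nn_integral_mono)
      fix h :: 'a
      let ?h = "h /\<^sub>R real M"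
      show "(\<Sum>k<K. indicator (cball c a) h *
          (\<integral>\<^sup>+y. indicator (segment_in \<Omega> ?h) y *
             ennreal (\<bar>level_trunc (l * 2 ^ k) (w (y + ?h)) - level_trunc (l * 2 ^ k) (w y)\<bar> powr p) \<partial>lborel))
        \<le> ennreal ((d / real M) powr p) * indicator (cball c a) h"
      proof (cases "h \<in> cball c a")
        case True
        then have h: "norm h \<le> d"
          using center(2)[OF c] norm_triangle_sub[of h c] by (auto simp: dist_norm norm_minus_commute)
        then have hM: "norm ?h \<le> d / real M" using M by (simp add: divide_inverse_commute mult_left_mono)
        have "d / real M \<le> d" using M h by (simp add: divide_le_eq mult_le_cancel_left1) (smt (verit) norm_ge_zero)
        then have "norm ?h \<le> d" using hM by linarith
        have "(\<Sum>k<K. (\<integral>\<^sup>+y. indicator (segment_in \<Omega> ?h) y *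
             ennreal (\<bar>level_trunc (l * 2 ^ k) (w (y + ?h)) - level_trunc (l * 2 ^ k) (w y)\<bar> powr p) \<partial>lborel))
          = (\<integral>\<^sup>+y. (\<Sum>k<K. indicator (segment_in \<Omega> ?h) y *
             ennreal (\<bar>level_trunc (l * 2 ^ k) (w (y + ?h)) - level_trunc (l * 2 ^ k) (w y)\<bar> powr p)) \<partial>lborel)"
          by (rule nn_integral_sum[symmetric]) measurable
        also have "\<dots> \<le> (\<integral>\<^sup>+y. indicator (segment_in \<Omega> ?h) y * ennreal (\<bar>w (y + ?h) - w y\<bar> powr p) \<partial>lborel)"
          using l p by (intro nn_integral_mono)
            (auto simp flip: sum_distrib_left intro!: mult_left_mono ennreal_leI sum_level_trunc_diff_powr_le)
        also have "\<dots> \<le> ennreal (norm ?h powr p)" by (rule diff) fact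
        also have "\<dots> \<le> ennreal ((d / real M) powr p)"
          using hM p by (intro ennreal_leI powr_mono2) auto
        finally show ?thesis using True by simp
      qed simp
    qed
    also have "\<dots> = ennreal ((d / real M) powr p) * emeasure lborel (cball c a)"
      by (simp add: nn_integral_cmult_indicator)
    also have "\<dots> = ennreal (measure lborel (cball (0::'a) a) * (d / real M) powr p)"
      unfolding emeasure_lborel_cball_center[of c]
      using emeasure_lborel_cball_finite[of "0::'a" a]
      by (subst emeasure_eq_ennreal_measure) (auto simp: ennreal_mult mult.commute)
    finally show ?thesis .
  qed
  have "(\<Sum>k<K. \<Sum>c\<in>J. \<integral>\<^sup>+h. indicator (cball c a) h *
          (\<integral>\<^sup>+y. indicator (segment_in \<Omega> (h /\<^sub>R real M)) y *
             ennreal (\<bar>level_trunc (l * 2 ^ k) (w (y + h /\<^sub>R real M)) - level_trunc (l * 2 ^ k) (w y)\<bar> powr p) \<partial>lborel) \<partial>lborel)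
      \<le> (\<Sum>c\<in>J. ennreal (measure lborel (cball (0::'a) a) * (d / real M) powr p))"
    by (subst sum.swap) (intro sum_mono le)
  also have "\<dots> = ennreal (real (card J) * measure lborel (cball (0::'a) a) * (d / real M) powr p)"
    by (simp add: ennreal_mult' ennreal_of_nat_eq_real_of_nat mult.assoc)
  finally show ?thesis .
qed

text \<open>Let \<open>m k\<close> be the measure of \<open>{x. L k \<le> w x}\<close> with
  \<open>L k = l * 2 ^ k\<close>. \<open>level_set_decay\<close>, used at a scale comparable to
  \<open>m k powr (1 / n)\<close>, bounds \<open>L k powr p * m (Suc k)\<close> by
  \<open>m k powr (p / n)\<close> times the energy \<open>D k\<close> of the layer. Multiplied by
  \<open>L k powr (t - p)\<close> and with \<open>t * (p / n) = t - p\<close>, this becomes a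
  recursion for \<open>f k = L k powr t * m k\<close> with exponent \<open>p / n < 1\<close>. The
  energies have a bounded sum, so \<open>sum_bootstrap\<close> bounds the sum of the
  \<open>f k\<close>, which is comparable to the part of the integral of \<open>w powr t\<close>
  above level \<open>l\<close>.\<close>

lemma (in cone_domain) critical_sobolev:
  fixes p :: real
  assumes p: "1 \<le> p" "p < DIM('a)"
  defines "t \<equiv> DIM('a) * p / (DIM('a) - p)"
  shows "\<exists>C\<ge>0. \<forall>w \<in> borel_measurable borel.
     (\<forall>x. 0 \<le> w x) \<longrightarrow> (\<forall>x. x \<notin> \<Omega> \<longrightarrow> w x = 0) \<longrightarrow>
     (\<integral>\<^sup>+x. ennreal (w x powr p) \<partial>lborel) \<le> 1 \<longrightarrow>
     (\<forall>h. norm h \<le> d \<longrightarrow> (\<integral>\<^sup>+y. indicator (segment_in \<Omega> h) y *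
        ennreal (\<bar>w (y + h) - w y\<bar> powr p) \<partial>lborel) \<le> ennreal (norm h powr p)) \<longrightarrow>
     (\<integral>\<^sup>+x. ennreal (w x powr t) \<partial>lborel) \<le> ennreal C"
proof -
  define n where "n = DIM('a)"
  define \<kappa> where "\<kappa> = measure lborel (cball (0::'a) a)"
  have \<kappa>e: "emeasure lborel (cball (0::'a) a) = ennreal \<kappa>"
    unfolding \<kappa>_def using emeasure_lborel_cball_finite[of "0::'a" a]
    by (intro emeasure_eq_ennreal_measure) auto
  have \<kappa>: "0 < \<kappa>"
    using content_cball_pos[OF radius_pos, of "0::'a"] by (simp add: \<kappa>_def)
  have n: "p < n" "0 < n" using p by (auto simp: n_def)
  have t: "p < t" "0 < t" "t * (p / n) = t - p"
    using p n by (auto simp: t_def n_def[symmetric] field_simps)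
  \<comment> \<open>With \<open>l powr p = 2 / \<kappa>\<close> Markov's inequality gives all level
    sets measure at most \<open>\<kappa> / 2\<close>, so the scales \<open>b k\<close> below are at
    most 1.\<close>
  define l where "l = (2 / \<kappa>) powr (1 / p)"
  have l: "0 < l" using \<kappa> by (simp add: l_def)
  have lp: "l powr p = 2 / \<kappa>" using p \<kappa> by (simp add: l_def powr_powr)
  define L where "L k = l * 2 ^ k" for k :: nat
  have L: "0 < L k" "l \<le> L k" for k using l by (auto simp: L_def)
  define B where "B = 2 powr t * (2 / \<kappa>) * 4 powr p * (2 / \<kappa>) powr (p / n)"
  define C1 where "C1 = real (card J) * \<kappa> * d powr p"
  define C where "C = max 1 ((l powr (t - p) + B * C1) powr (1 / (1 - p / n)))"
  have B: "0 \<le> B" using \<kappa> by (simp add: B_def)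
  have main: "(\<integral>\<^sup>+x. ennreal (w x powr t) \<partial>lborel) \<le> ennreal (l powr (t - p) + 2 powr t * C)"
    if [measurable]: "w \<in> borel_measurable borel" and w_nonneg: "\<And>x. 0 \<le> w x" and w0: "\<And>x. x \<notin> \<Omega> \<Longrightarrow> w x = 0"
      and wp: "(\<integral>\<^sup>+x. ennreal (w x powr p) \<partial>lborel) \<le> 1"
      and diff: "\<And>h. norm h \<le> d \<Longrightarrow> (\<integral>\<^sup>+y. indicator (segment_in \<Omega> h) y *
        ennreal (\<bar>w (y + h) - w y\<bar> powr p) \<partial>lborel) \<le> ennreal (norm h powr p)" for w
  proof -
    define A where "A k = {x. L k \<le> w x}" for k
    have [measurable]: "A k \<in> sets borel" for k unfolding A_def by measurable
    define m where "m k = measure lborel (A k)" for k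
    have markov: "ennreal (L k powr p) * emeasure lborel (A k) \<le> 1" for k
    proof -
      have "ennreal (L k powr p) * emeasure lborel (A k) = (\<integral>\<^sup>+x. ennreal (L k powr p) * indicator (A k) x \<partial>lborel)"
        by (simp add: nn_integral_cmult_indicator)
      also have "\<dots> \<le> (\<integral>\<^sup>+x. ennreal (w x powr p) \<partial>lborel)"
        using L p by (intro nn_integral_mono) (auto split: split_indicator simp: A_def less_imp_le intro!: ennreal_leI powr_mono2)
      finally show ?thesis using wp by simp
    qed
    have em: "emeasure lborel (A k) = ennreal (m k)" for k
    proof -
      have "emeasure lborel (A k) \<noteq> \<infinity>"
        using markov[of k] L[of k] by (auto simp: ennreal_mult_top top_unique)
      then show ?thesis unfolding m_def by (intro emeasure_eq_ennreal_measure) auto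
    qed
    have m0: "0 \<le> m k" for k by (simp add: m_def)
    have mL: "L k powr p * m k \<le> 1" for k
      using markov[of k] m0 by (simp add: em ennreal_mult[symmetric])
    have mk: "2 * m k / \<kappa> \<le> 1" for k
    proof -
      have "(2 / \<kappa>) * m k \<le> L k powr p * m k"
        unfolding lp[symmetric] using L m0 l p by (intro mult_right_mono powr_mono2) auto
      then show ?thesis using mL[of k] by simp
    qed
    define f where "f k = L k powr t * m k" for k
    have partial: "(\<Sum>k\<le>K. f k) \<le> C" for K
    proof -
      \<comment> \<open>The dilation for which a ball of radius \<open>b k * a\<close> has twice the
        measure of the level set \<open>A k\<close>.\<close>
      define b where "b k = (2 * m k / \<kappa>) powr (1 / n)" for k
      have b1: "b k \<le> 1" for k
        unfolding b_def using mk[of k] m0[of k] \<kappa> by (intro powr_le1) auto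
      have "\<forall>\<^sub>F M in sequentially. \<forall>k\<in>{..<K}. 0 < m k \<longrightarrow> 1 / real M \<le> b k"
      proof (rule eventually_ball_finite, simp, intro ballI)
        fix k
        show "\<forall>\<^sub>F M in sequentially. 0 < m k \<longrightarrow> 1 / real M \<le> b k"
        proof (cases "0 < m k")
          case True
          then have "0 < b k" using \<kappa> by (simp add: b_def)
          with lim_1_over_n[where 'a=real] have "\<forall>\<^sub>F M in sequentially. 1 / real M < b k"
            by (rule order_tendstoD)
          then show ?thesis by (rule eventually_mono) auto
        qed simp
      qed
      then have "\<forall>\<^sub>F M in sequentially. 0 < M \<and> (\<forall>k\<in>{..<K}. 0 < m k \<longrightarrow> 1 / real M \<le> b k)"
        using eventually_gt_at_top[of 0] by eventually_elim auto
      \<comment> \<open>\<open>M\<close> depends on \<open>K\<close> and on the level sets. It is so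
        large that rounding \<open>b k * M\<close> up to an integer at most doubles it; the final
        bound does not contain \<open>M\<close>.\<close>
      then obtain M where M: "0 < M" "\<And>k. k < K \<Longrightarrow> 0 < m k \<Longrightarrow> 1 / real M \<le> b k"
        using eventually_happens'[OF sequentially_bot] by (metis (mono_tags, lifting) lessThan_iff)
      define G where "G k = (\<Sum>c\<in>J. \<integral>\<^sup>+h. indicator (cball c a) h *
          (\<integral>\<^sup>+y. indicator (segment_in \<Omega> (h /\<^sub>R real M)) y *
             ennreal (\<bar>level_trunc (L k) (w (y + h /\<^sub>R real M)) - level_trunc (L k) (w y)\<bar> powr p) \<partial>lborel) \<partial>lborel)" for k
      have sumG: "(\<Sum>k<K. G k) \<le> ennreal (C1 / real M powr p)"
      proof -
        have "(d / real M) powr p = d powr p / real M powr p"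
          using d_pos M by (simp add: powr_divide)
        then show ?thesis
          using sum_level_differences_le[OF \<open>w \<in> borel_measurable borel\<close> p(1) l M(1) diff, of K]
          by (simp add: G_def L_def C1_def \<kappa>_def)
      qed
      \<comment> \<open>The factor \<open>M powr p\<close> cancels the step length, so the sum of
        the \<open>D k\<close> is at most \<open>C1\<close>, independently of \<open>M\<close> and
        \<open>K\<close>.\<close>
      define D where "D k = (if k < K then real M powr p * enn2real (G k) else 0)" for k
      have GD: "G k = ennreal (D k / real M powr p)" if "k < K" for k
      proof -
        have "G k \<le> (\<Sum>k<K. G k)" using that by (intro member_le_sum) auto
        then have "G k < \<infinity>" using sumG by (auto simp: order.strict_trans1 ennreal_less_top)
        then show ?thesis using that M by (simp add: D_def)
      qed
      have D0: "0 \<le> D k" for k by (simp add: D_def)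
      have "ennreal (\<Sum>k<K. D k / real M powr p) = (\<Sum>k<K. G k)"
        using D0 GD by (subst sum_ennreal[symmetric]) auto
      with sumG have "ennreal (\<Sum>k<K. D k / real M powr p) \<le> ennreal (C1 / real M powr p)" by simp
      moreover have "0 \<le> C1" using \<kappa> by (simp add: C1_def)
      ultimately have "(\<Sum>k<K. D k / real M powr p) \<le> C1 / real M powr p"
        by (subst (asm) ennreal_le_iff) auto
      then have sumD: "(\<Sum>k<K. D k) \<le> C1"
        using M by (simp add: sum_divide_distrib[symmetric] divide_le_cancel)
      have step: "f (Suc k) \<le> B * f k powr (p / n) * D k" if k: "k < K" for k
      proof (cases "m k = 0")
        case True
        have "m (Suc k) \<le> m k"
        proof -
          have "A (Suc k) \<subseteq> A k" using l by (auto simp: A_def L_def intro: order_trans[rotated])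
          then have "emeasure lborel (A (Suc k)) \<le> emeasure lborel (A k)" by (intro emeasure_mono) auto
          then show ?thesis using m0 by (simp add: em)
        qed
        then have "m (Suc k) = 0" using True m0[of "Suc k"] by simp
        then show ?thesis using B D0 by (simp add: f_def)
      next
        case False
        then have mpos: "0 < m k" using m0[of k] by simp
        have b: "0 < b k" using mpos \<kappa> by (simp add: b_def)
        have bn: "b k ^ n = 2 * m k / \<kappa>"
          using n mpos \<kappa> b by (simp add: b_def powr_powr flip: powr_realpow)
        have bM: "1 \<le> b k * real M" using M(2)[OF k mpos] M(1) by (simp add: divide_le_eq)
        \<comment> \<open>Rounding up keeps \<open>N / M \<ge> b k\<close>, which is the smallness
          required by \<open>level_set_decay\<close>; \<open>b k \<le> 1\<close> gives
          \<open>N \<le> M\<close>.\<close>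
        define N where "N = nat \<lceil>b k * real M\<rceil>"
        have N1: "b k * real M \<le> real N" "real N < b k * real M + 1"
          using bM by (auto simp: N_def) linarith
        have N2: "0 < N" using N1 bM by linarith
        have "b k * real M \<le> real M" using b1[of k] M by (simp add: mult_le_cancel_right1)
        then have N3: "N \<le> M" unfolding N_def by (simp add: ceiling_le_iff nat_le_iff)
        have small: "2 * emeasure lborel {x. L k \<le> w x} \<le> ennreal ((real N / real M) ^ DIM('a)) * emeasure lborel (cball (0::'a) a)"
        proof -
          have "2 * m k = b k ^ n * \<kappa>" using \<kappa> by (simp add: bn)
          also have "\<dots> \<le> (real N / real M) ^ n * \<kappa>"
            using N1 M b \<kappa> by (intro mult_right_mono power_mono) (auto simp: le_divide_eq)
          finally show ?thesis
            using m0 \<kappa> by (simp add: em[of k, unfolded A_def] \<kappa>e n_def ennreal_mult[symmetric] ennreal_leI flip: ennreal_numeral)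
        qed
        have "ennreal (L k powr p / 2) * ennreal \<kappa> * emeasure lborel {x. 2 * L k \<le> w x} \<le> ennreal (2 powr p * real N powr p) * G k"
          using level_set_decay[OF _ w0 L(1) p(1) N2 N3 small] by (simp add: G_def \<kappa>e)
        moreover have "{x. 2 * L k \<le> w x} = A (Suc k)" by (simp add: A_def L_def mult_ac)
        ultimately have "ennreal (L k powr p / 2) * ennreal \<kappa> * ennreal (m (Suc k)) \<le> ennreal (2 powr p * real N powr p) * ennreal (D k / real M powr p)"
          by (simp add: em GD[OF k])
        then have "L k powr p / 2 * \<kappa> * m (Suc k) \<le> 2 powr p * real N powr p * (D k / real M powr p)"
          using \<kappa> m0 D0 by (simp add: ennreal_mult[symmetric])
        \<comment> \<open>By \<open>bM\<close>, \<open>b k * M\<close> is at least 1, hence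
          \<open>N < b k * M + 1 \<le> 2 * b k * M\<close>.\<close>
        also have "\<dots> \<le> 2 powr p * (2 * b k * real M) powr p * (D k / real M powr p)"
          using N1 bM p D0 by (intro mult_right_mono mult_left_mono powr_mono2) auto
        also have "\<dots> = 2 powr p * (2 powr p * b k powr p) * D k"
          using M b by (simp add: powr_mult)
        also have "\<dots> = 4 powr p * b k powr p * D k"
          using powr_mult[of 2 2 p] by simp
        finally have "L k powr p * m (Suc k) \<le> (2 / \<kappa>) * (4 powr p * b k powr p * D k)"
          using \<kappa> by (simp add: field_simps)
        then have "2 powr t * L k powr (t - p) * (L k powr p * m (Suc k)) \<le> 2 powr t * L k powr (t - p) * ((2 / \<kappa>) * (4 powr p * b k powr p * D k))"
          by (intro mult_left_mono) auto
        moreover have "2 powr t * L k powr (t - p) * (L k powr p * m (Suc k)) = f (Suc k)"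
        proof -
          have "L (Suc k) powr t = 2 powr t * L k powr t"
            using L by (simp add: L_def powr_mult mult_ac)
          moreover have "L k powr (t - p) * L k powr p = L k powr t" using L[of k] by (simp flip: powr_add)
          ultimately show ?thesis by (simp add: f_def)
        qed
        moreover have "2 powr t * L k powr (t - p) * ((2 / \<kappa>) * (4 powr p * b k powr p * D k)) = B * f k powr (p / n) * D k"
        proof -
          have bp: "b k powr p = (2 / \<kappa>) powr (p / n) * m k powr (p / n)"
            using mpos \<kappa> n by (simp add: b_def powr_powr powr_mult powr_divide)
          have fp: "f k powr (p / n) = L k powr (t - p) * m k powr (p / n)"
            using L[of k] mpos t by (simp add: f_def powr_mult powr_powr)
          show ?thesis unfolding B_def bp fp by (simp only: mult_ac)
        qed
        ultimately show ?thesis by simp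
      qed
      have f0: "f 0 \<le> l powr (t - p)"
      proof -
        have "f 0 = l powr (t - p) * (L 0 powr p * m 0)"
          using l by (simp add: f_def L_def powr_add[symmetric] mult.assoc[symmetric])
        also have "\<dots> \<le> l powr (t - p) * 1" by (intro mult_left_mono mL) auto
        finally show ?thesis by simp
      qed
      show ?thesis unfolding C_def
        by (rule sum_bootstrap[where D=D]) (use m0 D0 B p n step sumD f0 in \<open>auto simp: f_def\<close>)
    qed
    have "(\<integral>\<^sup>+x. ennreal (w x powr t) \<partial>lborel) \<le>
      (\<integral>\<^sup>+x. ennreal (l powr (t - p)) * ennreal (w x powr p) + ennreal (2 powr t) * (\<Sum>k. ennreal (L k powr t) * indicator (A k) x) \<partial>lborel)"
    \<comment> \<open>Below \<open>l\<close> the excess power \<open>t - p\<close> is bounded by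
      that of \<open>l\<close>. Above \<open>l\<close> the value lies between some
      \<open>L k\<close> and \<open>L (Suc k) = 2 * L k\<close>, so one term of the series suffices
      up to the factor \<open>2 powr t\<close>.\<close>
    proof (intro nn_integral_mono)
      fix x
      show "ennreal (w x powr t) \<le> ennreal (l powr (t - p)) * ennreal (w x powr p) + ennreal (2 powr t) * (\<Sum>k. ennreal (L k powr t) * indicator (A k) x)"
      proof (cases "w x < l")
        case True
        have "w x powr t = w x powr (t - p) * w x powr p" by (simp flip: powr_add)
        also have "\<dots> \<le> l powr (t - p) * w x powr p"
          using True w_nonneg t by (intro mult_right_mono powr_mono2) auto
        finally have "ennreal (w x powr t) \<le> ennreal (l powr (t - p)) * ennreal (w x powr p)"
          by (simp add: ennreal_leI flip: ennreal_mult)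
        then show ?thesis by (rule order_trans) simp
      next
        case False
        obtain N where N: "w x < L N"
        proof -
          obtain N :: nat where "w x / l < 2 ^ N" using real_arch_pow[of 2 "w x / l"] by auto
          then show ?thesis using l that by (simp add: L_def field_simps)
        qed
        define P where "P k \<longleftrightarrow> w x < L (Suc k)" for k
        define k where "k = Least P"
        have "N \<noteq> 0" using N False by (intro notI) (simp add: L_def)
        then obtain N' where "N = Suc N'" using not0_implies_Suc by blast
        then have "P N'" using N by (simp add: P_def)
        then have "P k" unfolding k_def by (rule LeastI)
        then have k: "w x < L (Suc k)" by (simp add: P_def)
        have k2: "L k \<le> w x"
        proof (cases k)
          case 0
          then show ?thesis using False by (simp add: L_def)
        next
          case (Suc j)
          then have "\<not> P j" using not_less_Least[of j P] by (simp add: k_def)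
          then show ?thesis using Suc by (simp add: P_def)
        qed
        have "w x powr t \<le> L (Suc k) powr t" using k w_nonneg t by (intro powr_mono2) auto
        also have "\<dots> = 2 powr t * L k powr t" using L by (simp add: L_def powr_mult mult_ac)
        finally have "ennreal (w x powr t) \<le> ennreal (2 powr t) * (ennreal (L k powr t) * indicator (A k) x)"
          using k2 by (simp add: A_def ennreal_leI flip: ennreal_mult)
        also have "\<dots> \<le> ennreal (2 powr t) * (\<Sum>k. ennreal (L k powr t) * indicator (A k) x)"
        proof (rule mult_left_mono)
          define F where "F j = ennreal (L j powr t) * indicator (A j) x" for j
          have "(\<Sum>j\<in>{k}. F j) \<le> suminf F" by (intro sum_le_suminf) auto
          then have "F k \<le> suminf F" by simp
          then show "ennreal (L k powr t) * indicator (A k) x \<le> (\<Sum>k. ennreal (L k powr t) * indicator (A k) x)"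
            unfolding F_def .
        qed simp
        finally show ?thesis by (rule order_trans) simp
      qed
    qed
    also have "\<dots> = ennreal (l powr (t - p)) * (\<integral>\<^sup>+x. ennreal (w x powr p) \<partial>lborel) + ennreal (2 powr t) * (\<Sum>k. ennreal (L k powr t) * emeasure lborel (A k))"
      by (simp add: nn_integral_add nn_integral_cmult nn_integral_suminf nn_integral_cmult_indicator)
    also have "\<dots> \<le> ennreal (l powr (t - p)) * 1 + ennreal (2 powr t) * ennreal C"
    proof (intro add_mono mult_left_mono wp)
      have "(\<Sum>k<K. ennreal (L k powr t) * emeasure lborel (A k)) \<le> ennreal C" for K
      proof -
        have "(\<Sum>k<K. ennreal (L k powr t) * emeasure lborel (A k)) = ennreal (\<Sum>k<K. f k)"
          using m0 by (subst sum_ennreal[symmetric]) (auto simp: em f_def ennreal_mult)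
        also have "(\<Sum>k<K. f k) \<le> (\<Sum>k\<le>K. f k)" using m0 by (intro sum_mono2) (auto simp: f_def)
        finally show ?thesis using partial[of K] by (meson ennreal_leI order_trans)
      qed
      then show "(\<Sum>k. ennreal (L k powr t) * emeasure lborel (A k)) \<le> ennreal C"
        by (intro suminf_le_const) auto
    qed auto
    also have "\<dots> = ennreal (l powr (t - p) + 2 powr t * C)"
      by (simp add: C_def ennreal_mult)
    finally show ?thesis .
  qed
  show ?thesis
    by (intro exI[of _ "l powr (t - p) + 2 powr t * C"] conjI) (use main in \<open>auto simp: C_def\<close>)
qed

subsection \<open>Iterated Sobolev inequalities\<close>

text \<open>Encodes that \<open>f\<close> bounds the norm of the weak gradient of \<open>u\<close>; in a chain, \<open>f k\<close> bounds the derivatives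
  of order \<open>k\<close>.\<close>

definition gradient_bound :: "'a::euclidean_space set \<Rightarrow> ('a \<Rightarrow> real) \<Rightarrow> ('a \<Rightarrow> real) \<Rightarrow> bool" where
  "gradient_bound \<Omega> u f \<longleftrightarrow> (\<forall>h. AE y in lborel. y \<in> segment_in \<Omega> h \<longrightarrow>
     ennreal \<bar>u (y + h) - u y\<bar> \<le>
       ennreal (norm h) * (\<integral>\<^sup>+s. indicator {0..1} s * ennreal (f (y + s *\<^sub>R h)) \<partial>lborel))"

definition gradient_chain :: "'a::euclidean_space set \<Rightarrow> nat \<Rightarrow> (nat \<Rightarrow> 'a \<Rightarrow> real) \<Rightarrow> bool" where
  "gradient_chain \<Omega> r f \<longleftrightarrow> (\<forall>k. f k \<in> borel_measurable borel) \<and> (\<forall>k x. 0 \<le> f k x) \<and>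
     (\<forall>k x. x \<notin> \<Omega> \<longrightarrow> f k x = 0) \<and> (\<forall>k<r. gradient_bound \<Omega> (f k) (f (Suc k)))"

text \<open>\<open>powr_le_nn_integral\<close> on the unit interval: its mass is 1, so only the
  constant \<open>2 powr p\<close> remains.\<close>

lemma powr_le_unit_integral:
  assumes [measurable]: "F \<in> borel_measurable borel" and F: "\<And>s. 0 \<le> F s" and p: "1 \<le> p"
    and c: "0 \<le> c" and a: "0 \<le> a"
    and le: "ennreal a \<le> ennreal c * (\<integral>\<^sup>+s. indicator {0..1::real} s * ennreal (F s) \<partial>lborel)"
  shows "ennreal (a powr p) \<le> ennreal (2 powr p * c powr p) *
    (\<integral>\<^sup>+s. indicator {0..1} s * ennreal (F s powr p) \<partial>lborel)"
proof -
  let ?M = "density lborel (indicator {0..1::real})"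
  have "ennreal (a powr p) \<le> ennreal (2 powr p * 1 powr (p - 1)) * (\<integral>\<^sup>+s. ennreal ((c * F s) powr p) \<partial>?M)"
  proof (rule powr_le_nn_integral)
    show "ennreal a \<le> (\<integral>\<^sup>+s. ennreal (c * F s) \<partial>?M)"
      using le c F by (simp add: nn_integral_density nn_integral_cmult[symmetric] ennreal_mult mult_ac)
    show "emeasure ?M (space ?M) \<le> ennreal 1"
      by (simp add: emeasure_density)
  qed (use c F p a in auto)
  also have "\<dots> = ennreal (2 powr p) * (\<integral>\<^sup>+s. ennreal (c powr p) * (indicator {0..1} s * ennreal (F s powr p)) \<partial>lborel)"
    using c F by (simp add: nn_integral_density powr_mult ennreal_mult mult_ac)
  also have "\<dots> = ennreal (2 powr p * c powr p) * (\<integral>\<^sup>+s. indicator {0..1} s * ennreal (F s powr p) \<partial>lborel)"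
    by (subst nn_integral_cmult) (auto simp: ennreal_mult mult.assoc)
  finally show ?thesis .
qed

context cone_domain
begin

text \<open>Multiply \<open>u\<close> by a cutoff of slope 1 that equals 1 on the ball of radius
  \<open>R\<close> and 0 outside radius \<open>R + 1\<close>, and normalise. The product has
  increments controlled by \<open>f\<close> and \<open>u\<close> on a larger ball, so
  \<open>critical_sobolev\<close> applies. The margin \<open>1 + d\<close> consists of the width of
  the cutoff and the length \<open>d\<close> of the increments considered; the constant is
  independent of centre and radius.\<close>

lemma cutoff_sobolev:
  fixes p b :: real
  assumes p: "1 \<le> p" "p < DIM('a)" and b: "0 \<le> b"
  defines "t \<equiv> DIM('a) * p / (DIM('a) - p)"
  shows "\<exists>C\<ge>0. \<forall>u\<in>borel_measurable borel. \<forall>f\<in>borel_measurable borel. \<forall>x0 R.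
     (\<forall>x. 0 \<le> u x) \<longrightarrow> (\<forall>x. 0 \<le> f x) \<longrightarrow> (\<forall>x. x \<notin> \<Omega> \<longrightarrow> u x = 0) \<longrightarrow> gradient_bound \<Omega> u f \<longrightarrow>
     (\<integral>\<^sup>+x. indicator (ball x0 (R + (1 + d))) x * ennreal (u x powr p) \<partial>lborel) \<le> ennreal b \<longrightarrow>
     (\<integral>\<^sup>+x. indicator (ball x0 (R + (1 + d))) x * ennreal (f x powr p) \<partial>lborel) \<le> ennreal b \<longrightarrow>
     (\<integral>\<^sup>+x. indicator (ball x0 R) x * ennreal (u x powr t) \<partial>lborel) \<le> ennreal C"
proof -
  \<comment> \<open>\<open>A\<close> dominates both quantities to be normalised: the bound
    \<open>b\<close> for the integral of \<open>u powr p\<close>, and the factor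
    \<open>2 powr p * (2 powr p + 1) * b\<close> from the increments. Dividing by its
    \<open>p\<close>-th root makes both at most 1.\<close>
  define A where "A = 2 powr p * (2 powr p + 1) * b + b + 1"
  define c where "c = 1 / A powr (1 / p)"
  have A: "1 \<le> A" using b by (auto simp: A_def)
  have c: "0 < c" using A by (simp add: c_def)
  have cp: "c powr p * A = 1" using A p by (simp add: c_def powr_divide powr_powr)
  have cA: "c powr p * x \<le> 1" if "x \<le> A" for x
  proof -
    have "c powr p * x \<le> c powr p * A" by (rule mult_left_mono[OF that]) simp
    then show ?thesis using cp by simp
  qed
  obtain C where C: "0 \<le> C" and C0: "\<forall>w \<in> borel_measurable borel.
     (\<forall>x. 0 \<le> w x) \<longrightarrow> (\<forall>x. x \<notin> \<Omega> \<longrightarrow> w x = 0) \<longrightarrow>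
     (\<integral>\<^sup>+x. ennreal (w x powr p) \<partial>lborel) \<le> 1 \<longrightarrow>
     (\<forall>h. norm h \<le> d \<longrightarrow> (\<integral>\<^sup>+y. indicator (segment_in \<Omega> h) y *
        ennreal (\<bar>w (y + h) - w y\<bar> powr p) \<partial>lborel) \<le> ennreal (norm h powr p)) \<longrightarrow>
     (\<integral>\<^sup>+x. ennreal (w x powr t) \<partial>lborel) \<le> ennreal C"
    using critical_sobolev[OF p] unfolding t_def[symmetric] by (elim exE conjE)
  note C' = C0[rule_format]
  have main: "(\<integral>\<^sup>+x. indicator (ball x0 R) x * ennreal (u x powr t) \<partial>lborel) \<le> ennreal (c powr (- t) * C)"
    if [measurable]: "u \<in> borel_measurable borel" "f \<in> borel_measurable borel"
      and u0: "\<And>x. 0 \<le> u x" and f0: "\<And>x. 0 \<le> f x" and uz: "\<And>x. x \<notin> \<Omega> \<Longrightarrow> u x = 0"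
      and gb: "gradient_bound \<Omega> u f"
      and ub: "(\<integral>\<^sup>+x. indicator (ball x0 (R + (1 + d))) x * ennreal (u x powr p) \<partial>lborel) \<le> ennreal b"
      and fb: "(\<integral>\<^sup>+x. indicator (ball x0 (R + (1 + d))) x * ennreal (f x powr p) \<partial>lborel) \<le> ennreal b"
    for u f x0 R
  proof -
    define B where "B = ball x0 (R + (1 + d))"
    have [measurable]: "B \<in> sets borel" by (simp add: B_def)
    define \<zeta> where "\<zeta> x = max 0 (min 1 (R + 1 - norm (x - x0)))" for x
    have [measurable]: "\<zeta> \<in> borel_measurable borel" unfolding \<zeta>_def by measurable
    have \<zeta>: "0 \<le> \<zeta> x" "\<zeta> x \<le> 1" for x by (auto simp: \<zeta>_def)
    have \<zeta>0: "\<zeta> x = 0" if "x \<notin> ball x0 (R + 1)" for x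
      using that by (auto simp: \<zeta>_def dist_norm norm_minus_commute)
    \<comment> \<open>An increment of length at most \<open>d\<close> is felt by the cutoff only for
      starting points within \<open>R + 1 + d\<close> of the centre.\<close>
    have lip: "\<bar>\<zeta> (y + h) - \<zeta> y\<bar> \<le> norm h * indicator B y" if h: "norm h \<le> d" for y h
    proof (cases "y \<in> B")
      case True
      have "\<bar>norm (y + h - x0) - norm (y - x0)\<bar> \<le> norm h"
        using norm_triangle_ineq3[of "y + h - x0" "y - x0"] by simp
      then show ?thesis using True by (auto simp: \<zeta>_def)
    next
      case False
      have "norm (y - x0) \<le> norm (y + h - x0) + norm h"
        using norm_triangle_ineq4[of "y + h - x0" h] by simp
      then have "\<zeta> (y + h) = 0" "\<zeta> y = 0"
        using False h norm_ge_zero[of h] d_pos by (auto simp: B_def \<zeta>_def dist_norm norm_minus_commute)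
      then show ?thesis by simp
    qed
    define w where "w x = c * (\<zeta> x * u x)" for x
    have [measurable]: "w \<in> borel_measurable borel" unfolding w_def by measurable
    have "(\<integral>\<^sup>+x. ennreal (w x powr t) \<partial>lborel) \<le> ennreal C"
    proof (rule C')
      show "0 \<le> w x" for x using c \<zeta> u0 by (simp add: w_def)
      show "w x = 0" if "x \<notin> \<Omega>" for x using uz that by (simp add: w_def)
      have "(\<integral>\<^sup>+x. ennreal (w x powr p) \<partial>lborel) \<le> (\<integral>\<^sup>+x. ennreal (c powr p) * (indicator B x * ennreal (u x powr p)) \<partial>lborel)"
      proof (intro nn_integral_mono)
        fix x
        have "w x = 0" if "x \<notin> B"
          using that \<zeta>0[of x] d_pos by (auto simp: w_def B_def)
        moreover have "w x powr p \<le> c powr p * u x powr p"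
          using c \<zeta>[of x] u0[of x] p mult_right_mono[OF \<zeta>(2)[of x] u0[of x]]
          by (simp add: w_def powr_mult mult_left_mono powr_mono2 flip: powr_mult)
        ultimately show "ennreal (w x powr p) \<le> ennreal (c powr p) * (indicator B x * ennreal (u x powr p))"
          by (cases "x \<in> B") (auto simp flip: ennreal_mult intro!: ennreal_leI)
      qed
      also have "\<dots> \<le> ennreal (c powr p) * ennreal b"
        using ub unfolding B_def[symmetric] by (subst nn_integral_cmult) (auto intro!: mult_left_mono)
      also have "\<dots> \<le> 1"
        using cA[of b] b by (simp add: A_def flip: ennreal_mult) 
      finally show "(\<integral>\<^sup>+x. ennreal (w x powr p) \<partial>lborel) \<le> 1" .
    next
      fix h :: 'a assume h: "norm h \<le> d"
      define I where "I y = (\<integral>\<^sup>+s. indicator {0..1} s * ennreal ((indicator B (y + s *\<^sub>R h) * f (y + s *\<^sub>R h)) powr p) \<partial>lborel)" for y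
      have [measurable]: "I \<in> borel_measurable borel" unfolding I_def by measurable
      have "AE y in lborel. y \<in> segment_in \<Omega> h \<longrightarrow> ennreal \<bar>u (y + h) - u y\<bar> \<le>
       ennreal (norm h) * (\<integral>\<^sup>+s. indicator {0..1} s * ennreal (f (y + s *\<^sub>R h)) \<partial>lborel)"
        using gb by (simp add: gradient_bound_def)
      then have "(\<integral>\<^sup>+y. indicator (segment_in \<Omega> h) y * ennreal (\<bar>w (y + h) - w y\<bar> powr p) \<partial>lborel)
        \<le> (\<integral>\<^sup>+y. ennreal (c powr p * (2 powr p * norm h powr p)) * (ennreal (2 powr p) * I y + indicator B y * ennreal (u y powr p)) \<partial>lborel)"
      proof (intro nn_integral_mono_AE, elim eventually_mono)
        fix y
        assume y: "y \<in> segment_in \<Omega> h \<longrightarrow> ennreal \<bar>u (y + h) - u y\<bar> \<le>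
          ennreal (norm h) * (\<integral>\<^sup>+s. indicator {0..1} s * ennreal (f (y + s *\<^sub>R h)) \<partial>lborel)"
        show "indicator (segment_in \<Omega> h) y * ennreal (\<bar>w (y + h) - w y\<bar> powr p)
          \<le> ennreal (c powr p * (2 powr p * norm h powr p)) * (ennreal (2 powr p) * I y + indicator B y * ennreal (u y powr p))"
        proof (cases "y \<in> segment_in \<Omega> h")
          case True
          \<comment> \<open>Product rule for increments with the cutoff taken at the endpoint
            \<open>y + h\<close>: where it does not vanish, the endpoint is within
            \<open>R + 1\<close> of the centre and the whole segment lies in
            \<open>B\<close>.\<close>
          define \<alpha> where "\<alpha> = \<zeta> (y + h) * \<bar>u (y + h) - u y\<bar>"
          define \<beta> where "\<beta> = norm h * (indicator B y * u y)"
          have \<alpha>\<beta>: "0 \<le> \<alpha>" "0 \<le> \<beta>" using \<zeta> u0 by (auto simp: \<alpha>_def \<beta>_def)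
          have 1: "ennreal (\<alpha> powr p) \<le> ennreal (2 powr p * norm h powr p) * I y"
            unfolding I_def
          proof (rule powr_le_unit_integral)
            show "ennreal \<alpha> \<le> ennreal (norm h) * (\<integral>\<^sup>+s. indicator {0..1} s * ennreal (indicator B (y + s *\<^sub>R h) * f (y + s *\<^sub>R h)) \<partial>lborel)"
            proof (cases "y + h \<in> ball x0 (R + 1)")
              case False
              then show ?thesis using \<zeta>0 by (simp add: \<alpha>_def)
            next
              case in_ball: True
              have B: "y + s *\<^sub>R h \<in> B" if "s \<in> {0..1}" for s
              proof -
                have "norm ((1 - s) *\<^sub>R h) \<le> 1 * norm h"
                  using that by (simp add: mult_left_le_one_le)
                moreover have "norm (y + s *\<^sub>R h - x0) \<le> norm (y + h - x0) + norm ((1 - s) *\<^sub>R h)"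
                  using norm_triangle_ineq4[of "y + h - x0" "(1 - s) *\<^sub>R h"] by (simp add: algebra_simps)
                ultimately show ?thesis
                  using in_ball h by (auto simp: B_def dist_norm norm_minus_commute)
              qed
              have "ennreal \<alpha> \<le> ennreal \<bar>u (y + h) - u y\<bar>"
                using \<zeta>[of "y + h"] by (intro ennreal_leI) (auto simp: \<alpha>_def mult_left_le_one_le)
              also have "\<dots> \<le> ennreal (norm h) * (\<integral>\<^sup>+s. indicator {0..1} s * ennreal (f (y + s *\<^sub>R h)) \<partial>lborel)"
                using y True by simp
              also have "(\<integral>\<^sup>+s. indicator {0..1} s * ennreal (f (y + s *\<^sub>R h)) \<partial>lborel) =
                (\<integral>\<^sup>+s. indicator {0..1} s * ennreal (indicator B (y + s *\<^sub>R h) * f (y + s *\<^sub>R h)) \<partial>lborel)"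
                using B by (intro nn_integral_cong) (auto split: split_indicator)
              finally show ?thesis .
            qed
          qed (use f0 p \<alpha>\<beta> in auto)
          have "\<bar>\<zeta> (y + h) * u (y + h) - \<zeta> y * u y\<bar> \<le> \<alpha> + \<beta>"
          proof -
            have "\<zeta> (y + h) * u (y + h) - \<zeta> y * u y = \<zeta> (y + h) * (u (y + h) - u y) + (\<zeta> (y + h) - \<zeta> y) * u y"
              by (simp add: algebra_simps)
            also have "\<bar>\<dots>\<bar> \<le> \<zeta> (y + h) * \<bar>u (y + h) - u y\<bar> + \<bar>\<zeta> (y + h) - \<zeta> y\<bar> * u y"
              using \<zeta>[of "y + h"] u0[of y] by (intro order_trans[OF abs_triangle_ineq]) (simp add: abs_mult)
            also have "\<dots> \<le> \<alpha> + \<beta>"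
              using mult_right_mono[OF lip[OF h, of y] u0[of y]] by (simp add: \<alpha>_def \<beta>_def mult.assoc)
            finally show ?thesis .
          qed
          then have "\<bar>w (y + h) - w y\<bar> \<le> c * (\<alpha> + \<beta>)"
            using c by (simp add: w_def abs_mult flip: right_diff_distrib)
          then have "\<bar>w (y + h) - w y\<bar> powr p \<le> (c * (\<alpha> + \<beta>)) powr p"
            using p by (intro powr_mono2) auto
          also have "\<dots> = c powr p * (\<alpha> + \<beta>) powr p" using c \<alpha>\<beta> by (simp add: powr_mult)
          also have "\<dots> \<le> c powr p * (2 powr p * (\<alpha> powr p + \<beta> powr p))"
            using \<alpha>\<beta> p by (intro mult_left_mono powr_add_le_two) auto
          finally have "ennreal (\<bar>w (y + h) - w y\<bar> powr p) \<le> ennreal (c powr p * 2 powr p) * (ennreal (\<alpha> powr p) + ennreal (\<beta> powr p))"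
            by (simp add: ennreal_leI mult.assoc flip: ennreal_mult ennreal_plus)
          also have "\<dots> \<le> ennreal (c powr p * 2 powr p) * (ennreal (2 powr p * norm h powr p) * I y + ennreal (norm h powr p) * (indicator B y * ennreal (u y powr p)))"
          proof (intro mult_left_mono add_mono 1)
            show "ennreal (\<beta> powr p) \<le> ennreal (norm h powr p) * (indicator B y * ennreal (u y powr p))"
              using u0 by (auto simp: \<beta>_def powr_mult split: split_indicator simp flip: ennreal_mult)
          qed auto
          also have "\<dots> = ennreal (c powr p * (2 powr p * norm h powr p)) * (ennreal (2 powr p) * I y + indicator B y * ennreal (u y powr p))"
            by (simp add: ennreal_mult distrib_left mult_ac)
          finally show ?thesis using True by simp
        qed simp
      qed
      also have "\<dots> = ennreal (c powr p * (2 powr p * norm h powr p)) * (ennreal (2 powr p) * (\<integral>\<^sup>+y. I y \<partial>lborel) + (\<integral>\<^sup>+y. indicator B y * ennreal (u y powr p) \<partial>lborel))"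
        by (simp add: nn_integral_cmult nn_integral_add)
      also have "\<dots> \<le> ennreal (c powr p * (2 powr p * norm h powr p)) * (ennreal (2 powr p) * ennreal b + ennreal b)"
      proof (intro mult_left_mono add_mono)
        show "(\<integral>\<^sup>+y. indicator B y * ennreal (u y powr p) \<partial>lborel) \<le> ennreal b"
          using ub by (simp add: B_def)
        have "(\<integral>\<^sup>+y. I y \<partial>lborel) = (\<integral>\<^sup>+s. \<integral>\<^sup>+y. indicator {0..1} s * ennreal ((indicator B (y + s *\<^sub>R h) * f (y + s *\<^sub>R h)) powr p) \<partial>lborel \<partial>lborel)"
          unfolding I_def by (rule lborel_pair.Fubini') measurable
        also have "\<dots> = (\<integral>\<^sup>+s. indicator {0..1::real} s * (\<integral>\<^sup>+y. ennreal ((indicator B y * f y) powr p) \<partial>lborel) \<partial>lborel)"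
        proof (intro nn_integral_cong)
          fix s :: real
          have "(\<integral>\<^sup>+y. ennreal ((indicator B (y + s *\<^sub>R h) * f (y + s *\<^sub>R h)) powr p) \<partial>lborel) = (\<integral>\<^sup>+y. ennreal ((indicator B y * f y) powr p) \<partial>lborel)"
            by (rule nn_integral_lborel_shift[of "\<lambda>y. ennreal ((indicator B y * f y) powr p)"]) measurable
          then show "(\<integral>\<^sup>+y. indicator {0..1} s * ennreal ((indicator B (y + s *\<^sub>R h) * f (y + s *\<^sub>R h)) powr p) \<partial>lborel) =
            indicator {0..1} s * (\<integral>\<^sup>+y. ennreal ((indicator B y * f y) powr p) \<partial>lborel)"
            by (subst nn_integral_cmult) auto
        qed
        also have "\<dots> = (\<integral>\<^sup>+y. ennreal ((indicator B y * f y) powr p) \<partial>lborel)"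
          by (subst nn_integral_multc) auto
        also have "\<dots> = (\<integral>\<^sup>+y. indicator B y * ennreal (f y powr p) \<partial>lborel)"
          by (intro nn_integral_cong) (auto split: split_indicator)
        finally show "(\<integral>\<^sup>+y. I y \<partial>lborel) \<le> ennreal b" using fb by (simp add: B_def)
      qed auto
      also have "\<dots> = ennreal ((c powr p * (2 powr p * (2 powr p + 1) * b)) * norm h powr p)"
        using b by (simp add: ennreal_mult[symmetric] ennreal_plus[symmetric] algebra_simps del: ennreal_plus)
      also have "\<dots> \<le> ennreal (1 * norm h powr p)"
        using b by (intro ennreal_leI mult_right_mono cA) (auto simp: A_def)
      finally show "(\<integral>\<^sup>+y. indicator (segment_in \<Omega> h) y * ennreal (\<bar>w (y + h) - w y\<bar> powr p) \<partial>lborel) \<le> ennreal (norm h powr p)"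
        by simp
    qed measurable
    have "(\<integral>\<^sup>+x. indicator (ball x0 R) x * ennreal (u x powr t) \<partial>lborel) \<le> (\<integral>\<^sup>+x. ennreal (c powr (- t)) * ennreal (w x powr t) \<partial>lborel)"
    proof (intro nn_integral_mono)
      fix x
      show "indicator (ball x0 R) x * ennreal (u x powr t) \<le> ennreal (c powr (- t)) * ennreal (w x powr t)"
      proof (cases "x \<in> ball x0 R")
        case True
        then have "\<zeta> x = 1" by (auto simp: \<zeta>_def dist_norm norm_minus_commute)
        then have "c powr (- t) * w x powr t = u x powr t"
          using c u0 by (simp add: w_def powr_mult powr_minus)
        then show ?thesis using True by (simp flip: ennreal_mult)
      qed simp
    qed
    also have "\<dots> = ennreal (c powr (- t)) * (\<integral>\<^sup>+x. ennreal (w x powr t) \<partial>lborel)"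
      by (subst nn_integral_cmult) auto
    also have "\<dots> \<le> ennreal (c powr (- t)) * ennreal C"
      by (rule mult_left_mono) (fact, simp)
    finally show ?thesis using C by (simp add: ennreal_mult)
  qed
  show ?thesis
  proof (rule exI[of _ "c powr (- t) * C"], intro conjI ballI allI impI)
    show "0 \<le> c powr (- t) * C" using C by simp
  qed (rule main[rotated 5], assumption, auto)
qed

text \<open>Each application of \<open>cutoff_sobolev\<close> lowers the reciprocal exponent by
  \<open>1 / DIM('a)\<close> and uses up one order of derivatives and one margin
  \<open>1 + d\<close>. The hypothesis \<open>real r * p < DIM('a)\<close> keeps every exponent to
  which it is applied below the dimension.\<close>

lemma iterated_sobolev:
  fixes p b :: real
  assumes p: "1 \<le> p" and rp: "real r * p < DIM('a)" and b: "0 \<le> b" and m: "m \<le> r"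
  shows "\<exists>C\<ge>0. \<forall>f x0 R. gradient_chain \<Omega> r f \<longrightarrow>
     (\<forall>k\<le>r. (\<integral>\<^sup>+x. indicator (ball x0 (R + real m * (1 + d))) x * ennreal (f k x powr p) \<partial>lborel) \<le> ennreal b) \<longrightarrow>
     (\<forall>k\<le>r - m. (\<integral>\<^sup>+x. indicator (ball x0 R) x * ennreal (f k x powr (1 / (1 / p - real m / DIM('a)))) \<partial>lborel) \<le> ennreal C)"
  using m
proof (induction m)
  case 0
  then show ?case by (intro exI[of _ b]) (auto simp: b)
next
  case (Suc m)
  define n where "n = real DIM('a)"
  have n: "0 < n" by (simp add: n_def)
  define pm where "pm = 1 / (1 / p - real m / n)"
  have "m \<le> r" using Suc.prems by simp
  from Suc.IH[OF this] obtain B where B: "0 \<le> B" and IH0: "\<forall>f x0 R. gradient_chain \<Omega> r f \<longrightarrow>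
     (\<forall>k\<le>r. (\<integral>\<^sup>+x. indicator (ball x0 (R + real m * (1 + d))) x * ennreal (f k x powr p) \<partial>lborel) \<le> ennreal b) \<longrightarrow>
     (\<forall>k\<le>r - m. (\<integral>\<^sup>+x. indicator (ball x0 R) x * ennreal (f k x powr pm) \<partial>lborel) \<le> ennreal B)"
    unfolding pm_def n_def by (elim exE conjE)
  note IH = IH0[rule_format]
  have "real (Suc m) * p \<le> real r * p" using Suc.prems p by (intro mult_right_mono) auto
  then have sm: "real (Suc m) * p < n" using rp by (simp add: n_def)
  have *: "real (Suc m) / n < 1 / p"
  proof -
    have "real (Suc m) / n = real (Suc m) * p / (n * p)" using p by simp
    also have "\<dots> < n / (n * p)" using sm n p by (intro divide_strict_right_mono) auto
    finally show ?thesis using n by simp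
  qed
  have "real (Suc m) / n = 1 / n + real m / n" by (simp only: of_nat_Suc add_divide_distrib)
  with * have e: "1 / n < 1 / p - real m / n" by linarith
  then have pm: "0 < 1 / p - real m / n" using n by (meson less_trans zero_less_divide_1_iff)
  have pm1: "1 \<le> pm"
  proof -
    have "1 / p \<le> 1" "0 \<le> real m / n" using p n by auto
    then have "1 / p - real m / n \<le> 1" by linarith
    then show ?thesis using pm by (simp add: pm_def)
  qed
  have "1 / (1 / p - real m / n) < 1 / (1 / n)"
    using e pm n by (intro divide_strict_left_mono) auto
  then have pmn: "pm < n" by (simp add: pm_def)
  have t: "n * pm / (n - pm) = 1 / (1 / p - real (Suc m) / n)"
  proof -
    have "1 / p - real (Suc m) / n = 1 / pm - 1 / n" using n by (simp add: pm_def add_divide_distrib)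
    also have "\<dots> = (n - pm) / (n * pm)" using pm1 n by (simp add: field_simps)
    finally show ?thesis by simp
  qed
  obtain C where C: "0 \<le> C" and C0: "\<forall>u\<in>borel_measurable borel. \<forall>f\<in>borel_measurable borel. \<forall>x0 R.
     (\<forall>x. 0 \<le> u x) \<longrightarrow> (\<forall>x. 0 \<le> f x) \<longrightarrow> (\<forall>x. x \<notin> \<Omega> \<longrightarrow> u x = 0) \<longrightarrow> gradient_bound \<Omega> u f \<longrightarrow>
     (\<integral>\<^sup>+x. indicator (ball x0 (R + (1 + d))) x * ennreal (u x powr pm) \<partial>lborel) \<le> ennreal B \<longrightarrow>
     (\<integral>\<^sup>+x. indicator (ball x0 (R + (1 + d))) x * ennreal (f x powr pm) \<partial>lborel) \<le> ennreal B \<longrightarrow>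
     (\<integral>\<^sup>+x. indicator (ball x0 R) x * ennreal (u x powr (1 / (1 / p - real (Suc m) / n))) \<partial>lborel) \<le> ennreal C"
    using cutoff_sobolev[OF pm1 pmn[unfolded n_def] B] unfolding n_def[symmetric] t by (elim exE conjE)
  note C' = C0[rule_format]
  show ?case
  proof (intro exI[of _ C] conjI C allI impI)
    fix f x0 R k
    assume ch: "gradient_chain \<Omega> r f" and k: "k \<le> r - Suc m"
      and bd: "\<forall>k\<le>r. (\<integral>\<^sup>+x. indicator (ball x0 (R + real (Suc m) * (1 + d))) x * ennreal (f k x powr p) \<partial>lborel) \<le> ennreal b"
    \<comment> \<open>The margin next to the inner ball is set aside for the new Sobolev step; the
      remaining \<open>m\<close> margins belong to the induction hypothesis.\<close>
    have R: "R + real (Suc m) * (1 + d) = R + (1 + d) + real m * (1 + d)" by (simp add: algebra_simps)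
    have *: "(\<integral>\<^sup>+x. indicator (ball x0 (R + (1 + d))) x * ennreal (f j x powr pm) \<partial>lborel) \<le> ennreal B" if "j \<le> r - m" for j
      by (rule IH[OF ch _ that]) (use bd[unfolded R] in blast)
    show "(\<integral>\<^sup>+x. indicator (ball x0 R) x * ennreal (f k x powr (1 / (1 / p - real (Suc m) / DIM('a)))) \<partial>lborel) \<le> ennreal C"
      unfolding n_def[symmetric]
      by (rule C'[of "f k" "f (Suc k)"]) (use ch k Suc.prems * in \<open>auto simp: gradient_chain_def\<close>)
  qed
qed

end

subsection \<open>Weights of critical integrability\<close>

text \<open>The additive form of Hoelder's inequality for \<open>1 / p = 1 / q + 1 / t\<close>. The
  two terms on the right agree for \<open>y = x powr ((q - p) / p)\<close>, and on either side of
  this value one of them dominates.\<close>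

lemma young_powr:
  fixes x y p q t :: real
  assumes x: "0 \<le> x" and y: "0 \<le> y" and p: "1 \<le> p" "p < q"
  defines "t \<equiv> p * q / (q - p)"
  shows "(x * y) powr p \<le> x powr q + y powr t"
proof (cases "x = 0 \<or> y = 0")
  case False
  then have xy: "0 < x" "0 < y" using x y by auto
  show ?thesis
  proof (cases "y \<le> x powr ((q - p) / p)")
    case True
    have "(x * y) powr p \<le> (x * x powr ((q - p) / p)) powr p"
      using True xy p by (intro powr_mono2 mult_left_mono) auto
    also have "x * x powr ((q - p) / p) = x powr (1 + (q - p) / p)"
      using xy by (simp add: powr_add)
    also have "\<dots> powr p = x powr q"
      using p by (simp add: powr_powr field_simps)
    finally show ?thesis by (smt (verit) powr_ge_zero)
  next
    case False
    have "x = (x powr ((q - p) / p)) powr (p / (q - p))"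
      using xy p by (simp add: powr_powr)
    also have "\<dots> \<le> y powr (p / (q - p))" using False p by (intro powr_mono2) auto
    finally have "(x * y) powr p \<le> (y powr (p / (q - p)) * y) powr p"
      using xy p by (intro powr_mono2 mult_right_mono) auto
    also have "y powr (p / (q - p)) * y = y powr (p / (q - p) + 1)"
      using xy by (simp add: powr_add)
    also have "\<dots> powr p = y powr t"
      using p by (simp add: powr_powr t_def field_simps)
    finally show ?thesis by (smt (verit) powr_ge_zero)
  qed
qed (use p in \<open>auto simp: t_def\<close>)

lemma powr_le_add_powr:
  fixes x a b c :: real
  assumes "0 \<le> x" "0 < a" "a \<le> b" "b \<le> c"
  shows "x powr b \<le> x powr a + x powr c"
proof (cases "x \<le> 1")
  case True
  have "x powr b \<le> x powr a"
    using assms True by (cases "x = 0") (auto intro: powr_mono')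
  then show ?thesis by (simp add: add_increasing2)
next
  case False
  then have "x powr b \<le> x powr c" using assms by (intro powr_mono) auto
  then show ?thesis by (simp add: add_increasing)
qed

lemma powr_le_one_add_powr:
  fixes x a b :: real
  assumes "0 \<le> x" "0 < a" "a \<le> b"
  shows "x powr a \<le> 1 + x powr b"
proof (cases "x \<le> 1")
  case True
  then have "x powr a \<le> 1" using assms by (intro powr_le1) auto
  then show ?thesis by (simp add: add_increasing2)
next
  case False
  then have "x powr a \<le> x powr b" using assms by (intro powr_mono) auto
  then show ?thesis by simp
qed

lemma emeasure_lborel_ball_center:
  fixes c :: "'a::euclidean_space"
  shows "emeasure lborel (ball c \<rho>) = ennreal (measure lborel (ball (0::'a) \<rho>))"
proof -
  have "emeasure lborel (ball c \<rho>) = emeasure lborel ((+) c -` ball c \<rho> \<inter> space borel)"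
    using emeasure_distr[of "(+) c" lborel borel "ball c \<rho>"] by (simp add: lborel_distr_plus)
  also have "(+) c -` ball c \<rho> \<inter> space borel = ball 0 \<rho>"
    by (auto simp: dist_norm)
  also have "emeasure lborel (ball (0::'a) \<rho>) = ennreal (measure lborel (ball (0::'a) \<rho>))"
    using emeasure_lborel_ball_finite[of "0::'a" \<rho>] by (intro emeasure_eq_ennreal_measure) auto
  finally show ?thesis .
qed

text \<open>Lowering the exponent on a set of finite measure: where the value is at most 1 the
  measure of the ball pays, elsewhere the larger power does.\<close>

lemma nn_integral_powr_ball_le:
  fixes u :: "'a::euclidean_space \<Rightarrow> real"
  assumes [measurable]: "u \<in> borel_measurable borel" and u: "\<And>x. 0 \<le> u x" and e: "0 < a" "a \<le> b"
    and le: "(\<integral>\<^sup>+x. indicator (ball x0 \<rho>) x * ennreal (u x powr b) \<partial>lborel) \<le> 1"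
  shows "(\<integral>\<^sup>+x. indicator (ball x0 \<rho>) x * ennreal (u x powr a) \<partial>lborel)
    \<le> ennreal (measure lborel (ball (0::'a) \<rho>) + 1)"
proof -
  have [measurable]: "ball x0 \<rho> \<in> sets borel" by simp
  have "(\<integral>\<^sup>+x. indicator (ball x0 \<rho>) x * ennreal (u x powr a) \<partial>lborel)
    \<le> (\<integral>\<^sup>+x. indicator (ball x0 \<rho>) x + indicator (ball x0 \<rho>) x * ennreal (u x powr b) \<partial>lborel)"
  proof (intro nn_integral_mono)
    fix x
    have "ennreal (u x powr a) \<le> ennreal (1 + u x powr b)"
      using u e by (intro ennreal_leI powr_le_one_add_powr) auto
    then show "indicator (ball x0 \<rho>) x * ennreal (u x powr a) \<le> indicator (ball x0 \<rho>) x + indicator (ball x0 \<rho>) x * ennreal (u x powr b)"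
      by (auto split: split_indicator)
  qed
  also have "\<dots> = emeasure lborel (ball x0 \<rho>) + (\<integral>\<^sup>+x. indicator (ball x0 \<rho>) x * ennreal (u x powr b) \<partial>lborel)"
    by (simp add: nn_integral_add)
  also have "\<dots> \<le> ennreal (measure lborel (ball (0::'a) \<rho>)) + 1"
    unfolding emeasure_lborel_ball_center by (intro add_mono le) simp
  finally show ?thesis by simp
qed

text \<open>By \<open>young_powr\<close> it suffices to bound \<open>f 0\<close> in
  \<open>L^t\<close> with \<open>1 / t = 1 / p - 1 / q\<close>, and
  \<open>q \<ge> DIM('a) / r\<close> says that \<open>t\<close> does not exceed the exponent reached
  after \<open>r\<close> Sobolev steps. If \<open>r * p = DIM('a)\<close> these steps leave the
  subcritical range; then one starts from a smaller exponent \<open>p'\<close>, which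
  \<open>p > 1\<close> permits on a ball.\<close>

lemma (in cone_domain) local_weighted_critical:
  fixes p q :: real
  assumes p: "1 \<le> p" "p < q" and r: "1 \<le> r" and rp: "real r * p \<le> DIM('a)"
    and qr: "DIM('a) / real r \<le> q" and eq: "real r * p = DIM('a) \<Longrightarrow> 1 < p"
  shows "\<exists>C\<ge>0. \<forall>f G x0. gradient_chain \<Omega> r f \<longrightarrow> G \<in> borel_measurable borel \<longrightarrow> (\<forall>x. 0 \<le> G x) \<longrightarrow>
     (\<forall>k\<le>r. (\<integral>\<^sup>+x. indicator (ball x0 (d/2 + real r * (1 + d))) x * ennreal (f k x powr p) \<partial>lborel) \<le> 1) \<longrightarrow>
     (\<integral>\<^sup>+x. indicator (ball x0 (d/2)) x * ennreal (G x powr q) \<partial>lborel) \<le> 1 \<longrightarrow>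
     (\<integral>\<^sup>+x. indicator (ball x0 (d/2)) x * ennreal ((G x * f 0 x) powr p) \<partial>lborel) \<le> ennreal C"
proof -
  define n where "n = real DIM('a)"
  have n: "0 < n" by (simp add: n_def)
  define t where "t = p * q / (q - p)"
  have t: "p \<le> t" "1 / t = 1 / p - 1 / q" "0 < t"
  proof -
    show "1 / t = 1 / p - 1 / q" using p by (simp add: t_def field_simps)
    have "p * (q - p) \<le> p * q" using p by (intro mult_left_mono) auto
    then show "p \<le> t" using p by (simp add: t_def le_divide_eq)
    then show "0 < t" using p by simp
  qed
  \<comment> \<open>The starting exponent \<open>p'\<close> must be subcritical for all
    \<open>r\<close> steps and must still lead to an exponent at least \<open>t\<close>.\<close>
  have "\<exists>p'. 1 \<le> p' \<and> p' \<le> p \<and> real r * p' < n \<and> 1 / p' - real r / n \<le> 1 / t"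
  proof (cases "real r * p < n")
    case True
    have "1 / q \<le> real r / n"
    proof -
      have "n \<le> q * real r" using qr r by (simp add: n_def divide_le_eq)
      then show ?thesis using n p by (simp add: field_simps)
    qed
    then have "1 / p - real r / n \<le> 1 / t" by (simp add: t(2))
    then show ?thesis using p True by auto
  next
    case False
    then have e: "real r * p = n" "1 < p" using rp eq by (auto simp: n_def)
    \<comment> \<open>\<open>e\<close> will be \<open>1 / p'\<close>. The two entries of the minimum
      are the requirements \<open>p' \<ge> 1\<close> and \<open>1 / p' - r / n \<le> 1 / t\<close>;
      both exceed \<open>1 / p\<close>, so \<open>p' < p\<close>.\<close>
    define e where "e = min 1 (real r / n + 1 / t)"
    have rn: "real r / n = 1 / p" using e n by (simp add: field_simps)
    have e1: "1 / p < e" "e \<le> 1" "e - real r / n \<le> 1 / t" unfolding e_def rn using \<open>1 < p\<close> t(3) by auto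
    have "0 < e" using e1(1) \<open>1 < p\<close> by (smt (verit) zero_less_divide_1_iff)
    have "1 / e < p" using e1(1) \<open>0 < e\<close> \<open>1 < p\<close> by (simp add: field_simps)
    then show ?thesis
      using e e1 r \<open>0 < e\<close> by (intro exI[of _ "1 / e"]) (auto simp: field_simps)
  qed
  then obtain p' where p': "1 \<le> p'" "p' \<le> p" "real r * p' < n" "1 / p' - real r / n \<le> 1 / t" by blast
  define pr where "pr = 1 / (1 / p' - real r / n)"
  have "real r / n < 1 / p'" using p' n by (simp add: pos_divide_less_eq pos_less_divide_eq)
  then have pr: "t \<le> pr"
    unfolding pr_def using p'(4) t(3) by (simp add: field_simps)
  define R where "R = d/2 + real r * (1 + d)"
  \<comment> \<open>The bound for the \<open>p'\<close>-integrals on the large ball that follows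
    from \<open>p\<close>-integrals at most 1.\<close>
  define b where "b = measure lborel (ball (0::'a) R) + 1"
  have b: "0 \<le> b" by (simp add: b_def)
  obtain C where C: "0 \<le> C" and C0: "\<forall>f x0 R. gradient_chain \<Omega> r f \<longrightarrow>
     (\<forall>k\<le>r. (\<integral>\<^sup>+x. indicator (ball x0 (R + real r * (1 + d))) x * ennreal (f k x powr p') \<partial>lborel) \<le> ennreal b) \<longrightarrow>
     (\<forall>k\<le>r - r. (\<integral>\<^sup>+x. indicator (ball x0 R) x * ennreal (f k x powr pr) \<partial>lborel) \<le> ennreal C)"
    using iterated_sobolev[OF p'(1) p'(3)[unfolded n_def] b order_refl] unfolding pr_def n_def by (elim exE conjE)
  note C' = C0[rule_format]
  show ?thesis
  proof (intro exI[of _ "2 + C"] conjI allI impI)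
    fix f G x0
    assume ch: "gradient_chain \<Omega> r f" and [measurable]: "G \<in> borel_measurable borel" and G: "\<forall>x. 0 \<le> G x"
      and fk: "\<forall>k\<le>r. (\<integral>\<^sup>+x. indicator (ball x0 (d/2 + real r * (1 + d))) x * ennreal (f k x powr p) \<partial>lborel) \<le> 1"
      and Gq: "(\<integral>\<^sup>+x. indicator (ball x0 (d/2)) x * ennreal (G x powr q) \<partial>lborel) \<le> 1"
    have [measurable]: "f k \<in> borel_measurable borel" for k using ch by (simp add: gradient_chain_def)
    have f0: "0 \<le> f k x" for k x using ch by (simp add: gradient_chain_def)
    let ?B = "ball x0 (d/2)"
    have [measurable]: "?B \<in> sets borel" by simp
    have "(\<integral>\<^sup>+x. indicator ?B x * ennreal (f 0 x powr pr) \<partial>lborel) \<le> ennreal C"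
    proof (rule C'[OF ch])
      fix k assume "k \<le> r"
      then have "(\<integral>\<^sup>+x. indicator (ball x0 R) x * ennreal (f k x powr p) \<partial>lborel) \<le> 1"
        using fk by (simp add: R_def)
      then show "(\<integral>\<^sup>+x. indicator (ball x0 (d/2 + real r * (1 + d))) x * ennreal (f k x powr p') \<partial>lborel) \<le> ennreal b"
        unfolding b_def R_def[symmetric] using f0 p' by (intro nn_integral_powr_ball_le[where b=p]) auto
    qed simp
    moreover have "(\<integral>\<^sup>+x. indicator ?B x * ennreal (f 0 x powr p) \<partial>lborel) \<le> 1"
    proof -
      have "?B \<subseteq> ball x0 (d/2 + real r * (1 + d))" using d_pos by (intro subset_ball) simp
      then have "(\<integral>\<^sup>+x. indicator ?B x * ennreal (f 0 x powr p) \<partial>lborel) \<le>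
        (\<integral>\<^sup>+x. indicator (ball x0 (d/2 + real r * (1 + d))) x * ennreal (f 0 x powr p) \<partial>lborel)"
        by (intro nn_integral_mono) (auto simp: indicator_def)
      then show ?thesis using fk by (meson le0 order_trans)
    qed
    moreover have "(\<integral>\<^sup>+x. indicator ?B x * ennreal ((G x * f 0 x) powr p) \<partial>lborel) \<le>
      (\<integral>\<^sup>+x. indicator ?B x * ennreal (G x powr q) + (indicator ?B x * ennreal (f 0 x powr p) + indicator ?B x * ennreal (f 0 x powr pr)) \<partial>lborel)"
    proof (intro nn_integral_mono)
      fix x
      have "(G x * f 0 x) powr p \<le> G x powr q + f 0 x powr t"
        unfolding t_def using G f0 p by (intro young_powr) auto
      also have "\<dots> \<le> G x powr q + (f 0 x powr p + f 0 x powr pr)"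
        using f0 p t pr by (intro add_left_mono powr_le_add_powr) auto
      finally have "ennreal ((G x * f 0 x) powr p) \<le> ennreal (G x powr q) + (ennreal (f 0 x powr p) + ennreal (f 0 x powr pr))"
        by (simp add: ennreal_leI flip: ennreal_plus)
      then show "indicator ?B x * ennreal ((G x * f 0 x) powr p) \<le> indicator ?B x * ennreal (G x powr q) + (indicator ?B x * ennreal (f 0 x powr p) + indicator ?B x * ennreal (f 0 x powr pr))"
        by (auto split: split_indicator)
    qed
    moreover have "\<dots> = (\<integral>\<^sup>+x. indicator ?B x * ennreal (G x powr q) \<partial>lborel) + ((\<integral>\<^sup>+x. indicator ?B x * ennreal (f 0 x powr p) \<partial>lborel) + (\<integral>\<^sup>+x. indicator ?B x * ennreal (f 0 x powr pr) \<partial>lborel))"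
      by (simp add: nn_integral_add)
    ultimately have "(\<integral>\<^sup>+x. indicator ?B x * ennreal ((G x * f 0 x) powr p) \<partial>lborel) \<le> 1 + (1 + ennreal C)"
      using Gq by (smt (verit, best) add_mono order_trans)
    also have "\<dots> = ennreal (2 + C)" using C by (simp add: ennreal_plus[symmetric] flip: ennreal_1 del: ennreal_plus)
    finally show "(\<integral>\<^sup>+x. indicator ?B x * ennreal ((G x * f 0 x) powr p) \<partial>lborel) \<le> ennreal (2 + C)" .
  qed (use C in simp)
qed

section \<open>Taylor's formula as an inequality in one variable\<close>

lemma measurable_indicator_Icc [measurable]:
  fixes f g h :: "'b \<Rightarrow> real"
  assumes [measurable]: "f \<in> borel_measurable M" "g \<in> borel_measurable M" "h \<in> borel_measurable M"
  shows "(\<lambda>x. indicator {f x..g x} (h x) :: ennreal) \<in> borel_measurable M"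
proof -
  have "(\<lambda>x. if f x \<le> h x \<and> h x \<le> g x then 1 else 0 :: ennreal) \<in> borel_measurable M"
    by measurable
  then show ?thesis by (simp add: indicator_def of_bool_def)
qed

text \<open>The bound for the order \<open>Suc m\<close> is inserted into the remainder and the
  double integral is exchanged, which produces one more power of \<open>\<tau>\<close> in the
  remainder. The bounds are assumed only for almost every \<open>s\<close>; this is harmless under
  the integral, but the starting value at \<open>s = 0\<close> has to be assumed separately.\<close>

lemma taylor_segment_le:
  fixes \<phi> :: "nat \<Rightarrow> real \<Rightarrow> ennreal" and c :: ennreal
  assumes [measurable]: "\<And>k. \<phi> k \<in> borel_measurable borel"
    and start: "\<phi> 0 0 \<le> \<phi> 0 1 + c * (\<integral>\<^sup>+\<tau>. indicator {0..1} \<tau> * \<phi> 1 \<tau> \<partial>lborel)"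
    and step: "\<And>k. k < r \<Longrightarrow> AE s in lborel. s \<in> {0..1} \<longrightarrow>
        \<phi> k s \<le> \<phi> k 1 + c * (\<integral>\<^sup>+\<tau>. indicator {s..1} \<tau> * \<phi> (Suc k) \<tau> \<partial>lborel)"
    and m: "m < r"
  shows "\<phi> 0 0 \<le> (\<Sum>k\<le>m. c ^ k * \<phi> k 1) + c ^ Suc m * (\<integral>\<^sup>+\<tau>. indicator {0..1} \<tau> * (ennreal (\<tau> ^ m) * \<phi> (Suc m) \<tau>) \<partial>lborel)"
  using m
proof (induction m)
  case 0
  then show ?case using start by simp
next
  case (Suc m)
  have "(\<integral>\<^sup>+\<tau>. indicator {0..1} \<tau> * (ennreal (\<tau> ^ m) * \<phi> (Suc m) \<tau>) \<partial>lborel) \<le>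
    (\<integral>\<^sup>+s. indicator {0..1} s * \<phi> (Suc m) 1 + c * (\<integral>\<^sup>+\<tau>. indicator {0..1} s * ennreal (s ^ m) * (indicator {s..1} \<tau> * \<phi> (Suc (Suc m)) \<tau>) \<partial>lborel) \<partial>lborel)"
    using step[OF Suc.prems]
  proof (intro nn_integral_mono_AE, elim eventually_mono)
    fix s :: real
    assume *: "s \<in> {0..1} \<longrightarrow> \<phi> (Suc m) s \<le> \<phi> (Suc m) 1 + c * (\<integral>\<^sup>+\<tau>. indicator {s..1} \<tau> * \<phi> (Suc (Suc m)) \<tau> \<partial>lborel)"
    show "indicator {0..1} s * (ennreal (s ^ m) * \<phi> (Suc m) s) \<le> indicator {0..1} s * \<phi> (Suc m) 1 + c * (\<integral>\<^sup>+\<tau>. indicator {0..1} s * ennreal (s ^ m) * (indicator {s..1} \<tau> * \<phi> (Suc (Suc m)) \<tau>) \<partial>lborel)"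
    proof (cases "s \<in> {0..1}")
      case True
      have 1: "ennreal (s ^ m) \<le> 1" using True by (simp add: power_le_one)
      have "ennreal (s ^ m) * \<phi> (Suc m) s \<le> ennreal (s ^ m) * (\<phi> (Suc m) 1 + c * (\<integral>\<^sup>+\<tau>. indicator {s..1} \<tau> * \<phi> (Suc (Suc m)) \<tau> \<partial>lborel))"
        using * True by (intro mult_left_mono) auto
      also have "\<dots> = ennreal (s ^ m) * \<phi> (Suc m) 1 + c * (ennreal (s ^ m) * (\<integral>\<^sup>+\<tau>. indicator {s..1} \<tau> * \<phi> (Suc (Suc m)) \<tau> \<partial>lborel))"
        by (simp add: distrib_left mult_ac)
      also have "\<dots> \<le> 1 * \<phi> (Suc m) 1 + c * (ennreal (s ^ m) * (\<integral>\<^sup>+\<tau>. indicator {s..1} \<tau> * \<phi> (Suc (Suc m)) \<tau> \<partial>lborel))"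
        by (intro add_mono mult_right_mono 1) auto
      also have "ennreal (s ^ m) * (\<integral>\<^sup>+\<tau>. indicator {s..1} \<tau> * \<phi> (Suc (Suc m)) \<tau> \<partial>lborel) =
         (\<integral>\<^sup>+\<tau>. ennreal (s ^ m) * (indicator {s..1} \<tau> * \<phi> (Suc (Suc m)) \<tau>) \<partial>lborel)"
        by (subst nn_integral_cmult) auto
      finally show ?thesis using True by simp
    qed simp
  qed
  also have "\<dots> = \<phi> (Suc m) 1 + c * (\<integral>\<^sup>+s. \<integral>\<^sup>+\<tau>. indicator {0..1} s * ennreal (s ^ m) * (indicator {s..1} \<tau> * \<phi> (Suc (Suc m)) \<tau>) \<partial>lborel \<partial>lborel)"
  proof -
    have [measurable]: "(\<lambda>s. \<integral>\<^sup>+\<tau>. indicator {0..1} s * ennreal (s ^ m) * (indicator {s..1} \<tau> * \<phi> (Suc (Suc m)) \<tau>) \<partial>lborel) \<in> borel_measurable lborel"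
      by measurable
    show ?thesis by (subst nn_integral_add) (auto simp: nn_integral_multc nn_integral_cmult)
  qed
  also have "(\<integral>\<^sup>+s. \<integral>\<^sup>+\<tau>. indicator {0..1} s * ennreal (s ^ m) * (indicator {s..1} \<tau> * \<phi> (Suc (Suc m)) \<tau>) \<partial>lborel \<partial>lborel) =
     (\<integral>\<^sup>+\<tau>. \<integral>\<^sup>+s. indicator {0..1} s * ennreal (s ^ m) * (indicator {s..1} \<tau> * \<phi> (Suc (Suc m)) \<tau>) \<partial>lborel \<partial>lborel)"
    by (rule lborel_pair.Fubini') measurable
  also have "\<dots> \<le> (\<integral>\<^sup>+\<tau>. indicator {0..1} \<tau> * (ennreal (\<tau> ^ Suc m) * \<phi> (Suc (Suc m)) \<tau>) \<partial>lborel)"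
  proof (intro nn_integral_mono)
    fix \<tau> :: real
    have "(\<integral>\<^sup>+s. indicator {0..1} s * ennreal (s ^ m) * (indicator {s..1} \<tau> * \<phi> (Suc (Suc m)) \<tau>) \<partial>lborel)
      \<le> (\<integral>\<^sup>+s. (indicator {0..1} \<tau> * (ennreal (\<tau> ^ m) * \<phi> (Suc (Suc m)) \<tau>)) * indicator {0..\<tau>} s \<partial>lborel)"
    \<comment> \<open>On \<open>[0, \<tau>]\<close> the factor \<open>s ^ m\<close> is replaced by
      \<open>\<tau> ^ m\<close>, so that the inner integral gives \<open>\<tau> ^ Suc m\<close>; the
      factorials of Taylor's formula are given up.\<close>
    proof (intro nn_integral_mono)
      fix s :: real
      have "ennreal (s ^ m) * \<phi> (Suc (Suc m)) \<tau> \<le> ennreal (\<tau> ^ m) * \<phi> (Suc (Suc m)) \<tau>" if "0 \<le> s" "s \<le> \<tau>"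
        using that by (intro mult_right_mono ennreal_leI power_mono) auto
      then show "indicator {0..1} s * ennreal (s ^ m) * (indicator {s..1} \<tau> * \<phi> (Suc (Suc m)) \<tau>)
        \<le> (indicator {0..1} \<tau> * (ennreal (\<tau> ^ m) * \<phi> (Suc (Suc m)) \<tau>)) * indicator {0..\<tau>} s"
        by (auto split: split_indicator)
    qed
    also have "\<dots> = (indicator {0..1} \<tau> * (ennreal (\<tau> ^ m) * \<phi> (Suc (Suc m)) \<tau>)) * emeasure lborel {0..\<tau>}"
      by (subst nn_integral_cmult_indicator) auto
    also have "\<dots> \<le> indicator {0..1} \<tau> * (ennreal (\<tau> ^ Suc m) * \<phi> (Suc (Suc m)) \<tau>)"
      by (auto simp: ennreal_mult mult_ac split: split_indicator)
    finally show "(\<integral>\<^sup>+s. indicator {0..1} s * ennreal (s ^ m) * (indicator {s..1} \<tau> * \<phi> (Suc (Suc m)) \<tau>) \<partial>lborel)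
      \<le> indicator {0..1} \<tau> * (ennreal (\<tau> ^ Suc m) * \<phi> (Suc (Suc m)) \<tau>)" .
  qed
  finally have *: "(\<integral>\<^sup>+\<tau>. indicator {0..1} \<tau> * (ennreal (\<tau> ^ m) * \<phi> (Suc m) \<tau>) \<partial>lborel) \<le>
    \<phi> (Suc m) 1 + c * (\<integral>\<^sup>+\<tau>. indicator {0..1} \<tau> * (ennreal (\<tau> ^ Suc m) * \<phi> (Suc (Suc m)) \<tau>) \<partial>lborel)"
    by (simp add: mult_left_mono)
  have "\<phi> 0 0 \<le> (\<Sum>k\<le>m. c ^ k * \<phi> k 1) + c ^ Suc m * (\<integral>\<^sup>+\<tau>. indicator {0..1} \<tau> * (ennreal (\<tau> ^ m) * \<phi> (Suc m) \<tau>) \<partial>lborel)"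
    using Suc by simp
  also have "\<dots> \<le> (\<Sum>k\<le>m. c ^ k * \<phi> k 1) + c ^ Suc m * (\<phi> (Suc m) 1 + c * (\<integral>\<^sup>+\<tau>. indicator {0..1} \<tau> * (ennreal (\<tau> ^ Suc m) * \<phi> (Suc (Suc m)) \<tau>) \<partial>lborel))"
    by (intro add_left_mono mult_left_mono *) auto
  also have "\<dots> = (\<Sum>k\<le>Suc m. c ^ k * \<phi> k 1) + c ^ Suc (Suc m) * (\<integral>\<^sup>+\<tau>. indicator {0..1} \<tau> * (ennreal (\<tau> ^ Suc m) * \<phi> (Suc (Suc m)) \<tau>) \<partial>lborel)"
    by (simp add: distrib_left mult_ac add_ac)
  finally show ?case .
qed

subsection \<open>Taylor expansion along cones\<close>

context cone_domain
begin

text \<open>The gradient bound for the increment \<open>(1 - s) *\<^sub>R h\<close>, started at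
  \<open>y + s *\<^sub>R h\<close> and reparametrised to \<open>{s..1}\<close>.\<close>

lemma gradient_chain_segment_AE:
  assumes ch: "gradient_chain \<Omega> r f" and k: "k < r" and s: "s \<in> {0..1}"
  shows "AE y in lborel. y \<in> segment_in \<Omega> h \<longrightarrow> ennreal (f k (y + s *\<^sub>R h)) \<le> ennreal (f k (y + h)) +
    ennreal (norm h) * (\<integral>\<^sup>+\<tau>. indicator {s..1} \<tau> * ennreal (f (Suc k) (y + \<tau> *\<^sub>R h)) \<partial>lborel)"
proof (cases "s = 1")
  case True
  then show ?thesis by simp
next
  case False
  then have s1: "0 \<le> s" "s < 1" using s by auto
  have [measurable]: "f k \<in> borel_measurable borel" for k using ch by (simp add: gradient_chain_def)
  have f0: "0 \<le> f k x" for k x using ch by (simp add: gradient_chain_def)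
  let ?h = "(1 - s) *\<^sub>R h"
  have "AE z in lborel. z \<in> segment_in \<Omega> ?h \<longrightarrow> ennreal \<bar>f k (z + ?h) - f k z\<bar> \<le>
       ennreal (norm ?h) * (\<integral>\<^sup>+\<sigma>. indicator {0..1} \<sigma> * ennreal (f (Suc k) (z + \<sigma> *\<^sub>R ?h)) \<partial>lborel)"
  proof -
    have "gradient_bound \<Omega> (f k) (f (Suc k))" using ch k by (simp add: gradient_chain_def)
    then show ?thesis unfolding gradient_bound_def by (rule spec)
  qed
  from AE_lborel_shift[OF this, of "s *\<^sub>R h"] show ?thesis
  proof (rule eventually_mono, intro impI)
    fix y
    assume *: "y + s *\<^sub>R h \<in> segment_in \<Omega> ?h \<longrightarrow> ennreal \<bar>f k (y + s *\<^sub>R h + ?h) - f k (y + s *\<^sub>R h)\<bar> \<le>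
       ennreal (norm ?h) * (\<integral>\<^sup>+\<sigma>. indicator {0..1} \<sigma> * ennreal (f (Suc k) (y + s *\<^sub>R h + \<sigma> *\<^sub>R ?h)) \<partial>lborel)"
      and y: "y \<in> segment_in \<Omega> h"
    have "y + s *\<^sub>R h \<in> segment_in \<Omega> ?h"
      unfolding segment_in_def
    proof (intro CollectI ballI)
      fix \<sigma> :: real assume \<sigma>: "\<sigma> \<in> {0..1}"
      have "\<sigma> * (1 - s) \<le> 1 - s" using \<sigma> s1 mult_right_mono[of \<sigma> 1 "1 - s"] by simp
      then have "s + \<sigma> * (1 - s) \<le> s + (1 - s)" by (rule add_left_mono)
      then have "s + \<sigma> * (1 - s) \<le> 1" by simp
      moreover have "0 \<le> s + \<sigma> * (1 - s)"
        using \<sigma> s1 by (intro add_nonneg_nonneg mult_nonneg_nonneg) auto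
      ultimately have "s + \<sigma> * (1 - s) \<in> {0..1}" by (simp only: atLeastAtMost_iff)
      then have "y + (s + \<sigma> * (1 - s)) *\<^sub>R h \<in> \<Omega>" using y by (simp only: segment_in_def mem_Collect_eq)
      then show "y + s *\<^sub>R h + \<sigma> *\<^sub>R ?h \<in> \<Omega>" by (simp only: scaleR_left_distrib scaleR_scaleR add.assoc)
    qed
    moreover have e: "y + s *\<^sub>R h + ?h = y + h" by (simp add: algebra_simps)
    ultimately have 1: "ennreal \<bar>f k (y + h) - f k (y + s *\<^sub>R h)\<bar> \<le>
       ennreal (norm ?h) * (\<integral>\<^sup>+\<sigma>. indicator {0..1} \<sigma> * ennreal (f (Suc k) (y + s *\<^sub>R h + \<sigma> *\<^sub>R ?h)) \<partial>lborel)"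
      using * by (simp only: e)
    have "(\<integral>\<^sup>+\<tau>. indicator {s..1} \<tau> * ennreal (f (Suc k) (y + \<tau> *\<^sub>R h)) \<partial>lborel) =
      \<bar>1 - s\<bar> * (\<integral>\<^sup>+\<sigma>. indicator {s..1} (s + (1 - s) * \<sigma>) * ennreal (f (Suc k) (y + (s + (1 - s) * \<sigma>) *\<^sub>R h)) \<partial>lborel)"
      using s1 by (intro nn_integral_real_affine) auto
    also have "(\<integral>\<^sup>+\<sigma>. indicator {s..1} (s + (1 - s) * \<sigma>) * ennreal (f (Suc k) (y + (s + (1 - s) * \<sigma>) *\<^sub>R h)) \<partial>lborel) =
      (\<integral>\<^sup>+\<sigma>. indicator {0..1} \<sigma> * ennreal (f (Suc k) (y + s *\<^sub>R h + \<sigma> *\<^sub>R ?h)) \<partial>lborel)"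
    proof (intro nn_integral_cong)
      fix \<sigma> :: real
      have "s + (1 - s) * \<sigma> \<le> 1 \<longleftrightarrow> (1 - s) * \<sigma> \<le> (1 - s) * 1" by (metis add_le_cancel_left add.commute diff_add_cancel mult.right_neutral)
      also have "\<dots> \<longleftrightarrow> \<sigma> \<le> 1" using s1 by (subst mult_le_cancel_left_pos) auto
      finally have "indicator {s..1} (s + (1 - s) * \<sigma>) = (indicator {0..1} \<sigma> :: ennreal)"
        using s1 by (auto simp: indicator_def zero_le_mult_iff)
      then show "indicator {s..1} (s + (1 - s) * \<sigma>) * ennreal (f (Suc k) (y + (s + (1 - s) * \<sigma>) *\<^sub>R h)) =
        indicator {0..1} \<sigma> * ennreal (f (Suc k) (y + s *\<^sub>R h + \<sigma> *\<^sub>R ?h))"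
        by (simp add: scaleR_left_distrib mult.commute add.assoc)
    qed
    finally have 2: "ennreal (norm ?h) * (\<integral>\<^sup>+\<sigma>. indicator {0..1} \<sigma> * ennreal (f (Suc k) (y + s *\<^sub>R h + \<sigma> *\<^sub>R ?h)) \<partial>lborel) =
      ennreal (norm h) * (\<integral>\<^sup>+\<tau>. indicator {s..1} \<tau> * ennreal (f (Suc k) (y + \<tau> *\<^sub>R h)) \<partial>lborel)"
      by (simp add: ennreal_mult mult_ac)
    have "ennreal (f k (y + s *\<^sub>R h)) \<le> ennreal (f k (y + h) + \<bar>f k (y + h) - f k (y + s *\<^sub>R h)\<bar>)"
      by (intro ennreal_leI) linarith
    also have "\<dots> = ennreal (f k (y + h)) + ennreal \<bar>f k (y + h) - f k (y + s *\<^sub>R h)\<bar>"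
      using f0 by (intro ennreal_plus) auto
    finally show "ennreal (f k (y + s *\<^sub>R h)) \<le> ennreal (f k (y + h)) +
      ennreal (norm h) * (\<integral>\<^sup>+\<tau>. indicator {s..1} \<tau> * ennreal (f (Suc k) (y + \<tau> *\<^sub>R h)) \<partial>lborel)"
      using 1 unfolding 2 by (meson add_left_mono order_trans)
  qed
qed

text \<open>The exceptional set of starting points depends on \<open>s\<close>, and uncountably many
  \<open>s\<close> occur. Measurability of the exceptional pairs allows the quantifiers to be
  exchanged: for almost every \<open>y\<close> the bound holds for almost every \<open>s\<close>,
  which suffices for \<open>taylor_segment_le\<close>.\<close>

lemma gradient_chain_taylor_AE:
  assumes ch: "gradient_chain \<Omega> (Suc m) f"
  shows "AE y in lborel. y \<in> segment_in \<Omega> h \<longrightarrow> ennreal (f 0 y) \<le>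
    (\<Sum>k\<le>m. ennreal (norm h) ^ k * ennreal (f k (y + h))) +
    ennreal (norm h) ^ Suc m * (\<integral>\<^sup>+s. indicator {0..1} s * (ennreal (s ^ m) * ennreal (f (Suc m) (y + s *\<^sub>R h))) \<partial>lborel)"
proof -
  have [measurable]: "f k \<in> borel_measurable borel" for k using ch by (simp add: gradient_chain_def)
  define P where "P k s y \<longleftrightarrow> s \<in> {0..1} \<and> y \<in> segment_in \<Omega> h \<longrightarrow> ennreal (f k (y + s *\<^sub>R h)) \<le> ennreal (f k (y + h)) +
    ennreal (norm h) * (\<integral>\<^sup>+\<tau>. indicator {s..1} \<tau> * ennreal (f (Suc k) (y + \<tau> *\<^sub>R h)) \<partial>lborel)" for k s y
  have Py: "AE y in lborel. P k s y" if "k < Suc m" for k s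
    using gradient_chain_segment_AE[OF ch that, of s h] by (cases "s \<in> {0..1}") (auto simp: P_def)
  have "AE y in lborel. AE s in lborel. P k s y" if "k < Suc m" for k
  proof -
    have "{x \<in> space (lborel \<Otimes>\<^sub>M lborel). P k (fst x) (snd x)} \<in> sets (lborel \<Otimes>\<^sub>M lborel)"
      unfolding P_def atLeastAtMost_iff by measurable
    then have "(AE s in lborel. AE y in lborel. P k s y) \<longleftrightarrow> (AE y in lborel. AE s in lborel. P k s y)"
      by (rule lborel_pair.AE_commute)
    then show ?thesis using Py[OF that] by simp
  qed
  then have "AE y in lborel. \<forall>k\<in>{..<Suc m}. AE s in lborel. P k s y"
    by (subst AE_ball_countable) auto
  moreover have "AE y in lborel. P 0 0 y" by (rule Py) simp
  ultimately show ?thesis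
  proof (eventually_elim, intro impI)
    fix y
    assume P: "\<forall>k\<in>{..<Suc m}. AE s in lborel. P k s y" and P0: "P 0 0 y" and y: "y \<in> segment_in \<Omega> h"
    show "ennreal (f 0 y) \<le> (\<Sum>k\<le>m. ennreal (norm h) ^ k * ennreal (f k (y + h))) +
      ennreal (norm h) ^ Suc m * (\<integral>\<^sup>+s. indicator {0..1} s * (ennreal (s ^ m) * ennreal (f (Suc m) (y + s *\<^sub>R h))) \<partial>lborel)"
      using taylor_segment_le[of "\<lambda>k s. ennreal (f k (y + s *\<^sub>R h))" "ennreal (norm h)" "Suc m" m]
        P P0 y unfolding P_def by simp
  qed
qed

text \<open>Integration over the increments in \<open>cball c a\<close> turns the endpoint values
  \<open>f k (y + h)\<close> into integrals over a ball, which \<open>L^p\<close> bounds control.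
  The null sets, now depending on \<open>h\<close>, are exchanged once more.\<close>

lemma averaged_taylor:
  assumes ch: "gradient_chain \<Omega> (Suc m) f" and c: "c \<in> J"
  shows "AE y in lborel. y \<in> part c \<longrightarrow> emeasure lborel (cball (0::'a) a) * ennreal (f 0 y) \<le>
    (\<Sum>k\<le>m. ennreal d ^ k * (\<integral>\<^sup>+h. indicator (cball c a) h * ennreal (f k (y + h)) \<partial>lborel)) +
    ennreal d ^ Suc m * (\<integral>\<^sup>+s. \<integral>\<^sup>+h. indicator {0..1} s * ennreal (s ^ m) * (indicator (cball c a) h * ennreal (f (Suc m) (y + s *\<^sub>R h))) \<partial>lborel \<partial>lborel)"
proof -
  have [measurable]: "f k \<in> borel_measurable borel" for k using ch by (simp add: gradient_chain_def)
  have [measurable]: "cball c a \<in> sets borel" by simp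
  define Q where "Q h y \<longleftrightarrow> y \<in> segment_in \<Omega> h \<longrightarrow> ennreal (f 0 y) \<le>
    (\<Sum>k\<le>m. ennreal (norm h) ^ k * ennreal (f k (y + h))) +
    ennreal (norm h) ^ Suc m * (\<integral>\<^sup>+s. indicator {0..1} s * (ennreal (s ^ m) * ennreal (f (Suc m) (y + s *\<^sub>R h))) \<partial>lborel)" for h y
  have [measurable]: "(\<lambda>x. \<integral>\<^sup>+s. indicator {0..1} s * (ennreal (s ^ m) * ennreal (f (Suc m) (snd x + s *\<^sub>R fst x))) \<partial>lborel)
      \<in> borel_measurable (lborel \<Otimes>\<^sub>M lborel)"
    by measurable
  have [measurable]: "(\<lambda>x. \<Sum>k\<le>m. ennreal (norm (fst x)) ^ k * ennreal (f k (snd x + fst x))) \<in> borel_measurable (lborel \<Otimes>\<^sub>M lborel)"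
    by measurable
  have [measurable]: "Measurable.pred (lborel \<Otimes>\<^sub>M lborel) (\<lambda>x. snd x \<in> segment_in \<Omega> (fst x))"
    by measurable
  have "{x \<in> space (lborel \<Otimes>\<^sub>M lborel). Q (fst x) (snd x)} \<in> sets (lborel \<Otimes>\<^sub>M lborel)"
    unfolding Q_def by measurable
  then have "(AE h in lborel. AE y in lborel. Q h y) \<longleftrightarrow> (AE y in lborel. AE h in lborel. Q h y)"
    by (rule lborel_pair.AE_commute)
  then have "AE y in lborel. AE h in lborel. Q h y"
    using gradient_chain_taylor_AE[OF ch] unfolding Q_def by simp
  then show ?thesis
  proof (rule eventually_mono, intro impI)
    fix y assume Q: "AE h in lborel. Q h y" and y: "y \<in> part c"
    have "emeasure lborel (cball (0::'a) a) * ennreal (f 0 y) = (\<integral>\<^sup>+h. ennreal (f 0 y) * indicator (cball c a) h \<partial>lborel)"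
      by (simp add: nn_integral_cmult_indicator emeasure_lborel_cball_center[of c] mult.commute)
    also have "\<dots> \<le> (\<integral>\<^sup>+h. (\<Sum>k\<le>m. ennreal d ^ k * (indicator (cball c a) h * ennreal (f k (y + h)))) +
      ennreal d ^ Suc m * (\<integral>\<^sup>+s. indicator {0..1} s * ennreal (s ^ m) * (indicator (cball c a) h * ennreal (f (Suc m) (y + s *\<^sub>R h))) \<partial>lborel) \<partial>lborel)"
      using Q
    proof (intro nn_integral_mono_AE, elim eventually_mono)
      fix h assume Q: "Q h y"
      show "ennreal (f 0 y) * indicator (cball c a) h \<le> (\<Sum>k\<le>m. ennreal d ^ k * (indicator (cball c a) h * ennreal (f k (y + h)))) +
        ennreal d ^ Suc m * (\<integral>\<^sup>+s. indicator {0..1} s * ennreal (s ^ m) * (indicator (cball c a) h * ennreal (f (Suc m) (y + s *\<^sub>R h))) \<partial>lborel)"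
      proof (cases "h \<in> cball c a")
        case True
        have hd: "ennreal (norm h) \<le> ennreal d"
          using center(2)[OF c] norm_triangle_sub[of h c] True by (intro ennreal_leI) (auto simp: dist_norm norm_minus_commute)
        have "y \<in> segment_in \<Omega> h" using y True by (simp add: part_def)
        then have "ennreal (f 0 y) \<le> (\<Sum>k\<le>m. ennreal (norm h) ^ k * ennreal (f k (y + h))) +
          ennreal (norm h) ^ Suc m * (\<integral>\<^sup>+s. indicator {0..1} s * (ennreal (s ^ m) * ennreal (f (Suc m) (y + s *\<^sub>R h))) \<partial>lborel)"
          using Q by (simp add: Q_def)
        also have "\<dots> \<le> (\<Sum>k\<le>m. ennreal d ^ k * ennreal (f k (y + h))) +
          ennreal d ^ Suc m * (\<integral>\<^sup>+s. indicator {0..1} s * (ennreal (s ^ m) * ennreal (f (Suc m) (y + s *\<^sub>R h))) \<partial>lborel)"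
          by (intro add_mono sum_mono mult_right_mono power_mono hd) auto
        finally show ?thesis using True by (simp add: mult.assoc)
      qed simp
    qed
    also have "\<dots> = (\<Sum>k\<le>m. ennreal d ^ k * (\<integral>\<^sup>+h. indicator (cball c a) h * ennreal (f k (y + h)) \<partial>lborel)) +
      ennreal d ^ Suc m * (\<integral>\<^sup>+h. \<integral>\<^sup>+s. indicator {0..1} s * ennreal (s ^ m) * (indicator (cball c a) h * ennreal (f (Suc m) (y + s *\<^sub>R h))) \<partial>lborel \<partial>lborel)"
      by (subst nn_integral_add, measurable, subst nn_integral_sum, measurable, subst nn_integral_cmult, measurable, subst nn_integral_cmult, measurable)
    also have "(\<integral>\<^sup>+h. \<integral>\<^sup>+s. indicator {0..1} s * ennreal (s ^ m) * (indicator (cball c a) h * ennreal (f (Suc m) (y + s *\<^sub>R h))) \<partial>lborel \<partial>lborel) =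
      (\<integral>\<^sup>+s. \<integral>\<^sup>+h. indicator {0..1} s * ennreal (s ^ m) * (indicator (cball c a) h * ennreal (f (Suc m) (y + s *\<^sub>R h))) \<partial>lborel \<partial>lborel)"
      by (rule lborel_pair.Fubini') measurable
    finally show "emeasure lborel (cball (0::'a) a) * ennreal (f 0 y) \<le>
      (\<Sum>k\<le>m. ennreal d ^ k * (\<integral>\<^sup>+h. indicator (cball c a) h * ennreal (f k (y + h)) \<partial>lborel)) +
      ennreal d ^ Suc m * (\<integral>\<^sup>+s. \<integral>\<^sup>+h. indicator {0..1} s * ennreal (s ^ m) * (indicator (cball c a) h * ennreal (f (Suc m) (y + s *\<^sub>R h))) \<partial>lborel \<partial>lborel)" .
  qed
qed

end

lemma nn_integral_lborel_scale':
  fixes f :: "'a::euclidean_space \<Rightarrow> ennreal"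
  assumes [measurable]: "f \<in> borel_measurable borel" and t: "0 < t"
  shows "(\<integral>\<^sup>+x. f (t *\<^sub>R x) \<partial>lborel) = ennreal (t powr - real DIM('a)) * (\<integral>\<^sup>+x. f x \<partial>lborel)"
proof -
  have "ennreal (t powr - real DIM('a)) * ennreal (t ^ DIM('a)) = 1"
    using t by (simp add: powr_minus powr_realpow flip: ennreal_mult)
  then show ?thesis
    by (subst nn_integral_lborel_scale[of f t]) (auto simp: t mult.assoc[symmetric])
qed

lemma nn_integral_powr_unit_interval:
  fixes e :: real
  assumes e: "- 1 < e"
  shows "(\<integral>\<^sup>+s. indicator {0..1} s * ennreal (s powr e) \<partial>lborel) = ennreal (1 / (e + 1))"
proof -
  have "((\<lambda>s. s powr e) has_integral (1 powr (e + 1) / (e + 1))) {0..1::real}"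
    using e by (intro has_integral_powr_from_0) auto
  then have "((\<lambda>s. if s \<in> {0..1} then s powr e else 0) has_integral (1 / (e + 1))) UNIV"
    by (simp only: has_integral_restrict_UNIV powr_one_eq_one)
  then have "(\<integral>\<^sup>+s. ennreal (if s \<in> {0..1} then s powr e else 0) \<partial>lborel) = ennreal (1 / (e + 1))"
    by (intro nn_integral_has_integral_lborel) auto
  moreover have "(\<lambda>s. ennreal (if s \<in> {0..1} then s powr e else 0)) = (\<lambda>s. indicator {0..1} s * ennreal (s powr e))"
    by (auto simp: fun_eq_iff)
  ultimately show ?thesis by simp
qed

text \<open>The two ways of bounding the averaged remainder: above the critical exponent the
  factor \<open>s ^ m\<close> compensates the loss \<open>s powr (- DIM('a) / p)\<close>; for \<open>p = 1\<close> and \<open>r = DIM('a)\<close>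
  the cone misses a neighbourhood of its vertex, so that each direction is met only for
  \<open>s\<close> in an interval with endpoints of bounded ratio.\<close>

lemma remainder_supercritical:
  fixes F :: "'a::euclidean_space \<Rightarrow> real"
  assumes [measurable]: "F \<in> borel_measurable borel" and F: "\<And>x. 0 \<le> F x" and p: "1 \<le> p"
    and mp: "DIM('a) < real (Suc m) * p" and le: "(\<integral>\<^sup>+x. ennreal (F x powr p) \<partial>lborel) \<le> 1"
  shows "(\<integral>\<^sup>+s. \<integral>\<^sup>+h. indicator {0..1} s * ennreal (s ^ m) * (indicator (cball c a) h * ennreal (F (y + s *\<^sub>R h))) \<partial>lborel \<partial>lborel)
    \<le> ennreal ((measure lborel (cball (0::'a) a) + 1) / (real (Suc m) - DIM('a) / p))"
proof -
  define n where "n = real DIM('a)"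
  define \<kappa> where "\<kappa> = measure lborel (cball (0::'a) a)"
  have \<kappa>: "emeasure lborel (cball c a) = ennreal \<kappa>"
    unfolding emeasure_lborel_cball_center[of c] \<kappa>_def using emeasure_lborel_cball_finite[of "0::'a" a]
    by (intro emeasure_eq_ennreal_measure) auto
  have [measurable]: "cball c a \<in> sets borel" by simp
  have \<kappa>0: "0 \<le> \<kappa>" by (simp add: \<kappa>_def)
  have mp': "n / p < real (Suc m)" using mp p by (simp add: n_def pos_divide_less_eq del: of_nat_Suc)
  have inner: "(\<integral>\<^sup>+h. indicator (cball c a) h * ennreal (F (y + s *\<^sub>R h)) \<partial>lborel) \<le> ennreal (s powr (- (n / p)) * (\<kappa> + 1))"
    if s: "0 < s" for s
  proof -
    \<comment> \<open>The level that balances the two terms: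
      \<open>lam powr (1 - p) * s powr (- n)\<close> is again \<open>lam\<close>.\<close>
    define lam where "lam = s powr (- (n / p))"
    have lam: "0 < lam" using s by (simp add: lam_def)
    have "(\<integral>\<^sup>+h. indicator (cball c a) h * ennreal (F (y + s *\<^sub>R h)) \<partial>lborel) \<le>
      (\<integral>\<^sup>+h. ennreal lam * indicator (cball c a) h + ennreal (lam powr (1 - p)) * ennreal (F (s *\<^sub>R h + y) powr p) \<partial>lborel)"
    proof (intro nn_integral_mono)
      fix h
      have "ennreal (F (y + s *\<^sub>R h)) \<le> ennreal (lam + lam powr (1 - p) * F (y + s *\<^sub>R h) powr p)" for h
        by (intro ennreal_leI le_add_powr F lam p)
      then show "indicator (cball c a) h * ennreal (F (y + s *\<^sub>R h)) \<le>
        ennreal lam * indicator (cball c a) h + ennreal (lam powr (1 - p)) * ennreal (F (s *\<^sub>R h + y) powr p)"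
        using lam by (auto simp: ennreal_mult add.commute split: split_indicator)
    qed
    also have "\<dots> = ennreal lam * ennreal \<kappa> + ennreal (lam powr (1 - p)) * (\<integral>\<^sup>+h. ennreal (F (s *\<^sub>R h + y) powr p) \<partial>lborel)"
      by (simp add: nn_integral_add nn_integral_cmult nn_integral_cmult_indicator \<kappa>)
    also have "(\<integral>\<^sup>+h. ennreal (F (s *\<^sub>R h + y) powr p) \<partial>lborel) = ennreal (s powr - n) * (\<integral>\<^sup>+h. ennreal (F (h + y) powr p) \<partial>lborel)"
    proof -
      have meas: "(\<lambda>h. ennreal (F (h + y) powr p)) \<in> borel_measurable borel" by measurable
      show ?thesis using nn_integral_lborel_scale'[OF meas s] by (simp only: n_def)
    qed
    also have "(\<integral>\<^sup>+h. ennreal (F (h + y) powr p) \<partial>lborel) = (\<integral>\<^sup>+h. ennreal (F h powr p) \<partial>lborel)"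
      by (rule nn_integral_lborel_shift) measurable
    also have "ennreal lam * ennreal \<kappa> + ennreal (lam powr (1 - p)) * (ennreal (s powr - n) * (\<integral>\<^sup>+h. ennreal (F h powr p) \<partial>lborel))
      \<le> ennreal lam * ennreal \<kappa> + ennreal (lam powr (1 - p)) * (ennreal (s powr - n) * 1)"
      by (intro add_left_mono mult_left_mono le) auto
    also have "\<dots> = ennreal (lam * \<kappa> + lam powr (1 - p) * s powr - n)"
      using lam \<kappa>0 by (simp add: ennreal_mult)
    also have "lam powr (1 - p) * s powr - n = lam"
      using s p by (simp add: lam_def powr_powr field_simps flip: powr_add)
    finally show ?thesis by (simp add: lam_def distrib_left)
  qed
  have "(\<integral>\<^sup>+s. \<integral>\<^sup>+h. indicator {0..1} s * ennreal (s ^ m) * (indicator (cball c a) h * ennreal (F (y + s *\<^sub>R h))) \<partial>lborel \<partial>lborel)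
    \<le> (\<integral>\<^sup>+s. ennreal (\<kappa> + 1) * (indicator {0..1} s * ennreal (s powr (m - n / p))) \<partial>lborel)"
    using AE_lborel_singleton[of "0::real"]
  proof (intro nn_integral_mono_AE, elim eventually_mono)
    fix s :: real assume s0: "s \<noteq> 0"
    show "(\<integral>\<^sup>+h. indicator {0..1} s * ennreal (s ^ m) * (indicator (cball c a) h * ennreal (F (y + s *\<^sub>R h))) \<partial>lborel)
      \<le> ennreal (\<kappa> + 1) * (indicator {0..1} s * ennreal (s powr (m - n / p)))"
    proof (cases "s \<in> {0..1}")
      case True
      then have s: "0 < s" using s0 by auto
      have "(\<integral>\<^sup>+h. indicator {0..1} s * ennreal (s ^ m) * (indicator (cball c a) h * ennreal (F (y + s *\<^sub>R h))) \<partial>lborel)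
        = ennreal (s ^ m) * (\<integral>\<^sup>+h. indicator (cball c a) h * ennreal (F (y + s *\<^sub>R h)) \<partial>lborel)"
        using True by (simp add: nn_integral_cmult)
      also have "\<dots> \<le> ennreal (s ^ m) * ennreal (s powr (- (n / p)) * (\<kappa> + 1))"
        by (intro mult_left_mono inner s) simp
      also have "\<dots> = ennreal (\<kappa> + 1) * ennreal (s powr (m - n / p))"
      proof -
        have "s powr (m - n / p) = s ^ m * s powr (- (n / p))"
          using s by (simp add: powr_realpow[symmetric] flip: powr_add)
        then have "s ^ m * (s powr (- (n / p)) * (\<kappa> + 1)) = (\<kappa> + 1) * s powr (m - n / p)"
          by (simp only: mult_ac)
        then show ?thesis
          using s \<kappa>0 by (subst (1 2) ennreal_mult[symmetric]) auto
      qed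
      finally show ?thesis using True by simp
    qed simp
  qed
  \<comment> \<open>Supercriticality is exactly the condition \<open>m - n / p > - 1\<close> for
    this power of \<open>s\<close> to be integrable at 0.\<close>
  also have "\<dots> = ennreal (\<kappa> + 1) * ennreal (1 / (m - n / p + 1))"
    using mp' by (subst nn_integral_cmult, measurable, subst nn_integral_powr_unit_interval) auto
  also have "\<dots> = ennreal ((\<kappa> + 1) / (real (Suc m) - n / p))"
  proof -
    have "m - n / p + 1 = real (Suc m) - n / p" by simp
    then show ?thesis using mp' \<kappa>0 by (subst ennreal_mult[symmetric]) auto
  qed
  finally show ?thesis by (simp add: \<kappa>_def n_def)
qed

lemma remainder_endpoint:
  fixes F :: "'a::euclidean_space \<Rightarrow> real"
  assumes [measurable]: "F \<in> borel_measurable borel" and m: "Suc m = DIM('a)"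
    and c: "0 < a" "a < norm c" and le: "(\<integral>\<^sup>+x. ennreal (F x) \<partial>lborel) \<le> 1"
  shows "(\<integral>\<^sup>+s. \<integral>\<^sup>+h. indicator {0..1} s * ennreal (s ^ m) * (indicator (cball c a) h * ennreal (F (y + s *\<^sub>R h))) \<partial>lborel \<partial>lborel)
    \<le> ennreal ((norm c + a) / (norm c - a))"
proof -
  have [measurable]: "cball c a \<in> sets borel" by simp
  define \<alpha> where "\<alpha> = norm c - a"
  define \<beta> where "\<beta> = norm c + a"
  have \<alpha>\<beta>: "0 < \<alpha>" "0 < \<beta>" using c by (auto simp: \<alpha>_def \<beta>_def)
  have "(\<integral>\<^sup>+s. \<integral>\<^sup>+h. indicator {0..1} s * ennreal (s ^ m) * (indicator (cball c a) h * ennreal (F (y + s *\<^sub>R h))) \<partial>lborel \<partial>lborel)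
    \<le> (\<integral>\<^sup>+s. \<integral>\<^sup>+z. indicator {0..1} s * ennreal (1 / s) * (indicator (cball c a) (z /\<^sub>R s) * ennreal (F (y + z))) \<partial>lborel \<partial>lborel)"
    using AE_lborel_singleton[of "0::real"]
  proof (intro nn_integral_mono_AE, elim eventually_mono)
    fix s :: real assume s0: "s \<noteq> 0"
    show "(\<integral>\<^sup>+h. indicator {0..1} s * ennreal (s ^ m) * (indicator (cball c a) h * ennreal (F (y + s *\<^sub>R h))) \<partial>lborel)
      \<le> (\<integral>\<^sup>+z. indicator {0..1} s * ennreal (1 / s) * (indicator (cball c a) (z /\<^sub>R s) * ennreal (F (y + z))) \<partial>lborel)"
    proof (cases "s \<in> {0..1}")
      case True
      then have s: "0 < s" using s0 by auto
      have "(\<integral>\<^sup>+h. indicator (cball c a) h * ennreal (F (y + s *\<^sub>R h)) \<partial>lborel) =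
         (\<integral>\<^sup>+h. indicator (cball c a) ((s *\<^sub>R h) /\<^sub>R s) * ennreal (F (y + s *\<^sub>R h)) \<partial>lborel)"
        using s by simp
      also have "\<dots> = ennreal (s powr - real DIM('a)) * (\<integral>\<^sup>+z. indicator (cball c a) (z /\<^sub>R s) * ennreal (F (y + z)) \<partial>lborel)"
        by (rule nn_integral_lborel_scale'[of "\<lambda>z. indicator (cball c a) (z /\<^sub>R s) * ennreal (F (y + z))"]) (measurable, rule s)
      finally have "ennreal (s ^ m) * (\<integral>\<^sup>+h. indicator (cball c a) h * ennreal (F (y + s *\<^sub>R h)) \<partial>lborel) =
        ennreal (s ^ m * s powr - real DIM('a)) * (\<integral>\<^sup>+z. indicator (cball c a) (z /\<^sub>R s) * ennreal (F (y + z)) \<partial>lborel)"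
        using s by (simp add: ennreal_mult mult.assoc)
      \<comment> \<open>The substitution \<open>z = s *\<^sub>R h\<close> costs
        \<open>s powr (- DIM('a))\<close>, and \<open>Suc m = DIM('a)\<close> leaves
        \<open>1 / s\<close>, which alone would diverge at 0.\<close>
      also have "s ^ m * s powr - real DIM('a) = 1 / s"
      proof -
        have "s powr - real (Suc m) = inverse (s ^ Suc m)" by (simp only: powr_minus powr_realpow[OF s])
        then show ?thesis using s unfolding m[symmetric] by (simp add: field_simps)
      qed
      finally show ?thesis using True by (simp add: nn_integral_cmult)
    qed simp
  qed
  also have "\<dots> = (\<integral>\<^sup>+z. \<integral>\<^sup>+s. indicator {0..1} s * ennreal (1 / s) * (indicator (cball c a) (z /\<^sub>R s) * ennreal (F (y + z))) \<partial>lborel \<partial>lborel)"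
    by (rule lborel_pair.Fubini') measurable
  also have "\<dots> \<le> (\<integral>\<^sup>+z. ennreal (\<beta> / \<alpha>) * ennreal (F (z + y)) \<partial>lborel)"
  proof (intro nn_integral_mono)
    fix z :: 'a
    have "(\<integral>\<^sup>+s. indicator {0..1} s * ennreal (1 / s) * (indicator (cball c a) (z /\<^sub>R s) * ennreal (F (y + z))) \<partial>lborel)
      \<le> (\<integral>\<^sup>+s. (ennreal (\<beta> / norm z) * ennreal (F (y + z))) * indicator {0..norm z / \<alpha>} s \<partial>lborel)"
      using AE_lborel_singleton[of "0::real"]
    \<comment> \<open>If \<open>z /\<^sub>R s\<close> is in \<open>cball c a\<close>, then
      \<open>norm z / s\<close> lies between \<open>\<alpha>\<close> and \<open>\<beta>\<close>.
      Hence \<open>1 / s\<close> is at most \<open>\<beta> / norm z\<close> and \<open>s\<close>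
      ranges over a set of length at most \<open>norm z / \<alpha>\<close>; the product
      \<open>\<beta> / \<alpha>\<close> is independent of \<open>z\<close>.\<close>
    proof (intro nn_integral_mono_AE, elim eventually_mono)
      fix s :: real assume s0: "s \<noteq> 0"
      show "indicator {0..1} s * ennreal (1 / s) * (indicator (cball c a) (z /\<^sub>R s) * ennreal (F (y + z))) \<le>
         (ennreal (\<beta> / norm z) * ennreal (F (y + z))) * indicator {0..norm z / \<alpha>} s"
      proof (cases "s \<in> {0..1} \<and> z /\<^sub>R s \<in> cball c a")
        case True
        then have s: "0 < s" using s0 by auto
        have nz: "norm (z /\<^sub>R s) = norm z / s" using s by (simp add: divide_inverse_commute)
        have d: "norm (c - z /\<^sub>R s) \<le> a" using True by (simp add: dist_norm)
        have 1: "\<alpha> \<le> norm z / s" using norm_triangle_ineq2[of c "z /\<^sub>R s"] d nz by (simp add: \<alpha>_def)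
        have 2: "norm z / s \<le> \<beta>" using norm_triangle_ineq3[of c "z /\<^sub>R s"] d nz by (simp add: \<beta>_def)
        have z: "0 < norm z"
        proof (rule ccontr)
          assume "\<not> 0 < norm z"
          then have "norm z = 0" by simp
          then show False using 1 \<alpha>\<beta> by simp
        qed
        have "1 / s \<le> \<beta> / norm z" using 2 s z by (simp add: field_simps)
        moreover have "s \<le> norm z / \<alpha>" using 1 s \<alpha>\<beta> by (simp add: field_simps)
        ultimately show ?thesis using True s by (auto intro!: mult_right_mono ennreal_leI)
      next
        case False
        then show ?thesis by (auto split: split_indicator)
      qed
    qed
    also have "\<dots> = (ennreal (\<beta> / norm z) * ennreal (F (y + z))) * ennreal (norm z / \<alpha>)"
      using \<alpha>\<beta> by (subst nn_integral_cmult_indicator) auto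
    also have "\<dots> \<le> ennreal (\<beta> / \<alpha>) * ennreal (F (z + y))"
    proof (cases "z = 0")
      case False
      then have "ennreal (\<beta> / norm z) * ennreal (norm z / \<alpha>) = ennreal (\<beta> / \<alpha>)"
        using \<alpha>\<beta> by (simp flip: ennreal_mult)
      then show ?thesis by (simp add: mult_ac add.commute)
    qed simp
    finally show "(\<integral>\<^sup>+s. indicator {0..1} s * ennreal (1 / s) * (indicator (cball c a) (z /\<^sub>R s) * ennreal (F (y + z))) \<partial>lborel)
      \<le> ennreal (\<beta> / \<alpha>) * ennreal (F (z + y))" .
  qed
  also have "\<dots> = ennreal (\<beta> / \<alpha>) * (\<integral>\<^sup>+z. ennreal (F z) \<partial>lborel)"
    by (simp add: nn_integral_cmult nn_integral_lborel_shift[of "\<lambda>z. ennreal (F z)" y])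
  also have "\<dots> \<le> ennreal (\<beta> / \<alpha>) * 1" by (intro mult_left_mono le) auto
  finally show ?thesis by (simp add: \<alpha>_def \<beta>_def)
qed

subsection \<open>Weighted embeddings\<close>

lemma measurable_indicator_ball [measurable]:
  fixes f g :: "'b \<Rightarrow> 'a::euclidean_space"
  assumes [measurable]: "f \<in> borel_measurable M" "g \<in> borel_measurable M"
  shows "(\<lambda>x. indicator (ball (f x) \<rho>) (g x) :: ennreal) \<in> borel_measurable M"
proof -
  have "(\<lambda>x. if dist (f x) (g x) < \<rho> then 1 else 0 :: ennreal) \<in> borel_measurable M"
    by measurable
  then show ?thesis by (simp add: indicator_def of_bool_def)
qed

context cone_domain
begin

text \<open>Averaged Taylor expansion at the points served by one direction \<open>c\<close>. The
  increments have length at most \<open>d\<close>, so all points met from the ball of radius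
  \<open>d/2\<close> lie in the larger ball, where the derivatives are controlled.\<close>

lemma local_bounded_part:
  fixes p :: real
  assumes p: "1 \<le> p" and r: "r = Suc m" and rp: "DIM('a) < real r * p \<or> p = 1 \<and> r = DIM('a)" and c: "c \<in> J"
  shows "\<exists>C\<ge>0. \<forall>f x0. gradient_chain \<Omega> r f \<longrightarrow>
     (\<forall>k\<le>r. (\<integral>\<^sup>+x. indicator (ball x0 (d/2 + real r * (1 + d))) x * ennreal (f k x powr p) \<partial>lborel) \<le> 1) \<longrightarrow>
     (AE y in lborel. y \<in> part c \<inter> ball x0 (d/2) \<longrightarrow> f 0 y \<le> C)"
proof -
  define R where "R = d/2 + real r * (1 + d)"
  have Rd: "d/2 + d < R" using d_pos by (simp add: R_def r algebra_simps add_pos_nonneg)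
  define \<kappa> where "\<kappa> = measure lborel (cball (0::'a) a)"
  have \<kappa>e: "emeasure lborel (cball (0::'a) a) = ennreal \<kappa>"
    unfolding \<kappa>_def using emeasure_lborel_cball_finite[of "0::'a" a]
    by (intro emeasure_eq_ennreal_measure) auto
  have \<kappa>: "0 < \<kappa>"
    using content_cball_pos[OF radius_pos, of "0::'a"] by (simp add: \<kappa>_def)
  define b where "b = measure lborel (ball (0::'a) R) + 1"
  have b: "0 \<le> b" by (simp add: b_def)
  \<comment> \<open>One constant for both remainder estimates. If \<open>p = 1\<close> and
    \<open>r = DIM('a)\<close>, the first entry is a division by zero, that is 0, and the second
    one, positive in any case, is the maximum.\<close>
  define CJ where "CJ = max ((\<kappa> + 1) / (real r - DIM('a) / p)) ((norm c + a) / (norm c - a))"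
  have CJ0: "0 \<le> CJ"
    using center(1)[OF c] radius_pos by (auto simp: CJ_def le_max_iff_disj)
  define C where "C = ((\<Sum>k\<le>m. d ^ k * b) + d ^ r * CJ) / \<kappa>"
  have C: "0 \<le> C" unfolding C_def using \<kappa> b CJ0 d_pos by (intro divide_nonneg_pos add_nonneg_nonneg sum_nonneg mult_nonneg_nonneg) auto
  show ?thesis
  proof (intro exI[of _ C] conjI C allI impI)
    fix f x0
    assume ch: "gradient_chain \<Omega> r f"
      and fk0: "\<forall>k\<le>r. (\<integral>\<^sup>+x. indicator (ball x0 (d/2 + real r * (1 + d))) x * ennreal (f k x powr p) \<partial>lborel) \<le> 1"
    have fk: "(\<integral>\<^sup>+x. indicator (ball x0 R) x * ennreal (f k x powr p) \<partial>lborel) \<le> 1" if "k \<le> r" for k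
      using fk0 that by (simp add: R_def)
    have [measurable]: "f k \<in> borel_measurable borel" for k using ch by (simp add: gradient_chain_def)
    have f0: "0 \<le> f k x" for k x using ch by (simp add: gradient_chain_def)
    have [measurable]: "cball c a \<in> sets borel" "ball x0 R \<in> sets borel" by simp_all
    have inB: "y + s *\<^sub>R h \<in> ball x0 R" if "y \<in> ball x0 (d/2)" "h \<in> cball c a" "s \<in> {0..1}" for y h and s :: real
    proof -
      have "norm h \<le> d"
        using center(2)[OF c] norm_triangle_sub[of h c] that by (auto simp: dist_norm norm_minus_commute)
      moreover have "norm (s *\<^sub>R h) \<le> 1 * norm h" using that by (simp add: mult_left_le_one_le)
      moreover have "norm (y + s *\<^sub>R h - x0) \<le> norm (y - x0) + norm (s *\<^sub>R h)"
        using norm_triangle_ineq[of "y - x0" "s *\<^sub>R h"] by (simp add: algebra_simps)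
      ultimately show ?thesis using that Rd by (simp add: dist_norm norm_minus_commute)
    qed
    from averaged_taylor[OF ch[unfolded r] c] show "AE y in lborel. y \<in> part c \<inter> ball x0 (d/2) \<longrightarrow> f 0 y \<le> C"
    proof (rule eventually_mono, intro impI)
      fix y
      assume T: "y \<in> part c \<longrightarrow> emeasure lborel (cball (0::'a) a) * ennreal (f 0 y) \<le>
        (\<Sum>k\<le>m. ennreal d ^ k * (\<integral>\<^sup>+h. indicator (cball c a) h * ennreal (f k (y + h)) \<partial>lborel)) +
        ennreal d ^ Suc m * (\<integral>\<^sup>+s. \<integral>\<^sup>+h. indicator {0..1} s * ennreal (s ^ m) * (indicator (cball c a) h * ennreal (f (Suc m) (y + s *\<^sub>R h))) \<partial>lborel \<partial>lborel)"
        and y: "y \<in> part c \<inter> ball x0 (d/2)"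
      have 1: "(\<integral>\<^sup>+h. indicator (cball c a) h * ennreal (f k (y + h)) \<partial>lborel) \<le> ennreal b" if k: "k \<le> m" for k
      proof -
        have "(\<integral>\<^sup>+h. indicator (cball c a) h * ennreal (f k (y + h)) \<partial>lborel)
          \<le> (\<integral>\<^sup>+h. indicator (ball x0 R) (h + y) * ennreal (f k (h + y) powr 1) \<partial>lborel)"
          using inB[of y _ 1] y f0 by (intro nn_integral_mono) (auto simp: add.commute split: split_indicator)
        also have "\<dots> = (\<integral>\<^sup>+h. indicator (ball x0 R) h * ennreal (f k h powr 1) \<partial>lborel)"
          by (rule nn_integral_lborel_shift[of "\<lambda>h. indicator (ball x0 R) h * ennreal (f k h powr 1)"]) measurable
        also have "\<dots> \<le> ennreal b"
          unfolding b_def using f0 p fk[of k] k r by (intro nn_integral_powr_ball_le[where b=p]) auto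
        finally show ?thesis .
      qed
      \<comment> \<open>The remainder estimates ask for a bound on the integral over the whole
        space; restricting the highest derivative to the ball provides it without changing the
        values that occur.\<close>
      define F where "F x = indicator (ball x0 R) x * f r x" for x
      have [measurable]: "F \<in> borel_measurable borel" unfolding F_def by measurable
      have F0: "0 \<le> F x" for x using f0 by (simp add: F_def)
      have "(\<integral>\<^sup>+x. ennreal (F x powr p) \<partial>lborel) = (\<integral>\<^sup>+x. indicator (ball x0 R) x * ennreal (f r x powr p) \<partial>lborel)"
        by (intro nn_integral_cong) (auto simp: F_def split: split_indicator)
      then have Fp: "(\<integral>\<^sup>+x. ennreal (F x powr p) \<partial>lborel) \<le> 1" using fk[of r] by simp
      have "(\<integral>\<^sup>+s. \<integral>\<^sup>+h. indicator {0..1} s * ennreal (s ^ m) * (indicator (cball c a) h * ennreal (f (Suc m) (y + s *\<^sub>R h))) \<partial>lborel \<partial>lborel)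
        = (\<integral>\<^sup>+s. \<integral>\<^sup>+h. indicator {0..1} s * ennreal (s ^ m) * (indicator (cball c a) h * ennreal (F (y + s *\<^sub>R h))) \<partial>lborel \<partial>lborel)"
        using inB[of y] y by (intro nn_integral_cong) (auto simp: F_def r split: split_indicator)
      also have "\<dots> \<le> ennreal CJ"
      proof (cases "DIM('a) < real r * p")
        case True
        then have "(\<integral>\<^sup>+s. \<integral>\<^sup>+h. indicator {0..1} s * ennreal (s ^ m) * (indicator (cball c a) h * ennreal (F (y + s *\<^sub>R h))) \<partial>lborel \<partial>lborel)
          \<le> ennreal ((\<kappa> + 1) / (real r - DIM('a) / p))"
          unfolding \<kappa>_def r using Fp F0 p by (intro remainder_supercritical) auto
        also have "\<dots> \<le> ennreal CJ" by (intro ennreal_leI) (simp add: CJ_def)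
        finally show ?thesis .
      next
        case False
        then have e: "p = 1" "Suc m = DIM('a)" using rp r by auto
        have "(\<integral>\<^sup>+s. \<integral>\<^sup>+h. indicator {0..1} s * ennreal (s ^ m) * (indicator (cball c a) h * ennreal (F (y + s *\<^sub>R h))) \<partial>lborel \<partial>lborel)
          \<le> ennreal ((norm c + a) / (norm c - a))"
          using Fp F0 e center(1)[OF c] radius_pos by (intro remainder_endpoint) auto
        also have "\<dots> \<le> ennreal CJ" by (intro ennreal_leI) (simp add: CJ_def)
        finally show ?thesis .
      qed
      finally have 2: "(\<integral>\<^sup>+s. \<integral>\<^sup>+h. indicator {0..1} s * ennreal (s ^ m) * (indicator (cball c a) h * ennreal (f (Suc m) (y + s *\<^sub>R h))) \<partial>lborel \<partial>lborel) \<le> ennreal CJ" .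
      have "ennreal (\<kappa> * f 0 y) = emeasure lborel (cball (0::'a) a) * ennreal (f 0 y)"
        using \<kappa> f0 by (simp add: \<kappa>e ennreal_mult)
      also have "\<dots> \<le> (\<Sum>k\<le>m. ennreal d ^ k * (\<integral>\<^sup>+h. indicator (cball c a) h * ennreal (f k (y + h)) \<partial>lborel)) +
        ennreal d ^ Suc m * (\<integral>\<^sup>+s. \<integral>\<^sup>+h. indicator {0..1} s * ennreal (s ^ m) * (indicator (cball c a) h * ennreal (f (Suc m) (y + s *\<^sub>R h))) \<partial>lborel \<partial>lborel)"
        using T y by blast
      also have "\<dots> \<le> (\<Sum>k\<le>m. ennreal d ^ k * ennreal b) + ennreal d ^ Suc m * ennreal CJ"
        using 1 2 by (intro add_mono sum_mono mult_left_mono) auto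
      also have "\<dots> = ennreal ((\<Sum>k\<le>m. d ^ k * b) + d ^ r * CJ)"
        using d_pos b CJ0 by (simp add: ennreal_power ennreal_mult[symmetric] sum_nonneg r del: power_Suc)
      finally have "\<kappa> * f 0 y \<le> (\<Sum>k\<le>m. d ^ k * b) + d ^ r * CJ"
        using d_pos b CJ0 by (subst (asm) ennreal_le_iff) (auto intro!: add_nonneg_nonneg sum_nonneg mult_nonneg_nonneg)
      then show "f 0 y \<le> C" using \<kappa> by (simp add: C_def le_divide_eq mult.commute)
    qed
  qed
qed

text \<open>Finitely many parts cover the domain, so \<open>f 0\<close> is bounded almost everywhere
  on the ball by the sum of their constants. What remains is \<open>G\<close> in \<open>L^p\<close>
  of a ball, which follows from \<open>L^q\<close> because \<open>p \<le> q\<close>.\<close>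

lemma local_weighted_bounded:
  fixes p q :: real
  assumes p: "1 \<le> p" "p \<le> q" and r: "1 \<le> r" and rp: "DIM('a) < real r * p \<or> p = 1 \<and> r = DIM('a)"
  shows "\<exists>C\<ge>0. \<forall>f G x0. gradient_chain \<Omega> r f \<longrightarrow> G \<in> borel_measurable borel \<longrightarrow> (\<forall>x. 0 \<le> G x) \<longrightarrow>
     (\<forall>k\<le>r. (\<integral>\<^sup>+x. indicator (ball x0 (d/2 + real r * (1 + d))) x * ennreal (f k x powr p) \<partial>lborel) \<le> 1) \<longrightarrow>
     (\<integral>\<^sup>+x. indicator (ball x0 (d/2)) x * ennreal (G x powr q) \<partial>lborel) \<le> 1 \<longrightarrow>
     (\<integral>\<^sup>+x. indicator (ball x0 (d/2)) x * ennreal ((G x * f 0 x) powr p) \<partial>lborel) \<le> ennreal C"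
proof -
  obtain m where m: "r = Suc m" using r by (cases r) auto
  have "\<forall>c\<in>J. \<exists>C. 0 \<le> C \<and> (\<forall>f x0. gradient_chain \<Omega> r f \<longrightarrow>
     (\<forall>k\<le>r. (\<integral>\<^sup>+x. indicator (ball x0 (d/2 + real r * (1 + d))) x * ennreal (f k x powr p) \<partial>lborel) \<le> 1) \<longrightarrow>
     (AE y in lborel. y \<in> part c \<inter> ball x0 (d/2) \<longrightarrow> f 0 y \<le> C))"
    using local_bounded_part[OF p(1) m rp] by blast
  from bchoice[OF this] obtain Cf where Cf0: "\<forall>c\<in>J. 0 \<le> Cf c \<and> (\<forall>f x0. gradient_chain \<Omega> r f \<longrightarrow>
     (\<forall>k\<le>r. (\<integral>\<^sup>+x. indicator (ball x0 (d/2 + real r * (1 + d))) x * ennreal (f k x powr p) \<partial>lborel) \<le> 1) \<longrightarrow>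
     (AE y in lborel. y \<in> part c \<inter> ball x0 (d/2) \<longrightarrow> f 0 y \<le> Cf c))"
    by (elim exE)
  have Cf: "0 \<le> Cf c" if "c \<in> J" for c using bspec[OF Cf0 that] by (rule conjunct1)
  define C where "C = (\<Sum>c\<in>J. Cf c)"
  have C: "0 \<le> C" unfolding C_def by (intro sum_nonneg Cf)
  define b where "b = measure lborel (ball (0::'a) (d/2)) + 1"
  show ?thesis
  proof (intro exI[of _ "C powr p * b"] conjI allI impI)
    show "0 \<le> C powr p * b" by (simp add: b_def)
    fix f G x0
    assume ch: "gradient_chain \<Omega> r f" and [measurable]: "G \<in> borel_measurable borel" and G: "\<forall>x. 0 \<le> G x"
      and fk: "\<forall>k\<le>r. (\<integral>\<^sup>+x. indicator (ball x0 (d/2 + real r * (1 + d))) x * ennreal (f k x powr p) \<partial>lborel) \<le> 1"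
      and Gq: "(\<integral>\<^sup>+x. indicator (ball x0 (d/2)) x * ennreal (G x powr q) \<partial>lborel) \<le> 1"
    have f0: "0 \<le> f k x" for k x using ch by (simp add: gradient_chain_def)
    have fz: "f k x = 0" if "x \<notin> \<Omega>" for k x using ch that by (simp add: gradient_chain_def)
    have "AE y in lborel. \<forall>c\<in>J. y \<in> part c \<inter> ball x0 (d/2) \<longrightarrow> f 0 y \<le> Cf c"
      using finite_dirs
    proof (subst AE_ball_countable)
      show "\<forall>c\<in>J. AE y in lborel. y \<in> part c \<inter> ball x0 (d/2) \<longrightarrow> f 0 y \<le> Cf c"
        using Cf0 ch fk by blast
    qed (rule countable_finite)
    then have "(\<integral>\<^sup>+x. indicator (ball x0 (d/2)) x * ennreal ((G x * f 0 x) powr p) \<partial>lborel) \<le>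
       (\<integral>\<^sup>+x. ennreal (C powr p) * (indicator (ball x0 (d/2)) x * ennreal (G x powr p)) \<partial>lborel)"
    proof (intro nn_integral_mono_AE, elim eventually_mono)
      fix x assume x: "\<forall>c\<in>J. x \<in> part c \<inter> ball x0 (d/2) \<longrightarrow> f 0 x \<le> Cf c"
      show "indicator (ball x0 (d/2)) x * ennreal ((G x * f 0 x) powr p) \<le> ennreal (C powr p) * (indicator (ball x0 (d/2)) x * ennreal (G x powr p))"
      proof (cases "x \<in> ball x0 (d/2)")
        case True
        have "f 0 x \<le> C"
        proof (cases "x \<in> \<Omega>")
          case False
          then show ?thesis using fz C by simp
        next
          case in_dom: True
          then obtain c where c: "c \<in> J" "x \<in> part c" using domain_subset_parts by blast
          then have "f 0 x \<le> Cf c" using x True by blast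
          also have "\<dots> \<le> C" unfolding C_def using c finite_dirs Cf by (intro member_le_sum) auto
          finally show ?thesis .
        qed
        then have "(G x * f 0 x) powr p \<le> (C * G x) powr p"
          using G f0 p by (intro powr_mono2) (auto simp: mult.commute[of C] intro: mult_left_mono)
        also have "\<dots> = C powr p * G x powr p" using C G by (simp add: powr_mult)
        finally show ?thesis using True by (simp add: ennreal_leI flip: ennreal_mult)
      qed simp
    qed
    also have "\<dots> = ennreal (C powr p) * (\<integral>\<^sup>+x. indicator (ball x0 (d/2)) x * ennreal (G x powr p) \<partial>lborel)"
      by (rule nn_integral_cmult) measurable
    also have "\<dots> \<le> ennreal (C powr p) * ennreal b"
      unfolding b_def using G p Gq by (intro mult_left_mono nn_integral_powr_ball_le[where b=q]) auto
    also have "\<dots> = ennreal (C powr p * b)" by (simp add: b_def ennreal_mult)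
    finally show "(\<integral>\<^sup>+x. indicator (ball x0 (d/2)) x * ennreal ((G x * f 0 x) powr p) \<partial>lborel) \<le> ennreal (C powr p * b)" .
  qed
qed

text \<open>The local estimates are stated for normalised data; this scaling removes the
  normalisation of \<open>f\<close>.\<close>

lemma gradient_chain_scale:
  assumes ch: "gradient_chain \<Omega> r f" and c: "0 \<le> c"
  shows "gradient_chain \<Omega> r (\<lambda>k x. c * f k x)"
  unfolding gradient_chain_def
proof (intro conjI allI impI)
  have [measurable]: "f k \<in> borel_measurable borel" for k using ch by (simp add: gradient_chain_def)
  show "(\<lambda>x. c * f k x) \<in> borel_measurable borel" for k by measurable
  show "0 \<le> c * f k x" for k x using ch c by (simp add: gradient_chain_def)
  show "c * f k x = 0" if "x \<notin> \<Omega>" for k x using ch that by (simp add: gradient_chain_def)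
  fix k assume "k < r"
  then have gb: "gradient_bound \<Omega> (f k) (f (Suc k))" using ch by (simp add: gradient_chain_def)
  show "gradient_bound \<Omega> (\<lambda>x. c * f k x) (\<lambda>x. c * f (Suc k) x)"
    unfolding gradient_bound_def
  proof
    fix h
    from gb[unfolded gradient_bound_def, rule_format, of h]
    show "AE y in lborel. y \<in> segment_in \<Omega> h \<longrightarrow> ennreal \<bar>c * f k (y + h) - c * f k y\<bar> \<le>
       ennreal (norm h) * (\<integral>\<^sup>+s. indicator {0..1} s * ennreal (c * f (Suc k) (y + s *\<^sub>R h)) \<partial>lborel)"
    proof (rule eventually_mono, intro impI)
      fix y
      assume *: "y \<in> segment_in \<Omega> h \<longrightarrow> ennreal \<bar>f k (y + h) - f k y\<bar> \<le>
        ennreal (norm h) * (\<integral>\<^sup>+s. indicator {0..1} s * ennreal (f (Suc k) (y + s *\<^sub>R h)) \<partial>lborel)"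
        and y: "y \<in> segment_in \<Omega> h"
      have "ennreal \<bar>c * f k (y + h) - c * f k y\<bar> = ennreal c * ennreal \<bar>f k (y + h) - f k y\<bar>"
        using c by (simp add: abs_mult ennreal_mult flip: right_diff_distrib)
      also have "\<dots> \<le> ennreal c * (ennreal (norm h) * (\<integral>\<^sup>+s. indicator {0..1} s * ennreal (f (Suc k) (y + s *\<^sub>R h)) \<partial>lborel))"
        using * y by (intro mult_left_mono) auto
      also have "\<dots> = ennreal (norm h) * (ennreal c * (\<integral>\<^sup>+s. indicator {0..1} s * ennreal (f (Suc k) (y + s *\<^sub>R h)) \<partial>lborel))"
        by (simp add: mult_ac)
      also have "ennreal c * (\<integral>\<^sup>+s. indicator {0..1} s * ennreal (f (Suc k) (y + s *\<^sub>R h)) \<partial>lborel) =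
        (\<integral>\<^sup>+s. ennreal c * (indicator {0..1} s * ennreal (f (Suc k) (y + s *\<^sub>R h))) \<partial>lborel)"
        by (rule nn_integral_cmult[symmetric]) measurable
      also have "\<dots> = (\<integral>\<^sup>+s. indicator {0..1} s * ennreal (c * f (Suc k) (y + s *\<^sub>R h)) \<partial>lborel)"
        using c by (intro nn_integral_cong) (simp add: ennreal_mult' mult_ac)
      finally show "ennreal \<bar>c * f k (y + h) - c * f k y\<bar> \<le>
        ennreal (norm h) * (\<integral>\<^sup>+s. indicator {0..1} s * ennreal (c * f (Suc k) (y + s *\<^sub>R h)) \<partial>lborel)" .
    qed
  qed
qed

text \<open>A point lies in \<open>ball x0 \<rho>\<close> precisely for the centres
  \<open>x0\<close> in a ball of the same radius about the point. Integrating local inequalities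
  over all centres therefore gives a global one with constants that are ratios of measures of
  balls.\<close>

lemma nn_integral_ball_average:
  assumes [measurable]: "F \<in> borel_measurable borel"
  shows "(\<integral>\<^sup>+x0. \<integral>\<^sup>+x. indicator (ball x0 \<rho>) x * F x \<partial>lborel \<partial>lborel) =
    ennreal (measure lborel (ball (0::'a) \<rho>)) * (\<integral>\<^sup>+x. F (x::'a) \<partial>lborel)"
proof -
  have [measurable]: "ball x \<rho> \<in> sets borel" for x :: 'a by simp
  have "(\<integral>\<^sup>+x0. \<integral>\<^sup>+x. indicator (ball x0 \<rho>) x * F x \<partial>lborel \<partial>lborel) = (\<integral>\<^sup>+x. \<integral>\<^sup>+x0. indicator (ball x0 \<rho>) x * F x \<partial>lborel \<partial>lborel)"
    by (rule lborel_pair.Fubini') measurable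
  also have "\<dots> = (\<integral>\<^sup>+x. \<integral>\<^sup>+x0. F x * indicator (ball x \<rho>) x0 \<partial>lborel \<partial>lborel)"
    by (intro nn_integral_cong) (auto simp: dist_commute split: split_indicator)
  also have "\<dots> = (\<integral>\<^sup>+x. ennreal (measure lborel (ball (0::'a) \<rho>)) * F x \<partial>lborel)"
    by (intro nn_integral_cong) (simp add: nn_integral_cmult_indicator emeasure_lborel_ball_center mult.commute)
  also have "\<dots> = ennreal (measure lborel (ball (0::'a) \<rho>)) * (\<integral>\<^sup>+x. F x \<partial>lborel)"
    by (rule nn_integral_cmult) measurable
  finally show ?thesis .
qed

text \<open>The local estimate, freed from its normalisation, reads
  \<open>X x0 \<le> C * K powr p * Q x0\<close>: both sides are integrals of \<open>p\<close>-th
  powers over balls about \<open>x0\<close>. This form is additive, so it can be integrated over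
  \<open>x0\<close> although the bound on \<open>G\<close> is only uniform and local.\<close>

theorem weighted_embedding:
  fixes p q :: real
  assumes p: "1 \<le> p" "p \<le> q" and r: "1 \<le> r" and qr: "DIM('a) / real r \<le> q"
    and eq: "DIM('a) / real r = p \<Longrightarrow> 1 < p \<Longrightarrow> DIM('a) / real r < q"
  shows "\<exists>C\<ge>0. \<forall>f G K. gradient_chain \<Omega> r f \<longrightarrow> G \<in> borel_measurable borel \<longrightarrow> (\<forall>x. 0 \<le> G x) \<longrightarrow> 0 < K \<longrightarrow>
     (\<forall>x\<in>\<Omega>. (\<integral>\<^sup>+y. indicator (\<Omega> \<inter> ball x d) y * ennreal (G y powr q) \<partial>lborel) \<le> ennreal (K powr q)) \<longrightarrow>
     (\<integral>\<^sup>+x. ennreal ((G x * f 0 x) powr p) \<partial>lborel)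
       \<le> ennreal (C * K powr p) * (\<Sum>k\<le>r. \<integral>\<^sup>+x. ennreal (f k x powr p) \<partial>lborel)"
proof -
  define R where "R = d/2 + real r * (1 + d)"
  have "\<exists>C\<ge>0. \<forall>f G x0. gradient_chain \<Omega> r f \<longrightarrow> G \<in> borel_measurable borel \<longrightarrow> (\<forall>x. 0 \<le> G x) \<longrightarrow>
     (\<forall>k\<le>r. (\<integral>\<^sup>+x. indicator (ball x0 (d/2 + real r * (1 + d))) x * ennreal (f k x powr p) \<partial>lborel) \<le> 1) \<longrightarrow>
     (\<integral>\<^sup>+x. indicator (ball x0 (d/2)) x * ennreal (G x powr q) \<partial>lborel) \<le> 1 \<longrightarrow>
     (\<integral>\<^sup>+x. indicator (ball x0 (d/2)) x * ennreal ((G x * f 0 x) powr p) \<partial>lborel) \<le> ennreal C"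
  proof (cases "DIM('a) < real r * p \<or> p = 1 \<and> r = DIM('a)")
    case True
    show ?thesis by (rule local_weighted_bounded[OF p r True])
  next
    case False
    then have rp: "real r * p \<le> DIM('a)" by simp
    have dr: "DIM('a) / real r = p" if "real r * p = DIM('a)" using that r by (simp add: field_simps)
    have pos: "real r * p = DIM('a) \<Longrightarrow> 1 < p" using False p by (cases "p = 1") auto
    have "p < q"
    proof (cases "real r * p = DIM('a)")
      case True
      then show ?thesis using dr eq pos by metis
    next
      case False
      then have "p < DIM('a) / real r" using rp r by (simp add: pos_less_divide_eq mult.commute)
      then show ?thesis using qr by simp
    qed
    then show ?thesis using local_weighted_critical[OF p(1) _ r rp qr pos] by blast
  qed
  then obtain C1 where C1: "0 \<le> C1" and C0: "\<forall>f G x0. gradient_chain \<Omega> r f \<longrightarrow> G \<in> borel_measurable borel \<longrightarrow> (\<forall>x. 0 \<le> G x) \<longrightarrow>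
     (\<forall>k\<le>r. (\<integral>\<^sup>+x. indicator (ball x0 R) x * ennreal (f k x powr p) \<partial>lborel) \<le> 1) \<longrightarrow>
     (\<integral>\<^sup>+x. indicator (ball x0 (d/2)) x * ennreal (G x powr q) \<partial>lborel) \<le> 1 \<longrightarrow>
     (\<integral>\<^sup>+x. indicator (ball x0 (d/2)) x * ennreal ((G x * f 0 x) powr p) \<partial>lborel) \<le> ennreal C1"
    unfolding R_def by (elim exE conjE)
  \<comment> \<open>A positive constant keeps the right-hand side infinite where \<open>Q x0\<close>
    is infinite, as 0 times infinity is 0 in \<open>ennreal\<close>.\<close>
  define C where "C = C1 + 1"
  have C: "0 < C" using C1 by (simp add: C_def)
  have "ennreal C1 \<le> ennreal C" by (intro ennreal_leI) (simp add: C_def)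
  note C' = order_trans[OF C0[rule_format] this]
  define \<beta>1 where "\<beta>1 = measure lborel (ball (0::'a) (d/2))"
  define \<beta>2 where "\<beta>2 = measure lborel (ball (0::'a) R)"
  have \<beta>: "0 < \<beta>1" "0 \<le> \<beta>2"
    using content_ball_pos[of "d/2" "0::'a"] d_pos by (auto simp: \<beta>1_def \<beta>2_def)
  show ?thesis
  proof (intro exI[of _ "C * \<beta>2 / \<beta>1"] conjI allI impI)
    show "0 \<le> C * \<beta>2 / \<beta>1" using C \<beta> by simp
    fix f G K
    assume ch: "gradient_chain \<Omega> r f" and [measurable]: "G \<in> borel_measurable borel" and G: "\<forall>x. 0 \<le> G x" and K: "0 < (K::real)"
      and GK: "\<forall>x\<in>\<Omega>. (\<integral>\<^sup>+y. indicator (\<Omega> \<inter> ball x d) y * ennreal (G y powr q) \<partial>lborel) \<le> ennreal (K powr q)"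
    have [measurable]: "f k \<in> borel_measurable borel" for k using ch by (simp add: gradient_chain_def)
    have f0: "0 \<le> f k x" for k x using ch by (simp add: gradient_chain_def)
    have fz: "f k x = 0" if "x \<notin> \<Omega>" for k x using ch that by (simp add: gradient_chain_def)
    have [measurable]: "\<Omega> \<inter> ball x d \<in> sets borel" for x by simp
    define Q where "Q x0 = (\<Sum>k\<le>r. \<integral>\<^sup>+x. indicator (ball x0 R) x * ennreal (f k x powr p) \<partial>lborel)" for x0
    define X where "X x0 = (\<integral>\<^sup>+x. indicator (ball x0 (d/2)) x * ennreal ((G x * f 0 x) powr p) \<partial>lborel)" for x0
    have loc: "X x0 \<le> ennreal (C * K powr p) * Q x0" for x0
    \<comment> \<open>A ball missing the domain contributes nothing. Any other ball of radius
      \<open>d/2\<close> is contained in the ball of radius \<open>d\<close> about one of its points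
      in the domain, and about such points the norm of \<open>G\<close> is controlled.\<close>
    proof (cases "ball x0 (d/2) \<inter> \<Omega> = {}")
      case True
      have "X x0 = (\<integral>\<^sup>+x. 0 \<partial>(lborel :: 'a measure))"
        unfolding X_def
      proof (intro nn_integral_cong)
        fix x
        have "f 0 x = 0" if "x \<in> ball x0 (d/2)" using fz True that by blast
        then show "indicator (ball x0 (d/2)) x * ennreal ((G x * f 0 x) powr p) = 0"
          using p by (cases "x \<in> ball x0 (d/2)") auto
      qed
      then show ?thesis by simp
    next
      case False
      then obtain x1 where x1: "x1 \<in> \<Omega>" "dist x0 x1 < d/2" by auto
      have sub: "ball x0 (d/2) \<subseteq> ball x1 d"
        using x1 by (intro subsetI) (smt (verit) dist_commute dist_triangle field_sum_of_halves mem_ball)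
      \<comment> \<open>\<open>G\<close> is controlled only inside the domain; cutting it off there
        does not change the product with \<open>f 0\<close>, which vanishes outside.\<close>
      define G' where "G' x = indicator \<Omega> x * G x / K" for x
      have [measurable]: "G' \<in> borel_measurable borel" unfolding G'_def by measurable
      have G'0: "0 \<le> G' x" for x using G K by (simp add: G'_def)
      have G'q: "(\<integral>\<^sup>+x. indicator (ball x0 (d/2)) x * ennreal (G' x powr q) \<partial>lborel) \<le> 1"
      proof -
        have "(\<integral>\<^sup>+x. indicator (ball x0 (d/2)) x * ennreal (G' x powr q) \<partial>lborel) \<le>
          (\<integral>\<^sup>+x. ennreal (1 / K powr q) * (indicator (\<Omega> \<inter> ball x1 d) x * ennreal (G x powr q)) \<partial>lborel)"
        proof (intro nn_integral_mono)
          fix x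
          show "indicator (ball x0 (d/2)) x * ennreal (G' x powr q) \<le> ennreal (1 / K powr q) * (indicator (\<Omega> \<inter> ball x1 d) x * ennreal (G x powr q))"
            using sub G K p by (auto simp: G'_def powr_divide split: split_indicator simp flip: ennreal_mult)
        qed
        also have "\<dots> = ennreal (1 / K powr q) * (\<integral>\<^sup>+x. indicator (\<Omega> \<inter> ball x1 d) x * ennreal (G x powr q) \<partial>lborel)"
          by (rule nn_integral_cmult) measurable
        also have "\<dots> \<le> ennreal (1 / K powr q) * ennreal (K powr q)"
          using GK x1 by (intro mult_left_mono) auto
        also have "\<dots> = 1" using K by (simp flip: ennreal_mult)
        finally show ?thesis .
      qed
      have XG': "X x0 = ennreal (K powr p) * (\<integral>\<^sup>+x. indicator (ball x0 (d/2)) x * ennreal ((G' x * f 0 x) powr p) \<partial>lborel)"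
      proof -
        have "X x0 = (\<integral>\<^sup>+x. ennreal (K powr p) * (indicator (ball x0 (d/2)) x * ennreal ((G' x * f 0 x) powr p)) \<partial>lborel)"
          unfolding X_def
        proof (intro nn_integral_cong)
          fix x
          have "(G x * f 0 x) powr p = K powr p * (G' x * f 0 x) powr p"
            using K fz[of x 0] G f0 p by (cases "x \<in> \<Omega>") (auto simp: G'_def powr_divide powr_mult)
          then show "indicator (ball x0 (d/2)) x * ennreal ((G x * f 0 x) powr p) = ennreal (K powr p) * (indicator (ball x0 (d/2)) x * ennreal ((G' x * f 0 x) powr p))"
            by (simp add: ennreal_mult mult_ac)
        qed
        also have "\<dots> = ennreal (K powr p) * (\<integral>\<^sup>+x. indicator (ball x0 (d/2)) x * ennreal ((G' x * f 0 x) powr p) \<partial>lborel)"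
          by (rule nn_integral_cmult) measurable
        finally show ?thesis .
      qed
      define Y where "Y = (\<integral>\<^sup>+x. indicator (ball x0 (d/2)) x * ennreal ((G' x * f 0 x) powr p) \<partial>lborel)"
      \<comment> \<open>Any positive \<open>S\<close> above \<open>Q x0\<close> may serve for the
        normalisation; \<open>Q x0\<close> itself may be zero.\<close>
      have scaled: "Y \<le> ennreal (C * S)" if S: "0 < S" "Q x0 \<le> ennreal S" for S
      proof -
        define c where "c = 1 / S powr (1 / p)"
        have c: "0 < c" using S by (simp add: c_def)
        have cp: "c powr p = 1 / S" using S p by (simp add: c_def powr_divide powr_powr)
        have "(\<integral>\<^sup>+x. indicator (ball x0 (d/2)) x * ennreal ((G' x * (c * f 0 x)) powr p) \<partial>lborel) \<le> ennreal C"
        proof (rule C'[OF gradient_chain_scale[OF ch less_imp_le[OF c]] _ _ _ G'q])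
          fix k assume k: "k \<le> r"
          have "(\<integral>\<^sup>+x. indicator (ball x0 R) x * ennreal ((c * f k x) powr p) \<partial>lborel) =
            (\<integral>\<^sup>+x. ennreal (1 / S) * (indicator (ball x0 R) x * ennreal (f k x powr p)) \<partial>lborel)"
            using c f0 S by (intro nn_integral_cong) (simp add: powr_mult cp ennreal_mult'[symmetric] mult_ac split: split_indicator)
          also have "\<dots> = ennreal (1 / S) * (\<integral>\<^sup>+x. indicator (ball x0 R) x * ennreal (f k x powr p) \<partial>lborel)"
            by (rule nn_integral_cmult) measurable
          also have "\<dots> \<le> ennreal (1 / S) * Q x0"
            unfolding Q_def using k by (intro mult_left_mono member_le_sum) auto
          also have "\<dots> \<le> ennreal (1 / S) * ennreal S" using S by (intro mult_left_mono) auto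
          also have "\<dots> = 1" using S by (simp flip: ennreal_mult)
          finally show "(\<integral>\<^sup>+x. indicator (ball x0 R) x * ennreal ((c * f k x) powr p) \<partial>lborel) \<le> 1" .
        qed (use G'0 in auto)
        moreover have "(\<integral>\<^sup>+x. indicator (ball x0 (d/2)) x * ennreal ((G' x * (c * f 0 x)) powr p) \<partial>lborel) =
          (\<integral>\<^sup>+x. ennreal (1 / S) * (indicator (ball x0 (d/2)) x * ennreal ((G' x * f 0 x) powr p)) \<partial>lborel)"
        proof (intro nn_integral_cong)
          fix x
          have "(G' x * (c * f 0 x)) powr p = 1 / S * (G' x * f 0 x) powr p"
            using c f0[of 0 x] G'0[of x] by (simp add: powr_mult cp)
          then show "indicator (ball x0 (d/2)) x * ennreal ((G' x * (c * f 0 x)) powr p) = ennreal (1 / S) * (indicator (ball x0 (d/2)) x * ennreal ((G' x * f 0 x) powr p))"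
            using S by (simp only: ennreal_mult' mult_ac divide_nonneg_pos zero_le_one)
        qed
        moreover have "\<dots> = ennreal (1 / S) * Y" unfolding Y_def by (rule nn_integral_cmult) measurable
        ultimately have "ennreal S * (ennreal (1 / S) * Y) \<le> ennreal S * ennreal C" by (intro mult_left_mono) auto
        moreover have "ennreal S * (ennreal (1 / S) * Y) = Y"
          using S by (simp add: mult.assoc[symmetric] flip: ennreal_mult)
        ultimately show ?thesis using S C by (simp add: mult.commute flip: ennreal_mult)
      qed
      have "Y \<le> ennreal C * Q x0"
      proof (cases "Q x0")
        case (real S)
        \<comment> \<open>\<open>S\<close> exceeds \<open>Q x0\<close> by
          \<open>e / (C + 1)\<close>, which costs at most \<open>e\<close> after multiplication by
          \<open>C\<close> and avoids dividing by zero.\<close>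
        have "Y \<le> ennreal C * Q x0 + ennreal e" if e: "0 < e" for e
        proof -
          have "Y \<le> ennreal (C * (S + e / (C + 1)))"
            using real e C by (intro scaled) (auto intro!: add_nonneg_pos ennreal_leI)
          also have "\<dots> \<le> ennreal (C * S + e)"
          proof (intro ennreal_leI)
            have "C * (e / (C + 1)) \<le> e" using e C by (simp add: divide_le_eq algebra_simps)
            then show "C * (S + e / (C + 1)) \<le> C * S + e" by (simp add: distrib_left)
          qed
          also have "\<dots> = ennreal C * Q x0 + ennreal e"
            using C e real by (simp add: ennreal_mult)
          finally show ?thesis .
        qed
        then show ?thesis by (rule ennreal_le_epsilon)
      next
        case top
        then show ?thesis using C by (simp add: ennreal_mult_top)
      qed
      then have "ennreal (K powr p) * Y \<le> ennreal (K powr p) * (ennreal C * Q x0)"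
        by (rule mult_left_mono) simp
      then show ?thesis unfolding XG' Y_def[symmetric] using C by (simp add: ennreal_mult mult_ac)
    qed
    have "ennreal \<beta>1 * (\<integral>\<^sup>+x. ennreal ((G x * f 0 x) powr p) \<partial>lborel) = (\<integral>\<^sup>+x0. X x0 \<partial>lborel)"
      unfolding X_def \<beta>1_def by (rule nn_integral_ball_average[symmetric]) measurable
    also have "\<dots> \<le> (\<integral>\<^sup>+x0. ennreal (C * K powr p) * Q x0 \<partial>lborel)"
      by (intro nn_integral_mono loc)
    also have "\<dots> = ennreal (C * K powr p) * (\<Sum>k\<le>r. \<integral>\<^sup>+x0. \<integral>\<^sup>+x. indicator (ball x0 R) x * ennreal (f k x powr p) \<partial>lborel \<partial>lborel)"
      unfolding Q_def by (subst nn_integral_cmult, measurable, subst nn_integral_sum, measurable)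
    also have "\<dots> = ennreal (C * K powr p) * (ennreal \<beta>2 * (\<Sum>k\<le>r. \<integral>\<^sup>+x. ennreal (f k x powr p) \<partial>lborel))"
      unfolding \<beta>2_def by (subst nn_integral_ball_average) (auto simp: sum_distrib_left)
    finally have le: "ennreal \<beta>1 * (\<integral>\<^sup>+x. ennreal ((G x * f 0 x) powr p) \<partial>lborel) \<le> ennreal (C * K powr p) * (ennreal \<beta>2 * (\<Sum>k\<le>r. \<integral>\<^sup>+x. ennreal (f k x powr p) \<partial>lborel))" .
    have "(\<integral>\<^sup>+x. ennreal ((G x * f 0 x) powr p) \<partial>lborel) = ennreal (1 / \<beta>1) * (ennreal \<beta>1 * (\<integral>\<^sup>+x. ennreal ((G x * f 0 x) powr p) \<partial>lborel))"
      using \<beta> by (simp add: mult.assoc[symmetric] flip: ennreal_mult)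
    also have "\<dots> \<le> ennreal (1 / \<beta>1) * (ennreal (C * K powr p) * (ennreal \<beta>2 * (\<Sum>k\<le>r. \<integral>\<^sup>+x. ennreal (f k x powr p) \<partial>lborel)))"
      by (intro mult_left_mono le) simp
    also have "\<dots> = ennreal (1 / \<beta>1 * (C * K powr p) * \<beta>2) * (\<Sum>k\<le>r. \<integral>\<^sup>+x. ennreal (f k x powr p) \<partial>lborel)"
    proof -
      have "ennreal (1 / \<beta>1 * (C * K powr p) * \<beta>2) = ennreal (1 / \<beta>1) * ennreal (C * K powr p) * ennreal \<beta>2"
        using \<beta> C by (simp add: ennreal_mult[symmetric])
      then show ?thesis by (simp only: mult.assoc)
    qed
    also have "1 / \<beta>1 * (C * K powr p) * \<beta>2 = C * \<beta>2 / \<beta>1 * K powr p" by simp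
    finally show "(\<integral>\<^sup>+x. ennreal ((G x * f 0 x) powr p) \<partial>lborel)
       \<le> ennreal (C * \<beta>2 / \<beta>1 * K powr p) * (\<Sum>k\<le>r. \<integral>\<^sup>+x. ennreal (f k x powr p) \<partial>lborel)" .
  qed
qed

end

subsection \<open>Bump functions\<close>

text \<open>\<open>flat 1\<close> is the classical smooth function \<open>exp (- (1 / x))\<close>
  extended by 0. The polynomial parameter closes the class under differentiation.\<close>

definition flat :: "real poly \<Rightarrow> real \<Rightarrow> real" where
  "flat P x = (if 0 < x then poly P (1 / x) * exp (- (1 / x)) else 0)"

text \<open>In the variable \<open>y = 1 / x\<close> the derivative of
  \<open>P y * exp (- y)\<close> with respect to \<open>x\<close> is
  \<open>y ^ 2 * (P y - P' y) * exp (- y)\<close>.\<close>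

definition flat_deriv :: "real poly \<Rightarrow> real poly" where
  "flat_deriv P = [:0, 0, 1:] * (P - pderiv P)"

lemma poly_times_exp_tendsto_0:
  fixes P :: "real poly"
  shows "((\<lambda>y. y ^ k * poly P y * exp (- y)) \<longlongrightarrow> 0) at_top"
proof (induction P arbitrary: k)
  case 0
  then show ?case by simp
next
  case (pCons c P)
  have "((\<lambda>y::real. y ^ k * exp (- y)) \<longlongrightarrow> 0) at_top"
    using tendsto_power_div_exp_0[of k] by (simp add: exp_minus divide_inverse)
  then have "((\<lambda>y::real. c * (y ^ k * exp (- y)) + y ^ Suc k * poly P y * exp (- y)) \<longlongrightarrow> c * 0 + 0) at_top"
    by (intro tendsto_intros pCons.IH)
  then show ?case by (simp add: algebra_simps)
qed

text \<open>Only the origin needs an argument: with \<open>y = 1 / h\<close> the right difference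
  quotient is a polynomial in \<open>y\<close> times \<open>exp (- y)\<close>, which tends to
  0.\<close>

lemma flat_has_derivative: "(flat P has_field_derivative flat (flat_deriv P) x) (at x)"
proof -
  consider "0 < x" | "x < 0" | "x = 0" by linarith
  then show ?thesis
  proof cases
    case 1
    have "((\<lambda>x. poly P (1 / x) * exp (- (1 / x))) has_field_derivative flat (flat_deriv P) x) (at x)"
      using 1 by (auto simp: flat_def flat_deriv_def field_simps power2_eq_square intro!: derivative_eq_intros DERIV_chain2[OF poly_DERIV])
    then show ?thesis
      by (rule has_field_derivative_transform_within_open[where S = "{0<..}"]) (use 1 in \<open>auto simp: flat_def\<close>)
  next
    case 2
    have "((\<lambda>x. 0) has_field_derivative flat (flat_deriv P) x) (at x)"
      using 2 by (auto simp: flat_def)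
    then show ?thesis
      by (rule has_field_derivative_transform_within_open[where S = "{..<0}"]) (use 2 in \<open>auto simp: flat_def\<close>)
  next
    case 3
    have "((\<lambda>h. flat P h / h) \<longlongrightarrow> 0) (at 0)"
    proof (subst filterlim_at_split, intro conjI)
      have "\<forall>\<^sub>F h in at_left 0. flat P h / h = 0"
        unfolding eventually_at_filter by (auto simp: flat_def intro!: always_eventually)
      then show "((\<lambda>h. flat P h / h) \<longlongrightarrow> 0) (at_left 0)"
        by (simp add: tendsto_eventually)
      have "((\<lambda>y. y ^ 1 * poly P y * exp (- y)) \<longlongrightarrow> 0) at_top" by (rule poly_times_exp_tendsto_0)
      then have "((\<lambda>h. (inverse h) ^ 1 * poly P (inverse h) * exp (- inverse h)) \<longlongrightarrow> 0) (at_right (0::real))"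
        by (rule filterlim_compose[OF _ filterlim_inverse_at_top_right])
      moreover have "\<forall>\<^sub>F h in at_right (0::real). (inverse h) ^ 1 * poly P (inverse h) * exp (- inverse h) = flat P h / h"
        unfolding eventually_at_filter by (auto simp: flat_def divide_inverse intro!: always_eventually)
      ultimately show "((\<lambda>h. flat P h / h) \<longlongrightarrow> 0) (at_right 0)"
        by (rule Lim_transform_eventually)
    qed
    then show ?thesis using 3 by (simp add: DERIV_def flat_def)
  qed
qed

text \<open>A class generated by algebraic operations and stable under partial derivatives.
  Differentiability of all iterated derivatives then follows by one induction over the
  generators.\<close>

inductive_set smooth_family :: "(real^'n::finite \<Rightarrow> complex) set" where
  const: "(\<lambda>x. c) \<in> smooth_family"
| flat: "(\<lambda>x. complex_of_real (flat P (\<alpha> + \<beta> * x $ i))) \<in> smooth_family"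
| add: "f \<in> smooth_family \<Longrightarrow> g \<in> smooth_family \<Longrightarrow> (\<lambda>x. f x + g x) \<in> smooth_family"
| mult: "f \<in> smooth_family \<Longrightarrow> g \<in> smooth_family \<Longrightarrow> (\<lambda>x. f x * g x) \<in> smooth_family"

lemma partial_deriv_eq:
  assumes "(f has_derivative f') (at x)"
  shows "partial_deriv i f x = f' (axis i 1)"
  using frechet_derivative_at[OF assms] by (simp add: partial_deriv_def)

lemma smooth_family_deriv:
  fixes f :: "real^'n \<Rightarrow> complex"
  assumes "f \<in> smooth_family"
  shows "(\<forall>x. f differentiable (at x)) \<and> (\<forall>j. partial_deriv j f \<in> smooth_family)"
  using assms
proof induction
  case (const c)
  have "partial_deriv j (\<lambda>x. c) = (\<lambda>x. 0)" for j :: 'n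
    by (rule ext) (subst partial_deriv_eq[OF has_derivative_const], simp)
  then show ?case by (auto intro: smooth_family.const)
next
  case (flat P \<alpha> \<beta> i)
  have D: "((\<lambda>x. complex_of_real (flat P (\<alpha> + \<beta> * x $ i))) has_derivative
     (\<lambda>h. complex_of_real (flat (flat_deriv P) (\<alpha> + \<beta> * x $ i) * (\<beta> * h $ i)))) (at x)" for x :: "real^'n"
  proof -
    have "((\<lambda>x. \<alpha> + \<beta> * x $ i) has_derivative (\<lambda>h. \<beta> * h $ i)) (at x)"
      by (auto intro!: derivative_eq_intros bounded_linear_imp_has_derivative bounded_linear_vec_nth)
    then have "((\<lambda>x. flat P (\<alpha> + \<beta> * x $ i)) has_derivative (\<lambda>h. flat (flat_deriv P) (\<alpha> + \<beta> * x $ i) * (\<beta> * h $ i))) (at x)"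
      by (rule has_derivative_compose[OF _ flat_has_derivative[unfolded has_field_derivative_def]])
    then show ?thesis by (rule has_derivative_of_real)
  qed
  have P: "partial_deriv j (\<lambda>x. complex_of_real (flat P (\<alpha> + \<beta> * x $ i))) =
     (\<lambda>x. complex_of_real (if j = i then \<beta> else 0) * complex_of_real (flat (flat_deriv P) (\<alpha> + \<beta> * x $ i)))" for j
    by (rule ext) (simp add: partial_deriv_eq[OF D] axis_def)
  show ?case
    unfolding P using D
    by (auto intro!: smooth_family.intros simp: differentiable_def)
next
  case (add f g)
  have D: "((\<lambda>x. f x + g x) has_derivative (\<lambda>h. frechet_derivative f (at x) h + frechet_derivative g (at x) h)) (at x)" for x
    using add by (auto intro!: has_derivative_add simp: frechet_derivative_works[symmetric])
  have "partial_deriv j (\<lambda>x. f x + g x) = (\<lambda>x. partial_deriv j f x + partial_deriv j g x)" for j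
    by (rule ext) (simp add: partial_deriv_eq[OF D] partial_deriv_def)
  then show ?case
    using add D by (auto intro!: smooth_family.intros simp: differentiable_def)
next
  case (mult f g)
  have D: "((\<lambda>x. f x * g x) has_derivative (\<lambda>h. f x * frechet_derivative g (at x) h + frechet_derivative f (at x) h * g x)) (at x)" for x
    using mult by (auto intro!: has_derivative_mult simp: frechet_derivative_works[symmetric])
  have "partial_deriv j (\<lambda>x. f x * g x) = (\<lambda>x. f x * partial_deriv j g x + partial_deriv j f x * g x)" for j
    by (rule ext) (simp add: partial_deriv_eq[OF D] partial_deriv_def)
  then show ?case
    using mult D by (auto intro!: smooth_family.intros simp: differentiable_def)
qed

lemma smooth_family_iter_partial_deriv: "f \<in> smooth_family \<Longrightarrow> iter_partial_deriv js f \<in> smooth_family"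
  by (induction js) (auto simp: smooth_family_deriv)

lemma smooth_family_prod: "(\<And>i. i \<in> I \<Longrightarrow> f i \<in> smooth_family) \<Longrightarrow> (\<lambda>x. \<Prod>i\<in>I. f i x) \<in> smooth_family"
  by (induction I rule: infinite_finite_induct) (auto intro: smooth_family.intros)

lemma partial_deriv_vanishes:
  assumes "closed S" and f: "\<And>x. x \<notin> S \<Longrightarrow> f x = 0" and x: "x \<notin> S"
  shows "partial_deriv i f x = 0"
proof -
  have "((\<lambda>x. 0) has_derivative (\<lambda>x. 0)) (at x)" by simp
  then have "(f has_derivative (\<lambda>x. 0)) (at x)"
    by (rule has_derivative_transform_within_open[where s = "- S"]) (use assms in auto)
  from partial_deriv_eq[OF this] show ?thesis .
qed

lemma smooth_family_test_function:
  assumes f: "f \<in> smooth_family" and S: "compact S" "S \<subseteq> \<Omega>" "\<And>x. x \<notin> S \<Longrightarrow> f x = 0"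
  shows "f \<in> test_functions \<Omega>"
proof -
  have sub: "closure {x. f x \<noteq> 0} \<subseteq> S"
    using S by (intro closure_minimal) (auto intro: compact_imp_closed)
  then have "compact (closure {x. f x \<noteq> 0})"
    using S by (metis closed_closure compact_Int_closed inf.absorb_iff2)
  moreover have "iter_partial_deriv js f differentiable_on UNIV" for js
    using smooth_family_deriv[OF smooth_family_iter_partial_deriv[OF f]]
    by (auto simp: differentiable_on_def)
  ultimately show ?thesis using sub S by (auto simp: test_functions_def)
qed

text \<open>A product of flat functions of the distances to the faces of the box. The factor
  \<open>Suc k\<close> drives each \<open>exp (- 1 / (Suc k * c))\<close> to 1 inside the box, so
  the bumps approximate its indicator while staying bounded by 1.\<close>

definition bump :: "nat \<Rightarrow> real^'n \<Rightarrow> real^'n \<Rightarrow> real^'n \<Rightarrow> complex" where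
  "bump k a b x = (\<Prod>i\<in>UNIV. complex_of_real (flat 1 (real (Suc k) * (x $ i - a $ i))) *
     complex_of_real (flat 1 (real (Suc k) * (b $ i - x $ i))))"

lemma bump_smooth: "bump k a b \<in> smooth_family"
proof -
  have "(\<lambda>x. \<Prod>i\<in>UNIV. complex_of_real (flat 1 (real (Suc k) * - (a $ i) + real (Suc k) * x $ i)) *
     complex_of_real (flat 1 (real (Suc k) * b $ i + - real (Suc k) * x $ i))) \<in> smooth_family"
    by (intro smooth_family_prod smooth_family.mult smooth_family.flat)
  moreover have "bump k a b = (\<lambda>x. \<Prod>i\<in>UNIV. complex_of_real (flat 1 (real (Suc k) * - (a $ i) + real (Suc k) * x $ i)) *
     complex_of_real (flat 1 (real (Suc k) * b $ i + - real (Suc k) * x $ i)))"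
    unfolding bump_def by (intro ext prod.cong) (auto simp: algebra_simps)
  ultimately show ?thesis by simp
qed

lemma flat_one_bounds: "0 \<le> flat 1 x" "flat 1 x \<le> 1"
  by (auto simp: flat_def)

lemma norm_bump_le: "norm (bump k a b x) \<le> 1"
  unfolding bump_def using flat_one_bounds
  by (subst prod_norm[symmetric]) (auto intro!: prod_le_1 mult_le_one simp: norm_mult)

lemma bump_outside: "x \<notin> box a b \<Longrightarrow> bump k a b x = 0"
proof -
  assume "x \<notin> box a b"
  then obtain i where "x $ i \<le> a $ i \<or> b $ i \<le> x $ i" by (auto simp: mem_box_cart not_less)
  then have "complex_of_real (flat 1 (real (Suc k) * (x $ i - a $ i))) *
     complex_of_real (flat 1 (real (Suc k) * (b $ i - x $ i))) = 0"
    by (auto simp: flat_def zero_less_mult_iff)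
  then show ?thesis unfolding bump_def by (intro prod_zero) auto
qed

lemma bump_tendsto:
  fixes a b x :: "real^'n"
  shows "(\<lambda>k. bump k a b x) \<longlonglongrightarrow> indicator (box a b) x"
proof (cases "x \<in> box a b")
  case False
  then show ?thesis by (simp add: bump_outside)
next
  case True
  have *: "(\<lambda>k. complex_of_real (flat 1 (real (Suc k) * c))) \<longlonglongrightarrow> 1" if c: "0 < c" for c
  proof -
    have "(\<lambda>k. inverse (real (Suc k)) / c) \<longlonglongrightarrow> 0 / c"
      by (intro tendsto_intros LIMSEQ_inverse_real_of_nat) (use c in simp)
    then have "(\<lambda>k. exp (- (inverse (real (Suc k)) / c))) \<longlonglongrightarrow> exp (- 0)"
      by (intro tendsto_intros) simp
    moreover have "exp (- (inverse (real (Suc k)) / c)) = flat 1 (real (Suc k) * c)" for k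
      using c by (simp add: flat_def divide_inverse)
    ultimately have "(\<lambda>k. flat 1 (real (Suc k) * c)) \<longlonglongrightarrow> 1" by simp
    then show ?thesis by (metis of_real_1 tendsto_of_real)
  qed
  have "(\<lambda>k. bump k a b x) \<longlonglongrightarrow> (\<Prod>i\<in>(UNIV::'n set). 1 * 1)"
    unfolding bump_def by (rule tendsto_prod, rule tendsto_mult; rule *) (use True in \<open>auto simp: mem_box_cart\<close>)
  then show ?thesis using True by simp
qed

lemma bump_shift: "bump k a b (x - z) = bump k (a + z) (b + z) x"
  by (simp add: bump_def algebra_simps)

lemma bump_test_function: "cbox a b \<subseteq> \<Omega> \<Longrightarrow> bump k a b \<in> test_functions \<Omega>"
  using bump_outside[of _ a b k] box_subset_cbox[of a b]
  by (intro smooth_family_test_function[OF bump_smooth, of "cbox a b"]) auto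

lemma smooth_family_continuous: "f \<in> smooth_family \<Longrightarrow> continuous_on UNIV f"
  using smooth_family_deriv[of f]
  by (auto intro!: continuous_at_imp_continuous_on differentiable_imp_continuous_within)

lemma smooth_family_bounded:
  assumes f: "f \<in> smooth_family" and S: "compact S" "\<And>x. x \<notin> S \<Longrightarrow> f x = 0"
  obtains M where "0 \<le> M" "\<And>x. norm (f x) \<le> M"
proof -
  have "compact (f ` S)"
    using S smooth_family_continuous[OF f] by (meson compact_continuous_image continuous_on_subset subset_UNIV)
  then obtain M where "\<And>y. y \<in> f ` S \<Longrightarrow> norm y \<le> M"
    by (meson bounded_iff compact_imp_bounded)
  then have "norm (f x) \<le> max M 0" for x using S(2)[of x] by (cases "x \<in> S") force+
  then show ?thesis by (intro that[of "max M 0"]) auto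
qed

text \<open>Lebesgue's differentiation theorem: almost everywhere the function is the limit of its
  averages over shrinking cubes, and all of these averages vanish. Extending \<open>F\<close> by 0
  outside the fixed box allows cubes that are not contained in it.\<close>

lemma AE_zero_if_box_integrals_zero:
  fixes F :: "real^'n \<Rightarrow> complex"
  assumes F: "integrable lborel (\<lambda>x. indicator (cbox A B) x *\<^sub>R F x)"
    and zero: "\<And>a b. cbox a b \<subseteq> cbox A B \<Longrightarrow> (LINT x|lborel. indicator (box a b) x *\<^sub>R F x) = 0"
  shows "AE x in lborel. x \<in> cbox A B \<longrightarrow> F x = 0"
proof -
  define G where "G x = indicator (cbox A B) x *\<^sub>R F x" for x
  have G: "integrable lborel G" using F by (simp add: G_def[abs_def])
  have Gset: "set_integrable lborel S G" if "S \<in> sets borel" for S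
    unfolding set_integrable_def using integrable_mult_indicator[OF _ G] that by simp
  have "integral (cbox a b) G = 0" for a b
  proof -
    obtain c e where ce: "cbox a b \<inter> cbox A B = cbox c e" using Int_interval by blast
    have "integral (cbox a b) G = integral (cbox c e) G"
    proof -
      have "integral (cbox a b) G = integral UNIV (\<lambda>x. if x \<in> cbox a b then G x else 0)" by (simp add: integral_restrict_UNIV)
      also have "(\<lambda>x. if x \<in> cbox a b then G x else 0) = (\<lambda>x. if x \<in> cbox c e then G x else 0)"
        unfolding ce[symmetric] by (auto simp: G_def fun_eq_iff)
      also have "integral UNIV \<dots> = integral (cbox c e) G" by (simp add: integral_restrict_UNIV)
      finally show ?thesis .
    qed
    also have "\<dots> = integral (box c e) G" by (rule integral_open_interval[symmetric])
    also have "\<dots> = (LINT x : box c e | lborel. G x)"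
      by (rule set_borel_integral_eq_integral(2)[symmetric]) (rule Gset, simp)
    also have "\<dots> = (LINT x | lborel. indicator (box c e) x *\<^sub>R F x)"
      unfolding set_lebesgue_integral_def using ce box_subset_cbox[of c e]
      by (intro Bochner_Integration.integral_cong) (auto simp: G_def split: split_indicator)
    also have "\<dots> = 0" by (rule zero) (use ce in blast)
    finally show ?thesis .
  qed
  moreover have "G integrable_on cbox a b" for a b
    by (rule set_borel_integral_eq_integral(1)) (rule Gset, simp)
  ultimately obtain N where N: "negligible N" and lim: "\<And>x e. \<lbrakk>x \<notin> N; 0 < e\<rbrakk> \<Longrightarrow>
     \<exists>d>0. \<forall>h. 0 < h \<and> h < d \<longrightarrow> norm (0 /\<^sub>R h ^ DIM(real^'n) - G x) < e"
    using integrable_ccontinuous_explicit[of G] by metis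
  have "G x = 0" if x: "x \<notin> N" for x
  proof (rule ccontr)
    assume "G x \<noteq> 0"
    then obtain d where d: "0 < d" "\<And>h. 0 < h \<and> h < d \<Longrightarrow> norm (0 /\<^sub>R h ^ DIM(real^'n) - G x) < norm (G x)"
      using lim[OF x, of "norm (G x)"] by auto
    from d(2)[of "d/2"] d(1) show False by simp
  qed
  moreover have "AE x in lebesgue. x \<notin> N"
    using N by (simp add: negligible_iff_null_sets AE_not_in)
  ultimately have "AE x in lebesgue. G x = 0" by (auto elim: eventually_mono)
  then have "AE x in lborel. G x = 0" by (simp add: AE_completion_iff)
  then show ?thesis by (rule eventually_mono) (auto simp: G_def)
qed

text \<open>An open set is a countable union of closed boxes contained in it, so the exceptional
  sets can be united.\<close>

lemma AE_open_of_AE_boxes: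
  fixes U :: "'a::euclidean_space set"
  assumes U: "open U" and box: "\<And>a b. cbox a b \<subseteq> U \<Longrightarrow> AE x in lborel. x \<in> cbox a b \<longrightarrow> P x"
  shows "AE x in lborel. x \<in> U \<longrightarrow> P x"
proof -
  obtain \<D> where D: "countable \<D>" "\<D> \<subseteq> Pow U" "\<And>X. X \<in> \<D> \<Longrightarrow> \<exists>a b. X = cbox a b" "\<Union>\<D> = U"
    using open_countable_Union_open_cbox[OF U] by metis
  have "AE x in lborel. \<forall>X\<in>\<D>. x \<in> X \<longrightarrow> P x"
  proof (subst AE_ball_countable[OF D(1)], intro ballI)
    fix X assume X: "X \<in> \<D>"
    then obtain a b where "X = cbox a b" using D(3) by blast
    then show "AE x in lborel. x \<in> X \<longrightarrow> P x" using box[of a b] X D(2) by blast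
  qed
  then show ?thesis by (rule eventually_mono) (use D(4) in blast)
qed

subsection \<open>Weak derivatives along segments\<close>

lemma lborel_shift_integrable_iff:
  fixes f :: "'a::euclidean_space \<Rightarrow> 'b::{banach, second_countable_topology}"
  shows "integrable lborel (\<lambda>x. f (x + h)) \<longleftrightarrow> integrable lborel f"
proof -
  have *: "integrable lborel (\<lambda>x. f (x + h))" if f: "integrable lborel f" for f :: "'a \<Rightarrow> 'b" and h
  proof -
    have "integrable (distr lborel borel ((+) h)) f" using f by (simp add: lborel_distr_plus)
    then have "integrable lborel (\<lambda>x. f (h + x))" by (rule integrable_distr[rotated]) simp
    then show ?thesis by (simp add: add.commute)
  qed
  from *[of f h] *[of "\<lambda>x. f (x + h)" "- h"] show ?thesis by auto
qed

lemma lborel_shift_integral: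
  fixes f :: "'a::euclidean_space \<Rightarrow> 'b::{banach, second_countable_topology}"
  assumes [measurable]: "f \<in> borel_measurable borel"
  shows "(LINT x|lborel. f (x + h)) = (LINT x|lborel. f x)"
proof -
  have "(LINT x|lborel. f x) = (LINT x|distr lborel borel ((+) h). f x)" by (simp add: lborel_distr_plus)
  also have "\<dots> = (LINT x|lborel. f (x + h))"
    by (subst integral_distr) (auto simp: add.commute)
  finally show ?thesis by simp
qed

lemma partial_deriv_shift:
  assumes "\<And>x. f differentiable (at x)"
  shows "partial_deriv i (\<lambda>x. f (x - z)) y = partial_deriv i f (y - z)"
proof -
  have "(f has_derivative frechet_derivative f (at (y - z))) (at (y - z))"
    using assms by (simp add: frechet_derivative_works[symmetric])
  then have "((\<lambda>x. f (x - z)) has_derivative (\<lambda>h. frechet_derivative f (at (y - z)) h)) (at y)"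
  proof (rule has_derivative_compose[rotated])
    show "((\<lambda>x. x - z) has_derivative (\<lambda>h. h)) (at y)" by (auto intro!: derivative_eq_intros)
  qed
  from partial_deriv_eq[OF this] show ?thesis by (simp add: partial_deriv_def)
qed

lemma frechet_derivative_eq_sum_partial_deriv:
  fixes f :: "real^'n \<Rightarrow> complex"
  assumes "f differentiable (at x)"
  shows "frechet_derivative f (at x) h = (\<Sum>i\<in>UNIV. of_real (h $ i) * partial_deriv i f x)"
proof -
  have lin: "linear (frechet_derivative f (at x))" using assms by (rule linear_frechet_derivative)
  have "h = (\<Sum>i\<in>UNIV. h $ i *\<^sub>R axis i 1)"
    using basis_expansion[of h] by (simp add: scalar_mult_eq_scaleR)
  then have "frechet_derivative f (at x) h = frechet_derivative f (at x) (\<Sum>i\<in>UNIV. h $ i *\<^sub>R axis i 1)" by simp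
  also have "\<dots> = (\<Sum>i\<in>UNIV. h $ i *\<^sub>R frechet_derivative f (at x) (axis i 1))"
    by (simp add: linear_sum[OF lin] linear_scale[OF lin])
  finally show ?thesis by (simp add: partial_deriv_def scaleR_conv_of_real)
qed

text \<open>The fundamental theorem of calculus on the backward segment from \<open>y\<close> to
  \<open>y - h\<close>. The direction is reversed because a translation of \<open>u\<close> by
  \<open>h\<close> is moved onto the test function.\<close>

lemma segment_integral_partial_deriv:
  fixes f :: "real^'n \<Rightarrow> complex"
  assumes f: "f \<in> smooth_family"
  shows "(LINT s|lborel. indicator {0..1} s *\<^sub>R (\<Sum>i\<in>UNIV. - of_real (h $ i) * partial_deriv i f (y - s *\<^sub>R h))) = f (y - h) - f y"
proof -
  have D: "((\<lambda>s. f (y - s *\<^sub>R h)) has_vector_derivative (\<Sum>i\<in>UNIV. - of_real (h $ i) * partial_deriv i f (y - s *\<^sub>R h))) (at s within {0..1})" for s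
  proof -
    have "(f has_derivative frechet_derivative f (at (y - s *\<^sub>R h))) (at (y - s *\<^sub>R h))"
      using smooth_family_deriv[OF f] by (simp add: frechet_derivative_works[symmetric])
    moreover have "((\<lambda>s. y - s *\<^sub>R h) has_derivative (\<lambda>t. - (t *\<^sub>R h))) (at s within {0..1})"
      by (auto intro!: derivative_eq_intros)
    ultimately have "((\<lambda>s. f (y - s *\<^sub>R h)) has_derivative (\<lambda>t. frechet_derivative f (at (y - s *\<^sub>R h)) (- (t *\<^sub>R h)))) (at s within {0..1})"
      by (rule has_derivative_compose[rotated])
    moreover have eq: "frechet_derivative f (at (y - s *\<^sub>R h)) (- (t *\<^sub>R h)) = t *\<^sub>R (\<Sum>i\<in>UNIV. - of_real (h $ i) * partial_deriv i f (y - s *\<^sub>R h))" for t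
      using smooth_family_deriv[OF f]
      by (subst frechet_derivative_eq_sum_partial_deriv)
         (auto simp: scaleR_sum_right scaleR_conv_of_real[where 'a = complex] mult.assoc sum_distrib_left)
    ultimately show ?thesis unfolding has_vector_derivative_def eq by blast
  qed
  have cont: "continuous_on {0..1} (\<lambda>s. \<Sum>i\<in>UNIV. - of_real (h $ i) * partial_deriv i f (y - s *\<^sub>R h))"
  proof (intro continuous_intros)
    fix i
    have "continuous_on UNIV (partial_deriv i f)"
      by (intro smooth_family_continuous smooth_family_deriv[OF f, THEN conjunct2, rule_format])
    moreover have "continuous_on {0..1} (\<lambda>s. y - s *\<^sub>R h)" by (intro continuous_intros)
    ultimately show "continuous_on {0..1} (\<lambda>s. partial_deriv i f (y - s *\<^sub>R h))"
      by (rule continuous_on_compose2) simp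
  qed
  have "(LINT s|lborel. indicator {0..1} s *\<^sub>R (\<Sum>i\<in>UNIV. - of_real (h $ i) * partial_deriv i f (y - s *\<^sub>R h))) =
    f (y - 1 *\<^sub>R h) - f (y - 0 *\<^sub>R h)"
    by (rule integral_FTC_Icc[OF _ D cont]) simp
  then show ?thesis by simp
qed

text \<open>Absolute integrability in \<open>(y, s)\<close> for both placements of the translation.
  \<open>K\<close> contains every point reached from the support of \<open>\<psi>\<close>, so local
  integrability of \<open>w\<close> suffices and Fubini's theorem becomes available.\<close>

lemma segment_pair_integrable:
  fixes w \<psi> :: "'a::euclidean_space \<Rightarrow> complex"
  assumes [measurable]: "w \<in> borel_measurable borel" "\<psi> \<in> borel_measurable borel" "K \<in> sets borel"
    and w: "integrable lborel (\<lambda>x. indicator K x *\<^sub>R w x)"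
    and \<psi>: "\<And>x. norm (\<psi> x) \<le> M" "\<And>x. x \<notin> B \<Longrightarrow> \<psi> x = 0"
    and K: "\<And>y s. y \<in> B \<Longrightarrow> s \<in> {0..1} \<Longrightarrow> y + s *\<^sub>R h \<in> K"
  shows "integrable (lborel \<Otimes>\<^sub>M lborel) (\<lambda>(y, s). indicator {0..1::real} s *\<^sub>R (\<psi> y * w (y + s *\<^sub>R h)))" (is ?A)
    and "integrable (lborel \<Otimes>\<^sub>M lborel) (\<lambda>(y, s). indicator {0..1::real} s *\<^sub>R (\<psi> (y - s *\<^sub>R h) * w y))" (is ?B)
proof -
  define I where "I = (\<integral>\<^sup>+x. ennreal (norm (indicator K x *\<^sub>R w x)) \<partial>lborel)"
  have I: "I < \<infinity>" using w by (simp add: I_def integrable_iff_bounded)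
  have M: "0 \<le> M" using \<psi>(1)[of undefined] norm_ge_zero order_trans by blast
  have fin: "(\<integral>\<^sup>+s. indicator {0..1::real} s * (ennreal M * I) \<partial>lborel) < \<infinity>"
    using I by (simp add: nn_integral_multc ennreal_mult_less_top)
  show ?A
  proof (rule integrableI_bounded)
    have "(\<integral>\<^sup>+x. ennreal (norm (case x of (y, s) \<Rightarrow> indicator {0..1::real} s *\<^sub>R (\<psi> y * w (y + s *\<^sub>R h)))) \<partial>(lborel \<Otimes>\<^sub>M lborel))
      = (\<integral>\<^sup>+s. \<integral>\<^sup>+y. ennreal (norm (indicator {0..1::real} s *\<^sub>R (\<psi> y * w (y + s *\<^sub>R h)))) \<partial>lborel \<partial>lborel)"
      by (subst lborel_pair.nn_integral_snd[symmetric]) auto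
    also have "\<dots> \<le> (\<integral>\<^sup>+s. indicator {0..1::real} s * (ennreal M * I) \<partial>lborel)"
    proof (intro nn_integral_mono)
      fix s :: real
      show "(\<integral>\<^sup>+y. ennreal (norm (indicator {0..1::real} s *\<^sub>R (\<psi> y * w (y + s *\<^sub>R h)))) \<partial>lborel) \<le> indicator {0..1::real} s * (ennreal M * I)"
      proof (cases "s \<in> {0..1}")
        case True
        have "(\<integral>\<^sup>+y. ennreal (norm (indicator {0..1::real} s *\<^sub>R (\<psi> y * w (y + s *\<^sub>R h)))) \<partial>lborel)
          \<le> (\<integral>\<^sup>+y. ennreal M * ennreal (norm (indicator K (y + s *\<^sub>R h) *\<^sub>R w (y + s *\<^sub>R h))) \<partial>lborel)"
        proof (intro nn_integral_mono)
          fix y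
          have "norm (\<psi> y * w (y + s *\<^sub>R h)) \<le> M * norm (indicator K (y + s *\<^sub>R h) *\<^sub>R w (y + s *\<^sub>R h))"
            using \<psi>[of y] K[OF _ True, of y] M by (cases "y \<in> B") (auto simp: norm_mult intro!: mult_right_mono)
          then show "ennreal (norm (indicator {0..1::real} s *\<^sub>R (\<psi> y * w (y + s *\<^sub>R h)))) \<le> ennreal M * ennreal (norm (indicator K (y + s *\<^sub>R h) *\<^sub>R w (y + s *\<^sub>R h)))"
            using True M by (simp add: ennreal_leI flip: ennreal_mult)
        qed
        also have "\<dots> = ennreal M * (\<integral>\<^sup>+y. ennreal (norm (indicator K (y + s *\<^sub>R h) *\<^sub>R w (y + s *\<^sub>R h))) \<partial>lborel)"
          by (rule nn_integral_cmult) measurable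
        also have "(\<integral>\<^sup>+y. ennreal (norm (indicator K (y + s *\<^sub>R h) *\<^sub>R w (y + s *\<^sub>R h))) \<partial>lborel) = I"
          unfolding I_def by (rule nn_integral_lborel_shift[of "\<lambda>y. ennreal (norm (indicator K y *\<^sub>R w y))"]) measurable
        finally show ?thesis using True by simp
      qed simp
    qed
    also note fin
    finally show "(\<integral>\<^sup>+x. ennreal (norm (case x of (y, s) \<Rightarrow> indicator {0..1::real} s *\<^sub>R (\<psi> y * w (y + s *\<^sub>R h)))) \<partial>(lborel \<Otimes>\<^sub>M lborel)) < \<infinity>" .
  qed measurable
  show ?B
  proof (rule integrableI_bounded)
    have "(\<integral>\<^sup>+x. ennreal (norm (case x of (y, s) \<Rightarrow> indicator {0..1::real} s *\<^sub>R (\<psi> (y - s *\<^sub>R h) * w y))) \<partial>(lborel \<Otimes>\<^sub>M lborel))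
      = (\<integral>\<^sup>+s. \<integral>\<^sup>+y. ennreal (norm (indicator {0..1::real} s *\<^sub>R (\<psi> (y - s *\<^sub>R h) * w y))) \<partial>lborel \<partial>lborel)"
      by (subst lborel_pair.nn_integral_snd[symmetric]) auto
    also have "\<dots> \<le> (\<integral>\<^sup>+s. indicator {0..1::real} s * (ennreal M * I) \<partial>lborel)"
    proof (intro nn_integral_mono)
      fix s :: real
      show "(\<integral>\<^sup>+y. ennreal (norm (indicator {0..1::real} s *\<^sub>R (\<psi> (y - s *\<^sub>R h) * w y))) \<partial>lborel) \<le> indicator {0..1::real} s * (ennreal M * I)"
      proof (cases "s \<in> {0..1}")
        case True
        have "(\<integral>\<^sup>+y. ennreal (norm (indicator {0..1::real} s *\<^sub>R (\<psi> (y - s *\<^sub>R h) * w y))) \<partial>lborel)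
          \<le> (\<integral>\<^sup>+y. ennreal M * ennreal (norm (indicator K y *\<^sub>R w y)) \<partial>lborel)"
        proof (intro nn_integral_mono)
          fix y
          have "norm (\<psi> (y - s *\<^sub>R h) * w y) \<le> M * norm (indicator K y *\<^sub>R w y)"
            using \<psi>[of "y - s *\<^sub>R h"] K[OF _ True, of "y - s *\<^sub>R h"] M
            by (cases "y - s *\<^sub>R h \<in> B") (auto simp: norm_mult intro!: mult_right_mono)
          then show "ennreal (norm (indicator {0..1::real} s *\<^sub>R (\<psi> (y - s *\<^sub>R h) * w y))) \<le> ennreal M * ennreal (norm (indicator K y *\<^sub>R w y))"
            using True M by (simp add: ennreal_leI flip: ennreal_mult)
        qed
        also have "\<dots> = ennreal M * I"
          unfolding I_def by (rule nn_integral_cmult) measurable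
        finally show ?thesis using True by simp
      qed simp
    qed
    also note fin
    finally show "(\<integral>\<^sup>+x. ennreal (norm (case x of (y, s) \<Rightarrow> indicator {0..1::real} s *\<^sub>R (\<psi> (y - s *\<^sub>R h) * w y))) \<partial>(lborel \<Otimes>\<^sub>M lborel)) < \<infinity>" .
  qed measurable
qed

lemma bounded_times_integrable:
  fixes w \<psi> :: "'a::euclidean_space \<Rightarrow> complex"
  assumes [measurable]: "w \<in> borel_measurable borel" "\<psi> \<in> borel_measurable borel" "K \<in> sets borel"
    and w: "integrable lborel (\<lambda>x. indicator K x *\<^sub>R w x)"
    and \<psi>: "\<And>x. norm (\<psi> x) \<le> M" "\<And>x. x \<notin> K \<Longrightarrow> \<psi> x = 0"
  shows "integrable lborel (\<lambda>x. \<psi> x * w x)"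
proof (rule Bochner_Integration.integrable_bound[OF integrable_mult_right[OF w, of "complex_of_real M"]])
  show "AE x in lborel. norm (\<psi> x * w x) \<le> norm (complex_of_real M * (indicator K x *\<^sub>R w x))"
  proof (intro AE_I2)
    fix x
    have "norm (\<psi> x) \<le> \<bar>M\<bar>" using \<psi>(1)[of x] by linarith
    then show "norm (\<psi> x * w x) \<le> norm (complex_of_real M * (indicator K x *\<^sub>R w x))"
      using \<psi>(2)[of x] by (cases "x \<in> K") (auto simp: norm_mult intro!: mult_right_mono)
  qed
qed measurable

text \<open>Dominated convergence: the bumps tend to the indicator of the open box, with modulus at
  most 1 and support in the closed box.\<close>

lemma box_integral_zero_of_bumps:
  fixes E :: "real^'n \<Rightarrow> complex"
  assumes [measurable]: "E \<in> borel_measurable borel"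
    and intE: "integrable lborel (\<lambda>y. indicator (cbox a b) y *\<^sub>R E y)"
    and zero: "\<And>k. (LINT y|lborel. bump k a b y * E y) = 0"
  shows "(LINT y|lborel. indicator (box a b) y *\<^sub>R E y) = 0"
proof -
  have "(\<lambda>k. LINT y|lborel. bump k a b y * E y) \<longlonglongrightarrow> (LINT y|lborel. indicator (box a b) y * E y)"
  proof (rule integral_dominated_convergence[where w = "\<lambda>y. norm (indicator (cbox a b) y *\<^sub>R E y)"])
    show "AE y in lborel. (\<lambda>k. bump k a b y * E y) \<longlonglongrightarrow> indicator (box a b) y * E y"
      by (intro AE_I2 tendsto_intros bump_tendsto)
    show "AE y in lborel. norm (bump k a b y * E y) \<le> norm (indicator (cbox a b) y *\<^sub>R E y)" for k
    proof (intro AE_I2)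
      fix y
      show "norm (bump k a b y * E y) \<le> norm (indicator (cbox a b) y *\<^sub>R E y)"
      proof (cases "y \<in> cbox a b")
        case True
        then show ?thesis using norm_bump_le[of k a b y] by (simp add: norm_mult mult_left_le_one_le)
      next
        case False
        then have "bump k a b y = 0" using bump_outside[of y a b k] box_subset_cbox[of a b] by blast
        then show ?thesis by simp
      qed
    qed
    show "(\<lambda>y. bump k a b y * E y) \<in> borel_measurable lborel" for k
    proof -
      have [measurable]: "bump k a b \<in> borel_measurable borel"
        by (rule borel_measurable_continuous_onI[OF smooth_family_continuous[OF bump_smooth]])
      show ?thesis by measurable
    qed
    show "integrable lborel (\<lambda>y. norm (indicator (cbox a b) y *\<^sub>R E y))"
      by (rule integrable_norm[OF intE])
  qed measurable
  then have "(LINT y|lborel. indicator (box a b) y * E y) = 0"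
    unfolding zero by (simp add: LIMSEQ_const_iff)
  moreover have "(\<lambda>y. indicator (box a b) y * E y) = (\<lambda>y. indicator (box a b) y *\<^sub>R E y)"
    by (auto simp: fun_eq_iff split: split_indicator)
  ultimately show ?thesis by simp
qed

text \<open>For fixed \<open>s\<close> the bump translated by \<open>s *\<^sub>R h\<close> is still
  a test function, because the translated box lies in the domain. The definition of the weak
  derivative is applied to it, and the result is integrated over \<open>s\<close>.\<close>

lemma pair_integral_weak_deriv:
  fixes u :: "real^'n \<Rightarrow> complex" and v :: "real^'n \<Rightarrow> complex"
  assumes [measurable]: "u \<in> borel_measurable borel" "v \<in> borel_measurable borel"
    and int: "\<And>K. compact K \<Longrightarrow> K \<subseteq> \<Omega> \<Longrightarrow> integrable lborel (\<lambda>x. indicator K x *\<^sub>R u x)"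
             "\<And>K. compact K \<Longrightarrow> K \<subseteq> \<Omega> \<Longrightarrow> integrable lborel (\<lambda>x. indicator K x *\<^sub>R v x)"
    and weak: "\<And>\<phi>. \<phi> \<in> test_functions \<Omega> \<Longrightarrow> (LINT x|lborel. u x * partial_deriv i \<phi> x) = - (LINT x|lborel. v x * \<phi> x)"
    and box: "cbox a b \<subseteq> segment_in \<Omega> h"
  shows "(LINT (y, s)|(lborel \<Otimes>\<^sub>M lborel). indicator {0..1::real} s *\<^sub>R (partial_deriv i (bump k a b) (y - s *\<^sub>R h) * u y)) =
    - (LINT (y, s)|(lborel \<Otimes>\<^sub>M lborel). indicator {0..1::real} s *\<^sub>R (bump k a b y * v (y + s *\<^sub>R h)))"
    and "integrable (lborel \<Otimes>\<^sub>M lborel) (\<lambda>(y, s). indicator {0..1::real} s *\<^sub>R (partial_deriv i (bump k a b) (y - s *\<^sub>R h) * u y))"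
    and "integrable (lborel \<Otimes>\<^sub>M lborel) (\<lambda>(y, s). indicator {0..1::real} s *\<^sub>R (bump k a b y * v (y + s *\<^sub>R h)))"
proof -
  define K where "K = (\<lambda>(y, s). y + s *\<^sub>R h) ` (cbox a b \<times> {0..1})"
  have K: "compact K" unfolding K_def
    by (intro compact_continuous_image compact_Times) (auto simp: case_prod_unfold intro!: continuous_intros)
  have Ksub: "K \<subseteq> \<Omega>" using box by (auto simp: K_def segment_in_def)
  have Km [measurable]: "K \<in> sets borel" using K by (simp add: compact_imp_closed)
  have inK: "y + s *\<^sub>R h \<in> K" if "y \<in> cbox a b" "s \<in> {0..1}" for y s
    using that by (auto simp: K_def)
  let ?\<phi> = "bump k a b"
  have \<phi>S: "?\<phi> \<in> smooth_family" and d\<phi>S: "partial_deriv i ?\<phi> \<in> smooth_family"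
    using bump_smooth smooth_family_deriv by blast+
  have [measurable]: "?\<phi> \<in> borel_measurable borel" "partial_deriv i ?\<phi> \<in> borel_measurable borel"
    using smooth_family_continuous[OF \<phi>S] smooth_family_continuous[OF d\<phi>S]
    by (auto intro: borel_measurable_continuous_onI)
  have \<phi>0: "?\<phi> x = 0" if "x \<notin> cbox a b" for x
    using that bump_outside[of x a b k] box_subset_cbox[of a b] by blast
  have d\<phi>0: "partial_deriv i ?\<phi> x = 0" if "x \<notin> cbox a b" for x
    by (rule partial_deriv_vanishes[OF closed_cbox \<phi>0 that])
  obtain M where M: "\<And>x. norm (partial_deriv i ?\<phi> x) \<le> M"
    using smooth_family_bounded[OF d\<phi>S compact_cbox d\<phi>0] by blast
  show 1: "integrable (lborel \<Otimes>\<^sub>M lborel) (\<lambda>(y, s). indicator {0..1::real} s *\<^sub>R (partial_deriv i ?\<phi> (y - s *\<^sub>R h) * u y))"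
    by (rule segment_pair_integrable(2)[OF _ _ Km int(1)[OF K Ksub] M d\<phi>0 inK]) auto
  show 2: "integrable (lborel \<Otimes>\<^sub>M lborel) (\<lambda>(y, s). indicator {0..1::real} s *\<^sub>R (?\<phi> y * v (y + s *\<^sub>R h)))"
    by (rule segment_pair_integrable(1)[OF _ _ Km int(2)[OF K Ksub] norm_bump_le \<phi>0 inK]) auto
  have inner: "(LINT y|lborel. indicator {0..1::real} s *\<^sub>R (partial_deriv i ?\<phi> (y - s *\<^sub>R h) * u y)) =
    - (LINT y|lborel. indicator {0..1::real} s *\<^sub>R (?\<phi> y * v (y + s *\<^sub>R h)))" for s
  proof (cases "s \<in> {0..1}")
    case True
    have "cbox (a + s *\<^sub>R h) (b + s *\<^sub>R h) \<subseteq> \<Omega>"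
    proof
      fix x assume "x \<in> cbox (a + s *\<^sub>R h) (b + s *\<^sub>R h)"
      then have "x - s *\<^sub>R h \<in> cbox a b" by (auto simp: mem_box_cart algebra_simps)
      then show "x \<in> \<Omega>" using inK[OF _ True, of "x - s *\<^sub>R h"] Ksub by auto
    qed
    then have "(\<lambda>y. ?\<phi> (y - s *\<^sub>R h)) \<in> test_functions \<Omega>"
      unfolding bump_shift by (rule bump_test_function)
    from weak[OF this] have "(LINT x|lborel. u x * partial_deriv i ?\<phi> (x - s *\<^sub>R h)) = - (LINT x|lborel. v x * ?\<phi> (x - s *\<^sub>R h))"
      using smooth_family_deriv[OF \<phi>S] by (simp add: partial_deriv_shift)
    also have "(LINT x|lborel. v x * ?\<phi> (x - s *\<^sub>R h)) = (LINT x|lborel. v (x + s *\<^sub>R h) * ?\<phi> x)"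
      using lborel_shift_integral[of "\<lambda>x. v x * ?\<phi> (x - s *\<^sub>R h)" "s *\<^sub>R h"] by simp
    finally show ?thesis using True by (simp add: mult.commute)
  qed simp
  have "(LINT (y, s)|(lborel \<Otimes>\<^sub>M lborel). indicator {0..1::real} s *\<^sub>R (partial_deriv i ?\<phi> (y - s *\<^sub>R h) * u y)) =
    (LINT s|lborel. LINT y|lborel. indicator {0..1::real} s *\<^sub>R (partial_deriv i ?\<phi> (y - s *\<^sub>R h) * u y))"
    by (rule lborel_pair.integral_snd[OF 1, symmetric])
  also have "\<dots> = - (LINT s|lborel. LINT y|lborel. indicator {0..1::real} s *\<^sub>R (?\<phi> y * v (y + s *\<^sub>R h)))"
    unfolding inner by simp
  also have "(LINT s|lborel. LINT y|lborel. indicator {0..1::real} s *\<^sub>R (?\<phi> y * v (y + s *\<^sub>R h))) =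
    (LINT (y, s)|(lborel \<Otimes>\<^sub>M lborel). indicator {0..1::real} s *\<^sub>R (?\<phi> y * v (y + s *\<^sub>R h)))"
    by (rule lborel_pair.integral_snd[OF 2])
  finally show "(LINT (y, s)|(lborel \<Otimes>\<^sub>M lborel). indicator {0..1::real} s *\<^sub>R (partial_deriv i ?\<phi> (y - s *\<^sub>R h) * u y)) =
    - (LINT (y, s)|(lborel \<Otimes>\<^sub>M lborel). indicator {0..1::real} s *\<^sub>R (?\<phi> y * v (y + s *\<^sub>R h)))" .
qed

text \<open>For almost every \<open>y\<close> the increment \<open>u (y + h) - u y\<close> is the integral of the weak gradient along
  the segment: both sides have the same integral against the test functions approximating the
  indicator of a box.\<close>

lemma weak_deriv_segment_formula:
  fixes u :: "real^'n \<Rightarrow> complex" and v :: "'n \<Rightarrow> real^'n \<Rightarrow> complex"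
  assumes um [measurable]: "u \<in> borel_measurable borel" and vm [measurable]: "\<And>i. v i \<in> borel_measurable borel"
    and \<Omega>: "open \<Omega>"
    and int: "\<And>K. compact K \<Longrightarrow> K \<subseteq> \<Omega> \<Longrightarrow> integrable lborel (\<lambda>x. indicator K x *\<^sub>R u x)"
             "\<And>K i. compact K \<Longrightarrow> K \<subseteq> \<Omega> \<Longrightarrow> integrable lborel (\<lambda>x. indicator K x *\<^sub>R v i x)"
    and weak: "\<And>\<phi> i. \<phi> \<in> test_functions \<Omega> \<Longrightarrow> (LINT x|lborel. u x * partial_deriv i \<phi> x) = - (LINT x|lborel. v i x * \<phi> x)"
  shows "AE y in lborel. y \<in> segment_in \<Omega> h \<longrightarrow> u (y + h) - u y =
    (LINT s|lborel. (\<Sum>i\<in>UNIV. of_real (h $ i) * (indicator {0..1::real} s *\<^sub>R v i (y + s *\<^sub>R h))))"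
proof -
  define D where "D y = (LINT s|lborel. (\<Sum>i\<in>UNIV. of_real (h $ i) * (indicator {0..1::real} s *\<^sub>R v i (y + s *\<^sub>R h))))" for y
  have [measurable]: "D \<in> borel_measurable borel" unfolding D_def by measurable
  \<comment> \<open>The error in the asserted formula; its integrals over boxes will be shown to
    vanish.\<close>
  define E where "E y = u (y + h) - u y - D y" for y
  have [measurable]: "E \<in> borel_measurable borel" unfolding E_def by measurable
  have main: "integrable lborel (\<lambda>y. indicator (cbox a b) y *\<^sub>R E y) \<and> (LINT y|lborel. indicator (box a b) y *\<^sub>R E y) = 0"
    if box: "cbox a b \<subseteq> segment_in \<Omega> h" for a b
  proof -
    define K where "K = (\<lambda>(y, s). y + s *\<^sub>R h) ` (cbox a b \<times> {0..1})"
    have K: "compact K" unfolding K_def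
      by (intro compact_continuous_image compact_Times) (auto simp: case_prod_unfold intro!: continuous_intros)
    have Ksub: "K \<subseteq> \<Omega>" using box by (auto simp: K_def segment_in_def)
    have Km [measurable]: "K \<in> sets borel" using K by (simp add: compact_imp_closed)
    have inK: "y + s *\<^sub>R h \<in> K" if "y \<in> cbox a b" "s \<in> {0..1}" for y s
      using that by (auto simp: K_def)
    have [measurable]: "cbox a b \<in> sets borel" "box a b \<in> sets borel" by simp_all
    \<comment> \<open>Stated for a general bounded \<open>\<psi>\<close> supported in the box
      because it is used for the indicator of the closed box, to make \<open>E\<close> integrable,
      and for the bump functions, to compute its integral.\<close>
    have intu: "integrable lborel (\<lambda>y. \<psi> y * u (y + h))" "integrable lborel (\<lambda>y. \<psi> y * u y)" "integrable lborel (\<lambda>y. \<psi> y * D y)"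
      "(LINT y|lborel. \<psi> y * D y) = (\<Sum>i\<in>UNIV. of_real (h $ i) * (LINT (y, s)|(lborel \<Otimes>\<^sub>M lborel). indicator {0..1::real} s *\<^sub>R (\<psi> y * v i (y + s *\<^sub>R h))))"
      if [measurable]: "\<psi> \<in> borel_measurable borel" and \<psi>1: "\<And>x. norm (\<psi> x) \<le> 1" and \<psi>0: "\<And>x. x \<notin> cbox a b \<Longrightarrow> \<psi> x = 0" for \<psi>
    proof -
      have "integrable lborel (\<lambda>y. \<psi> (y - h) * u y)"
      proof (rule bounded_times_integrable[OF _ _ Km int(1)[OF K Ksub]])
        show "\<psi> (x - h) = 0" if "x \<notin> K" for x
          using \<psi>0[of "x - h"] inK[of "x - h" 1] that by auto
      qed (use \<psi>1 in auto)
      then show "integrable lborel (\<lambda>y. \<psi> y * u (y + h))"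
        using lborel_shift_integrable_iff[of "\<lambda>y. \<psi> (y - h) * u y" h] by simp
      show "integrable lborel (\<lambda>y. \<psi> y * u y)"
      proof (rule bounded_times_integrable[OF _ _ Km int(1)[OF K Ksub]])
        show "\<psi> x = 0" if "x \<notin> K" for x
          using \<psi>0[of x] inK[of x 0] that by auto
      qed (use \<psi>1 in auto)
      have i: "integrable (lborel \<Otimes>\<^sub>M lborel) (\<lambda>(y, s). indicator {0..1::real} s *\<^sub>R (\<psi> y * v i (y + s *\<^sub>R h)))" for i
        by (rule segment_pair_integrable(1)[OF _ _ Km int(2)[OF K Ksub] \<psi>1 \<psi>0 inK]) auto
      define g where "g x = (\<Sum>i\<in>UNIV. of_real (h $ i) * (case x of (y, s) \<Rightarrow> indicator {0..1::real} s *\<^sub>R (\<psi> y * v i (y + s *\<^sub>R h))))" for x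
      have g: "integrable (lborel \<Otimes>\<^sub>M lborel) g"
        unfolding g_def by (intro Bochner_Integration.integrable_sum integrable_mult_right i)
      have gD: "(LINT s|lborel. g (y, s)) = \<psi> y * D y" for y
      proof -
        have "(LINT s|lborel. g (y, s)) = (LINT s|lborel. \<psi> y * (\<Sum>i\<in>UNIV. of_real (h $ i) * (indicator {0..1::real} s *\<^sub>R v i (y + s *\<^sub>R h))))"
          by (intro Bochner_Integration.integral_cong) (auto simp: g_def sum_distrib_left mult_ac intro!: sum.cong split: split_indicator)
        then show ?thesis by (simp add: D_def)
      qed
      show "integrable lborel (\<lambda>y. \<psi> y * D y)"
        using lborel_pair.integrable_fst'[OF g] by (simp add: gD)
      have "(LINT y|lborel. \<psi> y * D y) = integral\<^sup>L (lborel \<Otimes>\<^sub>M lborel) g"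
        using lborel_pair.integral_fst'[OF g] by (simp add: gD)
      also have "\<dots> = (\<Sum>i\<in>UNIV. of_real (h $ i) * (LINT (y, s)|(lborel \<Otimes>\<^sub>M lborel). indicator {0..1::real} s *\<^sub>R (\<psi> y * v i (y + s *\<^sub>R h))))"
        unfolding g_def by (subst Bochner_Integration.integral_sum) (auto intro!: integrable_mult_right i)
      finally show "(LINT y|lborel. \<psi> y * D y) = (\<Sum>i\<in>UNIV. of_real (h $ i) * (LINT (y, s)|(lborel \<Otimes>\<^sub>M lborel). indicator {0..1::real} s *\<^sub>R (\<psi> y * v i (y + s *\<^sub>R h))))" .
    qed
    have intE: "integrable lborel (\<lambda>y. indicator (cbox a b) y *\<^sub>R E y)"
    proof -
      have "integrable lborel (\<lambda>y. indicator (cbox a b) y * u (y + h) - indicator (cbox a b) y * u y - indicator (cbox a b) y * D y)"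
        by (intro Bochner_Integration.integrable_diff intu) (auto simp: indicator_def)
      then show ?thesis
        by (rule Bochner_Integration.integrable_cong[THEN iffD1, rotated -1]) (auto simp: E_def split: split_indicator)
    qed
    \<comment> \<open>Moving the translation onto the bump turns the increment of \<open>u\<close>
      into the integral of \<open>(?\<phi> (y - h) - ?\<phi> y) * u y\<close>. The increment of the
      bump is an integral of its gradient over a segment, and
      \<open>pair_integral_weak_deriv\<close> transfers that gradient to \<open>v\<close>, which
      gives the integral against \<open>D\<close>.\<close>
    have zero: "(LINT y|lborel. bump k a b y * E y) = 0" for k
    proof -
      let ?\<phi> = "bump k a b"
      have \<phi>S: "?\<phi> \<in> smooth_family" by (rule bump_smooth)
      have [measurable]: "?\<phi> \<in> borel_measurable borel"
        using smooth_family_continuous[OF \<phi>S] by (auto intro: borel_measurable_continuous_onI)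
      have \<phi>0: "?\<phi> x = 0" if "x \<notin> cbox a b" for x
        using that bump_outside[of x a b k] box_subset_cbox[of a b] by blast
      note I = intu[of ?\<phi>, OF _ norm_bump_le \<phi>0]
      have pw: "(LINT (y, s)|(lborel \<Otimes>\<^sub>M lborel). indicator {0..1::real} s *\<^sub>R (partial_deriv i ?\<phi> (y - s *\<^sub>R h) * u y)) =
          - (LINT (y, s)|(lborel \<Otimes>\<^sub>M lborel). indicator {0..1::real} s *\<^sub>R (?\<phi> y * v i (y + s *\<^sub>R h)))"
        and pi: "integrable (lborel \<Otimes>\<^sub>M lborel) (\<lambda>(y, s). indicator {0..1::real} s *\<^sub>R (partial_deriv i ?\<phi> (y - s *\<^sub>R h) * u y))" for i
        using pair_integral_weak_deriv[OF um vm int(1) int(2) weak box] by blast+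
      define g where "g x = (\<Sum>i\<in>UNIV. - of_real (h $ i) * (case x of (y, s) \<Rightarrow> indicator {0..1::real} s *\<^sub>R (partial_deriv i ?\<phi> (y - s *\<^sub>R h) * u y)))" for x
      have g: "integrable (lborel \<Otimes>\<^sub>M lborel) g"
        unfolding g_def by (intro Bochner_Integration.integrable_sum integrable_mult_right pi)
      have gy: "(LINT s|lborel. g (y, s)) = (?\<phi> (y - h) - ?\<phi> y) * u y" for y
      proof -
        have "(LINT s|lborel. g (y, s)) = (LINT s|lborel. (indicator {0..1} s *\<^sub>R (\<Sum>i\<in>UNIV. - of_real (h $ i) * partial_deriv i ?\<phi> (y - s *\<^sub>R h))) * u y)"
          by (intro Bochner_Integration.integral_cong) (auto simp: g_def sum_distrib_left mult_ac split: split_indicator)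
        also have "\<dots> = (LINT s|lborel. indicator {0..1} s *\<^sub>R (\<Sum>i\<in>UNIV. - of_real (h $ i) * partial_deriv i ?\<phi> (y - s *\<^sub>R h))) * u y"
          by (rule integral_mult_left_zero)
        finally show ?thesis by (simp only: segment_integral_partial_deriv[OF \<phi>S])
      qed
      have "(LINT y|lborel. ?\<phi> y * u (y + h)) = (LINT y|lborel. ?\<phi> (y - h) * u y)"
        using lborel_shift_integral[of "\<lambda>y. ?\<phi> (y - h) * u y" h] by simp
      moreover have "integrable lborel (\<lambda>y. ?\<phi> (y - h) * u y)"
        using I(1) lborel_shift_integrable_iff[of "\<lambda>y. ?\<phi> (y - h) * u y" h] by simp
      ultimately have "(LINT y|lborel. ?\<phi> y * u (y + h)) - (LINT y|lborel. ?\<phi> y * u y) = (LINT y|lborel. (?\<phi> (y - h) - ?\<phi> y) * u y)"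
        using I(2) by (simp add: left_diff_distrib)
      also have "\<dots> = integral\<^sup>L (lborel \<Otimes>\<^sub>M lborel) g"
        using lborel_pair.integral_fst'[OF g] by (simp add: gy)
      also have "\<dots> = (\<Sum>i\<in>UNIV. - of_real (h $ i) * (LINT (y, s)|(lborel \<Otimes>\<^sub>M lborel). indicator {0..1::real} s *\<^sub>R (partial_deriv i ?\<phi> (y - s *\<^sub>R h) * u y)))"
        unfolding g_def by (subst Bochner_Integration.integral_sum) (auto intro!: integrable_mult_right pi simp del: mult_minus_left)
      also have "\<dots> = (LINT y|lborel. ?\<phi> y * D y)"
        unfolding pw using I(4) by simp
      finally show ?thesis
        using I(1-3) by (simp add: E_def right_diff_distrib)
    qed
    show ?thesis using intE box_integral_zero_of_bumps[OF _ intE zero] by simp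
  qed
  have "AE y in lborel. y \<in> segment_in \<Omega> h \<longrightarrow> E y = 0"
  proof (rule AE_open_of_AE_boxes[OF open_segment_in[OF \<Omega>]])
    fix a b assume ab: "cbox a b \<subseteq> segment_in \<Omega> h"
    show "AE y in lborel. y \<in> cbox a b \<longrightarrow> E y = 0"
      by (rule AE_zero_if_box_integrals_zero) (use main ab in auto)
  qed
  then show ?thesis by (rule eventually_mono) (auto simp: E_def D_def)
qed

text \<open>Norms are taken under the integral of the segment formula, and every component of
  \<open>h\<close> is bounded by \<open>norm h\<close>.\<close>

lemma weak_deriv_increment_bound:
  fixes u :: "real^'n \<Rightarrow> complex" and v :: "'n \<Rightarrow> real^'n \<Rightarrow> complex"
  assumes um [measurable]: "u \<in> borel_measurable borel" and vm [measurable]: "\<And>i. v i \<in> borel_measurable borel"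
    and \<Omega>: "open \<Omega>"
    and int: "\<And>K. compact K \<Longrightarrow> K \<subseteq> \<Omega> \<Longrightarrow> integrable lborel (\<lambda>x. indicator K x *\<^sub>R u x)"
             "\<And>K i. compact K \<Longrightarrow> K \<subseteq> \<Omega> \<Longrightarrow> integrable lborel (\<lambda>x. indicator K x *\<^sub>R v i x)"
    and weak: "\<And>\<phi> i. \<phi> \<in> test_functions \<Omega> \<Longrightarrow> (LINT x|lborel. u x * partial_deriv i \<phi> x) = - (LINT x|lborel. v i x * \<phi> x)"
  shows "AE y in lborel. y \<in> segment_in \<Omega> h \<longrightarrow> ennreal (norm (u (y + h) - u y)) \<le>
    ennreal (norm h) * (\<integral>\<^sup>+s. indicator {0..1} s * ennreal (\<Sum>i\<in>UNIV. norm (v i (y + s *\<^sub>R h))) \<partial>lborel)"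
proof -
  have "AE y in lborel. y \<in> segment_in \<Omega> h \<longrightarrow> u (y + h) - u y =
    (LINT s|lborel. (\<Sum>i\<in>UNIV. of_real (h $ i) * (indicator {0..1::real} s *\<^sub>R v i (y + s *\<^sub>R h))))"
    by (rule weak_deriv_segment_formula[OF um vm \<Omega>]) (fact int weak)+
  then show ?thesis
proof (rule eventually_mono, intro impI)
  fix y
  define G where "G s = (\<Sum>i\<in>UNIV. of_real (h $ i) * (indicator {0..1::real} s *\<^sub>R v i (y + s *\<^sub>R h)))" for s
  assume "y \<in> segment_in \<Omega> h \<longrightarrow> u (y + h) - u y =
    (LINT s|lborel. (\<Sum>i\<in>UNIV. of_real (h $ i) * (indicator {0..1::real} s *\<^sub>R v i (y + s *\<^sub>R h))))"
    and "y \<in> segment_in \<Omega> h"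
  then have "u (y + h) - u y = (LINT s|lborel. G s)" by (simp add: G_def)
  also have "ennreal (norm \<dots>) \<le> (\<integral>\<^sup>+s. ennreal (norm (G s)) \<partial>lborel)"
  proof (cases "integrable lborel G")
    case True
    then show ?thesis by (rule integral_norm_bound_ennreal)
  next
    case False
    \<comment> \<open>The Bochner integral of a non-integrable function is 0 by convention, so the
      inequality is trivial here.\<close>
    then show ?thesis by (simp add: not_integrable_integral_eq)
  qed
  also have "\<dots> \<le> (\<integral>\<^sup>+s. ennreal (norm h) * (indicator {0..1} s * ennreal (\<Sum>i\<in>UNIV. norm (v i (y + s *\<^sub>R h)))) \<partial>lborel)"
  proof (intro nn_integral_mono)
    fix s :: real
    have "norm (G s) \<le> (\<Sum>i\<in>UNIV. norm (of_real (h $ i) * (indicator {0..1::real} s *\<^sub>R v i (y + s *\<^sub>R h))))"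
      unfolding G_def by (rule norm_sum)
    also have "\<dots> \<le> (\<Sum>i\<in>UNIV. norm h * (indicator {0..1::real} s * norm (v i (y + s *\<^sub>R h))))"
    proof (intro sum_mono)
      fix i
      have "\<bar>h $ i\<bar> * (indicator {0..1} s * norm (v i (y + s *\<^sub>R h))) \<le> norm h * (indicator {0..1} s * norm (v i (y + s *\<^sub>R h)))"
        by (intro mult_right_mono component_le_norm_cart) auto
      then show "norm (of_real (h $ i) * (indicator {0..1::real} s *\<^sub>R v i (y + s *\<^sub>R h))) \<le> norm h * (indicator {0..1::real} s * norm (v i (y + s *\<^sub>R h)))"
        by (auto simp: norm_mult split: split_indicator)
    qed
    also have "\<dots> = norm h * (indicator {0..1} s * (\<Sum>i\<in>UNIV. norm (v i (y + s *\<^sub>R h))))"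
      by (simp add: sum_distrib_left)
    finally have "ennreal (norm (G s)) \<le> ennreal (norm h * (indicator {0..1} s * (\<Sum>i\<in>UNIV. norm (v i (y + s *\<^sub>R h)))))"
      by (rule ennreal_leI)
    also have "\<dots> = ennreal (norm h) * (indicator {0..1} s * ennreal (\<Sum>i\<in>UNIV. norm (v i (y + s *\<^sub>R h))))"
      by (auto simp: ennreal_mult sum_nonneg split: split_indicator)
    finally show "ennreal (norm (G s)) \<le> ennreal (norm h) * (indicator {0..1} s * ennreal (\<Sum>i\<in>UNIV. norm (v i (y + s *\<^sub>R h))))" .
  qed
  also have "\<dots> = ennreal (norm h) * (\<integral>\<^sup>+s. indicator {0..1} s * ennreal (\<Sum>i\<in>UNIV. norm (v i (y + s *\<^sub>R h))) \<partial>lborel)"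
    by (rule nn_integral_cmult) measurable
  finally show "ennreal (norm (u (y + h) - u y)) \<le>
    ennreal (norm h) * (\<integral>\<^sup>+s. indicator {0..1} s * ennreal (\<Sum>i\<in>UNIV. norm (v i (y + s *\<^sub>R h))) \<partial>lborel)" .
qed
qed

subsection \<open>Total boundedness under translations\<close>

text \<open>Turns a finite set of codes into a finite net: one element of \<open>W\<close> is kept
  for each code.\<close>

lemma finite_image_representatives:
  assumes "finite (g ` W)"
  obtains F where "F \<subseteq> W" "finite F" "\<And>w. w \<in> W \<Longrightarrow> \<exists>f\<in>F. g w = g f"
proof
  define F where "F = inv_into W g ` (g ` W)"
  show "F \<subseteq> W" unfolding F_def by (auto intro: inv_into_into)
  show "finite F" unfolding F_def using assms by (rule finite_imageI)
  fix w assume w: "w \<in> W"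
  then have "g w = g (inv_into W g (g w))" by (simp add: f_inv_into_f)
  then show "\<exists>f\<in>F. g w = g f" unfolding F_def using w by blast
qed

lemma powr_add3_le:
  fixes x y z p :: real
  assumes "0 \<le> x" "0 \<le> y" "0 \<le> z" "1 \<le> p"
  shows "(x + y + z) powr p \<le> 4 powr p * (x powr p + y powr p + z powr p)"
proof -
  have "x + y + z \<le> 3 * max x (max y z)" by linarith
  also have "\<dots> \<le> 4 * max x (max y z)" using assms by (intro mult_right_mono) auto
  finally have "(x + y + z) powr p \<le> (4 * max x (max y z)) powr p"
    using assms by (intro powr_mono2) auto
  also have "\<dots> = 4 powr p * max x (max y z) powr p" using assms by (simp add: powr_mult)
  also have "max x (max y z) powr p \<le> x powr p + y powr p + z powr p"
    by (auto simp: max_def)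
  finally show ?thesis by simp
qed

definition ball_average :: "real \<Rightarrow> ('a::euclidean_space \<Rightarrow> complex) \<Rightarrow> 'a \<Rightarrow> complex" where
  "ball_average \<delta> w x = (LINT h|lborel. indicator (ball 0 \<delta>) h *\<^sub>R w (x + h)) /\<^sub>R measure lborel (ball (0::'a) \<delta>)"

lemma ball_average_measurable [measurable]:
  assumes [measurable]: "w \<in> borel_measurable borel"
  shows "ball_average \<delta> w \<in> borel_measurable borel"
proof -
  have [measurable]: "ball (0::'a) \<delta> \<in> sets borel" by simp
  show ?thesis unfolding ball_average_def by measurable
qed

lemma ball_average_integrable:
  fixes w :: "'a::euclidean_space \<Rightarrow> complex"
  assumes [measurable]: "w \<in> borel_measurable borel" and p: "1 \<le> p"
    and fin: "(\<integral>\<^sup>+x. ennreal (norm (w x) powr p) \<partial>lborel) < \<infinity>"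
  shows "integrable lborel (\<lambda>h. indicator (ball 0 \<delta>) h *\<^sub>R w (x + h))"
proof (rule integrableI_bounded)
  have [measurable]: "ball (0::'a) \<delta> \<in> sets borel" by simp
  show "(\<lambda>h. indicator (ball 0 \<delta>) h *\<^sub>R w (x + h)) \<in> borel_measurable lborel" by measurable
  have "(\<integral>\<^sup>+h. ennreal (norm (indicator (ball 0 \<delta>) h *\<^sub>R w (x + h))) \<partial>lborel) \<le>
     (\<integral>\<^sup>+h. indicator (ball 0 \<delta>) h + ennreal (norm (w (h + x)) powr p) \<partial>lborel)"
  proof (intro nn_integral_mono)
    fix h
    have "norm (w (h + x)) \<le> 1 + 1 * norm (w (h + x)) powr p"
      using le_add_powr[of "norm (w (h + x))" 1 p] p by simp
    then have "ennreal (norm (w (h + x))) \<le> 1 + ennreal (norm (w (h + x)) powr p)"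
      by (metis ennreal_1 ennreal_leI ennreal_plus mult_1 powr_ge_zero zero_le_one)
    then show "ennreal (norm (indicator (ball 0 \<delta>) h *\<^sub>R w (x + h))) \<le> indicator (ball 0 \<delta>) h + ennreal (norm (w (h + x)) powr p)"
      by (simp add: add.commute split: split_indicator)
  qed
  also have "\<dots> = emeasure lborel (ball (0::'a) \<delta>) + (\<integral>\<^sup>+h. ennreal (norm (w (h + x)) powr p) \<partial>lborel)"
    by (simp add: nn_integral_add)
  also have "(\<integral>\<^sup>+h. ennreal (norm (w (h + x)) powr p) \<partial>lborel) = (\<integral>\<^sup>+h. ennreal (norm (w h) powr p) \<partial>lborel)"
    by (rule nn_integral_lborel_shift[of "\<lambda>h. ennreal (norm (w h) powr p)"]) measurable
  also have "emeasure lborel (ball (0::'a) \<delta>) + \<dots> < \<infinity>"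
    using fin emeasure_lborel_ball_finite[of "0::'a" \<delta>] by simp
  finally show "(\<integral>\<^sup>+h. ennreal (norm (indicator (ball 0 \<delta>) h *\<^sub>R w (x + h))) \<partial>lborel) < \<infinity>" .
qed

text \<open>The Jensen substitute on a ball of mass \<open>\<kappa>\<close>: its factor
  \<open>\<kappa> powr (p - 1)\<close> and the normalisation \<open>\<kappa> powr p\<close> of the
  average leave \<open>1 / \<kappa>\<close>.\<close>

lemma norm_ball_integral_powr_le:
  fixes G :: "'a::euclidean_space \<Rightarrow> complex"
  assumes [measurable]: "G \<in> borel_measurable borel" and p: "1 \<le> p" and \<delta>: "0 < \<delta>"
    and int: "integrable lborel (\<lambda>h. indicator (ball 0 \<delta>) h *\<^sub>R G h)"
  defines "\<kappa> \<equiv> measure lborel (ball (0::'a) \<delta>)"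
  shows "ennreal (norm ((LINT h|lborel. indicator (ball 0 \<delta>) h *\<^sub>R G h) /\<^sub>R \<kappa>) powr p) \<le>
    ennreal (2 powr p / \<kappa>) * (\<integral>\<^sup>+h. indicator (ball 0 \<delta>) h * ennreal (norm (G h) powr p) \<partial>lborel)"
proof -
  have [measurable]: "ball (0::'a) \<delta> \<in> sets borel" by simp
  have \<kappa>: "0 < \<kappa>" using content_ball_pos[OF \<delta>, of "0::'a"] by (simp add: \<kappa>_def)
  let ?M = "density lborel (indicator (ball (0::'a) \<delta>))"
  define A where "A = norm (LINT h|lborel. indicator (ball 0 \<delta>) h *\<^sub>R G h)"
  have "ennreal (A powr p) \<le> ennreal (2 powr p * \<kappa> powr (p - 1)) * (\<integral>\<^sup>+h. ennreal (norm (G h) powr p) \<partial>?M)"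
  proof (rule powr_le_nn_integral)
    have "emeasure ?M (space ?M) = emeasure lborel (ball (0::'a) \<delta>)"
      by (simp add: emeasure_density)
    also have "\<dots> = ennreal \<kappa>"
      unfolding \<kappa>_def using emeasure_lborel_ball_finite[of "0::'a" \<delta>] by (intro emeasure_eq_ennreal_measure) auto
    finally show "emeasure ?M (space ?M) \<le> ennreal \<kappa>" by simp
    have "ennreal A \<le> (\<integral>\<^sup>+h. ennreal (norm (indicator (ball 0 \<delta>) h *\<^sub>R G h)) \<partial>lborel)"
      unfolding A_def by (rule integral_norm_bound_ennreal[OF int])
    also have "\<dots> = (\<integral>\<^sup>+h. ennreal (norm (G h)) \<partial>?M)"
      by (subst nn_integral_density) (auto intro!: nn_integral_cong split: split_indicator)
    finally show "ennreal A \<le> (\<integral>\<^sup>+h. ennreal (norm (G h)) \<partial>?M)" .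
  qed (use \<kappa> p in \<open>auto simp: A_def\<close>)
  also have "(\<integral>\<^sup>+h. ennreal (norm (G h) powr p) \<partial>?M) = (\<integral>\<^sup>+h. indicator (ball 0 \<delta>) h * ennreal (norm (G h) powr p) \<partial>lborel)"
    by (subst nn_integral_density) auto
  finally have "ennreal (1 / \<kappa> powr p) * ennreal (A powr p) \<le> ennreal (1 / \<kappa> powr p) *
    (ennreal (2 powr p * \<kappa> powr (p - 1)) * (\<integral>\<^sup>+h. indicator (ball 0 \<delta>) h * ennreal (norm (G h) powr p) \<partial>lborel))"
    by (rule mult_left_mono) simp
  moreover have "norm ((LINT h|lborel. indicator (ball 0 \<delta>) h *\<^sub>R G h) /\<^sub>R \<kappa>) powr p = 1 / \<kappa> powr p * A powr p"
    using \<kappa> by (simp add: A_def powr_divide divide_inverse_commute[symmetric])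
  moreover have "1 / \<kappa> powr p * (2 powr p * \<kappa> powr (p - 1)) = 2 powr p / \<kappa>"
    using \<kappa> by (simp add: powr_diff)
  ultimately show ?thesis
    using \<kappa> by (simp add: mult.assoc[symmetric] flip: ennreal_mult)
qed

text \<open>The three properties that make averages useful for compactness: they are close to
  \<open>w\<close> when translations move it little, their oscillation is controlled pointwise by
  translations of \<open>w\<close>, and they are bounded pointwise by the \<open>L^p\<close>
  norm.\<close>

lemma ball_average_diff_powr_le:
  fixes w :: "'a::euclidean_space \<Rightarrow> complex"
  assumes wm [measurable]: "w \<in> borel_measurable borel" and p: "1 \<le> p" and \<delta>: "0 < \<delta>"
    and fin: "(\<integral>\<^sup>+x. ennreal (norm (w x) powr p) \<partial>lborel) < \<infinity>"
  defines "\<kappa> \<equiv> measure lborel (ball (0::'a) \<delta>)"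
  shows "ennreal (norm (w x - ball_average \<delta> w x) powr p) \<le>
      ennreal (2 powr p / \<kappa>) * (\<integral>\<^sup>+h. indicator (ball 0 \<delta>) h * ennreal (norm (w (x + h) - w x) powr p) \<partial>lborel)" (is ?A)
    and "ennreal (norm (ball_average \<delta> w x - ball_average \<delta> w x') powr p) \<le>
      ennreal (2 powr p / \<kappa>) * (\<integral>\<^sup>+y. ennreal (norm (w (y + (x - x')) - w y) powr p) \<partial>lborel)" (is ?B)
    and "ennreal (norm (ball_average \<delta> w x) powr p) \<le>
      ennreal (2 powr p / \<kappa>) * (\<integral>\<^sup>+y. ennreal (norm (w y) powr p) \<partial>lborel)" (is ?C)
proof -
  have \<kappa>: "0 < \<kappa>" using content_ball_pos[OF \<delta>, of "0::'a"] by (simp add: \<kappa>_def)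
  note int = ball_average_integrable[OF wm p fin, of \<delta>]
  have one: "integrable lborel (\<lambda>h. indicator (ball (0::'a) \<delta>) h *\<^sub>R w x)"
    using emeasure_lborel_ball_finite[of "0::'a" \<delta>] by (intro integrable_scaleR_left) (auto simp: integrable_indicator_iff)
  have cst: "(LINT h|lborel. indicator (ball (0::'a) \<delta>) h *\<^sub>R w x) = \<kappa> *\<^sub>R w x"
    using emeasure_lborel_ball_finite[of "0::'a" \<delta>] by (simp add: \<kappa>_def integrable_indicator_iff)
  have "ball_average \<delta> w x - w x = (LINT h|lborel. indicator (ball 0 \<delta>) h *\<^sub>R (w (x + h) - w x)) /\<^sub>R \<kappa>"
    using \<kappa> int[of x] one by (simp add: scaleR_diff_right cst ball_average_def \<kappa>_def[symmetric])
  then show ?A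
    using norm_ball_integral_powr_le[of "\<lambda>h. w (x + h) - w x" p \<delta>] p \<delta> int[of x] one
    by (simp add: norm_minus_commute[of "w x"] scaleR_diff_right \<kappa>_def)
  have "ball_average \<delta> w x - ball_average \<delta> w x' = (LINT h|lborel. indicator (ball 0 \<delta>) h *\<^sub>R (w (x + h) - w (x' + h))) /\<^sub>R \<kappa>"
    using \<kappa> int[of x] int[of x'] by (simp add: scaleR_diff_right ball_average_def \<kappa>_def[symmetric])
  then have "ennreal (norm (ball_average \<delta> w x - ball_average \<delta> w x') powr p) \<le>
    ennreal (2 powr p / \<kappa>) * (\<integral>\<^sup>+h. indicator (ball 0 \<delta>) h * ennreal (norm (w (x + h) - w (x' + h)) powr p) \<partial>lborel)"
    using norm_ball_integral_powr_le[of "\<lambda>h. w (x + h) - w (x' + h)" p \<delta>] p \<delta> int[of x] int[of x']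
    by (simp add: scaleR_diff_right \<kappa>_def)
  also have "\<dots> \<le> ennreal (2 powr p / \<kappa>) * (\<integral>\<^sup>+y. ennreal (norm (w ((y + x') + (x - x')) - w (y + x')) powr p) \<partial>lborel)"
    by (intro mult_left_mono nn_integral_mono) (auto simp: algebra_simps split: split_indicator)
  also have "(\<integral>\<^sup>+y. ennreal (norm (w ((y + x') + (x - x')) - w (y + x')) powr p) \<partial>lborel) =
    (\<integral>\<^sup>+y. ennreal (norm (w (y + (x - x')) - w y) powr p) \<partial>lborel)"
    by (rule nn_integral_lborel_shift[of "\<lambda>y. ennreal (norm (w (y + (x - x')) - w y) powr p)"]) measurable
  finally show ?B .
  have "ennreal (norm (ball_average \<delta> w x) powr p) \<le>
    ennreal (2 powr p / \<kappa>) * (\<integral>\<^sup>+h. indicator (ball 0 \<delta>) h * ennreal (norm (w (x + h)) powr p) \<partial>lborel)"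
    unfolding ball_average_def \<kappa>_def by (rule norm_ball_integral_powr_le) (use p \<delta> int in auto)
  also have "\<dots> \<le> ennreal (2 powr p / \<kappa>) * (\<integral>\<^sup>+h. ennreal (norm (w (h + x)) powr p) \<partial>lborel)"
    by (intro mult_left_mono nn_integral_mono) (auto simp: add.commute split: split_indicator)
  also have "(\<integral>\<^sup>+h. ennreal (norm (w (h + x)) powr p) \<partial>lborel) = (\<integral>\<^sup>+h. ennreal (norm (w h) powr p) \<partial>lborel)"
    by (rule nn_integral_lborel_shift[of "\<lambda>h. ennreal (norm (w h) powr p)"]) measurable
  finally show ?C .
qed

text \<open>The Frechet--Kolmogorov criterion: averages over small balls are equicontinuous, so finitely
  many of their values, taken up to \<open>\<eta>\<close>, determine a function up to a small error.\<close>

lemma translation_totally_bounded: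
  fixes W :: "('a::euclidean_space \<Rightarrow> complex) set"
  assumes p: "1 \<le> p" and Q: "compact Q" and C: "0 \<le> C"
    and W: "\<And>w. w \<in> W \<Longrightarrow> w \<in> borel_measurable borel" "\<And>w x. w \<in> W \<Longrightarrow> x \<notin> Q \<Longrightarrow> w x = 0"
    and bound: "\<And>w. w \<in> W \<Longrightarrow> (\<integral>\<^sup>+x. ennreal (norm (w x) powr p) \<partial>lborel) \<le> ennreal C"
    and equi: "\<And>e. 0 < e \<Longrightarrow> \<exists>\<delta>>0. \<forall>w\<in>W. \<forall>h. norm h < \<delta> \<longrightarrow>
        (\<integral>\<^sup>+y. ennreal (norm (w (y + h) - w y) powr p) \<partial>lborel) \<le> ennreal e"
    and e: "0 < e"
  shows "\<exists>F\<subseteq>W. finite F \<and> (\<forall>w\<in>W. \<exists>f\<in>F. (\<integral>\<^sup>+x. ennreal (norm (w x - f x) powr p) \<partial>lborel) \<le> ennreal e)"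
proof -
  have Qm [measurable]: "Q \<in> sets borel" using Q by (simp add: compact_imp_closed)
  define q where "q = measure lborel Q"
  have q: "emeasure lborel Q = ennreal q" "0 \<le> q"
    using emeasure_compact_finite[OF Q] by (auto simp: q_def emeasure_eq_ennreal_measure)
  \<comment> \<open>The two errors made by passing to averages contribute
    \<open>2 * 4 powr p * 2 powr p * e1\<close>, that is \<open>e / 2\<close>; the comparison of the
    averages takes the other half.\<close>
  define e1 where "e1 = e / (4 * 4 powr p * 2 powr p)"
  have e1: "0 < e1" using e by (simp add: e1_def)
  obtain \<delta> where \<delta>: "0 < \<delta>" and \<delta>': "\<And>w h. w \<in> W \<Longrightarrow> norm h < \<delta> \<Longrightarrow>
      (\<integral>\<^sup>+y. ennreal (norm (w (y + h) - w y) powr p) \<partial>lborel) \<le> ennreal e1"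
    using equi[OF e1] by blast
  define \<kappa> where "\<kappa> = measure lborel (ball (0::'a) \<delta>)"
  have \<kappa>: "0 < \<kappa>" using content_ball_pos[OF \<delta>, of "0::'a"] by (simp add: \<kappa>_def)
  have \<kappa>e: "emeasure lborel (ball (0::'a) \<delta>) = ennreal \<kappa>"
    unfolding \<kappa>_def using emeasure_lborel_ball_finite[of "0::'a" \<delta>] by (intro emeasure_eq_ennreal_measure) auto
  define A :: "('a \<Rightarrow> complex) \<Rightarrow> 'a \<Rightarrow> complex" where "A = ball_average \<delta>"
  have fin: "(\<integral>\<^sup>+x. ennreal (norm (w x) powr p) \<partial>lborel) < \<infinity>" if "w \<in> W" for w
    using bound[OF that] by (rule order.strict_trans1) simp
  note Ad = ball_average_diff_powr_le[OF W(1) p \<delta> fin, folded \<kappa>_def A_def]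
  have approx: "(\<integral>\<^sup>+x. ennreal (norm (w x - A w x) powr p) \<partial>lborel) \<le> ennreal (2 powr p * e1)" if w: "w \<in> W" for w
  proof -
    have [measurable]: "w \<in> borel_measurable borel" using W(1)[OF w] .
    have [measurable]: "ball (0::'a) \<delta> \<in> sets borel" by simp
    have "(\<integral>\<^sup>+x. ennreal (norm (w x - A w x) powr p) \<partial>lborel) \<le>
      (\<integral>\<^sup>+x. ennreal (2 powr p / \<kappa>) * (\<integral>\<^sup>+h. indicator (ball 0 \<delta>) h * ennreal (norm (w (x + h) - w x) powr p) \<partial>lborel) \<partial>lborel)"
      by (intro nn_integral_mono Ad(1) w)
    also have "\<dots> = ennreal (2 powr p / \<kappa>) * (\<integral>\<^sup>+x. \<integral>\<^sup>+h. indicator (ball 0 \<delta>) h * ennreal (norm (w (x + h) - w x) powr p) \<partial>lborel \<partial>lborel)"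
      by (rule nn_integral_cmult) measurable
    also have "(\<integral>\<^sup>+x. \<integral>\<^sup>+h. indicator (ball 0 \<delta>) h * ennreal (norm (w (x + h) - w x) powr p) \<partial>lborel \<partial>lborel) =
      (\<integral>\<^sup>+h. \<integral>\<^sup>+x. indicator (ball 0 \<delta>) h * ennreal (norm (w (x + h) - w x) powr p) \<partial>lborel \<partial>lborel)"
      by (rule lborel_pair.Fubini') measurable
    also have "\<dots> \<le> (\<integral>\<^sup>+h. ennreal e1 * indicator (ball (0::'a) \<delta>) h \<partial>lborel)"
      using \<delta>'[OF w] by (intro nn_integral_mono) (auto simp: nn_integral_cmult split: split_indicator)
    also have "\<dots> = ennreal (e1 * \<kappa>)"
      using e1 \<kappa> by (simp add: nn_integral_cmult_indicator \<kappa>e ennreal_mult)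
    finally show ?thesis
      using \<kappa> e1 by (simp add: mult_left_mono mult.assoc flip: ennreal_mult)
  qed
  \<comment> \<open>On \<open>Q\<close> the averages of two functions with the same code differ by
    at most \<open>4 * \<eta>\<close>; the value of \<open>\<eta>\<close> makes this contribute at
    most \<open>e / 2\<close>. The summand 1 in \<open>q + 1\<close> covers a null set
    \<open>Q\<close>.\<close>
  define \<eta> where "\<eta> = (e / (2 * 4 powr p * (q + 1))) powr (1 / p) / 4"
  have \<eta>: "0 < \<eta>" using e q by (simp add: \<eta>_def)
  have \<eta>p: "(4 * \<eta>) powr p * q \<le> e / (2 * 4 powr p)"
  proof -
    have "(4 * \<eta>) powr p = e / (2 * 4 powr p * (q + 1))" using e q p by (simp add: \<eta>_def powr_powr)
    also have "\<dots> * q \<le> e / (2 * 4 powr p)" using e q by (simp add: divide_simps)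
    finally show ?thesis by simp
  qed
  \<comment> \<open>Cancels the factor \<open>2 powr p / \<kappa>\<close> in the oscillation bound,
    so that averages vary by at most \<open>\<eta>\<close> over distances below
    \<open>\<delta>2\<close>.\<close>
  define e3 where "e3 = \<eta> powr p * \<kappa> / 2 powr p"
  have e3: "0 < e3" using \<eta> \<kappa> by (simp add: e3_def)
  obtain \<delta>2 where \<delta>2: "0 < \<delta>2" and \<delta>2': "\<And>w h. w \<in> W \<Longrightarrow> norm h < \<delta>2 \<Longrightarrow>
      (\<integral>\<^sup>+y. ennreal (norm (w (y + h) - w y) powr p) \<partial>lborel) \<le> ennreal e3"
    using equi[OF e3] by blast
  have close: "norm (A w x - A w x') \<le> \<eta>" if w: "w \<in> W" and x: "dist x x' < \<delta>2" for w x x'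
  proof -
    have "ennreal (norm (A w x - A w x') powr p) \<le> ennreal (2 powr p / \<kappa>) * ennreal e3"
    proof (rule order_trans[OF Ad(2)[OF w w]], rule mult_left_mono)
      show "(\<integral>\<^sup>+y. ennreal (norm (w (y + (x - x')) - w y) powr p) \<partial>lborel) \<le> ennreal e3"
        using x by (intro \<delta>2'[OF w]) (simp add: dist_norm)
    qed simp
    also have "\<dots> = ennreal (\<eta> powr p)" using \<kappa> by (simp add: e3_def flip: ennreal_mult)
    finally have le: "norm (A w x - A w x') powr p \<le> \<eta> powr p" by simp
    have "norm (A w x - A w x') = (norm (A w x - A w x') powr p) powr (1 / p)"
      using p by (simp add: powr_powr)
    also have "\<dots> \<le> (\<eta> powr p) powr (1 / p)" using p by (intro powr_mono2 le) auto
    also have "\<dots> = \<eta>" using p \<eta> by (simp add: powr_powr)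
    finally show ?thesis .
  qed
  define Mb where "Mb = (2 powr p / \<kappa> * C) powr (1 / p)"
  have bdd: "norm (A w x) \<le> Mb" if w: "w \<in> W" for w x
  proof -
    have "ennreal (norm (A w x) powr p) \<le> ennreal (2 powr p / \<kappa>) * ennreal C"
      by (rule order_trans[OF Ad(3)[OF w w]], rule mult_left_mono[OF bound[OF w]]) simp
    also have "\<dots> = ennreal (2 powr p / \<kappa> * C)" using \<kappa> C by (simp flip: ennreal_mult)
    finally have "norm (A w x) powr p \<le> 2 powr p / \<kappa> * C"
      using \<kappa> C by (subst (asm) ennreal_le_iff) auto
    then have "(norm (A w x) powr p) powr (1 / p) \<le> Mb" unfolding Mb_def using p by (intro powr_mono2) auto
    moreover have "(norm (A w x) powr p) powr (1 / p) = norm (A w x)" using p by (simp add: powr_powr)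
    ultimately show ?thesis by simp
  qed
  obtain X where X: "finite X" "X \<subseteq> Q" "Q \<subseteq> (\<Union>x\<in>X. ball x \<delta>2)"
  proof -
    have "Q \<subseteq> (\<Union>x\<in>Q. ball x \<delta>2)" using \<delta>2 by auto
    then show ?thesis using compactE_image[OF Q, of Q "\<lambda>x. ball x \<delta>2"] that by (metis open_ball)
  qed
  \<comment> \<open>The code of \<open>w\<close>: the cells of side \<open>\<eta>\<close> containing
    the real and imaginary parts of its average at the finitely many points of \<open>X\<close>.
    Boundedness of the averages leaves finitely many codes.\<close>
  define g where "g w = restrict (\<lambda>x. (\<lfloor>Re (A w x) / \<eta>\<rfloor>, \<lfloor>Im (A w x) / \<eta>\<rfloor>)) X" for w
  have "finite (g ` W)"
  proof (rule finite_subset)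
    define L where "L = \<lceil>Mb / \<eta>\<rceil> + 1"
    have fl: "\<lfloor>r / \<eta>\<rfloor> \<in> {- L..L}" if "\<bar>r\<bar> \<le> Mb" for r
    proof -
      have "r / \<eta> \<le> Mb / \<eta>" "- (Mb / \<eta>) \<le> r / \<eta>"
        using that \<eta> by (auto simp: divide_right_mono minus_divide_left simp del: minus_divide_left[symmetric])
      then show ?thesis unfolding L_def by simp linarith
    qed
    show "g ` W \<subseteq> (\<Pi>\<^sub>E x\<in>X. {- L..L} \<times> {- L..L})"
    proof (clarify, intro PiE_I)
      fix w x assume w: "w \<in> W" and x: "x \<in> X"
      have "\<bar>Re (A w x)\<bar> \<le> Mb" "\<bar>Im (A w x)\<bar> \<le> Mb"
        using abs_Re_le_cmod[of "A w x"] abs_Im_le_cmod[of "A w x"] bdd[OF w, of x] by linarith+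
      then show "g w x \<in> {- L..L} \<times> {- L..L}" using x fl unfolding g_def by (simp only: restrict_apply if_True SigmaI)
    qed (auto simp: g_def)
    show "finite (\<Pi>\<^sub>E x\<in>X. {- L..L} \<times> {- L..L})" using X by (intro finite_PiE) auto
  qed
  then obtain F where F: "F \<subseteq> W" "finite F" "\<And>w. w \<in> W \<Longrightarrow> \<exists>f\<in>F. g w = g f"
    by (rule finite_image_representatives) (rule that)
  show ?thesis
  proof (intro exI[of _ F] conjI ballI F(1,2))
    fix w assume w: "w \<in> W"
    then obtain f where f: "f \<in> F" "g w = g f" using F by blast
    then have fW: "f \<in> W" using F by blast
    have [measurable]: "w \<in> borel_measurable borel" "f \<in> borel_measurable borel" using W(1) w fW by auto
    have [measurable]: "A w \<in> borel_measurable borel" "A f \<in> borel_measurable borel" unfolding A_def by measurable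
    have onX: "norm (A w x - A f x) \<le> 2 * \<eta>" if x: "x \<in> X" for x
    proof -
      have "g w x = g f x" using f by simp
      then have eq: "\<lfloor>Re (A w x) / \<eta>\<rfloor> = \<lfloor>Re (A f x) / \<eta>\<rfloor>" "\<lfloor>Im (A w x) / \<eta>\<rfloor> = \<lfloor>Im (A f x) / \<eta>\<rfloor>"
        using x by (auto simp: g_def)
      have *: "\<bar>r - s\<bar> \<le> \<eta>" if "\<lfloor>r / \<eta>\<rfloor> = \<lfloor>s / \<eta>\<rfloor>" for r s :: real
      proof -
        have "\<bar>r / \<eta> - s / \<eta>\<bar> \<le> 1" using that by linarith
        then have "\<bar>(r - s) / \<eta>\<bar> \<le> 1" by (simp add: diff_divide_distrib)
        then show ?thesis using \<eta> by (simp add: abs_divide)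
      qed
      show ?thesis using *[OF eq(1)] *[OF eq(2)] cmod_le[of "A w x - A f x"] by simp
    qed
    have onQ: "norm (A w x - A f x) \<le> 4 * \<eta>" if x: "x \<in> Q" for x
    proof -
      obtain x' where x': "x' \<in> X" "dist x x' < \<delta>2" using X(3) x by (auto simp: dist_commute)
      have "A w x - A f x = (A w x - A w x') + (A w x' - A f x') + - (A f x - A f x')" by simp
      also have "norm \<dots> \<le> norm (A w x - A w x') + norm (A w x' - A f x') + norm (A f x - A f x')"
        by (intro order_trans[OF norm_triangle_ineq] add_mono) (auto simp: norm_triangle_ineq norm_minus_commute)
      \<comment> \<open>Equal codes allow a difference of \<open>\<eta>\<close> in each of the two
        parts at \<open>x'\<close>, and moving from \<open>x\<close> to \<open>x'\<close> costs
        \<open>\<eta>\<close> for either function.\<close>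
      also have "\<dots> \<le> \<eta> + 2 * \<eta> + \<eta>" using close[OF w x'(2)] close[OF fW x'(2)] onX[OF x'(1)] by linarith
      finally show ?thesis by simp
    qed
    have "(\<integral>\<^sup>+x. ennreal (norm (w x - f x) powr p) \<partial>lborel) \<le>
      (\<integral>\<^sup>+x. ennreal (4 powr p) * (ennreal (norm (w x - A w x) powr p) + ennreal ((4 * \<eta>) powr p) * indicator Q x + ennreal (norm (f x - A f x) powr p)) \<partial>lborel)"
    proof (intro nn_integral_mono)
      fix x
      show "ennreal (norm (w x - f x) powr p) \<le> ennreal (4 powr p) * (ennreal (norm (w x - A w x) powr p) + ennreal ((4 * \<eta>) powr p) * indicator Q x + ennreal (norm (f x - A f x) powr p))"
      proof (cases "x \<in> Q")
        case False
        then have "w x = 0" "f x = 0" using W(2) w fW by auto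
        then show ?thesis by simp
      next
        case True
        have "w x - f x = (w x - A w x) + (A w x - A f x) + - (f x - A f x)" by simp
        also have "norm \<dots> \<le> norm (w x - A w x) + norm (A w x - A f x) + norm (f x - A f x)"
          by (intro order_trans[OF norm_triangle_ineq] add_mono) (auto simp: norm_triangle_ineq norm_minus_commute)
        also have "\<dots> \<le> norm (w x - A w x) + 4 * \<eta> + norm (f x - A f x)" using onQ[OF True] by simp
        finally have "norm (w x - f x) powr p \<le> (norm (w x - A w x) + 4 * \<eta> + norm (f x - A f x)) powr p"
          using p by (intro powr_mono2) auto
        also have "\<dots> \<le> 4 powr p * (norm (w x - A w x) powr p + (4 * \<eta>) powr p + norm (f x - A f x) powr p)"
          using p \<eta> by (intro powr_add3_le) auto
        finally have "ennreal (norm (w x - f x) powr p) \<le> ennreal \<dots>" by (rule ennreal_leI)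
        then show ?thesis using True by (simp add: ennreal_mult)
      qed
    qed
    also have "\<dots> = ennreal (4 powr p) * ((\<integral>\<^sup>+x. ennreal (norm (w x - A w x) powr p) \<partial>lborel) + ennreal ((4 * \<eta>) powr p) * ennreal q + (\<integral>\<^sup>+x. ennreal (norm (f x - A f x) powr p) \<partial>lborel))"
      by (simp add: nn_integral_cmult nn_integral_add nn_integral_cmult_indicator q)
    also have "\<dots> \<le> ennreal (4 powr p) * (ennreal (2 powr p * e1) + ennreal ((4 * \<eta>) powr p) * ennreal q + ennreal (2 powr p * e1))"
      by (intro mult_left_mono add_mono approx w fW) auto
    also have "\<dots> = ennreal (4 powr p * (2 powr p * e1 + (4 * \<eta>) powr p * q + 2 powr p * e1))"
      using e1 q by (simp add: ennreal_mult[symmetric] ennreal_plus[symmetric] del: ennreal_plus)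
    also have "\<dots> \<le> ennreal e"
    proof (intro ennreal_leI)
      have "4 powr p * (2 powr p * e1 + (4 * \<eta>) powr p * q + 2 powr p * e1) = e / 2 + 4 powr p * ((4 * \<eta>) powr p * q)"
        by (simp add: e1_def field_simps)
      also have "\<dots> \<le> e / 2 + 4 powr p * (e / (2 * 4 powr p))" by (intro add_left_mono mult_left_mono \<eta>p) auto
      also have "\<dots> = e" by simp
      finally show "4 powr p * (2 powr p * e1 + (4 * \<eta>) powr p * q + 2 powr p * e1) \<le> e" .
    qed
    finally have "(\<integral>\<^sup>+x. ennreal (norm (w x - f x) powr p) \<partial>lborel) \<le> ennreal e" .
    then show "\<exists>f\<in>F. (\<integral>\<^sup>+x. ennreal (norm (w x - f x) powr p) \<partial>lborel) \<le> ennreal e"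
      using f(1) by blast
  qed
qed

subsection \<open>Compactness for seminorms\<close>

text \<open>The constant \<open>c\<close> in the triangle inequality does not affect topology, total
  boundedness or Cauchy sequences. With \<open>c = 2\<close> the inequality follows for the
  \<open>L^p\<close> and Morrey norms from elementary inequalities for powers.\<close>

locale quasi_seminorm =
  fixes V :: "'v::minus set" and N :: "'v \<Rightarrow> real" and c :: real
  assumes c_pos: "0 < c"
    and self: "\<And>f. f \<in> V \<Longrightarrow> N (f - f) = 0"
    and sym: "\<And>f g. f \<in> V \<Longrightarrow> g \<in> V \<Longrightarrow> N (f - g) = N (g - f)"
    and triangle: "\<And>f g h. f \<in> V \<Longrightarrow> g \<in> V \<Longrightarrow> h \<in> V \<Longrightarrow> N (f - h) \<le> c * (N (f - g) + N (g - h))"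
begin

abbreviation topo :: "'v topology" where "topo \<equiv> seminorm_topology V N"

lemma triangle_less:
  assumes "f \<in> V" "g \<in> V" "h \<in> V" "N (f - g) < e / (2 * c)" "N (g - h) < e / (2 * c)"
  shows "N (f - h) < e"
proof -
  have "N (f - h) \<le> c * (N (f - g) + N (g - h))" using assms by (intro triangle)
  also have "\<dots> < c * (e / (2 * c) + e / (2 * c))" using assms c_pos by (intro mult_strict_left_mono add_strict_mono)
  also have "\<dots> = e" using c_pos by simp
  finally show ?thesis .
qed

text \<open>With a constant in the triangle inequality a ball \<open>{h. N (h - x) < e}\<close> need
  not be open. The set \<open>U\<close> of points having a whole neighbourhood inside the ball is
  open, and it contains \<open>x\<close>.\<close>

lemma closure_of_approx:
  assumes x: "x \<in> topo closure_of S" and e: "0 < e"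
  shows "\<exists>s\<in>S. s \<in> V \<and> N (s - x) < e"
proof -
  have xV: "x \<in> V" using x by (simp add: in_closure_of)
  define U where "U = {h \<in> V. \<exists>\<delta>>0. \<forall>k\<in>V. N (k - h) < \<delta> \<longrightarrow> N (k - x) < e}"
  have "openin topo U"
    unfolding openin_seminorm_topology
  proof (intro conjI ballI)
    show "U \<subseteq> V" by (auto simp: U_def)
    fix h assume "h \<in> U"
    then obtain \<delta> where h: "h \<in> V" "0 < \<delta>" "\<And>k. k \<in> V \<Longrightarrow> N (k - h) < \<delta> \<Longrightarrow> N (k - x) < e"
      by (auto simp: U_def)
    show "\<exists>\<epsilon>>0. \<forall>h'\<in>V. N (h' - h) < \<epsilon> \<longrightarrow> h' \<in> U"
    proof (intro exI conjI ballI impI)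
      show "0 < \<delta> / (2 * c)" using h c_pos by simp
      fix h' assume h': "h' \<in> V" "N (h' - h) < \<delta> / (2 * c)"
      have "N (k - x) < e" if "k \<in> V" "N (k - h') < \<delta> / (2 * c)" for k
        using h(3)[OF that(1)] triangle_less[OF that(1) h'(1) h(1) that(2) h'(2)] by blast
      then show "h' \<in> U" unfolding U_def using h' \<open>0 < \<delta> / (2 * c)\<close> by blast
    qed
  qed
  moreover have "x \<in> U" using xV e unfolding U_def by blast
  ultimately obtain y where y: "y \<in> S" "y \<in> U" using x unfolding in_closure_of by blast
  then obtain \<delta> where "y \<in> V" "0 < \<delta>" "\<forall>k\<in>V. N (k - y) < \<delta> \<longrightarrow> N (k - x) < e" by (auto simp: U_def)
  then have "N (y - x) < e" using self[of y] by auto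
  then show ?thesis using y \<open>y \<in> V\<close> by blast
qed

text \<open>If no finite subfamily covers, total boundedness yields smaller and smaller nested pieces with the
  same property, and completeness provides a point whose neighbourhoods contain them.\<close>

lemma compactin_closure_of:
  assumes complete: "\<And>X. (\<And>n. X n \<in> V) \<Longrightarrow> (\<And>e. 0 < e \<Longrightarrow> \<exists>M. \<forall>m\<ge>M. \<forall>n\<ge>M. N (X m - X n) < e) \<Longrightarrow>
      \<exists>l\<in>V. (\<lambda>n. N (X n - l)) \<longlonglongrightarrow> 0"
    and S: "S \<subseteq> V"
    and tb: "\<And>e. 0 < e \<Longrightarrow> \<exists>F\<subseteq>V. finite F \<and> (\<forall>s\<in>S. \<exists>f\<in>F. N (s - f) < e)"
  shows "compactin topo (topo closure_of S)"
proof -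
  define K where "K = topo closure_of S"
  have KV: "K \<subseteq> V" unfolding K_def using closure_of_subset_topspace[of topo S] by simp
  \<comment> \<open>The closure inherits finite nets from \<open>S\<close>: a net at precision
    \<open>e / (2 * c)\<close> serves after moving to a nearby point of \<open>S\<close>.\<close>
  have Ktb: "\<exists>F\<subseteq>V. finite F \<and> (\<forall>k\<in>K. \<exists>f\<in>F. N (k - f) < e)" if e: "0 < e" for e
  proof -
    have e': "0 < e / (2 * c)" using e c_pos by simp
    obtain F where F: "F \<subseteq> V" "finite F" "\<And>s. s \<in> S \<Longrightarrow> \<exists>f\<in>F. N (s - f) < e / (2 * c)"
      using tb[OF e'] by blast
    have "\<exists>f\<in>F. N (k - f) < e" if k: "k \<in> K" for k
    proof -
      obtain s where s: "s \<in> S" "s \<in> V" "N (s - k) < e / (2 * c)"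
        using closure_of_approx[of k S, OF _ e'] k by (auto simp: K_def)
      obtain f where f: "f \<in> F" "N (s - f) < e / (2 * c)" using F(3)[OF s(1)] by blast
      have "k \<in> V" "f \<in> V" using k KV f F by auto
      then have "N (k - f) < e" using triangle_less[of k s f] s f sym[of s k] by simp
      then show ?thesis using f by blast
    qed
    then show ?thesis using F by blast
  qed
  show ?thesis
    unfolding compactin_def K_def[symmetric]
  proof (intro conjI allI impI)
    show "K \<subseteq> topspace topo" using KV by simp
    fix \<U> assume \<U>: "Ball \<U> (openin topo) \<and> K \<subseteq> \<Union>\<U>"
    show "\<exists>\<F>. finite \<F> \<and> \<F> \<subseteq> \<U> \<and> K \<subseteq> \<Union>\<F>"
    proof (rule ccontr)
      define bad where "bad A \<longleftrightarrow> A \<subseteq> K \<and> \<not> (\<exists>\<F>. finite \<F> \<and> \<F> \<subseteq> \<U> \<and> A \<subseteq> \<Union>\<F>)" for A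
      assume "\<not> (\<exists>\<F>. finite \<F> \<and> \<F> \<subseteq> \<U> \<and> K \<subseteq> \<Union>\<F>)"
      then have badK: "bad K" by (simp add: bad_def)
      have split: "\<exists>B. bad B \<and> B \<subseteq> A \<and> (\<exists>f\<in>V. \<forall>b\<in>B. N (b - f) < e)" if A: "bad A" and e: "0 < e" for A e
      proof -
        obtain F where F: "F \<subseteq> V" "finite F" "\<And>k. k \<in> K \<Longrightarrow> \<exists>f\<in>F. N (k - f) < e" using Ktb[OF e] by blast
        define P where "P f = {b \<in> A. N (b - f) < e}" for f
        have "\<exists>f\<in>F. bad (P f)"
        proof (rule ccontr)
          assume "\<not> (\<exists>f\<in>F. bad (P f))"
          moreover have "P f \<subseteq> K" for f using A by (auto simp: bad_def P_def)
          ultimately have "\<forall>f\<in>F. \<exists>\<F>. finite \<F> \<and> \<F> \<subseteq> \<U> \<and> P f \<subseteq> \<Union>\<F>" by (auto simp: bad_def)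
          from bchoice[OF this] obtain G where G: "\<forall>f\<in>F. finite (G f) \<and> G f \<subseteq> \<U> \<and> P f \<subseteq> \<Union>(G f)" by (elim exE)
          have AG: "A \<subseteq> \<Union>(\<Union>f\<in>F. G f)"
          proof
            fix b assume b: "b \<in> A"
            then have "b \<in> K" using A unfolding bad_def by blast
            then obtain f where f: "f \<in> F" "N (b - f) < e" using F(3) by blast
            then have "b \<in> P f" using b by (simp add: P_def)
            then show "b \<in> \<Union>(\<Union>f\<in>F. G f)" using bspec[OF G f(1)] f(1) by blast
          qed
          have "finite (\<Union>f\<in>F. G f)"
            by (rule finite_UN_I[OF F(2)]) (use G in blast)
          moreover have "(\<Union>f\<in>F. G f) \<subseteq> \<U>" using G by blast
          moreover have "\<not> (\<exists>\<F>. finite \<F> \<and> \<F> \<subseteq> \<U> \<and> A \<subseteq> \<Union>\<F>)" using A unfolding bad_def by (rule conjunct2)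
          ultimately show False using AG by (metis (no_types))
        qed
        then obtain f where "f \<in> F" "bad (P f)" by blast
        moreover have "P f \<subseteq> A" "\<forall>b\<in>P f. N (b - f) < e" by (auto simp: P_def)
        ultimately show ?thesis using F(1) by blast
      qed
      have "\<exists>A. \<forall>n. bad (A n) \<and> A (Suc n) \<subseteq> A n \<and> (\<exists>f\<in>V. \<forall>b\<in>A (Suc n). N (b - f) < inverse (real (Suc n)))"
        by (rule dependent_nat_choice) (use badK split in auto)
      then obtain A where A: "\<And>n. bad (A n)" "\<And>n. A (Suc n) \<subseteq> A n"
        and Af: "\<And>n. \<exists>f\<in>V. \<forall>b\<in>A (Suc n). N (b - f) < inverse (real (Suc n))" by blast
      have ne: "\<exists>x. x \<in> A (Suc n)" for n
      proof (rule ccontr)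
        assume "\<not> (\<exists>x. x \<in> A (Suc n))"
        then have "A (Suc n) \<subseteq> \<Union>{}" by blast
        then show False using A(1)[of "Suc n"] unfolding bad_def by blast
      qed
      then obtain X where X: "\<And>n. X n \<in> A (Suc n)" by metis
      have dec: "A (Suc m) \<subseteq> A (Suc n)" if "n \<le> m" for n m
        by (rule lift_Suc_antimono_le[of "\<lambda>n. A (Suc n)", OF A(2) that])
      have AV: "A n \<subseteq> V" for n using A(1)[of n] KV by (auto simp: bad_def)
      have XV: "X n \<in> V" for n using X AV by blast
      have small: "\<exists>M. \<forall>n\<ge>M. \<forall>b\<in>A (Suc n). \<forall>b'\<in>A (Suc n). N (b - b') < e" if e: "0 < e" for e
      proof -
        obtain M where M: "inverse (real (Suc M)) < e / (2 * c)"
          using reals_Archimedean[of "e / (2 * c)"] e c_pos by auto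
        have "N (b - b') < e" if n: "M \<le> n" and b: "b \<in> A (Suc n)" "b' \<in> A (Suc n)" for n b b'
        proof -
          obtain f where f: "f \<in> V" "\<forall>b\<in>A (Suc M). N (b - f) < inverse (real (Suc M))" using Af by blast
          have bb: "b \<in> A (Suc M)" "b' \<in> A (Suc M)" using dec[OF n] b by auto
          then have "N (b - f) < e / (2 * c)" "N (b' - f) < e / (2 * c)" using f M by fastforce+
          moreover have "b \<in> V" "b' \<in> V" using bb AV by auto
          ultimately show ?thesis using triangle_less[of b f b' e] f sym[of b' f] by simp
        qed
        then show ?thesis by blast
      qed
      have "\<exists>M. \<forall>m\<ge>M. \<forall>n\<ge>M. N (X m - X n) < e" if e: "0 < e" for e
      proof -
        obtain M where M: "\<And>n b b'. M \<le> n \<Longrightarrow> b \<in> A (Suc n) \<Longrightarrow> b' \<in> A (Suc n) \<Longrightarrow> N (b - b') < e" using small[OF e] by blast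
        have "N (X m - X n) < e" if "M \<le> m" "M \<le> n" for m n
          using M[of M "X m" "X n"] X[of m] X[of n] dec[OF that(1)] dec[OF that(2)] by blast
        then show ?thesis by blast
      qed
      from complete[OF XV this] obtain l where l: "l \<in> V" "(\<lambda>n. N (X n - l)) \<longlonglongrightarrow> 0" by blast
      have "l \<in> K"
      proof (rule ccontr)
        assume "l \<notin> K"
        have "closedin topo K" unfolding K_def by simp
        then have "openin topo (V - K)" by (simp add: closedin_def)
        then obtain \<epsilon> where "0 < \<epsilon>" "\<forall>h\<in>V. N (h - l) < \<epsilon> \<longrightarrow> h \<in> V - K"
          using l(1) \<open>l \<notin> K\<close> unfolding openin_seminorm_topology by blast
        moreover obtain n where "N (X n - l) < \<epsilon>"
          using order_tendstoD(2)[OF l(2) \<open>0 < \<epsilon>\<close>] by (auto simp: eventually_sequentially)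
        ultimately have "X n \<notin> K" using XV by blast
        then show False using X A(1)[of "Suc n"] by (auto simp: bad_def)
      qed
      then obtain U where U: "U \<in> \<U>" "l \<in> U" using \<U> by blast
      then have "openin topo U" using \<U> by blast
      then obtain \<epsilon> where \<epsilon>: "0 < \<epsilon>" "\<And>h. h \<in> V \<Longrightarrow> N (h - l) < \<epsilon> \<Longrightarrow> h \<in> U"
        using U(2) unfolding openin_seminorm_topology by blast
      have \<epsilon>': "0 < \<epsilon> / (2 * c)" using \<epsilon> c_pos by simp
      obtain M where M: "\<And>n b b'. M \<le> n \<Longrightarrow> b \<in> A (Suc n) \<Longrightarrow> b' \<in> A (Suc n) \<Longrightarrow> N (b - b') < \<epsilon> / (2 * c)" using small[OF \<epsilon>'] by blast
      have "\<forall>\<^sub>F n in sequentially. N (X n - l) < \<epsilon> / (2 * c) \<and> M \<le> n"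
        using order_tendstoD(2)[OF l(2) \<epsilon>'] eventually_ge_at_top[of M] by (rule eventually_conj)
      then obtain n where n: "N (X n - l) < \<epsilon> / (2 * c)" "M \<le> n"
        using eventually_happens'[OF sequentially_bot] by blast
      \<comment> \<open>The piece is small and contains \<open>X n\<close>, which is close to
        \<open>l\<close>. Thus the single set \<open>U\<close> covers it, although no finite
        subfamily should.\<close>
      have "A (Suc n) \<subseteq> U"
      proof
        fix b assume b: "b \<in> A (Suc n)"
        then have bV: "b \<in> V" using AV by blast
        have "N (b - X n) < \<epsilon> / (2 * c)" using M[OF n(2) b X] .
        then show "b \<in> U" using \<epsilon>(2)[OF bV] triangle_less[OF bV XV l(1) _ n(1)] by blast
      qed
      then have "A (Suc n) \<subseteq> \<Union>{U}" by simp
      then show False using A(1)[of "Suc n"] U(1) unfolding bad_def by blast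
    qed
  qed
qed

end

section \<open>Lebesgue spaces: quasi-norm and completeness\<close>

lemma Lp_iff:
  "f \<in> Lp p S \<longleftrightarrow> f \<in> borel_measurable (lebesgue_on S) \<and> (\<integral>\<^sup>+x. ennreal (norm (f x) powr p) \<partial>lebesgue_on S) < \<infinity>"
  unfolding Lp_def integrable_iff_bounded by auto

lemma Lp_norm_nonneg: "0 \<le> Lp_norm p S f"
  by (simp add: Lp_norm_def)

lemma Lp_norm_powr:
  assumes f: "f \<in> Lp p S" and p: "1 \<le> p"
  shows "ennreal (Lp_norm p S f powr p) = (\<integral>\<^sup>+x. ennreal (norm (f x) powr p) \<partial>lebesgue_on S)"
proof -
  have "integrable (lebesgue_on S) (\<lambda>x. norm (f x) powr p)" using f by (simp add: Lp_def)
  then have "(\<integral>\<^sup>+x. ennreal (norm (f x) powr p) \<partial>lebesgue_on S) = ennreal (LINT x|lebesgue_on S. norm (f x) powr p)"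
    by (intro nn_integral_eq_integral) auto
  moreover have "0 \<le> (LINT x|lebesgue_on S. norm (f x) powr p)" by (intro Bochner_Integration.integral_nonneg) auto
  ultimately show ?thesis using p by (simp add: Lp_norm_def powr_powr)
qed

lemma powr_le_powr_cancel:
  fixes a b p :: real
  assumes "0 \<le> b" "0 < p" "a powr p \<le> b powr p" "0 \<le> a"
  shows "a \<le> b"
proof (rule ccontr)
  assume "\<not> a \<le> b"
  then have "b powr p < a powr p" using assms by (intro powr_less_mono2) auto
  then show False using assms by simp
qed

lemma Lp_norm_le:
  assumes f: "f \<in> Lp p S" and p: "1 \<le> p" and a: "0 \<le> a"
    and le: "(\<integral>\<^sup>+x. ennreal (norm (f x) powr p) \<partial>lebesgue_on S) \<le> ennreal (a powr p)"
  shows "Lp_norm p S f \<le> a"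
proof -
  have "Lp_norm p S f powr p \<le> a powr p" using le by (simp add: Lp_norm_powr[OF f p, symmetric])
  then show ?thesis by (rule powr_le_powr_cancel[OF a _ _ Lp_norm_nonneg, rotated]) (use p in simp)
qed

lemma nn_integral_norm_diff_powr_le:
  fixes f g h :: "'b \<Rightarrow> complex"
  assumes [measurable]: "f \<in> borel_measurable M" "g \<in> borel_measurable M" "h \<in> borel_measurable M" and p: "1 \<le> p"
  shows "(\<integral>\<^sup>+x. ennreal (norm (f x - h x) powr p) \<partial>M) \<le>
    ennreal (2 powr p) * ((\<integral>\<^sup>+x. ennreal (norm (f x - g x) powr p) \<partial>M) + (\<integral>\<^sup>+x. ennreal (norm (g x - h x) powr p) \<partial>M))"
proof -
  have "(\<integral>\<^sup>+x. ennreal (norm (f x - h x) powr p) \<partial>M) \<le>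
    (\<integral>\<^sup>+x. ennreal (2 powr p) * (ennreal (norm (f x - g x) powr p) + ennreal (norm (g x - h x) powr p)) \<partial>M)"
  proof (intro nn_integral_mono)
    fix x
    have "norm (f x - h x) powr p \<le> (norm (f x - g x) + norm (g x - h x)) powr p"
      using p norm_triangle_ineq[of "f x - g x" "g x - h x"] by (intro powr_mono2) auto
    also have "\<dots> \<le> 2 powr p * (norm (f x - g x) powr p + norm (g x - h x) powr p)"
      using p by (intro powr_add_le_two) auto
    finally show "ennreal (norm (f x - h x) powr p) \<le> ennreal (2 powr p) * (ennreal (norm (f x - g x) powr p) + ennreal (norm (g x - h x) powr p))"
      by (simp add: ennreal_leI flip: ennreal_mult ennreal_plus)
  qed
  also have "\<dots> = ennreal (2 powr p) * ((\<integral>\<^sup>+x. ennreal (norm (f x - g x) powr p) \<partial>M) + (\<integral>\<^sup>+x. ennreal (norm (g x - h x) powr p) \<partial>M))"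
    by (simp add: nn_integral_cmult nn_integral_add)
  finally show ?thesis .
qed

lemma Lp_diff:
  assumes f: "f \<in> Lp p S" and g: "g \<in> Lp p S" and p: "1 \<le> p"
  shows "f - g \<in> Lp p S"
proof -
  have [measurable]: "f \<in> borel_measurable (lebesgue_on S)" "g \<in> borel_measurable (lebesgue_on S)"
    using f g by (auto simp: Lp_iff)
  have "(\<integral>\<^sup>+x. ennreal (norm (f x - g x) powr p) \<partial>lebesgue_on S) \<le>
    ennreal (2 powr p) * ((\<integral>\<^sup>+x. ennreal (norm (f x - 0) powr p) \<partial>lebesgue_on S) + (\<integral>\<^sup>+x. ennreal (norm (0 - g x) powr p) \<partial>lebesgue_on S))"
    by (rule nn_integral_norm_diff_powr_le) (use p in auto)
  also have "\<dots> < \<infinity>" using f g by (simp add: Lp_iff ennreal_mult_less_top)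
  finally show ?thesis by (simp add: Lp_iff fun_diff_def)
qed

text \<open>The power of a sum costs \<open>2 powr p\<close>, and the sum of the powers of the two
  norms is at most the power of their sum; the \<open>p\<close>-th root leaves the constant
  2.\<close>

lemma Lp_quasi_seminorm:
  assumes p: "1 \<le> p"
  shows "quasi_seminorm (Lp p S) (Lp_norm p S) 2"
proof
  show "Lp_norm p S (f - f) = 0" for f using p by (simp add: Lp_norm_def)
  show "Lp_norm p S (f - g) = Lp_norm p S (g - f)" for f g by (simp add: Lp_norm_def norm_minus_commute)
  fix f g h assume f: "f \<in> Lp p S" and g: "g \<in> Lp p S" and h: "h \<in> Lp p S"
  have [measurable]: "f \<in> borel_measurable (lebesgue_on S)" "g \<in> borel_measurable (lebesgue_on S)" "h \<in> borel_measurable (lebesgue_on S)"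
    using f g h by (auto simp: Lp_iff)
  let ?a = "Lp_norm p S (f - g)" and ?b = "Lp_norm p S (g - h)"
  note nn = Lp_norm_nonneg[of p S]
  show "Lp_norm p S (f - h) \<le> 2 * (?a + ?b)"
  proof (rule Lp_norm_le[OF Lp_diff[OF f h p] p])
    show "0 \<le> 2 * (?a + ?b)" using nn by simp
    have ab: "(\<integral>\<^sup>+x. ennreal (norm ((f - g) x) powr p) \<partial>lebesgue_on S) = ennreal (?a powr p)"
      "(\<integral>\<^sup>+x. ennreal (norm ((g - h) x) powr p) \<partial>lebesgue_on S) = ennreal (?b powr p)"
      by (rule Lp_norm_powr[OF Lp_diff[OF f g p] p, symmetric], rule Lp_norm_powr[OF Lp_diff[OF g h p] p, symmetric])
    have "(\<integral>\<^sup>+x. ennreal (norm ((f - h) x) powr p) \<partial>lebesgue_on S) \<le>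
      ennreal (2 powr p) * ((\<integral>\<^sup>+x. ennreal (norm ((f - g) x) powr p) \<partial>lebesgue_on S) + (\<integral>\<^sup>+x. ennreal (norm ((g - h) x) powr p) \<partial>lebesgue_on S))"
      using nn_integral_norm_diff_powr_le[of f "lebesgue_on S" g h p] p by simp
    also have "\<dots> = ennreal (2 powr p * (?a powr p + ?b powr p))"
      unfolding ab by (simp add: ennreal_mult)
    also have "\<dots> \<le> ennreal (2 powr p * (?a + ?b) powr p)"
      using nn p by (intro ennreal_leI mult_left_mono powr_superadditive) auto
    also have "2 powr p * (?a + ?b) powr p = (2 * (?a + ?b)) powr p"
      by (subst powr_mult) (use nn in auto)
    finally show "(\<integral>\<^sup>+x. ennreal (norm ((f - h) x) powr p) \<partial>lebesgue_on S) \<le> ennreal ((2 * (?a + ?b)) powr p)" .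
  qed
qed simp

lemma convergent_of_geometric_steps:
  fixes y :: "nat \<Rightarrow> complex"
  assumes "\<And>j. norm (y (Suc j) - y j) \<le> B * (1/2) ^ j"
  shows "convergent y"
proof -
  have "summable (\<lambda>j. B * (1/2::real) ^ j)" by (intro summable_mult summable_geometric) simp
  then have "summable (\<lambda>j. y (Suc j) - y j)" by (rule summable_comparison_test'[where N = 0]) (use assms in auto)
  then have "convergent (\<lambda>n. \<Sum>j<n. y (Suc j) - y j)" by (simp add: summable_iff_convergent)
  then have "convergent (\<lambda>n. (\<Sum>j<n. y (Suc j) - y j) + y 0)" by (intro convergent_add convergent_const)
  then show ?thesis by (simp add: sum_lessThan_telescope)
qed

text \<open>The Riesz-Fischer argument. Along a subsequence with steps below
  \<open>(1/4) ^ j\<close> the series of the \<open>p\<close>-th powers weighted by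
  \<open>(2 ^ j) powr p\<close> is integrable. At almost every point the steps are therefore at most
  a constant times \<open>(1/2) ^ j\<close>, so the subsequence converges there; Fatou's lemma gives
  convergence of the whole sequence in norm.\<close>

lemma Lp_complete:
  fixes X :: "nat \<Rightarrow> real^'n \<Rightarrow> complex"
  assumes p: "1 \<le> p" and X: "\<And>n. X n \<in> Lp p S"
    and cauchy: "\<And>e. 0 < e \<Longrightarrow> \<exists>M. \<forall>m\<ge>M. \<forall>n\<ge>M. Lp_norm p S (X m - X n) < e"
  shows "\<exists>l\<in>Lp p S. (\<lambda>n. Lp_norm p S (X n - l)) \<longlonglongrightarrow> 0"
proof -
  let ?M = "lebesgue_on S"
  have [measurable]: "X n \<in> borel_measurable ?M" for n using X by (simp add: Lp_iff)
  have "\<forall>j. \<exists>M. \<forall>m\<ge>M. \<forall>n\<ge>M. Lp_norm p S (X m - X n) < (1/4) ^ j" using cauchy by simp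
  from choice[OF this] obtain M where M: "\<And>j m n. M j \<le> m \<Longrightarrow> M j \<le> n \<Longrightarrow> Lp_norm p S (X m - X n) < (1/4) ^ j" by blast
  \<comment> \<open>Summation makes \<open>k j\<close> dominate every \<open>M i\<close> with
    \<open>i \<le> j\<close>: the subsequence then has the required steps, and its tail can be
    compared with any late \<open>X m\<close>.\<close>
  define k where "k j = (\<Sum>i\<le>j. M i)" for j
  have kM: "M i \<le> k j" if "i \<le> j" for i j unfolding k_def using that by (intro member_le_sum) auto
  define Y where "Y j = X (k j)" for j
  have [measurable]: "Y j \<in> borel_measurable ?M" for j unfolding Y_def by measurable
  have int: "(\<integral>\<^sup>+x. ennreal (norm (X m x - X n x) powr p) \<partial>?M) \<le> ennreal (e powr p)" if "Lp_norm p S (X m - X n) < e" for m n e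
  proof -
    have "(\<integral>\<^sup>+x. ennreal (norm ((X m - X n) x) powr p) \<partial>?M) = ennreal (Lp_norm p S (X m - X n) powr p)"
      by (rule Lp_norm_powr[OF Lp_diff[OF X X p] p, symmetric])
    also have "\<dots> \<le> ennreal (e powr p)" using that p Lp_norm_nonneg by (intro ennreal_leI powr_mono2) auto
    finally show ?thesis by simp
  qed
  have "(\<integral>\<^sup>+x. (\<Sum>j. ennreal ((2 ^ j) powr p) * ennreal (norm (Y (Suc j) x - Y j x) powr p)) \<partial>?M) =
    (\<Sum>j. ennreal ((2 ^ j) powr p) * (\<integral>\<^sup>+x. ennreal (norm (Y (Suc j) x - Y j x) powr p) \<partial>?M))"
    by (simp add: nn_integral_suminf nn_integral_cmult)
  also have "\<dots> \<le> (\<Sum>j. ennreal ((1/2) ^ j))"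
  proof (intro suminf_le)
    fix j
    have "ennreal ((2 ^ j) powr p) * (\<integral>\<^sup>+x. ennreal (norm (Y (Suc j) x - Y j x) powr p) \<partial>?M) \<le> ennreal ((2 ^ j) powr p) * ennreal (((1/4) ^ j) powr p)"
      unfolding Y_def by (intro mult_left_mono int M kM) auto
    also have "\<dots> = ennreal (((1/2) ^ j) powr p)"
      by (simp add: powr_mult[symmetric] power_mult_distrib[symmetric] flip: ennreal_mult)
    also have "\<dots> \<le> ennreal (((1/2) ^ j) powr 1)"
      using p by (intro ennreal_leI powr_mono') (auto simp: power_le_one)
    finally show "ennreal ((2 ^ j) powr p) * (\<integral>\<^sup>+x. ennreal (norm (Y (Suc j) x - Y j x) powr p) \<partial>?M) \<le> ennreal ((1/2) ^ j)" by simp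
  qed auto
  also have "\<dots> < \<infinity>"
  proof -
    have "(\<Sum>j. ennreal ((1/2::real) ^ j)) = ennreal (\<Sum>j. (1/2) ^ j)" by (intro suminf_ennreal2 summable_geometric) auto
    then show ?thesis by simp
  qed
  finally have "AE x in ?M. (\<Sum>j. ennreal ((2 ^ j) powr p) * ennreal (norm (Y (Suc j) x - Y j x) powr p)) \<noteq> \<infinity>"
    by (intro nn_integral_PInf_AE) auto
  then have conv: "AE x in ?M. convergent (\<lambda>j. Y j x)"
  proof (rule eventually_mono)
    fix x assume fin: "(\<Sum>j. ennreal ((2 ^ j) powr p) * ennreal (norm (Y (Suc j) x - Y j x) powr p)) \<noteq> \<infinity>"
    then obtain B where B: "(\<Sum>j. ennreal ((2 ^ j) powr p) * ennreal (norm (Y (Suc j) x - Y j x) powr p)) = ennreal B" "0 \<le> B"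
      by (cases "\<Sum>j. ennreal ((2 ^ j) powr p) * ennreal (norm (Y (Suc j) x - Y j x) powr p)" rule: ennreal_cases) auto
    have "norm (Y (Suc j) x - Y j x) \<le> B powr (1 / p) * (1/2) ^ j" for j
    proof -
      define t where "t j = ennreal ((2 ^ j) powr p) * ennreal (norm (Y (Suc j) x - Y j x) powr p)" for j
      have "sum t {j} \<le> suminf t" by (intro sum_le_suminf) auto
      then have "t j \<le> ennreal B" using B by (simp add: t_def[abs_def])
      then have "(2 ^ j * norm (Y (Suc j) x - Y j x)) powr p \<le> B"
        using B(2) by (simp add: t_def powr_mult flip: ennreal_mult)
      then have "(2 ^ j * norm (Y (Suc j) x - Y j x)) powr p \<le> (B powr (1 / p)) powr p"
        using p B(2) by (simp add: powr_powr)
      then have "2 ^ j * norm (Y (Suc j) x - Y j x) \<le> B powr (1 / p)"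
        by (rule powr_le_powr_cancel[rotated 2]) (use p in auto)
      then show ?thesis by (simp add: power_divide field_simps)
    qed
    then show "convergent (\<lambda>j. Y j x)" by (rule convergent_of_geometric_steps)
  qed
  define l where "l x = lim (\<lambda>j. Y j x)" for x
  have [measurable]: "l \<in> borel_measurable ?M"
    unfolding l_def by (rule borel_measurable_lim_metric) measurable
  have close: "(\<integral>\<^sup>+x. ennreal (norm (X m x - l x) powr p) \<partial>?M) \<le> ennreal (((1/4) ^ i) powr p)" if m: "M i \<le> m" for i m
  proof -
    have "AE x in ?M. ennreal (norm (X m x - l x) powr p) = liminf (\<lambda>j. ennreal (norm (X m x - Y j x) powr p))"
      using conv
    proof (rule eventually_mono)
      fix x assume "convergent (\<lambda>j. Y j x)"
      then have "(\<lambda>j. Y j x) \<longlonglongrightarrow> l x" unfolding l_def by (simp add: convergent_LIMSEQ_iff)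
      then have "(\<lambda>j. norm (X m x - Y j x) powr p) \<longlonglongrightarrow> norm (X m x - l x) powr p"
        using p by (intro tendsto_powr' tendsto_intros) auto
      then have "(\<lambda>j. ennreal (norm (X m x - Y j x) powr p)) \<longlonglongrightarrow> ennreal (norm (X m x - l x) powr p)"
        by (intro tendsto_ennrealI)
      then show "ennreal (norm (X m x - l x) powr p) = liminf (\<lambda>j. ennreal (norm (X m x - Y j x) powr p))"
        by (intro lim_imp_Liminf[symmetric]) auto
    qed
    then have "(\<integral>\<^sup>+x. ennreal (norm (X m x - l x) powr p) \<partial>?M) = (\<integral>\<^sup>+x. liminf (\<lambda>j. ennreal (norm (X m x - Y j x) powr p)) \<partial>?M)"
      by (rule nn_integral_cong_AE)
    \<comment> \<open>Fatou's lemma along the subsequence; the bound by the Cauchy property is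
      uniform in its late members.\<close>
    also have "\<dots> \<le> liminf (\<lambda>j. \<integral>\<^sup>+x. ennreal (norm (X m x - Y j x) powr p) \<partial>?M)"
      by (rule nn_integral_liminf) measurable
    also have "\<dots> \<le> limsup (\<lambda>j. \<integral>\<^sup>+x. ennreal (norm (X m x - Y j x) powr p) \<partial>?M)"
      by (rule Liminf_le_Limsup) simp
    also have "\<dots> \<le> ennreal (((1/4) ^ i) powr p)"
    proof (rule Limsup_bounded)
      show "\<forall>\<^sub>F j in sequentially. (\<integral>\<^sup>+x. ennreal (norm (X m x - Y j x) powr p) \<partial>?M) \<le> ennreal (((1/4) ^ i) powr p)"
        using eventually_ge_at_top[of i]
      proof (rule eventually_mono)
        fix j assume "i \<le> j"
        then show "(\<integral>\<^sup>+x. ennreal (norm (X m x - Y j x) powr p) \<partial>?M) \<le> ennreal (((1/4) ^ i) powr p)"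
          unfolding Y_def by (intro int M m kM)
      qed
    qed
    finally show ?thesis .
  qed
  have diffL: "X m - l \<in> Lp p S" if "M i \<le> m" for i m
    using close[OF that] by (auto simp: Lp_iff fun_diff_def intro: order.strict_trans1)
  \<comment> \<open>Fatou's lemma controls the difference \<open>X m - l\<close>, and membership of
    \<open>l\<close> itself follows by subtraction.\<close>
  have "l = X (M 0) - (X (M 0) - l)" by auto
  then have lL: "l \<in> Lp p S" using Lp_diff[OF X diffL[of 0 "M 0"] p, of "M 0"] by simp
  have "(\<lambda>n. Lp_norm p S (X n - l)) \<longlonglongrightarrow> 0"
  proof (rule LIMSEQ_I)
    fix e :: real assume e: "0 < e"
    obtain i where i: "(1/4::real) ^ i < e" using real_arch_pow_inv[OF e, of "1/4"] by auto
    have "norm (Lp_norm p S (X n - l) - 0) < e" if n: "M i \<le> n" for n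
    proof -
      have "Lp_norm p S (X n - l) \<le> (1/4) ^ i"
        by (rule Lp_norm_le[OF diffL[OF n] p]) (use close[OF n] in auto)
      then show ?thesis using i Lp_norm_nonneg[of p S "X n - l"] by simp
    qed
    then show "\<exists>no. \<forall>n\<ge>no. norm (Lp_norm p S (X n - l) - 0) < e" by blast
  qed
  then show ?thesis using lL by blast
qed

lemma compactin_closure_of_Lp:
  fixes T :: "(real^'n \<Rightarrow> complex) set"
  assumes p: "1 \<le> p" and T: "T \<subseteq> Lp p S"
    and tb: "\<And>e. 0 < e \<Longrightarrow> \<exists>F\<subseteq>Lp p S. finite F \<and> (\<forall>s\<in>T. \<exists>f\<in>F. Lp_norm p S (s - f) < e)"
  shows "compactin (seminorm_topology (Lp p S) (Lp_norm p S)) (seminorm_topology (Lp p S) (Lp_norm p S) closure_of T)"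
proof (rule quasi_seminorm.compactin_closure_of[OF Lp_quasi_seminorm[OF p] _ T tb])
  fix X :: "nat \<Rightarrow> real^'n \<Rightarrow> complex"
  assume "\<And>n. X n \<in> Lp p S" "\<And>e. 0 < e \<Longrightarrow> \<exists>M. \<forall>m\<ge>M. \<forall>n\<ge>M. Lp_norm p S (X m - X n) < e"
  then show "\<exists>l\<in>Lp p S. (\<lambda>n. Lp_norm p S (X n - l)) \<longlonglongrightarrow> 0"
    by (rule Lp_complete[OF p])
qed

subsection \<open>Derivative bounds for Sobolev functions\<close>

text \<open>The last entry of a list is the derivative applied to \<open>\<phi>\<close> first. Lists
  are therefore extended at the end: testing with \<open>js @ [i]\<close> means testing with
  \<open>js\<close> against \<open>partial_deriv i \<phi>\<close>.\<close>

lemma iter_partial_deriv_append: "iter_partial_deriv (js @ [i]) \<phi> = iter_partial_deriv js (partial_deriv i \<phi>)"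
  by (induction js) auto

lemma test_function_partial_deriv:
  assumes \<phi>: "\<phi> \<in> test_functions \<Omega>"
  shows "partial_deriv i \<phi> \<in> test_functions \<Omega>"
proof -
  let ?Q = "closure {x. \<phi> x \<noteq> 0}"
  have Q: "compact ?Q" "?Q \<subseteq> \<Omega>" and d: "iter_partial_deriv js \<phi> differentiable_on UNIV" for js
    using \<phi> by (auto simp: test_functions_def)
  have zero: "\<phi> x = 0" if "x \<notin> ?Q" for x using that closure_subset[of "{x. \<phi> x \<noteq> 0}"] by blast
  have "{x. partial_deriv i \<phi> x \<noteq> 0} \<subseteq> ?Q"
    using partial_deriv_vanishes[OF closed_closure[of "{x. \<phi> x \<noteq> 0}"], of \<phi> _ i] zero by blast
  then have sub: "closure {x. partial_deriv i \<phi> x \<noteq> 0} \<subseteq> ?Q" by (intro closure_minimal) auto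
  have "?Q \<inter> closure {x. partial_deriv i \<phi> x \<noteq> 0} = closure {x. partial_deriv i \<phi> x \<noteq> 0}" using sub by blast
  then have "compact (closure {x. partial_deriv i \<phi> x \<noteq> 0})"
    using compact_Int_closed[OF Q(1), of "closure {x. partial_deriv i \<phi> x \<noteq> 0}"] by simp
  then show ?thesis using sub Q d[of "js @ [i]" for js]
    by (auto simp: test_functions_def iter_partial_deriv_append)
qed

lemma test_function_continuous:
  assumes "\<phi> \<in> test_functions \<Omega>"
  shows "continuous_on UNIV \<phi>"
proof -
  have "iter_partial_deriv [] \<phi> differentiable_on UNIV" using assms unfolding test_functions_def by blast
  then show ?thesis by (simp add: differentiable_imp_continuous_on)
qed

lemma test_function_measurable: "\<phi> \<in> test_functions \<Omega> \<Longrightarrow> \<phi> \<in> borel_measurable borel"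
  by (intro borel_measurable_continuous_onI test_function_continuous)

text \<open>The given functions are only Lebesgue measurable on \<open>S\<close> and arbitrary
  outside. A Borel function on the whole space that vanishes off \<open>S\<close> can be translated
  and integrated over product spaces.\<close>

definition is_rep :: "'a::euclidean_space set \<Rightarrow> ('a \<Rightarrow> complex) \<Rightarrow> ('a \<Rightarrow> complex) \<Rightarrow> bool" where
  "is_rep S f F \<longleftrightarrow> f \<in> borel_measurable (lebesgue_on S) \<and> F \<in> borel_measurable borel \<and> (\<forall>x. x \<notin> S \<longrightarrow> F x = 0) \<and> (AE x in lborel. x \<in> S \<longrightarrow> F x = f x)"

lemma ex_rep:
  assumes S: "S \<in> sets borel" and f: "f \<in> borel_measurable (lebesgue_on S)"
  shows "\<exists>F. is_rep S f F"
proof -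
  define f0 where "f0 x = (if x \<in> S then f x else 0)" for x
  have f0: "f0 \<in> borel_measurable lebesgue"
    unfolding f0_def using f S by (intro borel_measurable_if_I) auto
  have "(\<lambda>x. Re (f0 x)) \<in> borel_measurable lebesgue" "(\<lambda>x. Im (f0 x)) \<in> borel_measurable lebesgue"
    using measurable_compose[OF f0, of Re borel] measurable_compose[OF f0, of Im borel]
    by (simp_all add: borel_measurable_continuous_onI continuous_on_Re continuous_on_Im)
  then obtain R I where [measurable]: "R \<in> borel_measurable lborel" "I \<in> borel_measurable lborel"
    and RI: "AE x in lborel. Re (f0 x) = R x" "AE x in lborel. Im (f0 x) = I x"
    using completion_ex_borel_measurable_real[of "\<lambda>x. Re (f0 x)" lborel]
      completion_ex_borel_measurable_real[of "\<lambda>x. Im (f0 x)" lborel] by blast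
  have [measurable]: "S \<in> sets borel" by fact
  define F where "F x = indicator S x *\<^sub>R (complex_of_real (R x) + \<i> * complex_of_real (I x))" for x
  have "F \<in> borel_measurable borel" unfolding F_def by measurable
  moreover have "AE x in lborel. x \<in> S \<longrightarrow> F x = f x"
    using RI
  proof eventually_elim
    case (elim x)
    then show ?case by (auto simp: F_def f0_def complex_eq_iff)
  qed
  ultimately show ?thesis using f by (intro exI[of _ F]) (auto simp: is_rep_def F_def)
qed

lemma rep_mult:
  assumes "is_rep S f F" "is_rep S g G"
  shows "is_rep S (\<lambda>x. f x * g x) (\<lambda>x. F x * G x)"
proof -
  have [measurable]: "f \<in> borel_measurable (lebesgue_on S)" "g \<in> borel_measurable (lebesgue_on S)"
      "F \<in> borel_measurable borel" "G \<in> borel_measurable borel"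
    and ae: "AE x in lborel. x \<in> S \<longrightarrow> F x = f x" "AE x in lborel. x \<in> S \<longrightarrow> G x = g x"
    and z: "\<And>x. x \<notin> S \<Longrightarrow> F x = 0" "\<And>x. x \<notin> S \<Longrightarrow> G x = 0"
    using assms by (simp_all add: is_rep_def)
  have "AE x in lborel. x \<in> S \<longrightarrow> F x * G x = f x * g x"
    using ae by eventually_elim simp
  moreover have "(\<lambda>x. f x * g x) \<in> borel_measurable (lebesgue_on S)" "(\<lambda>x. F x * G x) \<in> borel_measurable borel"
    by measurable
  ultimately show ?thesis using z by (simp add: is_rep_def)
qed

lemma borel_measurable_lebesgue_on_of_borel:
  "\<psi> \<in> borel_measurable borel \<Longrightarrow> \<psi> \<in> borel_measurable (lebesgue_on S)"
  by (intro measurable_restrict_space1 measurable_completion) simp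

lemma rep_mult_borel:
  assumes "is_rep S f F" "\<psi> \<in> borel_measurable borel"
  shows "is_rep S (\<lambda>x. \<psi> x * f x) (\<lambda>x. \<psi> x * F x)"
proof -
  have [measurable]: "\<psi> \<in> borel_measurable (lebesgue_on S)" "f \<in> borel_measurable (lebesgue_on S)"
      "\<psi> \<in> borel_measurable borel" "F \<in> borel_measurable borel"
    and ae: "AE x in lborel. x \<in> S \<longrightarrow> F x = f x" and z: "\<And>x. x \<notin> S \<Longrightarrow> F x = 0"
    using assms borel_measurable_lebesgue_on_of_borel[OF assms(2), of S] by (simp_all add: is_rep_def)
  have "AE x in lborel. x \<in> S \<longrightarrow> \<psi> x * F x = \<psi> x * f x"
    using ae by eventually_elim simp
  moreover have "(\<lambda>x. \<psi> x * f x) \<in> borel_measurable (lebesgue_on S)" "(\<lambda>x. \<psi> x * F x) \<in> borel_measurable borel"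
    by measurable
  ultimately show ?thesis using z by (simp add: is_rep_def)
qed

lemma rep_nn_integral:
  assumes rep: "is_rep S f F" and T: "T \<in> sets borel" "T \<subseteq> S"
  shows "(\<integral>\<^sup>+x. ennreal (norm (f x) powr p) \<partial>lebesgue_on T) = (\<integral>\<^sup>+x. indicator T x * ennreal (norm (F x) powr p) \<partial>lborel)"
proof -
  have "(\<integral>\<^sup>+x. ennreal (norm (f x) powr p) \<partial>lebesgue_on T) = (\<integral>\<^sup>+x. ennreal (norm (f x) powr p) * indicator T x \<partial>lebesgue)"
    using T by (intro nn_integral_restrict_space) auto
  also have "\<dots> = (\<integral>\<^sup>+x. ennreal (norm (f x) powr p) * indicator T x \<partial>lborel)"
    by (rule nn_integral_completion)
  also have "\<dots> = (\<integral>\<^sup>+x. indicator T x * ennreal (norm (F x) powr p) \<partial>lborel)"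
    using rep T(2) by (intro nn_integral_cong_AE) (auto simp: is_rep_def mult.commute elim!: eventually_mono split: split_indicator)
  finally show ?thesis .
qed

lemma rep_nn_integral':
  assumes rep: "is_rep S f F" and S: "S \<in> sets borel"
  shows "(\<integral>\<^sup>+x. ennreal (norm (f x) powr p) \<partial>lebesgue_on S) = (\<integral>\<^sup>+x. ennreal (norm (F x) powr p) \<partial>lborel)"
  unfolding rep_nn_integral[OF rep S order_refl]
  using rep by (intro nn_integral_cong) (auto simp: is_rep_def split: split_indicator)

lemma rep_measurable_if:
  assumes rep: "is_rep S f F" and S: "S \<in> sets borel" and T: "T \<in> sets borel" "T \<subseteq> S" and [measurable]: "\<psi> \<in> borel_measurable borel"
  shows "(\<lambda>x. indicator T x *\<^sub>R (f x * \<psi> x)) \<in> borel_measurable lebesgue"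
    and "AE x in lebesgue. indicator T x *\<^sub>R (f x * \<psi> x) = indicator T x *\<^sub>R (F x * \<psi> x)"
proof -
  have [measurable]: "F \<in> borel_measurable borel" "T \<in> sets borel" using rep T by (auto simp: is_rep_def)
  have "AE x in lborel. indicator T x *\<^sub>R (f x * \<psi> x) = indicator T x *\<^sub>R (F x * \<psi> x)"
    using rep T(2) by (auto simp: is_rep_def elim!: eventually_mono split: split_indicator)
  then show ae: "AE x in lebesgue. indicator T x *\<^sub>R (f x * \<psi> x) = indicator T x *\<^sub>R (F x * \<psi> x)"
    by (rule AE_completion)
  define f0 where "f0 x = (if x \<in> S then f x else 0)" for x
  have "f0 \<in> borel_measurable lebesgue"
    unfolding f0_def using rep S by (intro borel_measurable_if_I) (auto simp: is_rep_def)
  moreover have "\<psi> \<in> borel_measurable lebesgue" "(indicator T :: 'a \<Rightarrow> real) \<in> borel_measurable lebesgue"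
    by (auto intro!: measurable_completion)
  ultimately have "(\<lambda>x. indicator T x *\<^sub>R (f0 x * \<psi> x)) \<in> borel_measurable lebesgue" by measurable
  moreover have "(\<lambda>x. indicator T x *\<^sub>R (f0 x * \<psi> x)) = (\<lambda>x. indicator T x *\<^sub>R (f x * \<psi> x))"
    using T(2) by (auto simp: f0_def fun_eq_iff split: split_indicator)
  ultimately show "(\<lambda>x. indicator T x *\<^sub>R (f x * \<psi> x)) \<in> borel_measurable lebesgue" by simp
qed

lemma rep_integral:
  assumes rep: "is_rep S f F" and S: "S \<in> sets borel" and \<psi> [measurable]: "\<psi> \<in> borel_measurable borel"
  shows "(LINT x|lebesgue_on S. f x * \<psi> x) = (LINT x|lborel. F x * \<psi> x)"
proof -
  have [measurable]: "F \<in> borel_measurable borel" "S \<in> sets borel" using rep S by (auto simp: is_rep_def)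
  have m: "(\<lambda>x. indicator S x *\<^sub>R (F x * \<psi> x)) \<in> borel_measurable lborel" by measurable
  have "(LINT x|lebesgue_on S. f x * \<psi> x) = (LINT x|lebesgue. indicator S x *\<^sub>R (f x * \<psi> x))"
    using S by (intro integral_restrict_space) auto
  also have "\<dots> = (LINT x|lebesgue. indicator S x *\<^sub>R (F x * \<psi> x))"
    using rep_measurable_if[OF rep S S order_refl \<psi>] measurable_completion[OF m] by (intro integral_cong_AE) auto
  also have "\<dots> = (LINT x|lborel. indicator S x *\<^sub>R (F x * \<psi> x))"
    by (rule integral_completion[OF m])
  also have "\<dots> = (LINT x|lborel. F x * \<psi> x)"
    using rep by (intro Bochner_Integration.integral_cong) (auto simp: is_rep_def split: split_indicator)
  finally show ?thesis .
qed

lemma rep_integrable: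
  assumes rep: "is_rep S f F" and S: "S \<in> sets borel" and K: "K \<in> sets borel" "K \<subseteq> S"
    and int: "integrable (lebesgue_on K) f"
  shows "integrable lborel (\<lambda>x. indicator K x *\<^sub>R F x)"
proof -
  have [measurable]: "F \<in> borel_measurable borel" "K \<in> sets borel" using rep K by (auto simp: is_rep_def)
  have m: "(\<lambda>x. indicator K x *\<^sub>R F x) \<in> borel_measurable lborel" by measurable
  have "integrable lebesgue (\<lambda>x. indicator K x *\<^sub>R f x)"
    using int K by (subst (asm) integrable_restrict_space) auto
  then have "integrable lebesgue (\<lambda>x. indicator K x *\<^sub>R F x)"
    using rep_measurable_if[OF rep S K, of "\<lambda>_. 1"] measurable_completion[OF m]
    by (subst (asm) integrable_cong_AE[where g = "\<lambda>x. indicator K x *\<^sub>R F x"]) auto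
  then show ?thesis using m by (simp add: integrable_completion)
qed

text \<open>The choice in \<open>sobolev_norm\<close> also picks a function for the empty list,
  which need not be \<open>u\<close> itself. Testing with bumps on boxes shows that it agrees with
  \<open>u\<close> almost everywhere.\<close>

lemma rep_of_weak_deriv_Nil:
  fixes u v :: "real^'n \<Rightarrow> complex"
  assumes \<Omega>: "open \<Omega>" and u: "u \<in> borel_measurable (lebesgue_on \<Omega>)" and rep: "is_rep \<Omega> v V"
    and weak: "has_weak_deriv \<Omega> [] u v"
  shows "is_rep \<Omega> u V"
proof -
  have \<Omega>m: "\<Omega> \<in> sets borel" using \<Omega> by simp
  obtain U where U: "is_rep \<Omega> u U" using ex_rep[OF \<Omega>m u] by blast
  have [measurable]: "U \<in> borel_measurable borel" "V \<in> borel_measurable borel" using U rep by (auto simp: is_rep_def)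
  have "AE x in lborel. x \<in> \<Omega> \<longrightarrow> U x - V x = 0"
  proof (rule AE_open_of_AE_boxes[OF \<Omega>])
    have box0: "integrable lborel (\<lambda>x. indicator (cbox a b) x *\<^sub>R (U x - V x)) \<and> (LINT x|lborel. indicator (box a b) x *\<^sub>R (U x - V x)) = 0"
      if ab: "cbox a b \<subseteq> \<Omega>" for a b
    proof -
      have iU: "integrable lborel (\<lambda>x. indicator (cbox a b) x *\<^sub>R U x)"
        using weak ab by (intro rep_integrable[OF U \<Omega>m]) (auto simp: has_weak_deriv_def)
      have iV: "integrable lborel (\<lambda>x. indicator (cbox a b) x *\<^sub>R V x)"
        using weak ab by (intro rep_integrable[OF rep \<Omega>m]) (auto simp: has_weak_deriv_def)
      have iE: "integrable lborel (\<lambda>x. indicator (cbox a b) x *\<^sub>R (U x - V x))"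
        using Bochner_Integration.integrable_diff[OF iU iV] by (simp add: scaleR_diff_right)
      have "(LINT x|lborel. bump k a b x * (U x - V x)) = 0" for k
      proof -
        have t: "bump k a b \<in> test_functions \<Omega>" using ab by (rule bump_test_function)
        have bm: "bump k a b \<in> borel_measurable borel" by (rule test_function_measurable[OF t])
        have b0: "bump k a b x = 0" if "x \<notin> cbox a b" for x
          using that bump_outside[of x a b k] box_subset_cbox[of a b] by blast
        have "(LINT x|lebesgue_on \<Omega>. u x * bump k a b x) = (LINT x|lebesgue_on \<Omega>. v x * bump k a b x)"
          using weak t by (simp add: has_weak_deriv_def)
        then have "(LINT x|lborel. U x * bump k a b x) = (LINT x|lborel. V x * bump k a b x)"
          by (simp add: rep_integral[OF U \<Omega>m bm] rep_integral[OF rep \<Omega>m bm])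
        moreover have "integrable lborel (\<lambda>x. bump k a b x * U x)" "integrable lborel (\<lambda>x. bump k a b x * V x)"
          by (rule bounded_times_integrable[OF _ bm _ _ norm_bump_le b0]; (rule iU iV | simp))+
        moreover have sw: "bump k a b x * U x = U x * bump k a b x" "bump k a b x * V x = V x * bump k a b x" for x
          by (rule mult.commute)+
        ultimately show ?thesis by (simp add: right_diff_distrib sw)
      qed
      then show ?thesis using iE box_integral_zero_of_bumps[OF _ iE] by simp
    qed
    fix a b assume ab: "cbox a b \<subseteq> \<Omega>"
    show "AE x in lborel. x \<in> cbox a b \<longrightarrow> U x - V x = 0"
      by (rule AE_zero_if_box_integrals_zero) (use box0 ab in auto)
  qed
  moreover have "AE x in lborel. x \<in> \<Omega> \<longrightarrow> U x = u x" using U by (simp add: is_rep_def)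
  ultimately have "AE x in lborel. x \<in> \<Omega> \<longrightarrow> V x = u x" by eventually_elim auto
  then show ?thesis using rep u by (simp add: is_rep_def)
qed

lemma finite_lists_le: "finite {js :: 'n::finite list. length js \<le> r}"
  using finite_lists_length_le[of "UNIV :: 'n set" r] by simp

text \<open>The constant \<open>2 powr p * D powr (p - 1)\<close> comes from comparing the power of a sum of at most \<open>D\<close>
  terms with the sum of the powers.\<close>

lemma sobolev_gradient_chain:
  fixes u :: "real^'n \<Rightarrow> complex"
  assumes \<Omega>: "open \<Omega>" and p: "1 \<le> p" and r: "1 \<le> r" and u: "u \<in> sobolev r p \<Omega>"
  defines "D \<equiv> real (card {js :: 'n list. length js \<le> r})"
  shows "\<exists>V f. is_rep \<Omega> u V \<and> gradient_chain \<Omega> r f \<and> f 0 = (\<lambda>x. norm (V x)) \<and>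
    (\<Sum>k\<le>r. \<integral>\<^sup>+x. ennreal (f k x powr p) \<partial>lborel) \<le> ennreal (2 powr p * D powr (p - 1) * sobolev_norm r p \<Omega> u powr p) \<and>
    (\<forall>h. AE y in lborel. y \<in> segment_in \<Omega> h \<longrightarrow> ennreal (norm (V (y + h) - V y)) \<le>
      ennreal (norm h) * (\<integral>\<^sup>+s. indicator {0..1} s * ennreal (f 1 (y + s *\<^sub>R h)) \<partial>lborel))"
proof -
  have \<Omega>m: "\<Omega> \<in> sets borel" using \<Omega> by simp
  let ?I = "{js :: 'n list. length js \<le> r}"
  \<comment> \<open>The same choice as in \<open>sobolev_norm\<close>, so that the
    \<open>p\<close>-th powers of the norms of the \<open>w js\<close> add up to that of the Sobolev
    norm exactly.\<close>
  define w where "w js = (SOME v. v \<in> Lp p \<Omega> \<and> has_weak_deriv \<Omega> js u v)" for js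
  have w: "w js \<in> Lp p \<Omega>" "has_weak_deriv \<Omega> js u (w js)" if "length js \<le> r" for js
  proof -
    have "\<exists>v. v \<in> Lp p \<Omega> \<and> has_weak_deriv \<Omega> js u v" using u that by (auto simp: sobolev_def)
    from someI_ex[OF this] show "w js \<in> Lp p \<Omega>" "has_weak_deriv \<Omega> js u (w js)" by (auto simp: w_def)
  qed
  have "\<forall>js\<in>?I. \<exists>F. is_rep \<Omega> (w js) F" using w(1) by (auto intro!: ex_rep[OF \<Omega>m] simp: Lp_iff)
  from bchoice[OF this] obtain W0 where W0: "\<forall>js\<in>?I. is_rep \<Omega> (w js) (W0 js)" by (elim exE)
  \<comment> \<open>A gradient chain must be measurable and vanish outside the domain at every
    index, also above \<open>r\<close>; lists longer than \<open>r\<close> receive the zero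
    function.\<close>
  define W where "W js = (if length js \<le> r then W0 js else (\<lambda>x. 0))" for js
  have W: "is_rep \<Omega> (w js) (W js)" if "length js \<le> r" for js using W0 that by (simp add: W_def)
  have Wm [measurable]: "W js \<in> borel_measurable borel" for js
    using W[of js] by (cases "length js \<le> r") (auto simp: is_rep_def W_def)
  have Wz: "W js x = 0" if "x \<notin> \<Omega>" for js x
    using W[of js] that by (cases "length js \<le> r") (auto simp: is_rep_def W_def)
  define f where "f k x = (\<Sum>js | length js = k. norm (W js x))" for k x
  have fin: "finite {js :: 'n list. length js = k}" for k
    using finite_lists_length_eq[of "UNIV :: 'n set" k] by simp
  have f0: "f 0 = (\<lambda>x. norm (W [] x))" by (auto simp: f_def fun_eq_iff)
  \<comment> \<open>A list of length \<open>Suc k\<close> is uniquely \<open>js @ [i]\<close>, so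
    the derivatives of order \<open>Suc k\<close> are grouped by the derivative of order
    \<open>k\<close> from which they arise.\<close>
  have fSuc: "f (Suc k) x = (\<Sum>js | length js = k. \<Sum>i\<in>UNIV. norm (W (js @ [i]) x))" for k x
  proof -
    have bij: "bij_betw (\<lambda>(js, i). js @ [i]) ({js :: 'n list. length js = k} \<times> UNIV) {js. length js = Suc k}"
      unfolding bij_betw_def
    proof
      show "inj_on (\<lambda>(js, i). js @ [i]) ({js :: 'n list. length js = k} \<times> UNIV)" by (auto simp: inj_on_def)
      show "(\<lambda>(js, i). js @ [i]) ` ({js :: 'n list. length js = k} \<times> UNIV) = {js. length js = Suc k}"
      proof (intro equalityI subsetI)
        fix js :: "'n list" assume "js \<in> {js. length js = Suc k}"
        then have l: "length js = Suc k" by simp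
        then have "js \<noteq> []" by auto
        then have "js = (\<lambda>(js, i). js @ [i]) (butlast js, last js)" by simp
        moreover have "(butlast js, last js) \<in> {js :: 'n list. length js = k} \<times> UNIV" using l by simp
        ultimately show "js \<in> (\<lambda>(js, i). js @ [i]) ` ({js :: 'n list. length js = k} \<times> UNIV)" by (rule image_eqI)
      qed auto
    qed
    have "f (Suc k) x = (\<Sum>z\<in>{js :: 'n list. length js = k} \<times> UNIV. norm (W ((\<lambda>(js, i). js @ [i]) z) x))"
      unfolding f_def by (rule sum.reindex_bij_betw[OF bij, symmetric])
    also have "\<dots> = (\<Sum>(js, i)\<in>{js :: 'n list. length js = k} \<times> UNIV. norm (W (js @ [i]) x))"
      by (rule sum.cong[OF refl]) (simp add: case_prod_unfold)
    also have "\<dots> = (\<Sum>js | length js = k. \<Sum>i\<in>UNIV. norm (W (js @ [i]) x))"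
      by (rule sum.cartesian_product[symmetric])
    finally show ?thesis .
  qed
  \<comment> \<open>Comparing the weak identities for \<open>js\<close> tested with
    \<open>partial_deriv i \<phi>\<close> and for \<open>js @ [i]\<close> tested with
    \<open>\<phi>\<close> shows that \<open>W (js @ [i])\<close> is the weak derivative of
    \<open>W js\<close> in direction \<open>i\<close>; the common sign cancels.\<close>
  have inc: "AE y in lborel. y \<in> segment_in \<Omega> h \<longrightarrow> ennreal (norm (W js (y + h) - W js y)) \<le>
      ennreal (norm h) * (\<integral>\<^sup>+s. indicator {0..1} s * ennreal (\<Sum>i\<in>UNIV. norm (W (js @ [i]) (y + s *\<^sub>R h))) \<partial>lborel)"
    if js: "length js < r" for js h
  proof (rule weak_deriv_increment_bound[OF Wm Wm \<Omega>])
    have jl: "length js \<le> r" "length (js @ [i]) \<le> r" for i using js by auto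
    show "integrable lborel (\<lambda>x. indicator K x *\<^sub>R W js x)" if "compact K" "K \<subseteq> \<Omega>" for K
      using w(2)[OF jl(1)] that by (intro rep_integrable[OF W[OF jl(1)] \<Omega>m]) (auto simp: has_weak_deriv_def compact_imp_closed)
    show "integrable lborel (\<lambda>x. indicator K x *\<^sub>R W (js @ [i]) x)" if "compact K" "K \<subseteq> \<Omega>" for K i
      using w(2)[OF jl(2)] that by (intro rep_integrable[OF W[OF jl(2)] \<Omega>m]) (auto simp: has_weak_deriv_def compact_imp_closed)
    fix \<phi> i assume t: "\<phi> \<in> test_functions \<Omega>"
    note t' = test_function_partial_deriv[OF t, of i]
    have "(LINT x|lebesgue_on \<Omega>. u x * iter_partial_deriv js (partial_deriv i \<phi>) x) = (- 1) ^ length js * (LINT x|lebesgue_on \<Omega>. w js x * partial_deriv i \<phi> x)"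
      using w(2)[OF jl(1)] t' by (simp add: has_weak_deriv_def)
    moreover have "(LINT x|lebesgue_on \<Omega>. u x * iter_partial_deriv (js @ [i]) \<phi> x) = (- 1) ^ length (js @ [i]) * (LINT x|lebesgue_on \<Omega>. w (js @ [i]) x * \<phi> x)"
      using w(2)[OF jl(2)] t by (simp add: has_weak_deriv_def)
    ultimately have "(- 1) ^ length js * (LINT x|lebesgue_on \<Omega>. w js x * partial_deriv i \<phi> x) = (- 1) ^ length js * - (LINT x|lebesgue_on \<Omega>. w (js @ [i]) x * \<phi> x)"
      by (simp add: iter_partial_deriv_append)
    then have "(LINT x|lebesgue_on \<Omega>. w js x * partial_deriv i \<phi> x) = - (LINT x|lebesgue_on \<Omega>. w (js @ [i]) x * \<phi> x)"
      by (subst (asm) mult_cancel_left) auto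
    then show "(LINT x|lborel. W js x * partial_deriv i \<phi> x) = - (LINT x|lborel. W (js @ [i]) x * \<phi> x)"
      by (simp add: rep_integral[OF W[OF jl(1)] \<Omega>m test_function_measurable[OF t']] rep_integral[OF W[OF jl(2)] \<Omega>m test_function_measurable[OF t]])
  qed
  have fm [measurable]: "f k \<in> borel_measurable borel" for k unfolding f_def by measurable
  have fnn: "0 \<le> f k x" for k x unfolding f_def by (intro sum_nonneg) auto
  have chain: "gradient_chain \<Omega> r f"
    unfolding gradient_chain_def
  proof (intro conjI allI impI fm fnn)
    show "f k x = 0" if "x \<notin> \<Omega>" for k x using Wz[OF that] by (simp add: f_def)
    fix k assume k: "k < r"
    show "gradient_bound \<Omega> (f k) (f (Suc k))"
      unfolding gradient_bound_def
    proof
      fix h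
      have "AE y in lborel. \<forall>js\<in>{js. length js = k}. y \<in> segment_in \<Omega> h \<longrightarrow> ennreal (norm (W js (y + h) - W js y)) \<le>
        ennreal (norm h) * (\<integral>\<^sup>+s. indicator {0..1} s * ennreal (\<Sum>i\<in>UNIV. norm (W (js @ [i]) (y + s *\<^sub>R h))) \<partial>lborel)"
        by (subst AE_ball_countable[OF countable_finite[OF fin]], intro ballI inc) (use k in simp)
      then show "AE y in lborel. y \<in> segment_in \<Omega> h \<longrightarrow> ennreal \<bar>f k (y + h) - f k y\<bar> \<le>
        ennreal (norm h) * (\<integral>\<^sup>+s. indicator {0..1} s * ennreal (f (Suc k) (y + s *\<^sub>R h)) \<partial>lborel)"
      proof (rule eventually_mono, intro impI)
        fix y
        assume *: "\<forall>js\<in>{js. length js = k}. y \<in> segment_in \<Omega> h \<longrightarrow> ennreal (norm (W js (y + h) - W js y)) \<le>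
          ennreal (norm h) * (\<integral>\<^sup>+s. indicator {0..1} s * ennreal (\<Sum>i\<in>UNIV. norm (W (js @ [i]) (y + s *\<^sub>R h))) \<partial>lborel)"
          and y: "y \<in> segment_in \<Omega> h"
        have "\<bar>f k (y + h) - f k y\<bar> = \<bar>\<Sum>js | length js = k. norm (W js (y + h)) - norm (W js y)\<bar>"
          by (simp add: f_def sum_subtractf)
        \<comment> \<open>Passing to norms does not enlarge increments, so sums of norms of
          derivatives still obey a gradient bound.\<close>
        also have "\<dots> \<le> (\<Sum>js | length js = k. norm (W js (y + h) - W js y))"
          by (intro order_trans[OF sum_abs] sum_mono norm_triangle_ineq3)
        finally have "ennreal \<bar>f k (y + h) - f k y\<bar> \<le> (\<Sum>js | length js = k. ennreal (norm (W js (y + h) - W js y)))"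
          by (subst sum_ennreal) (auto intro: ennreal_leI)
        also have "\<dots> \<le> (\<Sum>js | length js = k. ennreal (norm h) * (\<integral>\<^sup>+s. indicator {0..1} s * ennreal (\<Sum>i\<in>UNIV. norm (W (js @ [i]) (y + s *\<^sub>R h))) \<partial>lborel))"
          using * y by (intro sum_mono) auto
        also have "\<dots> = ennreal (norm h) * (\<integral>\<^sup>+s. (\<Sum>js | length js = k. indicator {0..1} s * ennreal (\<Sum>i\<in>UNIV. norm (W (js @ [i]) (y + s *\<^sub>R h)))) \<partial>lborel)"
          by (subst nn_integral_sum) (auto simp: sum_distrib_left)
        also have "(\<integral>\<^sup>+s. (\<Sum>js | length js = k. indicator {0..1} s * ennreal (\<Sum>i\<in>UNIV. norm (W (js @ [i]) (y + s *\<^sub>R h)))) \<partial>lborel) =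
          (\<integral>\<^sup>+s. indicator {0..1} s * ennreal (f (Suc k) (y + s *\<^sub>R h)) \<partial>lborel)"
          by (intro nn_integral_cong) (auto simp: fSuc sum_ennreal sum_nonneg simp flip: sum_distrib_left)
        finally show "ennreal \<bar>f k (y + h) - f k y\<bar> \<le>
          ennreal (norm h) * (\<integral>\<^sup>+s. indicator {0..1} s * ennreal (f (Suc k) (y + s *\<^sub>R h)) \<partial>lborel)" .
      qed
    qed
  qed
  have norm: "(\<Sum>k\<le>r. \<integral>\<^sup>+x. ennreal (f k x powr p) \<partial>lborel) \<le> ennreal (2 powr p * D powr (p - 1) * sobolev_norm r p \<Omega> u powr p)"
  proof -
    let ?c = "2 powr p * D powr (p - 1)"
    have one: "(\<integral>\<^sup>+x. ennreal (f k x powr p) \<partial>lborel) \<le> ennreal ?c * (\<Sum>js | length js = k. \<integral>\<^sup>+x. ennreal (norm (W js x) powr p) \<partial>lborel)"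
      if k: "k \<le> r" for k
    proof -
      have "(\<integral>\<^sup>+x. ennreal (f k x powr p) \<partial>lborel) \<le> (\<integral>\<^sup>+x. ennreal ?c * (\<Sum>js | length js = k. ennreal (norm (W js x) powr p)) \<partial>lborel)"
      proof (intro nn_integral_mono)
        fix x
        have ne: "{js :: 'n list. length js = k} \<noteq> {}" using Ex_list_of_length[of k] by auto
        have "card {js :: 'n list. length js = k} \<le> card ?I" using k by (intro card_mono finite_lists_le) auto
        then have cD: "real (card {js :: 'n list. length js = k}) \<le> D" by (simp add: D_def)
        have "f k x powr p \<le> 2 powr p * real (card {js :: 'n list. length js = k}) powr (p - 1) * (\<Sum>js | length js = k. norm (W js x) powr p)"
          unfolding f_def by (rule powr_sum_le[OF fin ne]) (use p in auto)
        also have "\<dots> \<le> ?c * (\<Sum>js | length js = k. norm (W js x) powr p)"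
          using cD p by (intro mult_right_mono mult_left_mono powr_mono2 sum_nonneg) auto
        finally have "ennreal (f k x powr p) \<le> ennreal (?c * (\<Sum>js | length js = k. norm (W js x) powr p))" by (rule ennreal_leI)
        then show "ennreal (f k x powr p) \<le> ennreal ?c * (\<Sum>js | length js = k. ennreal (norm (W js x) powr p))"
          by (simp add: ennreal_mult sum_nonneg)
      qed
      also have "\<dots> = ennreal ?c * (\<Sum>js | length js = k. \<integral>\<^sup>+x. ennreal (norm (W js x) powr p) \<partial>lborel)"
        by (subst nn_integral_cmult, measurable, subst nn_integral_sum) auto
      finally show ?thesis .
    qed
    have Wn: "(\<integral>\<^sup>+x. ennreal (norm (W js x) powr p) \<partial>lborel) = ennreal (Lp_norm p \<Omega> (w js) powr p)" if "length js \<le> r" for js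
      by (simp add: rep_nn_integral'[OF W[OF that] \<Omega>m, symmetric] Lp_norm_powr[OF w(1)[OF that] p])
    have "(\<Sum>k\<le>r. \<integral>\<^sup>+x. ennreal (f k x powr p) \<partial>lborel) \<le> (\<Sum>k\<le>r. ennreal ?c * (\<Sum>js | length js = k. \<integral>\<^sup>+x. ennreal (norm (W js x) powr p) \<partial>lborel))"
      by (intro sum_mono one) simp
    also have "\<dots> = ennreal ?c * (\<Sum>k\<le>r. \<Sum>js | length js = k. \<integral>\<^sup>+x. ennreal (norm (W js x) powr p) \<partial>lborel)"
      by (simp add: sum_distrib_left)
    also have "(\<Sum>k\<le>r. \<Sum>js | length js = k. \<integral>\<^sup>+x. ennreal (norm (W js x) powr p) \<partial>lborel) = (\<Sum>js\<in>?I. \<integral>\<^sup>+x. ennreal (norm (W js x) powr p) \<partial>lborel)"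
    proof -
      have "(\<Sum>k\<le>r. \<Sum>js | js \<in> ?I \<and> length js = k. \<integral>\<^sup>+x. ennreal (norm (W js x) powr p) \<partial>lborel) = (\<Sum>js\<in>?I. \<integral>\<^sup>+x. ennreal (norm (W js x) powr p) \<partial>lborel)"
        by (rule sum.group[OF finite_lists_le]) auto
      moreover have "{js. js \<in> ?I \<and> length js = k} = {js. length js = k}" if "k \<le> r" for k using that by auto
      ultimately show ?thesis by simp
    qed
    also have "\<dots> = (\<Sum>js\<in>?I. ennreal (Lp_norm p \<Omega> (w js) powr p))" by (intro sum.cong) (auto simp: Wn)
    also have "\<dots> = ennreal (\<Sum>js\<in>?I. Lp_norm p \<Omega> (w js) powr p)" by (rule sum_ennreal) simp
    also have "(\<Sum>js\<in>?I. Lp_norm p \<Omega> (w js) powr p) = sobolev_norm r p \<Omega> u powr p"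
      using p by (simp add: sobolev_norm_def w_def powr_powr sum_nonneg)
    finally show ?thesis by (simp add: ennreal_mult)
  qed
  have V1: "is_rep \<Omega> u (W [])"
  proof (rule rep_of_weak_deriv_Nil[OF \<Omega> _ W])
    show "u \<in> borel_measurable (lebesgue_on \<Omega>)" using u by (auto simp: sobolev_def Lp_iff)
    show "has_weak_deriv \<Omega> [] u (w [])" by (rule w(2)) simp
  qed simp
  have V2: "AE y in lborel. y \<in> segment_in \<Omega> h \<longrightarrow> ennreal (norm (W [] (y + h) - W [] y)) \<le>
      ennreal (norm h) * (\<integral>\<^sup>+s. indicator {0..1} s * ennreal (f 1 (y + s *\<^sub>R h)) \<partial>lborel)" for h
  proof -
    have "f 1 x = (\<Sum>i\<in>UNIV. norm (W ([] @ [i]) x))" for x using fSuc[of 0 x] by simp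
    then show ?thesis using inc[of "[]" h] r by simp
  qed
  show ?thesis
    by (rule exI[of _ "W []"], rule exI[of _ f]) (intro conjI allI V1 chain f0 norm V2)
qed

subsection \<open>Morrey spaces and multiplication operators\<close>

text \<open>A finite net of mesh \<open>sin \<theta> / 2\<close> on the unit sphere contains a
  direction \<open>e\<close> close to the axis of the cone at \<open>x\<close>, and the ball of
  radius \<open>sin \<theta> / 2\<close> about \<open>e\<close> still lies in that cone. Scaling by
  \<open>d/2\<close> keeps the increments shorter than \<open>d\<close>, since points of this ball
  have norm below 2.\<close>

lemma cone_domain_of_cone_condition:
  fixes \<Omega> :: "(real^'n) set"
  assumes d: "0 < d" and \<Omega>: "open \<Omega>" and cone: "cone_condition d \<Omega>"
  shows "\<exists>J a. cone_domain \<Omega> J a d"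
proof -
  obtain \<theta> where \<theta>: "0 < \<theta>" "\<theta> < pi / 2"
    and C: "\<And>x. x \<in> \<Omega> \<Longrightarrow> \<exists>C. is_open_cone \<theta> x C \<and> (\<forall>\<rho>\<in>{0<..d}. closure (C \<inter> ball x \<rho>) \<subseteq> \<Omega>)"
    using cone unfolding cone_condition_def by blast
  \<comment> \<open>Half of the sine is spent on the distance from the axis to the net, the other
    half on the ball of increments.\<close>
  define \<delta> where "\<delta> = sin \<theta> / 2"
  have \<delta>: "0 < \<delta>" "\<delta> < 1"
    unfolding \<delta>_def using \<theta> sin_gt_zero[of \<theta>] sin_le_one[of \<theta>] by linarith+
  obtain E where E: "finite E" "E \<subseteq> sphere (0::real^'n) 1" "sphere 0 1 \<subseteq> (\<Union>e\<in>E. ball e \<delta>)"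
    using seq_compact_imp_totally_bounded[of "sphere (0::real^'n) 1"] compact_sphere[of "0::real^'n" 1] \<delta>(1)
    by (auto simp: compact_eq_seq_compact_metric)
  have "cone_domain \<Omega> ((\<lambda>e. (d/2) *\<^sub>R e) ` E) (\<delta> * d / 2) d"
  proof
    fix c assume "c \<in> (\<lambda>e. (d/2) *\<^sub>R e) ` E"
    then have c: "norm c = d / 2" using E(2) d by auto
    show "\<delta> * d / 2 < norm c" using \<delta> d by (simp add: c)
    have "\<delta> * d \<le> d" using \<delta> d by simp
    then show "norm c + \<delta> * d / 2 \<le> d" by (simp add: c)
  next
    fix x assume x: "x \<in> \<Omega>"
    obtain C where "is_open_cone \<theta> x C" and sub: "closure (C \<inter> ball x d) \<subseteq> \<Omega>"
      using C[OF x] d by fastforce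
    then obtain a z where a: "0 < a" "a < norm (z - x)" "sin \<theta> = a / norm (z - x)"
      and Ceq: "C = {x + l *\<^sub>R (y - x) | l y. 0 < l \<and> norm (y - z) < a}"
      unfolding is_open_cone_def by blast
    define e0 where "e0 = (z - x) /\<^sub>R norm (z - x)"
    have "z \<noteq> x" using a by auto
    then have "e0 \<in> sphere 0 1" by (simp add: e0_def)
    then obtain e where e: "e \<in> E" "dist e e0 < \<delta>" using E(3) by auto
    have "x \<in> segment_in \<Omega> h" if h: "h \<in> cball ((d/2) *\<^sub>R e) (\<delta> * d / 2)" for h
      unfolding segment_in_def
    proof (intro CollectI ballI)
      fix s :: real assume s: "s \<in> {0..1}"
      define w where "w = (2/d) *\<^sub>R h"
      have hw: "h = (d/2) *\<^sub>R w" using d by (simp add: w_def)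
      have "norm ((d/2) *\<^sub>R (w - e)) \<le> \<delta> * d / 2"
        using h by (simp add: hw dist_norm norm_minus_commute scaleR_diff_right)
      then have "(d/2) * norm (w - e) \<le> (d/2) * \<delta>" using d by (simp add: mult.commute)
      then have we: "norm (w - e) \<le> \<delta>" using d by simp
      have "norm (w - e0) \<le> norm (w - e) + norm (e - e0)" using norm_triangle_ineq[of "w - e" "e - e0"] by simp
      then have "norm (w - e0) < 2 * \<delta>" using we e(2) by (simp add: dist_norm)
      then have we0: "norm (w - e0) < a / norm (z - x)" by (simp add: \<delta>_def a(3))
      have zx: "0 < norm (z - x)" by (rule order.strict_trans[OF a(1,2)])
      have "norm e = 1" using E(2) e(1) by auto
      then have "norm w \<le> 1 + \<delta>" using we norm_triangle_ineq[of e "w - e"] by simp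
      then have w2: "norm w < 2" using \<delta> by simp
      show "x + s *\<^sub>R h \<in> \<Omega>"
      proof (cases "s = 0")
        case False
        then have s0: "0 < s" using s by simp
        \<comment> \<open>The point on the ray through \<open>w\<close> at the scale of the ball
          that generates the cone: its distance from \<open>z\<close> is
          \<open>norm (z - x) * norm (w - e0)\<close>, hence below \<open>a\<close>.\<close>
        define y where "y = x + norm (z - x) *\<^sub>R w"
        have "y - z = norm (z - x) *\<^sub>R (w - e0)" using zx by (simp add: y_def e0_def scaleR_diff_right)
        then have "norm (y - z) = norm (z - x) * norm (w - e0)" by simp
        also have "\<dots> < norm (z - x) * (a / norm (z - x))" using we0 zx by (rule mult_strict_left_mono)
        finally have "norm (y - z) < a" using zx by simp
        moreover have "x + s *\<^sub>R h = x + (s * (d/2) / norm (z - x)) *\<^sub>R (y - x)"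
          using zx by (simp add: y_def hw)
        moreover have "0 < s * (d/2) / norm (z - x)" using s0 d zx by simp
        ultimately have "x + s *\<^sub>R h \<in> C" unfolding Ceq by blast
        moreover have "x + s *\<^sub>R h \<in> ball x d"
        proof -
          have "norm (s *\<^sub>R h) = s * ((d/2) * norm w)" using s0 d by (simp add: hw)
          also have "\<dots> \<le> 1 * ((d/2) * norm w)" using s d by (intro mult_right_mono) auto
          also have "\<dots> < d" using w2 d by simp
          finally show ?thesis by (simp add: dist_norm)
        qed
        ultimately show ?thesis using sub closure_subset[of "C \<inter> ball x d"] by blast
      qed (use x in simp)
    qed
    then show "\<exists>c\<in>(\<lambda>e. (d/2) *\<^sub>R e) ` E. \<forall>h\<in>cball c (\<delta> * d / 2). x \<in> segment_in \<Omega> h"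
      using e(1) by (intro bexI[of _ "(d/2) *\<^sub>R e"]) auto
  qed (use \<Omega> E(1) \<delta> d in auto)
  then show ?thesis by blast
qed

section \<open>Morrey norms on balls of radius \<open>d\<close>\<close>

lemma morrey_measurable:
  fixes g :: "real^'n \<Rightarrow> complex"
  assumes \<Omega>: "open \<Omega>" and g: "g \<in> morrey d q \<sigma> \<Omega>"
  shows "g \<in> borel_measurable (lebesgue_on \<Omega>)"
proof -
  \<comment> \<open>Membership in the Morrey space gives measurability only on balls; the balls
    about 0 exhaust the domain and \<open>g\<close> is a pointwise limit.\<close>
  have m: "(\<lambda>x. if x \<in> \<Omega> \<inter> ball 0 (real k) then g x else 0) \<in> borel_measurable lebesgue" for k
    using g \<Omega> by (intro borel_measurable_if_I) (auto simp: morrey_def Lp_iff)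
  have "(\<lambda>x. if x \<in> \<Omega> then g x else 0) \<in> borel_measurable lebesgue"
  proof (rule borel_measurable_LIMSEQ_metric[OF m])
    fix x :: "real^'n"
    obtain k where k: "norm x < real k" using reals_Archimedean2 by blast
    have "\<forall>\<^sub>F k in sequentially. (if x \<in> \<Omega> \<inter> ball 0 (real k) then g x else 0) = (if x \<in> \<Omega> then g x else 0)"
      using eventually_ge_at_top[of k] by (rule eventually_mono) (use k in auto)
    then show "(\<lambda>k. if x \<in> \<Omega> \<inter> ball 0 (real k) then g x else 0) \<longlonglongrightarrow> (if x \<in> \<Omega> then g x else 0)"
      by (rule tendsto_eventually)
  qed
  then show ?thesis by (rule borel_measurable_if_D)
qed

lemma morrey_norm_eq: "g \<in> morrey d q \<sigma> \<Omega> \<Longrightarrow> morrey_enorm d q \<sigma> \<Omega> g = ennreal (morrey_norm d q \<sigma> \<Omega> g)"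
  by (simp add: morrey_def morrey_norm_def)

lemma morrey_norm_nonneg: "0 \<le> morrey_norm d q \<sigma> \<Omega> g"
  by (simp add: morrey_norm_def)

text \<open>Only the radius \<open>\<rho> = d\<close> of the supremum is taken, so the exponent
  \<open>\<sigma>\<close> enters through a fixed power of \<open>d\<close>.\<close>

lemma morrey_local_bound:
  fixes g :: "real^'n \<Rightarrow> complex"
  assumes g: "g \<in> morrey d q \<sigma> \<Omega>" and q: "1 \<le> q" and d: "0 < d" and x: "x \<in> \<Omega>"
    and m: "morrey_norm d q \<sigma> \<Omega> g \<le> m"
  shows "(\<integral>\<^sup>+y. ennreal (norm (g y) powr q) \<partial>lebesgue_on (\<Omega> \<inter> ball x d)) \<le>
    ennreal ((m * d powr (real CARD('n) / q - \<sigma>)) powr q)"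
proof -
  let ?S = "\<Omega> \<inter> ball x d"
  have gL: "g \<in> Lp q ?S" using g by (simp add: morrey_def)
  have "ennreal (d powr (\<sigma> - real CARD('n) / q) * Lp_norm q ?S g) \<le> morrey_enorm d q \<sigma> \<Omega> g"
    unfolding morrey_enorm_def by (rule SUP_upper2[of "(x, d)"]) (use x d in auto)
  also have "\<dots> \<le> ennreal m" using m by (simp add: morrey_norm_eq[OF g] ennreal_leI)
  finally have le: "d powr (\<sigma> - real CARD('n) / q) * Lp_norm q ?S g \<le> m"
    using m morrey_norm_nonneg[of d q \<sigma> \<Omega> g] by (simp add: ennreal_le_iff)
  have "d powr (real CARD('n) / q - \<sigma>) * (d powr (\<sigma> - real CARD('n) / q) * Lp_norm q ?S g) \<le> d powr (real CARD('n) / q - \<sigma>) * m"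
    by (intro mult_left_mono le) simp
  moreover have "d powr (real CARD('n) / q - \<sigma>) * d powr (\<sigma> - real CARD('n) / q) = 1"
    using d by (simp flip: powr_add)
  ultimately have "Lp_norm q ?S g \<le> m * d powr (real CARD('n) / q - \<sigma>)"
    by (simp add: mult.assoc[symmetric] mult.commute[of m])
  then show ?thesis
    unfolding Lp_norm_powr[OF gL q, symmetric] using q Lp_norm_nonneg by (intro ennreal_leI powr_mono2) auto
qed

text \<open>Formulated for extended norms of locally integrable functions, so that it can also prove
  that a difference has finite norm.\<close>

lemma morrey_enorm_triangle:
  fixes f g h :: "real^'n \<Rightarrow> complex"
  assumes q: "1 \<le> q" and L: "\<And>x R. f \<in> Lp q (\<Omega> \<inter> ball x R)" "\<And>x R. g \<in> Lp q (\<Omega> \<inter> ball x R)" "\<And>x R. h \<in> Lp q (\<Omega> \<inter> ball x R)"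
  shows "morrey_enorm d q \<sigma> \<Omega> (f - h) \<le> 2 * (morrey_enorm d q \<sigma> \<Omega> (f - g) + morrey_enorm d q \<sigma> \<Omega> (g - h))"
  unfolding morrey_enorm_def[of d q \<sigma> \<Omega> "f - h"]
proof (rule SUP_least, clarify)
  fix x \<rho> assume x: "x \<in> \<Omega>" "\<rho> \<in> {0<..d}"
  let ?S = "\<Omega> \<inter> ball x \<rho>" and ?c = "\<rho> powr (\<sigma> - real CARD('n) / q)"
  have up: "ennreal (?c * Lp_norm q ?S k) \<le> morrey_enorm d q \<sigma> \<Omega> k" for k
    unfolding morrey_enorm_def by (rule SUP_upper2[of "(x, \<rho>)"]) (use x in auto)
  have "Lp_norm q ?S (f - h) \<le> 2 * (Lp_norm q ?S (f - g) + Lp_norm q ?S (g - h))"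
    by (rule quasi_seminorm.triangle[OF Lp_quasi_seminorm[OF q] L])
  then have "?c * Lp_norm q ?S (f - h) \<le> ?c * (2 * (Lp_norm q ?S (f - g) + Lp_norm q ?S (g - h)))"
    by (intro mult_left_mono) auto
  then have "ennreal (?c * Lp_norm q ?S (f - h)) \<le> ennreal (2 * (?c * Lp_norm q ?S (f - g) + ?c * Lp_norm q ?S (g - h)))"
    by (intro ennreal_leI) (simp add: algebra_simps)
  also have "\<dots> = 2 * (ennreal (?c * Lp_norm q ?S (f - g)) + ennreal (?c * Lp_norm q ?S (g - h)))"
    by (simp add: ennreal_mult ennreal_plus Lp_norm_nonneg del: ennreal_plus[symmetric])
  also have "\<dots> \<le> 2 * (morrey_enorm d q \<sigma> \<Omega> (f - g) + morrey_enorm d q \<sigma> \<Omega> (g - h))"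
    by (intro mult_left_mono add_mono up) auto
  finally show "ennreal (?c * Lp_norm q ?S (f - h)) \<le> 2 * (morrey_enorm d q \<sigma> \<Omega> (f - g) + morrey_enorm d q \<sigma> \<Omega> (g - h))" .
qed

lemma morrey_enorm_minus: "morrey_enorm d q \<sigma> \<Omega> (f - g) = morrey_enorm d q \<sigma> \<Omega> (g - f)"
  by (simp add: morrey_enorm_def Lp_norm_def norm_minus_commute)

lemma morrey_diff:
  fixes f g :: "real^'n \<Rightarrow> complex"
  assumes q: "1 \<le> q" and f: "f \<in> morrey d q \<sigma> \<Omega>" and g: "g \<in> morrey d q \<sigma> \<Omega>"
  shows "f - g \<in> morrey d q \<sigma> \<Omega>"
proof -
  let ?z = "(\<lambda>_. 0) :: real^'n \<Rightarrow> complex"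
  have L: "f \<in> Lp q (\<Omega> \<inter> ball x R)" "g \<in> Lp q (\<Omega> \<inter> ball x R)" "?z \<in> Lp q (\<Omega> \<inter> ball x R)" for x R
    using f g by (auto simp: morrey_def Lp_def)
  have z: "f - ?z = f" "g - ?z = g" by auto
  have "morrey_enorm d q \<sigma> \<Omega> (f - g) \<le> 2 * (morrey_enorm d q \<sigma> \<Omega> (f - ?z) + morrey_enorm d q \<sigma> \<Omega> (?z - g))"
    by (rule morrey_enorm_triangle[OF q L(1) L(3) L(2)])
  also have "\<dots> = 2 * (morrey_enorm d q \<sigma> \<Omega> f + morrey_enorm d q \<sigma> \<Omega> g)"
    unfolding morrey_enorm_minus[of d q \<sigma> \<Omega> ?z g] z by (rule refl)
  also have "\<dots> < \<infinity>" using f g by (auto simp: morrey_def ennreal_mult_less_top)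
  finally show ?thesis using Lp_diff[OF L(1,2) q] by (simp add: morrey_def)
qed

lemma morrey_quasi_seminorm:
  assumes q: "1 \<le> q"
  shows "quasi_seminorm (morrey d q \<sigma> \<Omega>) (morrey_norm d q \<sigma> \<Omega>) 2"
proof
  show "morrey_norm d q \<sigma> \<Omega> (f - g) = morrey_norm d q \<sigma> \<Omega> (g - f)" for f g
    by (simp add: morrey_norm_def morrey_enorm_minus)
  show "morrey_norm d q \<sigma> \<Omega> (f - f) = 0" if "f \<in> morrey d q \<sigma> \<Omega>" for f
  proof -
    have "morrey_enorm d q \<sigma> \<Omega> (f - f) \<le> 0"
      unfolding morrey_enorm_def by (rule SUP_least) (use q in \<open>auto simp: Lp_norm_def\<close>)
    then show ?thesis by (simp add: morrey_norm_def)
  qed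
  fix f g h assume m: "f \<in> morrey d q \<sigma> \<Omega>" "g \<in> morrey d q \<sigma> \<Omega>" "h \<in> morrey d q \<sigma> \<Omega>"
  have "morrey_enorm d q \<sigma> \<Omega> (f - h) \<le> 2 * (morrey_enorm d q \<sigma> \<Omega> (f - g) + morrey_enorm d q \<sigma> \<Omega> (g - h))"
    using m by (intro morrey_enorm_triangle[OF q]) (auto simp: morrey_def)
  then have "ennreal (morrey_norm d q \<sigma> \<Omega> (f - h)) \<le> ennreal (2 * (morrey_norm d q \<sigma> \<Omega> (f - g) + morrey_norm d q \<sigma> \<Omega> (g - h)))"
    using m by (simp add: morrey_norm_eq morrey_diff[OF q] ennreal_mult ennreal_plus morrey_norm_nonneg del: ennreal_plus[symmetric])
  then show "morrey_norm d q \<sigma> \<Omega> (f - h) \<le> 2 * (morrey_norm d q \<sigma> \<Omega> (f - g) + morrey_norm d q \<sigma> \<Omega> (g - h))"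
    using morrey_norm_nonneg[of d q \<sigma> \<Omega>] by (subst (asm) ennreal_le_iff) (auto intro!: add_nonneg_nonneg)
qed simp

text \<open>\<open>weighted_embedding\<close> carried over from Borel representatives to the
  functions themselves. The constant does not depend on \<open>h\<close>, so the bound can be
  applied to the difference of \<open>g\<close> and a test function.\<close>

lemma sobolev_multiplication_bound:
  fixes \<Omega> :: "(real^'n) set" and p q d :: real
  assumes d: "0 < d" and \<Omega>: "open \<Omega>" and cone: "cone_condition d \<Omega>" and r: "1 \<le> r" and p: "1 \<le> p" "p \<le> q"
    and qr: "real CARD('n) / real r \<le> q" "real CARD('n) / real r = p \<Longrightarrow> 1 < p \<Longrightarrow> real CARD('n) / real r < q"
  shows "\<exists>C\<ge>0. \<forall>u\<in>sobolev r p \<Omega>. \<forall>(h :: real^'n \<Rightarrow> complex) K. h \<in> borel_measurable (lebesgue_on \<Omega>) \<longrightarrow> 0 < K \<longrightarrow>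
    (\<forall>x\<in>\<Omega>. (\<integral>\<^sup>+y. ennreal (norm (h y) powr q) \<partial>lebesgue_on (\<Omega> \<inter> ball x d)) \<le> ennreal (K powr q)) \<longrightarrow>
    (\<integral>\<^sup>+x. ennreal (norm (h x * u x) powr p) \<partial>lebesgue_on \<Omega>) \<le> ennreal (C * K powr p * sobolev_norm r p \<Omega> u powr p)"
proof -
  have \<Omega>m: "\<Omega> \<in> sets borel" using \<Omega> by simp
  obtain J a where J: "cone_domain \<Omega> J a d" using cone_domain_of_cone_condition[OF d \<Omega> cone] by blast
  have dim: "real DIM(real^'n) = real CARD('n)" by simp
  obtain C where C: "0 \<le> C" and C': "\<And>f G K. gradient_chain \<Omega> r f \<Longrightarrow> G \<in> borel_measurable borel \<Longrightarrow> (\<forall>x. 0 \<le> G x) \<Longrightarrow> 0 < K \<Longrightarrow>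
     (\<forall>x\<in>\<Omega>. (\<integral>\<^sup>+y. indicator (\<Omega> \<inter> ball x d) y * ennreal (G y powr q) \<partial>lborel) \<le> ennreal (K powr q)) \<Longrightarrow>
     (\<integral>\<^sup>+x. ennreal ((G x * f 0 x) powr p) \<partial>lborel)
       \<le> ennreal (C * K powr p) * (\<Sum>k\<le>r. \<integral>\<^sup>+x. ennreal (f k x powr p) \<partial>lborel)"
    using cone_domain.weighted_embedding[OF J p r] qr unfolding dim by blast
  define D where "D = 2 powr p * real (card {js :: 'n list. length js \<le> r}) powr (p - 1)"
  show ?thesis
  proof (intro exI[of _ "C * D"] conjI ballI allI impI)
    show "0 \<le> C * D" using C by (simp add: D_def)
    fix u h :: "real^'n \<Rightarrow> complex" and K :: real
    assume u: "u \<in> sobolev r p \<Omega>" and h: "h \<in> borel_measurable (lebesgue_on \<Omega>)" and K: "0 < K"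
      and hK: "\<forall>x\<in>\<Omega>. (\<integral>\<^sup>+y. ennreal (norm (h y) powr q) \<partial>lebesgue_on (\<Omega> \<inter> ball x d)) \<le> ennreal (K powr q)"
    obtain V f where V: "is_rep \<Omega> u V" and ch: "gradient_chain \<Omega> r f" and f0: "f 0 = (\<lambda>x. norm (V x))"
      and sum: "(\<Sum>k\<le>r. \<integral>\<^sup>+x. ennreal (f k x powr p) \<partial>lborel) \<le> ennreal (D * sobolev_norm r p \<Omega> u powr p)"
      using sobolev_gradient_chain[OF \<Omega> p(1) r u] unfolding D_def by (elim exE conjE)
    obtain H where H: "is_rep \<Omega> h H" using ex_rep[OF \<Omega>m h] by blast
    have Hm [measurable]: "H \<in> borel_measurable borel" using H by (simp add: is_rep_def)
    have HK: "\<forall>x\<in>\<Omega>. (\<integral>\<^sup>+y. indicator (\<Omega> \<inter> ball x d) y * ennreal (norm (H y) powr q) \<partial>lborel) \<le> ennreal (K powr q)"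
    proof
      fix x assume x: "x \<in> \<Omega>"
      have "\<Omega> \<inter> ball x d \<in> sets borel" using \<Omega>m by simp
      from rep_nn_integral[OF H this Int_lower1, of q]
      show "(\<integral>\<^sup>+y. indicator (\<Omega> \<inter> ball x d) y * ennreal (norm (H y) powr q) \<partial>lborel) \<le> ennreal (K powr q)"
        using bspec[OF hK x] by (rule ord_eq_le_trans[OF sym])
    qed
    have "(\<integral>\<^sup>+x. ennreal (norm (h x * u x) powr p) \<partial>lebesgue_on \<Omega>) = (\<integral>\<^sup>+x. ennreal (norm (H x * V x) powr p) \<partial>lborel)"
      by (rule rep_nn_integral'[OF rep_mult[OF H V] \<Omega>m])
    also have "\<dots> = (\<integral>\<^sup>+x. ennreal ((norm (H x) * f 0 x) powr p) \<partial>lborel)" by (simp add: f0 norm_mult)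
    also have "\<dots> \<le> ennreal (C * K powr p) * (\<Sum>k\<le>r. \<integral>\<^sup>+x. ennreal (f k x powr p) \<partial>lborel)"
      by (rule C'[OF ch _ _ K HK]) auto
    also have "\<dots> \<le> ennreal (C * K powr p) * ennreal (D * sobolev_norm r p \<Omega> u powr p)"
      by (intro mult_left_mono sum) simp
    also have "\<dots> = ennreal (C * D * K powr p * sobolev_norm r p \<Omega> u powr p)"
      using C by (subst ennreal_mult[symmetric]) (auto simp: D_def mult_ac)
    finally show "(\<integral>\<^sup>+x. ennreal (norm (h x * u x) powr p) \<partial>lebesgue_on \<Omega>) \<le> ennreal (C * D * K powr p * sobolev_norm r p \<Omega> u powr p)" .
  qed
qed

section \<open>Rellich compactness for multiplication by a test function\<close>

lemma rep_diff:
  assumes "is_rep S f F" "is_rep S g G"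
  shows "is_rep S (\<lambda>x. f x - g x) (\<lambda>x. F x - G x)"
proof -
  have [measurable]: "f \<in> borel_measurable (lebesgue_on S)" "g \<in> borel_measurable (lebesgue_on S)"
      "F \<in> borel_measurable borel" "G \<in> borel_measurable borel"
    and ae: "AE x in lborel. x \<in> S \<longrightarrow> F x = f x" "AE x in lborel. x \<in> S \<longrightarrow> G x = g x"
    and z: "\<And>x. x \<notin> S \<Longrightarrow> F x = 0" "\<And>x. x \<notin> S \<Longrightarrow> G x = 0"
    using assms by (simp_all add: is_rep_def)
  have "AE x in lborel. x \<in> S \<longrightarrow> F x - G x = f x - g x"
    using ae by eventually_elim simp
  moreover have "(\<lambda>x. f x - g x) \<in> borel_measurable (lebesgue_on S)" "(\<lambda>x. F x - G x) \<in> borel_measurable borel"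
    by measurable
  ultimately show ?thesis using z by (simp add: is_rep_def)
qed

text \<open>The increment bound raised to the power \<open>p\<close> on each segment and integrated
  over the starting points: translation invariance makes every \<open>s\<close> contribute the same
  integral of \<open>f powr p\<close>.\<close>

lemma increment_powr_integral_le:
  fixes V :: "'a::euclidean_space \<Rightarrow> complex"
  assumes \<Omega>: "open \<Omega>" and p: "1 \<le> p" and V [measurable]: "V \<in> borel_measurable borel"
    and f [measurable]: "f \<in> borel_measurable borel" and f0: "\<And>x. 0 \<le> f x"
    and inc: "AE y in lborel. y \<in> segment_in \<Omega> h \<longrightarrow> ennreal (norm (V (y + h) - V y)) \<le>
      ennreal (norm h) * (\<integral>\<^sup>+s. indicator {0..1} s * ennreal (f (y + s *\<^sub>R h)) \<partial>lborel)"
  shows "(\<integral>\<^sup>+y. indicator (segment_in \<Omega> h) y * ennreal (norm (V (y + h) - V y) powr p) \<partial>lborel) \<le>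
    ennreal (2 powr p * norm h powr p) * (\<integral>\<^sup>+x. ennreal (f x powr p) \<partial>lborel)"
proof -
  have [measurable]: "segment_in \<Omega> h \<in> sets borel" using open_segment_in[OF \<Omega>] by simp
  have "(\<integral>\<^sup>+y. indicator (segment_in \<Omega> h) y * ennreal (norm (V (y + h) - V y) powr p) \<partial>lborel) \<le>
    (\<integral>\<^sup>+y. ennreal (2 powr p * norm h powr p) * (\<integral>\<^sup>+s. indicator {0..1} s * ennreal (f (y + s *\<^sub>R h) powr p) \<partial>lborel) \<partial>lborel)"
  proof (rule nn_integral_mono_AE, rule eventually_mono[OF inc])
    fix y
    assume *: "y \<in> segment_in \<Omega> h \<longrightarrow> ennreal (norm (V (y + h) - V y)) \<le>
      ennreal (norm h) * (\<integral>\<^sup>+s. indicator {0..1} s * ennreal (f (y + s *\<^sub>R h)) \<partial>lborel)"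
    show "indicator (segment_in \<Omega> h) y * ennreal (norm (V (y + h) - V y) powr p) \<le>
      ennreal (2 powr p * norm h powr p) * (\<integral>\<^sup>+s. indicator {0..1} s * ennreal (f (y + s *\<^sub>R h) powr p) \<partial>lborel)"
    proof (cases "y \<in> segment_in \<Omega> h")
      case True
      have "ennreal (norm (V (y + h) - V y) powr p) \<le>
        ennreal (2 powr p * norm h powr p) * (\<integral>\<^sup>+s. indicator {0..1} s * ennreal (f (y + s *\<^sub>R h) powr p) \<partial>lborel)"
        by (rule powr_le_unit_integral) (use * True f0 p in auto)
      then show ?thesis using True by simp
    qed simp
  qed
  also have "\<dots> = ennreal (2 powr p * norm h powr p) * (\<integral>\<^sup>+y. (\<integral>\<^sup>+s. indicator {0..1} s * ennreal (f (y + s *\<^sub>R h) powr p) \<partial>lborel) \<partial>lborel)"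
    by (rule nn_integral_cmult) measurable
  also have "(\<integral>\<^sup>+y. (\<integral>\<^sup>+s. indicator {0..1} s * ennreal (f (y + s *\<^sub>R h) powr p) \<partial>lborel) \<partial>lborel) =
    (\<integral>\<^sup>+s. (\<integral>\<^sup>+y. indicator {0..1} s * ennreal (f (y + s *\<^sub>R h) powr p) \<partial>lborel) \<partial>lborel)"
    by (rule lborel_pair.Fubini') measurable
  also have "\<dots> = (\<integral>\<^sup>+s. indicator {0..1::real} s * (\<integral>\<^sup>+x. ennreal (f x powr p) \<partial>lborel) \<partial>lborel)"
  proof (rule nn_integral_cong)
    fix s :: real
    have "(\<integral>\<^sup>+y. ennreal (f (y + s *\<^sub>R h) powr p) \<partial>lborel) = (\<integral>\<^sup>+x. ennreal (f x powr p) \<partial>lborel)"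
      by (rule nn_integral_lborel_shift[of "\<lambda>x. ennreal (f x powr p)" "s *\<^sub>R h"]) measurable
    then show "(\<integral>\<^sup>+y. indicator {0..1} s * ennreal (f (y + s *\<^sub>R h) powr p) \<partial>lborel) = indicator {0..1} s * (\<integral>\<^sup>+x. ennreal (f x powr p) \<partial>lborel)"
      by (subst nn_integral_cmult) auto
  qed
  also have "\<dots> = (\<integral>\<^sup>+x. ennreal (f x powr p) \<partial>lborel)"
    by (subst nn_integral_multc) auto
  finally show ?thesis .
qed

text \<open>For small \<open>h\<close> a point \<open>y\<close> outside \<open>segment_in \<Omega> h\<close> is far from the support of \<open>\<phi>\<close>, and so is \<open>y + h\<close>.\<close>

lemma compact_support_increment:
  fixes \<phi> V :: "'a::euclidean_space \<Rightarrow> complex"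
  assumes \<Omega>: "open \<Omega>" and Q: "compact Q" "Q \<subseteq> \<Omega>" and \<phi>: "continuous_on UNIV \<phi>" "\<And>x. x \<notin> Q \<Longrightarrow> \<phi> x = 0"
    and \<omega>: "0 < \<omega>"
  shows "\<exists>\<delta>>0. \<forall>y h. norm h < \<delta> \<longrightarrow>
    (y \<notin> segment_in \<Omega> h \<longrightarrow> \<phi> y = 0 \<and> \<phi> (y + h) = 0) \<and> norm (\<phi> (y + h) - \<phi> y) \<le> \<omega>"
proof -
  obtain \<eta> where \<eta>: "0 < \<eta>" "(\<Union>x\<in>Q. cball x \<eta>) \<subseteq> \<Omega>"
    using compact_subset_open_imp_cball_epsilon_subset[OF Q(1) \<Omega> Q(2)] by blast
  \<comment> \<open>If one of \<open>y\<close> and \<open>y + h\<close> is in \<open>Q\<close> and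
    \<open>h\<close> is shorter than 1, both lie in this compact set, on which \<open>\<phi>\<close>
    is uniformly continuous.\<close>
  define K where "K = {x + y | x y. x \<in> Q \<and> y \<in> cball 0 1}"
  have "compact K" unfolding K_def by (rule compact_sums[OF Q(1) compact_cball])
  then have "uniformly_continuous_on K \<phi>"
    using \<phi>(1) by (intro compact_uniformly_continuous) (auto intro: continuous_on_subset)
  then obtain \<delta> where \<delta>: "0 < \<delta>" "\<And>x y. x \<in> K \<Longrightarrow> y \<in> K \<Longrightarrow> dist y x < \<delta> \<Longrightarrow> dist (\<phi> y) (\<phi> x) < \<omega>"
    unfolding uniformly_continuous_on_def using \<omega> by blast
  show ?thesis
  proof (intro exI[of _ "min 1 (min \<delta> \<eta>)"] conjI allI impI)
    show "0 < min 1 (min \<delta> \<eta>)" using \<delta> \<eta> by simp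
    fix y h :: 'a assume h: "norm h < min 1 (min \<delta> \<eta>)"
    have near: "x \<in> \<Omega>" if "z \<in> Q" "norm (x - z) \<le> \<eta>" for x z
    proof -
      have "x \<in> cball z \<eta>" using that(2) by (simp add: dist_norm norm_minus_commute)
      then show ?thesis using \<eta>(2) that(1) by blast
    qed
    have sh: "norm (s *\<^sub>R h) \<le> \<eta>" if "\<bar>s\<bar> \<le> 1" for s
      using mult_right_mono[OF that, of "norm h"] h by simp
    show "\<phi> y = 0" if y: "y \<notin> segment_in \<Omega> h"
    proof (rule ccontr)
      assume "\<phi> y \<noteq> 0"
      then have yQ: "y \<in> Q" using \<phi>(2) by blast
      have "y + s *\<^sub>R h \<in> \<Omega>" if "s \<in> {0..1}" for s
        using near[OF yQ, of "y + s *\<^sub>R h"] sh[of s] that by simp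
      then show False using y by (simp add: segment_in_def)
    qed
    show "\<phi> (y + h) = 0" if y: "y \<notin> segment_in \<Omega> h"
    proof (rule ccontr)
      assume "\<phi> (y + h) \<noteq> 0"
      then have yQ: "y + h \<in> Q" using \<phi>(2) by blast
      have "y + s *\<^sub>R h \<in> \<Omega>" if "s \<in> {0..1}" for s
      proof (rule near[OF yQ])
        have "y + s *\<^sub>R h - (y + h) = (s - 1) *\<^sub>R h" by (simp add: algebra_simps)
        then show "norm (y + s *\<^sub>R h - (y + h)) \<le> \<eta>" using sh[of "s - 1"] that by simp
      qed
      then show False using y by (simp add: segment_in_def)
    qed
    show "norm (\<phi> (y + h) - \<phi> y) \<le> \<omega>"
    proof (cases "y \<in> Q \<or> y + h \<in> Q")
      case True
      have inK: "x \<in> K" if "z \<in> Q" "norm (x - z) \<le> 1" for x z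
        unfolding K_def mem_Collect_eq by (rule exI[of _ z], rule exI[of _ "x - z"]) (use that in simp)
      have "y \<in> K" "y + h \<in> K" using True inK[of y] inK[of "y + h"] h by auto
      then show ?thesis using \<delta>(2)[of y "y + h"] h by (simp add: dist_norm less_imp_le)
    next
      case False
      then show ?thesis using \<phi>(2)[of y] \<phi>(2)[of "y + h"] \<omega> by simp
    qed
  qed
qed

text \<open>Rellich's argument: the products with \<open>\<phi>\<close> are equicontinuous under translations.\<close>

lemma sobolev_test_function_totally_bounded:
  fixes \<phi> :: "real^'n \<Rightarrow> complex"
  assumes \<Omega>: "open \<Omega>" and p: "1 \<le> p" and r: "1 \<le> r" and \<phi>: "\<phi> \<in> test_functions \<Omega>"
    and B: "B \<subseteq> sobolev r p \<Omega>" and M: "\<And>u. u \<in> B \<Longrightarrow> sobolev_norm r p \<Omega> u \<le> M" and e: "0 < e"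
  shows "\<exists>F\<subseteq>B. finite F \<and>
    (\<forall>u\<in>B. \<exists>f\<in>F. (\<integral>\<^sup>+x. ennreal (norm (\<phi> x * u x - \<phi> x * f x) powr p) \<partial>lebesgue_on \<Omega>) \<le> ennreal e)"
proof -
  have \<Omega>m: "\<Omega> \<in> sets borel" using \<Omega> by simp
  \<comment> \<open>A common bound on \<open>B\<close> for the \<open>p\<close>-integrals of the
    functions and of their first derivatives.\<close>
  define A where "A = 2 powr p * real (card {js :: 'n list. length js \<le> r}) powr (p - 1) * M powr p"
  have A0: "0 \<le> A" by (simp add: A_def)
  have "\<forall>u\<in>B. \<exists>Vf. is_rep \<Omega> u (fst Vf) \<and> snd Vf \<in> borel_measurable borel \<and> (\<forall>x. 0 \<le> snd Vf x) \<and>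
    (\<integral>\<^sup>+x. ennreal (norm (fst Vf x) powr p) \<partial>lborel) \<le> ennreal A \<and> (\<integral>\<^sup>+x. ennreal (snd Vf x powr p) \<partial>lborel) \<le> ennreal A \<and>
    (\<forall>h. AE y in lborel. y \<in> segment_in \<Omega> h \<longrightarrow> ennreal (norm (fst Vf (y + h) - fst Vf y)) \<le>
      ennreal (norm h) * (\<integral>\<^sup>+s. indicator {0..1} s * ennreal (snd Vf (y + s *\<^sub>R h)) \<partial>lborel))"
  proof
    fix u assume u: "u \<in> B"
    have uS: "u \<in> sobolev r p \<Omega>" using u B by blast
    obtain V f where V: "is_rep \<Omega> u V" and ch: "gradient_chain \<Omega> r f" and f0: "f 0 = (\<lambda>x. norm (V x))"
      and sum: "(\<Sum>k\<le>r. \<integral>\<^sup>+x. ennreal (f k x powr p) \<partial>lborel) \<le>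
        ennreal (2 powr p * real (card {js :: 'n list. length js \<le> r}) powr (p - 1) * sobolev_norm r p \<Omega> u powr p)"
      and inc: "\<forall>h. AE y in lborel. y \<in> segment_in \<Omega> h \<longrightarrow> ennreal (norm (V (y + h) - V y)) \<le>
        ennreal (norm h) * (\<integral>\<^sup>+s. indicator {0..1} s * ennreal (f 1 (y + s *\<^sub>R h)) \<partial>lborel)"
      using sobolev_gradient_chain[OF \<Omega> p r uS] by (elim exE conjE)
    have "sobolev_norm r p \<Omega> u powr p \<le> M powr p"
      using M[OF u] p by (intro powr_mono2) (auto simp: sobolev_norm_def)
    then have "2 powr p * real (card {js :: 'n list. length js \<le> r}) powr (p - 1) * sobolev_norm r p \<Omega> u powr p \<le> A"
      unfolding A_def by (intro mult_left_mono) auto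
    with sum have sumA: "(\<Sum>k\<le>r. \<integral>\<^sup>+x. ennreal (f k x powr p) \<partial>lborel) \<le> ennreal A"
      by (rule order_trans[OF _ ennreal_leI])
    have each: "(\<integral>\<^sup>+x. ennreal (f k x powr p) \<partial>lborel) \<le> ennreal A" if "k \<le> r" for k
    proof (rule order_trans[OF _ sumA])
      show "(\<integral>\<^sup>+x. ennreal (f k x powr p) \<partial>lborel) \<le> (\<Sum>k\<le>r. \<integral>\<^sup>+x. ennreal (f k x powr p) \<partial>lborel)"
        using sum_mono2[of "{..r}" "{k}" "\<lambda>k. \<integral>\<^sup>+x. ennreal (f k x powr p) \<partial>lborel"] that by simp
    qed
    have "(\<integral>\<^sup>+x. ennreal (norm (V x) powr p) \<partial>lborel) \<le> ennreal A" using each[of 0] by (simp add: f0)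
    moreover have "f 1 \<in> borel_measurable borel" "\<forall>x. 0 \<le> f 1 x" using ch by (auto simp: gradient_chain_def)
    ultimately show "\<exists>Vf. is_rep \<Omega> u (fst Vf) \<and> snd Vf \<in> borel_measurable borel \<and> (\<forall>x. 0 \<le> snd Vf x) \<and>
      (\<integral>\<^sup>+x. ennreal (norm (fst Vf x) powr p) \<partial>lborel) \<le> ennreal A \<and> (\<integral>\<^sup>+x. ennreal (snd Vf x powr p) \<partial>lborel) \<le> ennreal A \<and>
      (\<forall>h. AE y in lborel. y \<in> segment_in \<Omega> h \<longrightarrow> ennreal (norm (fst Vf (y + h) - fst Vf y)) \<le>
        ennreal (norm h) * (\<integral>\<^sup>+s. indicator {0..1} s * ennreal (snd Vf (y + s *\<^sub>R h)) \<partial>lborel))"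
      by (intro exI[of _ "(V, f 1)"] conjI) (simp_all only: fst_conv snd_conv V inc each[OF r] simp_thms)
  qed
  from bchoice[OF this] obtain Vf where Vf: "\<forall>u\<in>B. is_rep \<Omega> u (fst (Vf u)) \<and> snd (Vf u) \<in> borel_measurable borel \<and> (\<forall>x. 0 \<le> snd (Vf u) x) \<and>
    (\<integral>\<^sup>+x. ennreal (norm (fst (Vf u) x) powr p) \<partial>lborel) \<le> ennreal A \<and> (\<integral>\<^sup>+x. ennreal (snd (Vf u) x powr p) \<partial>lborel) \<le> ennreal A \<and>
    (\<forall>h. AE y in lborel. y \<in> segment_in \<Omega> h \<longrightarrow> ennreal (norm (fst (Vf u) (y + h) - fst (Vf u) y)) \<le>
      ennreal (norm h) * (\<integral>\<^sup>+s. indicator {0..1} s * ennreal (snd (Vf u) (y + s *\<^sub>R h)) \<partial>lborel))"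
    by (elim exE)
  define V where "V u = fst (Vf u)" for u
  define f where "f u = snd (Vf u)" for u
  have rep: "is_rep \<Omega> u (V u)" and fm: "f u \<in> borel_measurable borel" and f0: "\<And>x. 0 \<le> f u x"
    and VA: "(\<integral>\<^sup>+x. ennreal (norm (V u x) powr p) \<partial>lborel) \<le> ennreal A" and fA: "(\<integral>\<^sup>+x. ennreal (f u x powr p) \<partial>lborel) \<le> ennreal A"
    and inc: "\<And>h. AE y in lborel. y \<in> segment_in \<Omega> h \<longrightarrow> ennreal (norm (V u (y + h) - V u y)) \<le>
      ennreal (norm h) * (\<integral>\<^sup>+s. indicator {0..1} s * ennreal (f u (y + s *\<^sub>R h)) \<partial>lborel)"
    if "u \<in> B" for u
    using bspec[OF Vf that] unfolding V_def f_def by (elim conjE; simp only: simp_thms)+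
  have Vm: "V u \<in> borel_measurable borel" if "u \<in> B" for u using rep[OF that] by (simp add: is_rep_def)
  define Q where "Q = closure {x. \<phi> x \<noteq> 0}"
  have Q: "compact Q" "Q \<subseteq> \<Omega>" using \<phi> by (auto simp: test_functions_def Q_def)
  have \<phi>0: "\<phi> x = 0" if "x \<notin> Q" for x using that closure_subset[of "{x. \<phi> x \<noteq> 0}"] by (auto simp: Q_def)
  have \<phi>c: "continuous_on UNIV \<phi>" by (rule test_function_continuous[OF \<phi>])
  have \<phi>m [measurable]: "\<phi> \<in> borel_measurable borel" by (rule test_function_measurable[OF \<phi>])
  have "bounded (\<phi> ` Q)"
    by (intro compact_imp_bounded compact_continuous_image Q(1) continuous_on_subset[OF \<phi>c]) simp
  then obtain m where m: "0 < m" "\<forall>x\<in>Q. norm (\<phi> x) \<le> m" unfolding bounded_pos by auto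
  then have \<phi>m': "norm (\<phi> x) \<le> m" for x using \<phi>0[of x] by (cases "x \<in> Q") auto
  define w where "w u x = \<phi> x * V u x" for u x
  have "\<exists>F\<subseteq>w ` B. finite F \<and> (\<forall>v\<in>w ` B. \<exists>f\<in>F. (\<integral>\<^sup>+x. ennreal (norm (v x - f x) powr p) \<partial>lborel) \<le> ennreal e)"
  proof (rule translation_totally_bounded[OF p Q(1) _ _ _ _ _ e])
    show "0 \<le> m powr p * A" using A0 by simp
    show "v \<in> borel_measurable borel" if v: "v \<in> w ` B" for v
    proof -
      obtain u where u: "u \<in> B" "v = w u" using v by blast
      have [measurable]: "V u \<in> borel_measurable borel" by (rule Vm[OF u(1)])
      show ?thesis unfolding u(2) w_def by measurable
    qed
    show "v x = 0" if "v \<in> w ` B" "x \<notin> Q" for v x using that \<phi>0 by (auto simp: w_def)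
    show "(\<integral>\<^sup>+x. ennreal (norm (v x) powr p) \<partial>lborel) \<le> ennreal (m powr p * A)" if v: "v \<in> w ` B" for v
    proof -
      obtain u where u: "u \<in> B" "v = w u" using v by blast
      have [measurable]: "V u \<in> borel_measurable borel" by (rule Vm[OF u(1)])
      have "(\<integral>\<^sup>+x. ennreal (norm (v x) powr p) \<partial>lborel) \<le> (\<integral>\<^sup>+x. ennreal (m powr p) * ennreal (norm (V u x) powr p) \<partial>lborel)"
      proof (rule nn_integral_mono)
        fix x
        have "norm (v x) powr p \<le> (m * norm (V u x)) powr p"
          unfolding u(2) w_def norm_mult using p by (intro powr_mono2 mult_right_mono \<phi>m') auto
        then show "ennreal (norm (v x) powr p) \<le> ennreal (m powr p) * ennreal (norm (V u x) powr p)"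
          using m by (simp add: powr_mult ennreal_leI flip: ennreal_mult)
      qed
      also have "\<dots> = ennreal (m powr p) * (\<integral>\<^sup>+x. ennreal (norm (V u x) powr p) \<partial>lborel)"
        by (rule nn_integral_cmult) measurable
      also have "\<dots> \<le> ennreal (m powr p) * ennreal A" by (intro mult_left_mono VA[OF u(1)]) simp
      finally show ?thesis using A0 by (simp add: ennreal_mult)
    qed
    fix e' :: real assume e': "0 < e'"
    \<comment> \<open>The factor in front of \<open>t\<close> in the final estimate; the summand 1
      keeps it positive even if \<open>A = 0\<close>.\<close>
    define c where "c = 2 powr p * (m powr p * 2 powr p * A + A) + 1"
    have c: "0 < c" using A0 m by (auto simp: c_def intro!: add_nonneg_pos)
    define t where "t = min 1 (e' / c)"
    have t: "0 < t" "t \<le> 1" "c * t \<le> e'"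
      using e' c by (auto simp: t_def min_def field_simps)
    obtain \<delta> where \<delta>: "0 < \<delta>" and \<delta>': "\<And>y h. norm h < \<delta> \<Longrightarrow>
      (y \<notin> segment_in \<Omega> h \<longrightarrow> \<phi> y = 0 \<and> \<phi> (y + h) = 0) \<and> norm (\<phi> (y + h) - \<phi> y) \<le> t"
      using compact_support_increment[OF \<Omega> Q \<phi>c \<phi>0 t(1)] by blast
    show "\<exists>\<delta>>0. \<forall>v\<in>w ` B. \<forall>h. norm h < \<delta> \<longrightarrow> (\<integral>\<^sup>+y. ennreal (norm (v (y + h) - v y) powr p) \<partial>lborel) \<le> ennreal e'"
    proof (intro exI[of _ "min \<delta> t"] conjI ballI allI impI)
      show "0 < min \<delta> t" using \<delta> t by simp
      fix v and h :: "real^'n" assume v: "v \<in> w ` B" and "norm h < min \<delta> t"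
      then have h: "norm h < \<delta>" "norm h \<le> t" by auto
      obtain u where u: "u \<in> B" "v = w u" using v by blast
      have [measurable]: "V u \<in> borel_measurable borel" "f u \<in> borel_measurable borel"
        using Vm[OF u(1)] fm[OF u(1)] by auto
      have [measurable]: "segment_in \<Omega> h \<in> sets borel" using open_segment_in[OF \<Omega>] by simp
      let ?I = "\<lambda>y. indicator (segment_in \<Omega> h) y * ennreal (norm (V u (y + h) - V u y) powr p)"
      \<comment> \<open>Both small quantities, the length of \<open>h\<close> and the variation of
        \<open>\<phi>\<close>, enter with power \<open>p\<close>; since \<open>t \<le> 1\<close>
        they can be replaced by \<open>t\<close> itself.\<close>
      have pt: "t powr p \<le> t" using powr_mono'[of 1 p t] t p by simp
      have "(\<integral>\<^sup>+y. ennreal (norm (v (y + h) - v y) powr p) \<partial>lborel) \<le>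
        (\<integral>\<^sup>+y. ennreal (2 powr p * m powr p) * ?I y + ennreal (2 powr p * t powr p) * ennreal (norm (V u y) powr p) \<partial>lborel)"
      proof (rule nn_integral_mono)
        fix y
        show "ennreal (norm (v (y + h) - v y) powr p) \<le>
          ennreal (2 powr p * m powr p) * ?I y + ennreal (2 powr p * t powr p) * ennreal (norm (V u y) powr p)"
        proof (cases "y \<in> segment_in \<Omega> h")
          case False
          then have "v (y + h) = 0" "v y = 0" using \<delta>'[OF h(1), of y] by (auto simp: u w_def)
          then show ?thesis by simp
        next
          case True
          have "v (y + h) - v y = \<phi> (y + h) * (V u (y + h) - V u y) + (\<phi> (y + h) - \<phi> y) * V u y"
            by (simp add: u w_def algebra_simps)
          then have "norm (v (y + h) - v y) \<le> norm (\<phi> (y + h)) * norm (V u (y + h) - V u y) + norm (\<phi> (y + h) - \<phi> y) * norm (V u y)"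
            using norm_triangle_ineq[of "\<phi> (y + h) * (V u (y + h) - V u y)" "(\<phi> (y + h) - \<phi> y) * V u y"] by (simp add: norm_mult)
          also have "\<dots> \<le> m * norm (V u (y + h) - V u y) + t * norm (V u y)"
            using \<phi>m' \<delta>'[OF h(1), of y] by (intro add_mono mult_right_mono) auto
          finally have "norm (v (y + h) - v y) powr p \<le> (m * norm (V u (y + h) - V u y) + t * norm (V u y)) powr p"
            using p by (intro powr_mono2) auto
          also have "\<dots> \<le> 2 powr p * ((m * norm (V u (y + h) - V u y)) powr p + (t * norm (V u y)) powr p)"
            using m t p by (intro powr_add_le_two) auto
          also have "\<dots> = 2 powr p * m powr p * norm (V u (y + h) - V u y) powr p + 2 powr p * t powr p * norm (V u y) powr p"
            using m t by (simp add: powr_mult algebra_simps)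
          finally show ?thesis using True by (simp add: ennreal_leI flip: ennreal_mult ennreal_plus)
        qed
      qed
      also have "\<dots> = ennreal (2 powr p * m powr p) * (\<integral>\<^sup>+y. ?I y \<partial>lborel) + ennreal (2 powr p * t powr p) * (\<integral>\<^sup>+y. ennreal (norm (V u y) powr p) \<partial>lborel)"
        by (simp add: nn_integral_add nn_integral_cmult)
      also have "\<dots> \<le> ennreal (2 powr p * m powr p) * (ennreal (2 powr p * t) * ennreal A) + ennreal (2 powr p * t) * ennreal A"
      proof (intro add_mono mult_left_mono mult_mono)
        have "norm h powr p \<le> t powr p" using h p by (intro powr_mono2) auto
        then have ht: "norm h powr p \<le> t" using pt by simp
        have "(\<integral>\<^sup>+y. ?I y \<partial>lborel) \<le> ennreal (2 powr p * norm h powr p) * (\<integral>\<^sup>+x. ennreal (f u x powr p) \<partial>lborel)"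
          by (rule increment_powr_integral_le[OF \<Omega> p Vm[OF u(1)] fm[OF u(1)] f0[OF u(1)] inc[OF u(1)]])
        also have "\<dots> \<le> ennreal (2 powr p * t) * ennreal A"
          using ht by (intro mult_mono ennreal_leI mult_left_mono fA[OF u(1)]) auto
        finally show "(\<integral>\<^sup>+y. ?I y \<partial>lborel) \<le> ennreal (2 powr p * t) * ennreal A" .
      qed (use pt VA[OF u(1)] in \<open>auto intro!: ennreal_leI\<close>)
      also have "\<dots> = ennreal (2 powr p * (m powr p * 2 powr p * A + A) * t)"
        using A0 t m by (simp add: algebra_simps flip: ennreal_mult ennreal_plus)
      also have "\<dots> \<le> ennreal e'"
      proof (rule ennreal_leI)
        have "2 powr p * (m powr p * 2 powr p * A + A) * t \<le> c * t" using t by (intro mult_right_mono) (auto simp: c_def)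
        then show "2 powr p * (m powr p * 2 powr p * A + A) * t \<le> e'" using t(3) by simp
      qed
      finally show "(\<integral>\<^sup>+y. ennreal (norm (v (y + h) - v y) powr p) \<partial>lborel) \<le> ennreal e'" .
    qed
  qed
  then obtain F0 where F0: "F0 \<subseteq> w ` B" "finite F0"
    and near: "\<And>v. v \<in> w ` B \<Longrightarrow> \<exists>f\<in>F0. (\<integral>\<^sup>+x. ennreal (norm (v x - f x) powr p) \<partial>lborel) \<le> ennreal e" by blast
  obtain F where F: "F \<subseteq> B" "finite F" "F0 = w ` F" using finite_subset_image[OF F0(2,1)] by blast
  have "\<exists>f\<in>F. (\<integral>\<^sup>+x. ennreal (norm (\<phi> x * u x - \<phi> x * f x) powr p) \<partial>lebesgue_on \<Omega>) \<le> ennreal e" if u: "u \<in> B" for u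
  proof -
    obtain f where f: "f \<in> F" and le: "(\<integral>\<^sup>+x. ennreal (norm (w u x - w f x) powr p) \<partial>lborel) \<le> ennreal e"
      using near[of "w u"] u F(3) by blast
    have fB: "f \<in> B" using f F by blast
    have wr: "is_rep \<Omega> (\<lambda>x. \<phi> x * u x - \<phi> x * f x) (\<lambda>x. w u x - w f x)"
      unfolding w_def by (intro rep_diff rep_mult_borel rep u fB \<phi>m)
    show ?thesis
      by (rule bexI[OF _ f]) (simp only: rep_nn_integral'[OF wr \<Omega>m] le)
  qed
  then show ?thesis using F by blast
qed

theorem theorem5p1:
  fixes \<Omega> :: "(real^'n) set" and r :: nat and d p q s :: real
    and g :: "real^'n \<Rightarrow> complex"
  assumes "0 < d"
    and "open \<Omega>"
    and "cone_condition d \<Omega>"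
    and "1 \<le> r"
    and "1 \<le> p" and "p \<le> q"
    and "real CARD('n) / real r \<le> q"
    and "real CARD('n) / real r = p \<and> 1 < p \<Longrightarrow> real CARD('n) / real r < q"
    and "s \<le> p"
    and "g \<in> morrey0 d q (s / p) \<Omega>"
  shows "compact_operator (sobolev r p \<Omega>) (sobolev_norm r p \<Omega>) (Lp p \<Omega>) (Lp_norm p \<Omega>)
           (\<lambda>u x. g x * u x)"
proof -
  have p: "1 \<le> p" "p \<le> q" and q: "1 \<le> q" and \<Omega>: "open \<Omega>" and d: "0 < d" using assms by auto
  let ?\<sigma> = "s / p"
  let ?M = "morrey d q ?\<sigma> \<Omega>" and ?N = "Lp_norm p \<Omega>"
  \<comment> \<open>Converts a bound on the Morrey norm into a bound on the \<open>L^q\<close> norm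
    over balls of radius \<open>d\<close>.\<close>
  define D where "D = d powr (real CARD('n) / q - ?\<sigma>)"
  have D: "0 < D" using d by (simp add: D_def)
  have "\<exists>C\<ge>0. \<forall>u\<in>sobolev r p \<Omega>. \<forall>(h :: real^'n \<Rightarrow> complex) K. h \<in> borel_measurable (lebesgue_on \<Omega>) \<longrightarrow> 0 < K \<longrightarrow>
    (\<forall>x\<in>\<Omega>. (\<integral>\<^sup>+y. ennreal (norm (h y) powr q) \<partial>lebesgue_on (\<Omega> \<inter> ball x d)) \<le> ennreal (K powr q)) \<longrightarrow>
    (\<integral>\<^sup>+x. ennreal (norm (h x * u x) powr p) \<partial>lebesgue_on \<Omega>) \<le> ennreal (C * K powr p * sobolev_norm r p \<Omega> u powr p)"
    by (rule sobolev_multiplication_bound) (use assms in auto)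
  then obtain C where C: "0 \<le> C" and C': "\<And>u h K. u \<in> sobolev r p \<Omega> \<Longrightarrow> h \<in> borel_measurable (lebesgue_on \<Omega>) \<Longrightarrow> 0 < K \<Longrightarrow>
    (\<And>x. x \<in> \<Omega> \<Longrightarrow> (\<integral>\<^sup>+y. ennreal (norm (h y) powr q) \<partial>lebesgue_on (\<Omega> \<inter> ball x d)) \<le> ennreal (K powr q)) \<Longrightarrow>
    (\<integral>\<^sup>+x. ennreal (norm (h x * u x) powr p) \<partial>lebesgue_on \<Omega>) \<le> ennreal (C * K powr p * sobolev_norm r p \<Omega> u powr p)"
    by blast
  have bound: "(\<integral>\<^sup>+x. ennreal (norm (h x * u x) powr p) \<partial>lebesgue_on \<Omega>) \<le> ennreal (C * (m * D) powr p * sobolev_norm r p \<Omega> u powr p)"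
    if h: "h \<in> ?M" "morrey_norm d q ?\<sigma> \<Omega> h \<le> m" and m: "0 < m" and u: "u \<in> sobolev r p \<Omega>" for h u m
    by (rule C'[OF u morrey_measurable[OF \<Omega> h(1)]])
       (use m D in \<open>simp, unfold D_def, intro morrey_local_bound[OF h(1) q d _ h(2)]\<close>)
  have mem: "(\<lambda>x. h x * u x) \<in> Lp p \<Omega>" if h: "h \<in> ?M" and u: "u \<in> sobolev r p \<Omega>" for h u
  proof -
    have [measurable]: "h \<in> borel_measurable (lebesgue_on \<Omega>)" "u \<in> borel_measurable (lebesgue_on \<Omega>)"
      using morrey_measurable[OF \<Omega> h] u by (auto simp: sobolev_def Lp_iff)
    have "(\<integral>\<^sup>+x. ennreal (norm (h x * u x) powr p) \<partial>lebesgue_on \<Omega>) < \<infinity>"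
      using bound[OF h _ _ u, of "morrey_norm d q ?\<sigma> \<Omega> h + 1"] morrey_norm_nonneg[of d q ?\<sigma> \<Omega> h]
      by (auto intro: order.strict_trans1)
    then show ?thesis unfolding Lp_iff by simp
  qed
  have gM: "g \<in> ?M" using \<open>g \<in> morrey0 d q ?\<sigma> \<Omega>\<close> by (simp add: morrey0_def in_closure_of)
  have "compactin (seminorm_topology (Lp p \<Omega>) ?N) (seminorm_topology (Lp p \<Omega>) ?N closure_of ((\<lambda>u x. g x * u x) ` B))"
    if B: "B \<subseteq> sobolev r p \<Omega>" and bdd: "\<exists>C. \<forall>u\<in>B. sobolev_norm r p \<Omega> u \<le> C" for B
  proof (rule compactin_closure_of_Lp[OF p(1)])
    show "(\<lambda>u x. g x * u x) ` B \<subseteq> Lp p \<Omega>" using mem[OF gM] B by blast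
    fix e :: real assume e: "0 < e"
    \<comment> \<open>The triangle inequality with constant 2 is used twice for three errors:
      \<open>2 * (e1 + 2 * (e1 + e1)) = 10 * e1\<close>, which is below
      \<open>16 * e1 = e\<close>.\<close>
    define e1 where "e1 = e / 16"
    have e1: "0 < e1" using e by (simp add: e1_def)
    obtain M0 where M0: "\<forall>u\<in>B. sobolev_norm r p \<Omega> u \<le> M0" using bdd by blast
    define M where "M = max 0 M0 + 1"
    have M: "0 < M" "\<And>u. u \<in> B \<Longrightarrow> sobolev_norm r p \<Omega> u \<le> M" using M0 by (auto simp: M_def max_def intro: order_trans)
    \<comment> \<open>Chosen so that \<open>(C + 1) * (m * D) * M = e1\<close>. The factor
      \<open>C + 1\<close> is nonzero, and being at least 1 it satisfies
      \<open>C \<le> (C + 1) powr p\<close>, so it can be drawn into the power.\<close>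
    define m where "m = e1 / (D * (C + 1) * M)"
    have m: "0 < m" using e1 D C M by (simp add: m_def)
    have mC: "C * (m * D) powr p * M powr p \<le> e1 powr p"
    proof -
      have "C \<le> (C + 1) powr p" using powr_mono[of 1 p "C + 1"] C p by simp
      then have "C * (m * D) powr p * M powr p \<le> (C + 1) powr p * (m * D) powr p * M powr p"
        by (intro mult_right_mono) auto
      also have "\<dots> = ((C + 1) * (m * D) * M) powr p" using C m D M by (simp add: powr_mult)
      also have "(C + 1) * (m * D) * M = e1" using C D M by (simp add: m_def)
      finally show ?thesis .
    qed
    obtain \<phi> where \<phi>: "\<phi> \<in> test_functions \<Omega>" "\<phi> \<in> ?M" "morrey_norm d q ?\<sigma> \<Omega> (\<phi> - g) < m"
      using quasi_seminorm.closure_of_approx[OF morrey_quasi_seminorm[OF q] _ m] \<open>g \<in> morrey0 d q ?\<sigma> \<Omega>\<close>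
      unfolding morrey0_def by blast
    have \<phi>g: "\<phi> - g \<in> ?M" by (rule morrey_diff[OF q \<phi>(2) gM])
    have near: "?N ((\<lambda>x. \<phi> x * u x) - (\<lambda>x. g x * u x)) \<le> e1" if u: "u \<in> B" for u
    proof (rule Lp_norm_le[OF Lp_diff[OF mem[OF \<phi>(2)] mem[OF gM] p(1)] p(1)])
      show uS: "u \<in> sobolev r p \<Omega>" "u \<in> sobolev r p \<Omega>" using u B by auto
      show "0 \<le> e1" using e1 by simp
      have "(\<integral>\<^sup>+x. ennreal (norm ((\<phi> - g) x * u x) powr p) \<partial>lebesgue_on \<Omega>) \<le> ennreal (C * (m * D) powr p * sobolev_norm r p \<Omega> u powr p)"
        by (rule bound[OF \<phi>g _ m uS(1)]) (use \<phi>(3) in simp)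
      also have "\<dots> \<le> ennreal (C * (m * D) powr p * M powr p)"
        using M(2)[OF u] C p by (intro ennreal_leI mult_left_mono powr_mono2) (auto simp: sobolev_norm_def)
      also have "\<dots> \<le> ennreal (e1 powr p)" using mC by (rule ennreal_leI)
      finally show "(\<integral>\<^sup>+x. ennreal (norm (((\<lambda>x. \<phi> x * u x) - (\<lambda>x. g x * u x)) x) powr p) \<partial>lebesgue_on \<Omega>) \<le> ennreal (e1 powr p)"
        by (simp add: left_diff_distrib)
    qed
    obtain F where F: "F \<subseteq> B" "finite F"
      and net: "\<And>u. u \<in> B \<Longrightarrow> \<exists>f\<in>F. (\<integral>\<^sup>+x. ennreal (norm (\<phi> x * u x - \<phi> x * f x) powr p) \<partial>lebesgue_on \<Omega>) \<le> ennreal (e1 powr p)"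
      using sobolev_test_function_totally_bounded[OF \<Omega> p(1) assms(4) \<phi>(1) B M(2), of "e1 powr p"] e1 by auto
    show "\<exists>F\<subseteq>Lp p \<Omega>. finite F \<and> (\<forall>v\<in>(\<lambda>u x. g x * u x) ` B. \<exists>f\<in>F. ?N (v - f) < e)"
    \<comment> \<open>A net found for multiplication by \<open>\<phi>\<close> is transported to
      multiplication by \<open>g\<close>: since \<open>F\<close> is a subset of \<open>B\<close>,
      the error of replacing \<open>\<phi>\<close> by \<open>g\<close> is small at the net points as
      well.\<close>
    proof (intro exI[of _ "(\<lambda>u x. g x * u x) ` F"] conjI ballI)
      show "(\<lambda>u x. g x * u x) ` F \<subseteq> Lp p \<Omega>" using mem[OF gM] B F by blast
      show "finite ((\<lambda>u x. g x * u x) ` F)" using F by simp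
      fix v assume "v \<in> (\<lambda>u x. g x * u x) ` B"
      then obtain u where u: "u \<in> B" "v = (\<lambda>x. g x * u x)" by blast
      obtain f where f: "f \<in> F" and le: "(\<integral>\<^sup>+x. ennreal (norm (\<phi> x * u x - \<phi> x * f x) powr p) \<partial>lebesgue_on \<Omega>) \<le> ennreal (e1 powr p)"
        using net[OF u(1)] by blast
      have fB: "f \<in> B" using f F by blast
      let ?gu = "\<lambda>x. g x * u x" and ?gf = "\<lambda>x. g x * f x" and ?pu = "\<lambda>x. \<phi> x * u x" and ?pf = "\<lambda>x. \<phi> x * f x"
      have L: "?gu \<in> Lp p \<Omega>" "?gf \<in> Lp p \<Omega>" "?pu \<in> Lp p \<Omega>" "?pf \<in> Lp p \<Omega>"
        using mem[OF gM] mem[OF \<phi>(2)] u fB B by auto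
      note tri = quasi_seminorm.triangle[OF Lp_quasi_seminorm[OF p(1), of \<Omega>]]
      have arith: "x \<le> 10 * k" if "a \<le> k" "b \<le> k" "c \<le> k" "x \<le> 2 * (a + y)" "y \<le> 2 * (b + c)" for a b c x y k :: real
        using that by (simp add: algebra_simps)
      have 1: "?N (?gu - ?pu) \<le> e1"
        using near[OF u(1)] quasi_seminorm.sym[OF Lp_quasi_seminorm[OF p(1)] L(1,3)] by simp
      have 2: "?N (?pu - ?pf) \<le> e1"
        by (rule Lp_norm_le[OF Lp_diff[OF L(3,4) p(1)] p(1)]) (use e1 le in auto)
      have 3: "?N (?pf - ?gf) \<le> e1" by (rule near[OF fB])
      have 4: "?N (?gu - ?gf) \<le> 2 * (?N (?gu - ?pu) + ?N (?pu - ?gf))" by (rule tri[OF L(1,3,2)])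
      have 5: "?N (?pu - ?gf) \<le> 2 * (?N (?pu - ?pf) + ?N (?pf - ?gf))" by (rule tri[OF L(3,4,2)])
      have "?N (?gu - ?gf) \<le> 10 * e1" by (rule arith[OF 1 2 3 4 5])
      then have "?N (v - ?gf) < e" using e by (simp add: u(2) e1_def)
      then show "\<exists>k\<in>(\<lambda>u x. g x * u x) ` F. ?N (v - k) < e" using f by (intro bexI[of _ ?gf]) auto
    qed
  qed
  moreover have "(\<lambda>u x. g x * u x) ` sobolev r p \<Omega> \<subseteq> Lp p \<Omega>" using mem[OF gM] by blast
  ultimately show ?thesis
    unfolding compact_operator_def by (auto simp: algebra_simps)
qed

end
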